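(* Let $G$ be a finite group, let $\mathscr{S}^G$ be the $1+1$ dimensional $G$-cobordism category, and let $B\mathscr{S}^G$ be its classifying space. There is a bijection $$\pi_0(B\mathscr{S}^G)\cong G/[G,G]$$ which is compatible with the tensor product of $\mathscr{S}^G$, i.e. the product on $\pi_0(B\mathscr{S}^G)$ induced by the monoidal structure (disjoint union) of $\mathscr{S}^G$ corresponds to the multiplication of the group $G/[G,G]$.
   Context: For $x\in G$, the principal $G$-bundle over the circle with monodromy $x$ is obtained from $[0,1]\times G$ by identifying $(0,y)$ with $(1,yx)$ for every $y\in G$; it projects to $S^1=[0,1]/(0\sim 1)$ by the first coordinate and $G$ acts by left multiplication on the second coordinate. Every principal $G$-bundle over the circle is isomorphic to one of these. The symbol $0$ denotes the empty $G$-bundle. A $G$-cobordism between principal $G$-bundles $\xi:P\to\Sigma$ and $\xi':P'\to\Sigma'$ (over closed oriented 1-manifolds) is a principal $G$-bundle $\epsilon:Q\to M$ over a compact oriented surface $M$, with diffeomorphisms $\partial M\cong\Sigma\sqcup-\Sigma'$ and $\partial Q\cong P\sqcup -P'$ compatible with the projections and the $G$-action. Two $G$-cobordisms $\epsilon:Q\to M$ and $\epsilon':Q'\to M'$ are equivalent if there are a diffeomorphism $\phi:M\to M'$ and a $G$-equivariant diffeomorphism $\psi:Q\to Q'$, both compatible with the boundary identifications, such that $\epsilon'\psi=\phi\epsilon$. The category $\mathscr{S}^G$ has as objects the finite sequences $(x_1,\dots,x_n)$ with $x_i\in G\sqcup\{0\}$, representing the disjoint union of the principal $G$-bundles over the circle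 with monodromies $x_i\in G$ and of empty $G$-bundles for $x_i=0$. Its morphisms are equivalence classes of $G$-cobordisms over oriented surfaces, and composition is gluing along the common boundary. It is a symmetric monoidal category under disjoint union, with unit the empty $G$-bundle. The classifying space $B\mathscr{C}$ of a category $\mathscr{C}$ is the geometric realization of its nerve. *)

theory Defs
  imports "HOL-Analysis.Analysis" "HOL-Homology.Homology" "HOL-Algebra.Group_Action" "HOL-Algebra.Generated_Groups"
begin

section \<open>Classifying spaces\<close>

record ('o, 'm) small_category =
  Ob :: "'o set"
  Arr :: "'m set"
  Dom :: "'m \<Rightarrow> 'o"
  Cod :: "'m \<Rightarrow> 'o"
  Ide :: "'o \<Rightarrow> 'm"
  Comp :: "'m \<Rightarrow> 'm \<Rightarrow> 'm"

text \<open>An \<open>n\<close>-simplex of the nerve is a composable chain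
  \<open>X\<^sub>0 \<rightarrow> X\<^sub>1 \<rightarrow> \<dots> \<rightarrow> X\<^sub>n\<close>, stored as \<open>X\<^sub>0\<close> together with the list
  of its \<open>n\<close> arrows. \<open>Comp C g f\<close> is \<open>g\<close> after \<open>f\<close>.\<close>

type_synonym ('o, 'm) chain_of_arrows = "'o \<times> 'm list"

definition nerve_vertex ::
    "('o, 'm) small_category \<Rightarrow> nat \<Rightarrow> ('o, 'm) chain_of_arrows \<Rightarrow> 'o" where
  "nerve_vertex C i \<sigma> = (if i = 0 then fst \<sigma> else Cod C (snd \<sigma> ! (i - 1)))"

definition nerve :: "('o, 'm) small_category \<Rightarrow> ('o, 'm) chain_of_arrows set" where
  "nerve C = {\<sigma>. fst \<sigma> \<in> Ob C \<and> set (snd \<sigma>) \<subseteq> Arr C \<and>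
     (\<forall>i < length (snd \<sigma>). Dom C (snd \<sigma> ! i) = nerve_vertex C i \<sigma>)}"

definition nerve_face ::
    "('o, 'm) small_category \<Rightarrow> nat \<Rightarrow> ('o, 'm) chain_of_arrows \<Rightarrow> ('o, 'm) chain_of_arrows" where
  "nerve_face C i = (\<lambda>(X, fs).
     if i = 0 then (Cod C (hd fs), tl fs)
     else if i = length fs then (X, butlast fs)
     else (X, take (i - 1) fs @ [Comp C (fs ! i) (fs ! (i - 1))] @ drop (i + 1) fs))"

definition nerve_degeneracy ::
    "('o, 'm) small_category \<Rightarrow> nat \<Rightarrow> ('o, 'm) chain_of_arrows \<Rightarrow> ('o, 'm) chain_of_arrows" where
  "nerve_degeneracy C i = (\<lambda>(X, fs).
     (X, take i fs @ [Ide C (nerve_vertex C i (X, fs))] @ drop i fs))"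

definition simplicial_degeneracy :: "nat \<Rightarrow> (nat \<Rightarrow> real) \<Rightarrow> nat \<Rightarrow> real" where
  "simplicial_degeneracy i t =
     (\<lambda>k. if k < i then t k else if k = i then t i + t (i + 1) else t (k + 1))"

definition nerve_cells ::
    "('o, 'm) small_category \<Rightarrow> (('o, 'm) chain_of_arrows \<times> (nat \<Rightarrow> real)) topology" where
  "nerve_cells C =
     sum_topology
       (\<lambda>\<sigma>. subtopology (powertop_real UNIV) (standard_simplex (length (snd \<sigma>))))
       (nerve C)"

definition cell_gluing ::
    "('o, 'm) small_category \<Rightarrow> (('o, 'm) chain_of_arrows \<times> (nat \<Rightarrow> real)) rel" where
  "cell_gluing C =
     {((nerve_face C i \<sigma>, t), (\<sigma>, simplical_face i t)) | i \<sigma> t.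
        \<sigma> \<in> nerve C \<and> snd \<sigma> \<noteq> [] \<and> i \<le> length (snd \<sigma>) \<and>
        t \<in> standard_simplex (length (snd \<sigma>) - 1)} \<union>
     {((nerve_degeneracy C i \<sigma>, t), (\<sigma>, simplicial_degeneracy i t)) | i \<sigma> t.
        \<sigma> \<in> nerve C \<and> i \<le> length (snd \<sigma>) \<and>
        t \<in> standard_simplex (length (snd \<sigma>) + 1)}"

definition quotient_topology :: "'a topology \<Rightarrow> 'a rel \<Rightarrow> 'a set topology" where
  "quotient_topology X r = topology (\<lambda>\<U>. \<U> \<subseteq> topspace X // r \<and> openin X (\<Union>\<U>))"

lemma openin_quotient_topology:
  assumes "equiv (topspace X) r"
  shows "openin (quotient_topology X r) \<U> \<longleftrightarrow> \<U> \<subseteq> topspace X // r \<and> openin X (\<Union>\<U>)"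
proof -
  have "istopology (\<lambda>\<U>. \<U> \<subseteq> topspace X // r \<and> openin X (\<Union>\<U>))"
    unfolding istopology_def
  proof (intro conjI allI impI)
    fix S T
    assume S: "S \<subseteq> topspace X // r \<and> openin X (\<Union>S)"
      and T: "T \<subseteq> topspace X // r \<and> openin X (\<Union>T)"
    have "A = B" if "A \<in> S" "B \<in> T" "x \<in> A" "x \<in> B" for A B x
      using quotient_disj[OF assms, of A B] S T that by blast
    then have "\<Union>(S \<inter> T) = \<Union>S \<inter> \<Union>T" by blast
    with S T show "openin X (\<Union>(S \<inter> T))" by auto
    show "S \<inter> T \<subseteq> topspace X // r" using S by blast
  next
    fix \<K>
    assume K: "\<forall>K\<in>\<K>. K \<subseteq> topspace X // r \<and> openin X (\<Union>K)"
    have "\<Union>(\<Union>\<K>) = (\<Union>K\<in>\<K>. \<Union>K)" by blast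
    with K show "openin X (\<Union>(\<Union>\<K>))" by auto
    show "\<Union>\<K> \<subseteq> topspace X // r" using K by blast
  qed
  then show ?thesis by (simp add: quotient_topology_def)
qed

definition generated_equiv :: "'a set \<Rightarrow> 'a rel \<Rightarrow> 'a rel" where
  "generated_equiv A r = Restr ((Restr r A \<union> (Restr r A)\<inverse>)\<^sup>*) A"

lemma equiv_generated_equiv: "equiv A (generated_equiv A r)"
proof (rule equivI)
  have "sym (Restr r A \<union> (Restr r A)\<inverse>)" by (auto intro: symI)
  from sym_rtrancl[OF this] show "sym (generated_equiv A r)"
    unfolding generated_equiv_def by (auto simp: sym_def)
  show "generated_equiv A r \<subseteq> A \<times> A" "refl_on A (generated_equiv A r)"
    unfolding generated_equiv_def by (auto intro: refl_onI)
  show "trans (generated_equiv A r)"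
    unfolding generated_equiv_def by (rule transI) auto
qed

definition classifying_space ::
    "('o, 'm) small_category \<Rightarrow> (('o, 'm) chain_of_arrows \<times> (nat \<Rightarrow> real)) set topology" where
  "classifying_space C =
     quotient_topology (nerve_cells C)
       (generated_equiv (topspace (nerve_cells C)) (cell_gluing C))"

definition classifying_vertex ::
    "('o, 'm) small_category \<Rightarrow> 'o \<Rightarrow> (('o, 'm) chain_of_arrows \<times> (nat \<Rightarrow> real)) set" where
  "classifying_vertex C X =
     generated_equiv (topspace (nerve_cells C)) (cell_gluing C)
       `` {((X, []), \<lambda>j. if j = 0 then 1 else 0)}"

abbreviation pi0 ::
    "('o, 'm) small_category \<Rightarrow> (('o, 'm) chain_of_arrows \<times> (nat \<Rightarrow> real)) set set set" where
  "pi0 C \<equiv> path_components_of (classifying_space C)"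

definition component_of_object ::
    "('o, 'm) small_category \<Rightarrow> 'o \<Rightarrow> (('o, 'm) chain_of_arrows \<times> (nat \<Rightarrow> real)) set set" where
  "component_of_object C X =
     path_component_of_set (classifying_space C) (classifying_vertex C X)"

text \<open>The product induced on path components by a tensor product of objects: the union of the
  components of \<open>X \<otimes> Y\<close> over all objects \<open>X\<close> in \<open>c\<close> and \<open>Y\<close> in \<open>d\<close>. As path components are
  nonempty and pairwise disjoint, this union is a path component exactly if \<open>c\<close> and \<open>d\<close> contain
  objects and the component of \<open>X \<otimes> Y\<close> does not depend on their choice.\<close>

definition pi0_tensor ::
    "('o, 'm) small_category \<Rightarrow> ('o \<Rightarrow> 'o \<Rightarrow> 'o) \<Rightarrow>
     (('o, 'm) chain_of_arrows \<times> (nat \<Rightarrow> real)) set set \<Rightarrow>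
     (('o, 'm) chain_of_arrows \<times> (nat \<Rightarrow> real)) set set \<Rightarrow>
     (('o, 'm) chain_of_arrows \<times> (nat \<Rightarrow> real)) set set" where
  "pi0_tensor C tensor c d =
     \<Union>{component_of_object C (tensor X Y) | X Y.
        X \<in> Ob C \<and> Y \<in> Ob C \<and> component_of_object C X = c \<and> component_of_object C Y = d}"


section \<open>Smooth surfaces with boundary\<close>

fun Ck_on :: "nat \<Rightarrow> ('a::euclidean_space \<Rightarrow> 'b::euclidean_space) \<Rightarrow> 'a set \<Rightarrow> bool" where
  "Ck_on 0 f S \<longleftrightarrow> continuous_on S f"
| "Ck_on (Suc k) f S \<longleftrightarrow>
     (\<forall>x\<in>S. f differentiable (at x)) \<and>
     (\<forall>v. Ck_on k (\<lambda>x. frechet_derivative f (at x) v) S)"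

definition smooth_on :: "'a::euclidean_space set \<Rightarrow> ('a \<Rightarrow> 'b::euclidean_space) \<Rightarrow> bool" where
  "smooth_on S f \<longleftrightarrow>
     (\<forall>x\<in>S. \<exists>T g. open T \<and> x \<in> T \<and> (\<forall>k. Ck_on k g T) \<and> (\<forall>y\<in>S \<inter> T. g y = f y))"

definition half_plane :: "(real^2) set" where
  "half_plane = {v. 0 \<le> v $ 2}"

text \<open>The atlas need not be maximal; a chart is a pair of its domain and its coordinate map.\<close>

record 'p surface =
  Top :: "'p topology"
  Atlas :: "('p set \<times> ('p \<Rightarrow> real^2)) set"

abbreviation pts :: "'p surface \<Rightarrow> 'p set" where
  "pts S \<equiv> topspace (Top S)"

definition chart_of :: "'p topology \<Rightarrow> 'p set \<times> ('p \<Rightarrow> real^2) \<Rightarrow> bool" where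
  "chart_of X = (\<lambda>(U, u). openin X U \<and> openin (top_of_set half_plane) (u ` U) \<and>
     homeomorphic_map (subtopology X U) (top_of_set (u ` U)) u)"

definition coord_dom ::
    "('p \<Rightarrow> 'q) \<Rightarrow> 'p set \<times> ('p \<Rightarrow> real^2) \<Rightarrow> 'q set \<times> ('q \<Rightarrow> real^2) \<Rightarrow> (real^2) set" where
  "coord_dom f c d = snd c ` {p \<in> fst c. f p \<in> fst d}"

definition coord_rep ::
    "('p \<Rightarrow> 'q) \<Rightarrow> 'p set \<times> ('p \<Rightarrow> real^2) \<Rightarrow> 'q set \<times> ('q \<Rightarrow> real^2) \<Rightarrow> real^2 \<Rightarrow> real^2" where
  "coord_rep f c d = snd d \<circ> f \<circ> inv_into (fst c) (snd c)"

definition smooth_map :: "'p surface \<Rightarrow> 'q surface \<Rightarrow> ('p \<Rightarrow> 'q) \<Rightarrow> bool" where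
  "smooth_map S T f \<longleftrightarrow> continuous_map (Top S) (Top T) f \<and>
     (\<forall>c\<in>Atlas S. \<forall>d\<in>Atlas T. smooth_on (coord_dom f c d) (coord_rep f c d))"

text \<open>Only meaningful for smooth maps between surfaces with smooth atlases.\<close>

definition orientation_preserving :: "'p surface \<Rightarrow> 'q surface \<Rightarrow> ('p \<Rightarrow> 'q) \<Rightarrow> bool" where
  "orientation_preserving S T f \<longleftrightarrow>
     (\<forall>c\<in>Atlas S. \<forall>d\<in>Atlas T. \<forall>v\<in>coord_dom f c d.
        \<exists>D. (coord_rep f c d has_derivative D) (at v within coord_dom f c d) \<and> 0 < det (matrix D))"

text \<open>For the identity map, \<^const>\<open>coord_rep\<close> runs through the chart transition maps.\<close>

definition smooth_surface :: "'p surface \<Rightarrow> bool" where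
  "smooth_surface S \<longleftrightarrow>
     Hausdorff_space (Top S) \<and> second_countable (Top S) \<and>
     (\<forall>c\<in>Atlas S. chart_of (Top S) c) \<and> (\<Union>c\<in>Atlas S. fst c) = pts S \<and>
     smooth_map S S (\<lambda>p. p)"

definition oriented_smooth_surface :: "'p surface \<Rightarrow> bool" where
  "oriented_smooth_surface S \<longleftrightarrow>
     smooth_surface S \<and> orientation_preserving S S (\<lambda>p. p)"

definition surface_boundary :: "'p surface \<Rightarrow> 'p set" where
  "surface_boundary S = {p. \<exists>(U, u)\<in>Atlas S. p \<in> U \<and> u p $ 2 = 0}"

definition diffeo :: "'p surface \<Rightarrow> 'q surface \<Rightarrow> ('p \<Rightarrow> 'q) \<Rightarrow> bool" where
  "diffeo S T f \<longleftrightarrow> bij_betw f (pts S) (pts T) \<and>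
     smooth_map S T f \<and> smooth_map T S (inv_into (pts S) f)"

definition restrict_surface :: "'p surface \<Rightarrow> 'p set \<Rightarrow> 'p surface" where
  "restrict_surface S W =
     \<lparr>Top = subtopology (Top S) W, Atlas = (\<lambda>(U, u). (U \<inter> W, u)) ` Atlas S\<rparr>"

definition times_discrete :: "'p surface \<Rightarrow> 'a set \<Rightarrow> ('p \<times> 'a) surface" where
  "times_discrete S A =
     \<lparr>Top = prod_topology (Top S) (discrete_topology A),
      Atlas = {(U \<times> {a}, u \<circ> fst) | U u a. (U, u) \<in> Atlas S \<and> a \<in> A}\<rparr>"

definition local_diffeo :: "'p surface \<Rightarrow> 'q surface \<Rightarrow> ('p \<Rightarrow> 'q) \<Rightarrow> bool" where
  "local_diffeo S T f \<longleftrightarrow>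
     (\<forall>p\<in>pts S. \<exists>U V. openin (Top S) U \<and> p \<in> U \<and> openin (Top T) V \<and>
        diffeo (restrict_surface S U) (restrict_surface T V) f)"

definition smooth_curve :: "'p surface \<Rightarrow> (real \<Rightarrow> 'p) \<Rightarrow> bool" where
  "smooth_curve S b \<longleftrightarrow> continuous_map euclideanreal (Top S) b \<and>
     (\<forall>(U, u)\<in>Atlas S. smooth_on {t. b t \<in> U} (u \<circ> b))"

text \<open>For a curve running inside the boundary. The half plane with its standard orientation
  induces on its boundary (outward normal first) the orientation of increasing first coordinate.\<close>

definition boundary_direction :: "real \<Rightarrow> 'p surface \<Rightarrow> (real \<Rightarrow> 'p) \<Rightarrow> bool" where
  "boundary_direction \<epsilon> S b \<longleftrightarrow>
     (\<forall>(U, u)\<in>Atlas S. \<forall>t. b t \<in> U \<longrightarrow>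
        (\<exists>d. ((u \<circ> b) has_vector_derivative d) (at t) \<and> 0 < \<epsilon> * d $ 1))"

text \<open>The strip \<open>[0,1] \<times> \<real>\<close>.\<close>

definition strip :: "(real \<times> real) surface" where
  "strip =
     \<lparr>Top = top_of_set ({0..1} \<times> UNIV),
      Atlas = {({0..<1} \<times> UNIV, \<lambda>(s, t). vector [t, s]),
               ({0<..1} \<times> UNIV, \<lambda>(s, t). vector [t, 1 - s])}\<rparr>"


section \<open>Cobordisms of principal bundles\<close>

text \<open>An object is a finite sequence in \<open>G \<squnion> {0}\<close>, with \<^const>\<open>None\<close> for the empty bundle \<open>0\<close>.\<close>

definition bundle_seqs :: "('g, 'r) monoid_scheme \<Rightarrow> 'g option list set" where
  "bundle_seqs G = {X. set X \<subseteq> insert None (Some ` carrier G)}"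

definition circles :: "'g option list \<Rightarrow> nat set" where
  "circles X = {i. i < length X \<and> X ! i \<noteq> None}"

text \<open>The last four fields are the boundary identifications on the \<open>i\<close>-th circle and on
  the \<open>i\<close>-th bundle of the source and of the target.\<close>

record ('p, 'q, 'g) gcob =
  base :: "'p surface"
  tot :: "'q surface"
  proj :: "'q \<Rightarrow> 'p"
  act :: "'g \<Rightarrow> 'q \<Rightarrow> 'q"
  in_base :: "nat \<Rightarrow> real \<Rightarrow> 'p"
  in_total :: "nat \<Rightarrow> real \<Rightarrow> 'g \<Rightarrow> 'q"
  out_base :: "nat \<Rightarrow> real \<Rightarrow> 'p"
  out_total :: "nat \<Rightarrow> real \<Rightarrow> 'g \<Rightarrow> 'q"

definition principal_bundle :: "('g, 'r) monoid_scheme \<Rightarrow> ('p, 'q, 'g) gcob \<Rightarrow> bool" where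
  "principal_bundle G W \<longleftrightarrow>
     smooth_surface (base W) \<and> smooth_surface (tot W) \<and>
     smooth_map (tot W) (base W) (proj W) \<and>
     group_action G (pts (tot W)) (act W) \<and>
     (\<forall>g\<in>carrier G. smooth_map (tot W) (tot W) (act W g)) \<and>
     (\<forall>g\<in>carrier G. \<forall>q\<in>pts (tot W). proj W (act W g q) = proj W q) \<and>
     (\<forall>p\<in>pts (base W). \<exists>U \<tau>. openin (Top (base W)) U \<and> p \<in> U \<and>
        diffeo (times_discrete (restrict_surface (base W) U) (carrier G))
               (restrict_surface (tot W) {q \<in> pts (tot W). proj W q \<in> U}) \<tau> \<and>
        (\<forall>u\<in>U. \<forall>y\<in>carrier G. proj W (\<tau> (u, y)) = u \<and>
           (\<forall>g\<in>carrier G. act W g (\<tau> (u, y)) = \<tau> (u, g \<otimes>\<^bsub>G\<^esub> y))))"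

text \<open>The bundle over the circle with monodromy \<open>x\<close>, the quotient of \<open>[0,1] \<times> G\<close> by
  \<open>(0, y) \<sim> (1, y x)\<close>, is also the quotient of \<open>\<real> \<times> G\<close> by \<open>(t, y) \<sim> (t + 1, y x)\<close>, which shows
  its smooth structure; a map out of it is a map on \<open>\<real> \<times> G\<close> respecting that identification, and
  \<open>[0,1) \<times> G\<close> is a fundamental domain. Likewise a map out of the circle is one of period 1 on \<open>\<real>\<close>.
  The following says that \<open>b\<close> and \<open>\<beta>\<close> form a smooth map of principal bundles from the disjoint
  union of the bundles of the sequence \<open>X\<close>.\<close>

definition bundle_seq_map ::
    "('g, 'r) monoid_scheme \<Rightarrow> 'g option list \<Rightarrow> ('p, 'q, 'g) gcob \<Rightarrow>
     (nat \<Rightarrow> real \<Rightarrow> 'p) \<Rightarrow> (nat \<Rightarrow> real \<Rightarrow> 'g \<Rightarrow> 'q) \<Rightarrow> bool" where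
  "bundle_seq_map G X W b \<beta> \<longleftrightarrow>
     (\<forall>i\<in>circles X.
        smooth_curve (base W) (b i) \<and> (\<forall>t. b i (t + 1) = b i t) \<and>
        (\<forall>y\<in>carrier G. smooth_curve (tot W) (\<lambda>t. \<beta> i t y) \<and>
           (\<forall>t. \<beta> i (t + 1) (y \<otimes>\<^bsub>G\<^esub> the (X ! i)) = \<beta> i t y \<and>
                proj W (\<beta> i t y) = b i t \<and>
                (\<forall>g\<in>carrier G. act W g (\<beta> i t y) = \<beta> i t (g \<otimes>\<^bsub>G\<^esub> y)))))"

text \<open>A bijective smooth map onto the boundary with nowhere vanishing speed is a diffeomorphism
  onto it. Targets carry the reversed orientation.\<close>

definition cobordisms ::
    "('g, 'r) monoid_scheme \<Rightarrow> 'g option list \<Rightarrow> 'g option list \<Rightarrow> ('p, 'q, 'g) gcob set" where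
  "cobordisms G X Y = {W.
     oriented_smooth_surface (base W) \<and> compact_space (Top (base W)) \<and>
     principal_bundle G W \<and>
     bundle_seq_map G X W (in_base W) (in_total W) \<and>
     bundle_seq_map G Y W (out_base W) (out_total W) \<and>
     (\<forall>i\<in>circles X. boundary_direction 1 (base W) (in_base W i)) \<and>
     (\<forall>i\<in>circles Y. boundary_direction (-1) (base W) (out_base W i)) \<and>
     bij_betw (case_sum (\<lambda>(i, t). in_base W i t) (\<lambda>(i, t). out_base W i t))
       ((circles X \<times> {0..<1}) <+> (circles Y \<times> {0..<1}))
       (surface_boundary (base W)) \<and>
     bij_betw (case_sum (\<lambda>(i, t, y). in_total W i t y) (\<lambda>(i, t, y). out_total W i t y))
       ((circles X \<times> {0..<1} \<times> carrier G) <+> (circles Y \<times> {0..<1} \<times> carrier G))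
       (surface_boundary (tot W))}"

definition cobordism_equiv ::
    "('g, 'r) monoid_scheme \<Rightarrow> 'g option list \<Rightarrow> 'g option list \<Rightarrow> ('p, 'q, 'g) gcob rel" where
  "cobordism_equiv G X Y = {(W, W').
     W \<in> cobordisms G X Y \<and> W' \<in> cobordisms G X Y \<and>
     (\<exists>\<phi> \<psi>.
        diffeo (base W) (base W') \<phi> \<and> orientation_preserving (base W) (base W') \<phi> \<and>
        diffeo (tot W) (tot W') \<psi> \<and>
        (\<forall>q\<in>pts (tot W). proj W' (\<psi> q) = \<phi> (proj W q) \<and>
           (\<forall>g\<in>carrier G. \<psi> (act W g q) = act W' g (\<psi> q))) \<and>
        (\<forall>i\<in>circles X. \<forall>t. \<phi> (in_base W i t) = in_base W' i t \<and>
           (\<forall>y\<in>carrier G. \<psi> (in_total W i t y) = in_total W' i t y)) \<and>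
        (\<forall>i\<in>circles Y. \<forall>t. \<phi> (out_base W i t) = out_base W' i t \<and>
           (\<forall>y\<in>carrier G. \<psi> (out_total W i t y) = out_total W' i t y)))}"

text \<open>\<open>W\<close> is obtained from \<open>U\<close> and \<open>V\<close> by gluing along the bundles of \<open>Y\<close>: both are embedded
  smoothly in \<open>W\<close>, cover it, and meet exactly in the common boundary. This determines \<open>W\<close> up to
  equivalence; the smooth structure of a glued surface is only unique in this sense.\<close>

definition is_gluing ::
    "('g, 'r) monoid_scheme \<Rightarrow> 'g option list \<Rightarrow> 'g option list \<Rightarrow> 'g option list \<Rightarrow>
     ('p, 'q, 'g) gcob \<Rightarrow> ('p, 'q, 'g) gcob \<Rightarrow> ('p, 'q, 'g) gcob \<Rightarrow> bool" where
  "is_gluing G X Y Z U V W \<longleftrightarrow>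
     (\<exists>\<phi> \<phi>' \<psi> \<psi>'.
        smooth_map (base U) (base W) \<phi> \<and> orientation_preserving (base U) (base W) \<phi> \<and>
        smooth_map (base V) (base W) \<phi>' \<and> orientation_preserving (base V) (base W) \<phi>' \<and>
        inj_on \<phi> (pts (base U)) \<and> inj_on \<phi>' (pts (base V)) \<and>
        \<phi> ` pts (base U) \<union> \<phi>' ` pts (base V) = pts (base W) \<and>
        (\<forall>p\<in>pts (base U). \<forall>q\<in>pts (base V). \<phi> p = \<phi>' q \<longleftrightarrow>
           (\<exists>i\<in>circles Y. \<exists>t. p = out_base U i t \<and> q = in_base V i t)) \<and>
        smooth_map (tot U) (tot W) \<psi> \<and> smooth_map (tot V) (tot W) \<psi>' \<and>
        (\<forall>q\<in>pts (tot U). proj W (\<psi> q) = \<phi> (proj U q) \<and>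
           (\<forall>g\<in>carrier G. \<psi> (act U g q) = act W g (\<psi> q))) \<and>
        (\<forall>q\<in>pts (tot V). proj W (\<psi>' q) = \<phi>' (proj V q) \<and>
           (\<forall>g\<in>carrier G. \<psi>' (act V g q) = act W g (\<psi>' q))) \<and>
        (\<forall>i\<in>circles Y. \<forall>t. \<forall>y\<in>carrier G. \<psi> (out_total U i t y) = \<psi>' (in_total V i t y)) \<and>
        (\<forall>i\<in>circles X. \<forall>t. in_base W i t = \<phi> (in_base U i t) \<and>
           (\<forall>y\<in>carrier G. in_total W i t y = \<psi> (in_total U i t y))) \<and>
        (\<forall>i\<in>circles Z. \<forall>t. out_base W i t = \<phi>' (out_base V i t) \<and>
           (\<forall>y\<in>carrier G. out_total W i t y = \<psi>' (out_total V i t y))))"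

text \<open>\<open>W\<close> is a copy of the product of \<open>[0,1]\<close> with the bundles of \<open>X\<close>, presented as a quotient of
  \<open>[0,1] \<times> \<real> \<times> G\<close>.\<close>

definition is_cylinder ::
    "('g, 'r) monoid_scheme \<Rightarrow> 'g option list \<Rightarrow> ('p, 'q, 'g) gcob \<Rightarrow> bool" where
  "is_cylinder G X W \<longleftrightarrow>
     (\<exists>h k.
        local_diffeo (times_discrete strip (circles X)) (base W) h \<and>
        local_diffeo (times_discrete strip (circles X \<times> carrier G)) (tot W) k \<and>
        bij_betw h (({0..1} \<times> {0..<1}) \<times> circles X) (pts (base W)) \<and>
        (\<forall>i\<in>circles X. \<forall>t.
           h ((0, t), i) = in_base W i t \<and> h ((1, t), i) = out_base W i t \<and>
           (\<forall>s\<in>{0..1}. h ((s, t + 1), i) = h ((s, t), i)) \<and>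
           (\<forall>y\<in>carrier G.
              k ((0, t), i, y) = in_total W i t y \<and> k ((1, t), i, y) = out_total W i t y \<and>
              (\<forall>s\<in>{0..1}.
                 k ((s, t + 1), i, y \<otimes>\<^bsub>G\<^esub> the (X ! i)) = k ((s, t), i, y) \<and>
                 proj W (k ((s, t), i, y)) = h ((s, t), i) \<and>
                 (\<forall>g\<in>carrier G. act W g (k ((s, t), i, y)) = k ((s, t), i, g \<otimes>\<^bsub>G\<^esub> y))))))"

text \<open>Compact surfaces and their finite coverings have at most continuum many points, so up to
  equivalence all cobordisms live on subsets of any fixed type of that cardinality. The surfaces
  carry their own topology; that of the type plays no role.\<close>

type_synonym point = "real \<times> real \<times> nat"

type_synonym 'g arrow =
  "'g option list \<times> 'g option list \<times> (point, point, 'g) gcob set"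

text \<open>The composite of two classes is the set of all gluings of representatives, the identity
  class the set of all cylinders.\<close>

definition cobordism_category ::
    "('g, 'r) monoid_scheme \<Rightarrow> ('g option list, 'g arrow) small_category" where
  "cobordism_category G =
     \<lparr>Ob = bundle_seqs G,
      Arr = {(X, Y, C). X \<in> bundle_seqs G \<and> Y \<in> bundle_seqs G \<and>
               C \<in> cobordisms G X Y // cobordism_equiv G X Y},
      Dom = (\<lambda>(X, Y, C). X),
      Cod = (\<lambda>(X, Y, C). Y),
      Ide = (\<lambda>X. (X, X, {W \<in> cobordisms G X X. is_cylinder G X W})),
      Comp = (\<lambda>(Y, Z, D) (X, Y', C).
        (X, Z, {W \<in> cobordisms G X Z. \<exists>U\<in>C. \<exists>V\<in>D. is_gluing G X Y Z U V W}))\<rparr>"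

end

theory Submission
  imports Defs "HOL-Algebra.Multiplicative_Group" "HOL-Complex_Analysis.Cauchy_Integral_Formula"
begin

text \<open>
  Path components of the classifying space are objects modulo zigzags of morphisms, so the claim is
  that two sequences are joined by cobordisms iff the products of their monodromies agree
  modulo \<open>[G, G]\<close>.

  A cobordism preserves this product: as characters of \<open>G\<close> separate \<open>G / [G, G]\<close>, it
  suffices that for a character \<open>\<xi>\<close> the associated flat line bundle over the surface has boundary
  holonomy with product 1. Choose a section \<open>f\<close> with finitely many, nondegenerate zeros,
  none on the boundary. In flat charts \<open>d arg f\<close> is a closed form away from the zeros, and its
  integral over the boundary is by Stokes a sum of winding numbers around the zeros, hence in
  \<open>2 \<pi> \<int>\<close>; along a boundary circle it measures the holonomy.

  Conversely, a disc with \<open>n\<close> holes carries a bundle with monodromies \<open>g\<^sub>1, \<dots>, g\<^sub>n\<close> around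
  the holes, and then \<open>g\<^sub>1 \<cdots> g\<^sub>n\<close> around the outer circle. So every sequence is joined to the product
  of its monodromies in any order, and \<open>(a, b, a\<^sup>-\<^sup>1, b\<^sup>-\<^sup>1, p)\<close> joins \<open>[a, b] p\<close> to \<open>p\<close>.
\<close>

section \<open>Path components of a classifying space\<close>

text \<open>The invariance half uses neither fundamental groups nor a classification of surfaces,
  only calculus in finitely many half plane charts. The line bundle of a character has locally
  constant transition functions of norm 1, so \<open>d arg f\<close> does not depend on the chart. A
  cut-off removes the poles of \<open>d arg f\<close> at the zeros and leaves a form of class 1
  whose curl lives in small squares around them. No winding number is computed: only
  \<open>cis\<close> of an integral is needed, and it is 1 because two paths between opposite
  corners of a square change the argument of \<open>f\<close> by the same amount modulo 2 \<pi>. The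
  construction half uses round holes with Cayley transforms as boundary charts: all transition maps
  are holomorphic, which settles smoothness and orientation at once. The bundle is glued from two
  trivializations; its total space is a product set with a twisted topology, and the third
  coordinate of \<open>point\<close> stores the fibre.\<close>

context
  fixes C :: "('o, 'm) small_category" and Q :: "'o \<Rightarrow> 'b"
  assumes Dom_Ob: "\<And>f. f \<in> Arr C \<Longrightarrow> Dom C f \<in> Ob C"
    and Cod_Ob: "\<And>f. f \<in> Arr C \<Longrightarrow> Cod C f \<in> Ob C"
    and Q_arrow: "\<And>f. f \<in> Arr C \<Longrightarrow> Q (Dom C f) = Q (Cod C f)"
    and Q_complete: "\<And>X Y. X \<in> Ob C \<Longrightarrow> Y \<in> Ob C \<Longrightarrow> Q X = Q Y \<Longrightarrow>
      (X, Y) \<in> ({(Dom C f, Cod C f) | f. f \<in> Arr C} \<union> {(Cod C f, Dom C f) | f. f \<in> Arr C})\<^sup>*"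
begin

private abbreviation "cells \<equiv> topspace (nerve_cells C)"
private abbreviation "glue \<equiv> generated_equiv cells (cell_gluing C)"
private abbreviation "e0 \<equiv> (\<lambda>j::nat. if j = 0 then 1 else 0 :: real)"

lemma cells_eq: "cells = Sigma (nerve C) (\<lambda>\<sigma>. standard_simplex (length (snd \<sigma>)))"
  by (auto simp: nerve_cells_def)

lemma openin_classifying_space:
  "openin (classifying_space C) \<U> \<longleftrightarrow> \<U> \<subseteq> cells // glue \<and> openin (nerve_cells C) (\<Union>\<U>)"
  unfolding classifying_space_def
  by (rule openin_quotient_topology) (rule equiv_generated_equiv)

lemma topspace_classifying_space: "topspace (classifying_space C) = cells // glue"
proof -
  have "\<Union>(cells // glue) = cells"
    by (rule Union_quotient) (rule equiv_generated_equiv)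
  then have "openin (classifying_space C) (cells // glue)"
    by (simp add: openin_classifying_space)
  then show ?thesis
    using openin_subset[of "classifying_space C"] openin_topspace[of "classifying_space C"]
    unfolding openin_classifying_space by blast
qed

lemma continuous_map_glue:
  "continuous_map (nerve_cells C) (classifying_space C) (\<lambda>x. glue `` {x})"
  unfolding continuous_map_def
proof (intro conjI allI impI)
  have eq: "equiv cells glue" by (rule equiv_generated_equiv)
  show "(\<lambda>x. glue `` {x}) \<in> cells \<rightarrow> topspace (classifying_space C)"
    by (auto simp: topspace_classifying_space quotientI)
  fix U assume "openin (classifying_space C) U"
  then have U: "U \<subseteq> cells // glue" "openin (nerve_cells C) (\<Union>U)"
    by (auto simp: openin_classifying_space)
  have "{x \<in> cells. glue `` {x} \<in> U} = \<Union>U"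
  proof (intro subset_antisym subsetI)
    fix x assume "x \<in> {x \<in> cells. glue `` {x} \<in> U}"
    then show "x \<in> \<Union>U" using equiv_class_self[OF eq] by blast
  next
    fix x assume "x \<in> \<Union>U"
    then obtain A where A: "x \<in> A" "A \<in> U" by blast
    with U(1) have "A \<in> cells // glue" by blast
    then obtain y where y: "y \<in> cells" "A = glue `` {y}" by (rule quotientE)
    then have "(y, x) \<in> glue" using A by blast
    then have "glue `` {y} = glue `` {x}" by (intro equiv_class_eq[OF eq])
    moreover have "x \<in> cells" using \<open>(y, x) \<in> glue\<close> equivE[OF eq] by blast
    ultimately show "x \<in> {x \<in> cells. glue `` {x} \<in> U}" using A y by auto
  qed
  then show "openin (nerve_cells C) {x \<in> cells. glue `` {x} \<in> U}" using U by simp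
qed

lemma gluing_step:
  assumes "(x, y) \<in> cell_gluing C" "x \<in> cells" "y \<in> cells"
  shows "glue `` {x} = glue `` {y}"
proof -
  have "(x, y) \<in> glue"
    unfolding generated_equiv_def using assms by auto
  then show ?thesis by (rule equiv_class_eq[OF equiv_generated_equiv])
qed

text \<open>Among the generating identifications only the face with index 0 moves the initial object
  of a chain, and it moves it along the first arrow, where \<open>Q\<close> is constant.\<close>

lemma gluing_invariant:
  assumes "(x, y) \<in> glue" shows "Q (fst (fst x)) = Q (fst (fst y))"
proof -
  have *: "Q (fst (fst x)) = Q (fst (fst y))" if "(x, y) \<in> cell_gluing C" for x y
    using that unfolding cell_gluing_def
  proof (elim UnE)
    assume "(x, y) \<in> {((nerve_face C i \<sigma>, t), (\<sigma>, simplical_face i t)) | i \<sigma> t.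
        \<sigma> \<in> nerve C \<and> snd \<sigma> \<noteq> [] \<and> i \<le> length (snd \<sigma>) \<and>
        t \<in> standard_simplex (length (snd \<sigma>) - 1)}"
    then obtain i X fs where *: "fst x = nerve_face C i (X, fs)" "fst y = (X, fs)"
      "(X, fs) \<in> nerve C" "fs \<noteq> []" by auto
    show ?thesis
    proof (cases "i = 0")
      case True
      have "Dom C (fs ! 0) = X" "fs ! 0 \<in> Arr C"
        using * by (auto simp: nerve_def nerve_vertex_def)
      then show ?thesis using * True Q_arrow[of "hd fs"]
        by (auto simp: nerve_face_def hd_conv_nth)
    qed (use * in \<open>auto simp: nerve_face_def\<close>)
  qed (auto simp: nerve_degeneracy_def)
  have "(x, y) \<in> (Restr (cell_gluing C) cells \<union> (Restr (cell_gluing C) cells)\<inverse>)\<^sup>*"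
    using assms by (auto simp: generated_equiv_def)
  then show ?thesis
    by (induction rule: rtrancl_induct) (use * in fastforce)+
qed

text \<open>A simplex is path connected and its map into the quotient is continuous.\<close>

lemma path_component_in_cell:
  assumes "\<sigma> \<in> nerve C" "s \<in> standard_simplex (length (snd \<sigma>))" "t \<in> standard_simplex (length (snd \<sigma>))"
  shows "path_component_of (classifying_space C) (glue `` {(\<sigma>, s)}) (glue `` {(\<sigma>, t)})"
proof -
  let ?X = "subtopology (powertop_real UNIV) (standard_simplex (length (snd \<sigma>)))"
  have "continuous_map ?X (nerve_cells C) (\<lambda>t. (\<sigma>, t))"
    unfolding nerve_cells_def using continuous_map_component_injection[OF assms(1)] by fastforce
  from continuous_map_compose[OF this continuous_map_glue]
  have c: "continuous_map ?X (classifying_space C) (\<lambda>t. glue `` {(\<sigma>, t)})"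
    by (simp add: o_def)
  have "path_connectedin ?X (standard_simplex (length (snd \<sigma>)))"
    by (simp add: path_connectedin_subtopology path_connectedin_standard_simplex)
  from path_connectedin_continuous_map_image[OF c this] show ?thesis
    unfolding path_component_of_def path_connectedin
    using assms path_component_of path_connectedin_continuous_map_image[OF c \<open>path_connectedin ?X _\<close>]
    by (metis (no_types, lifting) imageI path_component_of_def)
qed

lemma nerve_butlast: "(X, fs @ [f]) \<in> nerve C \<Longrightarrow> (X, fs) \<in> nerve C"
proof -
  assume *: "(X, fs @ [f]) \<in> nerve C"
  have "Dom C (fs ! i) = nerve_vertex C i (X, fs)" if "i < length fs" for i
  proof -
    have "Dom C ((fs @ [f]) ! i) = nerve_vertex C i (X, fs @ [f])"
      using * that by (simp add: nerve_def)
    then show ?thesis using that by (auto simp: nerve_vertex_def nth_append)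
  qed
  then show ?thesis using * by (simp add: nerve_def)
qed

lemma vertex_in_cells: "X \<in> Ob C \<Longrightarrow> ((X, []), e0) \<in> cells"
  unfolding cells_eq by (auto simp: nerve_def)

text \<open>Dropping the last arrow is a face map, and it identifies the first vertices of the two
  simplices. Barycentric coordinates are functions on all of \<open>nat\<close>, padded by zeros, so
  the same function \<open>e0\<close> is the first vertex in every dimension.\<close>

lemma glue_first_vertex:
  assumes "(X, fs) \<in> nerve C"
  shows "glue `` {((X, fs), e0)} = classifying_vertex C X"
  using assms
proof (induction fs rule: rev_induct)
  case Nil
  then show ?case by (simp add: classifying_vertex_def)
next
  case (snoc f fs)
  have n: "(X, fs) \<in> nerve C" using snoc.prems by (rule nerve_butlast)
  have e: "simplical_face (Suc (length fs)) e0 = e0"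
    by (auto simp: simplical_face_def fun_eq_iff)
  have f: "nerve_face C (Suc (length fs)) (X, fs @ [f]) = (X, fs)"
    by (simp add: nerve_face_def)
  have "((nerve_face C (Suc (length fs)) (X, fs @ [f]), e0), ((X, fs @ [f]), simplical_face (Suc (length fs)) e0))
      \<in> cell_gluing C"
    unfolding cell_gluing_def using snoc.prems by fastforce
  then have "glue `` {((X, fs), e0)} = glue `` {((X, fs @ [f]), e0)}"
    unfolding e f using snoc.prems n by (intro gluing_step) (auto simp: cells_eq)
  with snoc.IH[OF n] show ?case by simp
qed

lemma path_component_vertex:
  assumes "((X, fs), t) \<in> cells"
  shows "path_component_of (classifying_space C) (glue `` {((X, fs), t)}) (classifying_vertex C X)"
  using path_component_in_cell[of "(X, fs)" t e0] assms glue_first_vertex[of X fs]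
  by (auto simp: cells_eq)

lemma path_component_arrow:
  assumes "f \<in> Arr C"
  shows "path_component_of (classifying_space C) (classifying_vertex C (Dom C f)) (classifying_vertex C (Cod C f))"
proof -
  \<comment> \<open>The arrow is a 1-simplex: \<open>e0\<close> is its vertex at the domain, and
    \<open>?e1\<close>, the image of a point under the face with index 0, is its vertex at the
    codomain.\<close>
  let ?\<sigma> = "(Dom C f, [f])" and ?e1 = "simplical_face 0 e0"
  have n: "?\<sigma> \<in> nerve C" "(Cod C f, []) \<in> nerve C"
    using assms Dom_Ob Cod_Ob by (auto simp: nerve_def nerve_vertex_def)
  have e1: "?e1 \<in> standard_simplex 1"
    by (rule simplical_face_in_standard_simplex) auto
  have "((nerve_face C 0 ?\<sigma>, e0), (?\<sigma>, ?e1)) \<in> cell_gluing C"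
    unfolding cell_gluing_def using n by fastforce
  then have "glue `` {((Cod C f, []), e0)} = glue `` {(?\<sigma>, ?e1)}"
    using n e1 by (intro gluing_step) (auto simp: cells_eq nerve_face_def)
  moreover have "path_component_of (classifying_space C) (glue `` {(?\<sigma>, e0)}) (glue `` {(?\<sigma>, ?e1)})"
    using n e1 by (intro path_component_in_cell) auto
  ultimately show ?thesis
    using glue_first_vertex[OF n(1)] glue_first_vertex[OF n(2)] by simp
qed

text \<open>Zigzags give paths. Conversely, the value of \<open>Q\<close> at the initial object is
  constant on every cell and compatible with the gluing, so it cuts the space into open and closed
  pieces, and a path component lies in one of them.\<close>

lemma path_component_vertices_iff:
  assumes "X \<in> Ob C" "Y \<in> Ob C"
  shows "path_component_of (classifying_space C) (classifying_vertex C X) (classifying_vertex C Y) \<longleftrightarrow> Q X = Q Y"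
proof
  assume "Q X = Q Y"
  from Q_complete[OF assms this]
  show "path_component_of (classifying_space C) (classifying_vertex C X) (classifying_vertex C Y)"
  proof (induction rule: rtrancl_induct)
    case base
    show ?case
      using path_component_vertex[OF vertex_in_cells[OF assms(1)]]
      by (meson path_component_of_refl path_component_of_sym path_component_of_trans)
  next
    case (step Y Z)
    from step.hyps(2)
    have "path_component_of (classifying_space C) (classifying_vertex C Y) (classifying_vertex C Z)"
      by (auto intro: path_component_arrow path_component_of_sym[OF path_component_arrow])
    with step.IH show ?case by (rule path_component_of_trans)
  qed
next
  let ?O = "{A \<in> cells // glue. \<forall>x\<in>A. Q (fst (fst x)) = Q X}"
  let ?P = "{A \<in> cells // glue. \<exists>x\<in>A. Q (fst (fst x)) \<noteq> Q X}"
  have eq: "equiv cells glue" by (rule equiv_generated_equiv)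
  \<comment> \<open>Openness of a set of classes is openness of its union; for a set of classes
    given by a predicate this computes the union.\<close>
  have mem: "\<Union>{A \<in> cells // glue. P A} = {x \<in> cells. P (glue `` {x})}" for P
  proof (intro subset_antisym subsetI)
    fix x assume "x \<in> \<Union>{A \<in> cells // glue. P A}"
    then obtain y where y: "y \<in> cells" "P (glue `` {y})" "(y, x) \<in> glue"
      by (auto elim!: quotientE)
    then have "glue `` {y} = glue `` {x}" by (intro equiv_class_eq[OF eq])
    moreover have "x \<in> cells" using y(3) equivE[OF eq] by blast
    ultimately show "x \<in> {x \<in> cells. P (glue `` {x})}" using y by auto
  next
    fix x assume "x \<in> {x \<in> cells. P (glue `` {x})}"
    then show "x \<in> \<Union>{A \<in> cells // glue. P A}"
      using equiv_class_self[OF eq] quotientI[of x cells glue] by blast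
  qed
  have cls: "(\<forall>z \<in> glue `` {x}. Q (fst (fst z)) = Q X) \<longleftrightarrow> Q (fst (fst x)) = Q X" if "x \<in> cells" for x
    using gluing_invariant equiv_class_self[OF eq that] by fastforce
  have U1: "\<Union>?O = {x \<in> cells. Q (fst (fst x)) = Q X}"
    unfolding mem using cls by (intro Collect_cong conj_cong refl)
  have U2: "\<Union>?P = {x \<in> cells. Q (fst (fst x)) \<noteq> Q X}"
    unfolding mem by (intro Collect_cong conj_cong refl) (metis cls)
  \<comment> \<open>A union of whole cells is open in the disjoint sum of the cells.\<close>
  have op: "openin (nerve_cells C) {x \<in> cells. R (fst x)}" for R
  proof -
    have "{t. (\<sigma>, t) \<in> {x \<in> cells. R (fst x)}} = (if R \<sigma> then standard_simplex (length (snd \<sigma>)) else {})"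
      if "\<sigma> \<in> nerve C" for \<sigma> using that by (auto simp: cells_eq)
    moreover have "openin (subtopology (powertop_real UNIV) (standard_simplex n)) (standard_simplex n)" for n
      by (metis openin_topspace topspace_standard_simplex)
    ultimately show ?thesis
      using cells_eq unfolding nerve_cells_def openin_sum_topology
      by (auto simp flip: nerve_cells_def)
  qed
  have "openin (classifying_space C) ?O" "openin (classifying_space C) ?P"
    using U1 U2 op[of "\<lambda>\<sigma>. Q (fst \<sigma>) = Q X"] op[of "\<lambda>\<sigma>. Q (fst \<sigma>) \<noteq> Q X"]
    by (auto simp: openin_classifying_space)
  moreover have "topspace (classifying_space C) - ?O = ?P"
    by (auto simp: topspace_classifying_space)
  ultimately have clopen: "openin (classifying_space C) ?O" "closedin (classifying_space C) ?O"
    unfolding closedin_def using topspace_classifying_space by auto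
  assume "path_component_of (classifying_space C) (classifying_vertex C X) (classifying_vertex C Y)"
  moreover define T where "T = path_component_of_set (classifying_space C) (classifying_vertex C X)"
  moreover have "connectedin (classifying_space C) T"
    unfolding T_def by (rule path_connectedin_imp_connectedin[OF path_connectedin_path_component_of])
  ultimately have T: "connectedin (classifying_space C) T" "classifying_vertex C X \<in> T" "classifying_vertex C Y \<in> T"
    by (auto simp: path_component_of_refl) (metis path_component_of_equiv)
  have v: "classifying_vertex C Z \<in> ?O \<longleftrightarrow> Q Z = Q X" if "Z \<in> Ob C" for Z
    unfolding classifying_vertex_def using cls[OF vertex_in_cells[OF that]]
      quotientI[OF vertex_in_cells[OF that], of glue] by simp
  have "T \<subseteq> ?O"
    using connectedin_clopen_cases[OF T(1) clopen(2,1)] T(2) v[OF assms(1)]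
    unfolding disjnt_iff by blast
  then show "Q X = Q Y" using T(3) v[OF assms(2)] by auto
qed

lemma component_of_object_eq_iff:
  assumes "X \<in> Ob C" "Y \<in> Ob C"
  shows "component_of_object C X = component_of_object C Y \<longleftrightarrow> Q X = Q Y"
proof -
  have "path_component_of (classifying_space C) (classifying_vertex C X) (classifying_vertex C X)"
    "path_component_of (classifying_space C) (classifying_vertex C Y) (classifying_vertex C Y)"
    using path_component_vertices_iff assms by auto
  then show ?thesis
    unfolding component_of_object_def path_component_vertices_iff[OF assms, symmetric]
    using path_component_of_equiv by (metis mem_Collect_eq)
qed

text \<open>Every point of a cell is joined to the initial vertex of its simplex, so every component
  contains an object.\<close>

lemma pi0_eq: "pi0 C = component_of_object C ` Ob C"
proof (intro subset_antisym subsetI)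
  fix c assume "c \<in> pi0 C"
  then obtain A where A: "A \<in> cells // glue" "c = path_component_of_set (classifying_space C) A"
    by (auto simp: path_components_of_def topspace_classifying_space)
  then obtain X fs t where x: "((X, fs), t) \<in> cells" "A = glue `` {((X, fs), t)}"
    by (auto elim!: quotientE)
  then have "X \<in> Ob C" by (auto simp: cells_eq nerve_def)
  moreover have "c = component_of_object C X"
    unfolding A x(2) component_of_object_def
    using path_component_vertex[OF x(1)] path_component_of_equiv by metis
  ultimately show "c \<in> component_of_object C ` Ob C" by blast
next
  fix c assume "c \<in> component_of_object C ` Ob C"
  then obtain X where X: "X \<in> Ob C" "c = component_of_object C X" by blast
  have "classifying_vertex C X \<in> topspace (classifying_space C)"
    unfolding classifying_vertex_def topspace_classifying_space
    by (rule quotientI) (rule vertex_in_cells[OF X(1)])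
  then show "c \<in> pi0 C"
    using X by (auto simp: path_components_of_def component_of_object_def)
qed

end

section \<open>Characters of finite groups\<close>

text \<open>Values outside \<open>H\<close> are arbitrary; the value at the unit excludes the zero
  function.\<close>

definition subgroup_character :: "('a, 'b) monoid_scheme \<Rightarrow> 'a set \<Rightarrow> ('a \<Rightarrow> complex) \<Rightarrow> bool" where
  "subgroup_character A H \<psi> \<longleftrightarrow> subgroup H A \<and> \<psi> \<one>\<^bsub>A\<^esub> = 1 \<and>
     (\<forall>x\<in>H. \<forall>y\<in>H. \<psi> (x \<otimes>\<^bsub>A\<^esub> y) = \<psi> x * \<psi> y)"

context comm_group
begin

lemma character_pow:
  assumes "subgroup_character G H \<psi>" "x \<in> H"
  shows "x [^] (n::nat) \<in> H \<and> \<psi> (x [^] n) = \<psi> x ^ n"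
proof -
  interpret subgroup H G using assms by (simp add: subgroup_character_def)
  show ?thesis
    using assms by (induction n) (auto simp: subgroup_character_def mult.commute)
qed

text \<open>The subgroup generated by \<open>H\<close> and \<open>b\<close> consists of the products
  \<open>h \<otimes> b [^] n\<close>, and two of them coincide only up to powers of \<open>b\<close>
  that lie in \<open>H\<close>. The exponents of such powers are the multiples of \<open>k\<close>,
  so \<open>w ^ k = \<psi> (b [^] k)\<close> is the only constraint on the value at
  \<open>b\<close>.\<close>

lemma character_adjoin:
  assumes \<psi>: "subgroup_character G H \<psi>" and b: "b \<in> carrier G"
    and k: "0 < k" "b [^] k \<in> H" and min: "\<And>m. 0 < m \<Longrightarrow> m < k \<Longrightarrow> b [^] m \<notin> H"
    and w: "w ^ k = \<psi> (b [^] k)"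
  shows "\<exists>K \<xi>. subgroup_character G K \<xi> \<and> insert b H \<subseteq> K \<and> (\<forall>h\<in>H. \<xi> h = \<psi> h) \<and> \<xi> b = w"
proof -
  interpret H: subgroup H G using \<psi> by (simp add: subgroup_character_def)
  have mult: "\<psi> (x \<otimes> y) = \<psi> x * \<psi> y" if "x \<in> H" "y \<in> H" for x y
    using \<psi> that by (simp add: subgroup_character_def)
  have one: "\<psi> \<one> = 1" using \<psi> by (simp add: subgroup_character_def)
  define K where "K = {h \<otimes> b [^] (n::nat) | h n. h \<in> H}"
  \<comment> \<open>Minimality of \<open>k\<close> forces the remainder of \<open>d\<close> modulo
    \<open>k\<close> to vanish.\<close>
  have pow_H: "\<psi> (b [^] d) = w ^ d" if d: "b [^] d \<in> H" for d :: nat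
  proof -
    have pk: "b [^] (k * q) \<in> H \<and> \<psi> (b [^] (k * q)) = w ^ (k * q)" for q
      using character_pow[OF \<psi> k(2), of q] b w by (simp add: nat_pow_pow power_mult)
    have "b [^] d = b [^] (k * (d div k)) \<otimes> b [^] (d mod k)"
      using b by (simp add: nat_pow_mult)
    then have "b [^] (d mod k) = inv (b [^] (k * (d div k))) \<otimes> b [^] d"
      using b by (simp add: inv_solve_left)
    then have "b [^] (d mod k) \<in> H" using d pk by simp
    then have "d mod k = 0" using min[of "d mod k"] k(1) by (meson mod_less_divisor neq0_conv)
    then have "d = k * (d div k)" by (simp add: mod_0_imp_dvd)
    with pk[of "d div k"] show ?thesis by simp
  qed
  \<comment> \<open>Two representations of an element differ by the power
    \<open>b [^] (n - m)\<close>, which lies in \<open>H\<close>, so that \<open>pow_H\<close>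
    applies.\<close>
  have wd: "\<psi> h * w ^ n = \<psi> h' * w ^ m"
    if e: "h \<otimes> b [^] n = h' \<otimes> b [^] m" and h: "h \<in> H" "h' \<in> H" and nm: "m \<le> n" for h h' and n m :: nat
  proof -
    have "b [^] n = b [^] (n - m) \<otimes> b [^] m" using b nm by (simp add: nat_pow_mult)
    then have "h \<otimes> b [^] (n - m) \<otimes> b [^] m = h' \<otimes> b [^] m"
      using e b h by (simp add: m_assoc)
    then have e': "h \<otimes> b [^] (n - m) = h'" using b h by simp
    then have "b [^] (n - m) = inv h \<otimes> h'" using b h by (simp add: inv_solve_left)
    then have "b [^] (n - m) \<in> H" using h by simp
    then have "\<psi> h' = \<psi> h * w ^ (n - m)" using e' pow_H mult h by metis
    then show ?thesis using nm by (simp flip: power_add)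
  qed
  have wd': "\<psi> h * w ^ n = \<psi> h' * w ^ m"
    if "h \<otimes> b [^] n = h' \<otimes> b [^] m" "h \<in> H" "h' \<in> H" for h h' and n m :: nat
    using wd[OF that] wd[OF that(1)[symmetric] that(3,2)] by (cases "m \<le> n") auto
  define \<xi> where "\<xi> x = (SOME v. \<exists>h n. h \<in> H \<and> x = h \<otimes> b [^] (n::nat) \<and> v = \<psi> h * w ^ n)" for x
  have \<xi>: "\<xi> (h \<otimes> b [^] n) = \<psi> h * w ^ n" if "h \<in> H" for h and n :: nat
  proof -
    have "\<exists>v h' m. h' \<in> H \<and> h \<otimes> b [^] n = h' \<otimes> b [^] (m::nat) \<and> v = \<psi> h' * w ^ m"
      using that by blast
    from someI_ex[OF this] obtain h' m where
      "h' \<in> H" "h \<otimes> b [^] n = h' \<otimes> b [^] (m::nat)" "\<xi> (h \<otimes> b [^] n) = \<psi> h' * w ^ m"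
      unfolding \<xi>_def[symmetric] by blast
    then show ?thesis using wd'[OF _ that] by simp
  qed
  have \<xi>H: "\<xi> h = \<psi> h" if "h \<in> H" for h using \<xi>[OF that, of 0] that by simp
  have \<xi>b: "\<xi> b = w" using \<xi>[of \<one> 1] b one by simp
  have prod: "(h \<otimes> b [^] n) \<otimes> (h' \<otimes> b [^] m) = (h \<otimes> h') \<otimes> b [^] (n + m)"
    if "h \<in> H" "h' \<in> H" for h h' and n m :: nat
    using that b by (simp add: m_ac flip: nat_pow_mult)
  have K_I: "h \<otimes> b [^] n \<in> K" if "h \<in> H" for h and n :: nat
    using that unfolding K_def by blast
  have bH: "h \<in> carrier G" "b [^] n \<in> carrier G" if "h \<in> H" for h and n :: nat
    using that b by simp_all
  have "subgroup K G"
  proof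
    show "K \<subseteq> carrier G" unfolding K_def
      by (rule subsetI) (elim CollectE exE conjE, simp add: bH)
    show "\<one> \<in> K" using K_I[OF H.one_closed, of 0] by simp
    fix x y assume "x \<in> K" "y \<in> K"
    then obtain h n h' m where "x = h \<otimes> b [^] (n::nat)" "h \<in> H" "y = h' \<otimes> b [^] (m::nat)" "h' \<in> H"
      unfolding K_def by blast
    then show "x \<otimes> y \<in> K" using K_I[OF H.m_closed] prod by simp
  next
    fix x assume "x \<in> K"
    then obtain h n where x: "x = h \<otimes> b [^] (n::nat)" "h \<in> H" by (auto simp: K_def)
    \<comment> \<open>Exponents are natural numbers, so the inverse of \<open>b [^] n\<close> is
      written as \<open>b [^] (k * n - n)\<close> times the inverse of \<open>b [^] (k * n)\<close>,
      an element of \<open>H\<close>.\<close>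
    have "n * 1 \<le> n * k" using k(1) by (intro mult_le_mono2) simp
    then have n: "n \<le> k * n" by (simp add: mult.commute)
    have kn: "b [^] (k * n) \<in> H" using character_pow[OF \<psi> k(2), of n] b by (simp add: nat_pow_pow)
    define y where "y = inv (h \<otimes> b [^] (k * n)) \<otimes> b [^] (k * n - n)"
    have "h \<otimes> b [^] n \<otimes> b [^] (k * n - n) = h \<otimes> b [^] (k * n)"
      using n bH[OF x(2)] by (simp add: m_assoc nat_pow_mult b)
    then have "y \<otimes> x = \<one>"
      unfolding y_def x(1) using bH[OF x(2)] kn
      by (simp add: m_assoc m_comm[of "b [^] (k * n - n)"])
    then have "inv x = y"
      unfolding y_def x(1) using bH[OF x(2)] by (intro inv_equality) simp_all
    then show "inv x \<in> K" unfolding y_def using K_I kn x(2) by simp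
  qed
  moreover have "\<xi> (x \<otimes> y) = \<xi> x * \<xi> y" if xy: "x \<in> K" "y \<in> K" for x y
  proof -
    obtain h n h' m where *: "x = h \<otimes> b [^] (n::nat)" "h \<in> H" "y = h' \<otimes> b [^] (m::nat)" "h' \<in> H"
      using xy by (auto simp: K_def)
    have "\<xi> (x \<otimes> y) = \<psi> (h \<otimes> h') * w ^ (n + m)"
      unfolding *(1,3) prod[OF *(2,4)] using \<xi> * by simp
    also have "\<dots> = \<xi> x * \<xi> y" unfolding *(1,3) using \<xi> * mult by (simp add: power_add)
    finally show ?thesis .
  qed
  ultimately have "subgroup_character G K \<xi>"
    using \<xi>H one by (simp add: subgroup_character_def)
  moreover have "b \<in> K" using K_I[OF H.one_closed, of 1] b by simp
  moreover have "H \<subseteq> K"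
  proof
    fix h assume "h \<in> H"
    then show "h \<in> K" using K_I[of h 0] by simp
  qed
  ultimately show ?thesis using \<xi>H \<xi>b by (intro exI[of _ K] exI[of _ \<xi>]) simp
qed

lemma least_power_in_subgroup:
  assumes fin: "finite (carrier G)" and H: "subgroup H G" and b: "b \<in> carrier G"
  obtains k :: nat where "0 < k" "b [^] k \<in> H" "\<And>m. 0 < m \<Longrightarrow> m < k \<Longrightarrow> b [^] m \<notin> H"
proof -
  let ?P = "\<lambda>k::nat. 0 < k \<and> b [^] k \<in> H"
  have "?P (order G)"
    using pow_order_eq_1[OF b] fin H by (simp add: subgroup.one_closed order_gt_0_iff_finite)
  then have "?P (LEAST k. ?P k)" by (rule LeastI[of ?P])
  then show ?thesis using not_less_Least[of _ ?P] by (intro that[of "LEAST k. ?P k"]) auto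
qed

text \<open>Adjoin one element at a time; the root of order \<open>k\<close> that
  \<open>character_adjoin\<close> asks for exists in the complex numbers.\<close>

lemma character_extend:
  assumes fin: "finite (carrier G)"
  shows "subgroup_character G H \<psi> \<Longrightarrow> \<exists>\<xi>. subgroup_character G (carrier G) \<xi> \<and> (\<forall>h\<in>H. \<xi> h = \<psi> h)"
proof (induction "card (carrier G) - card H" arbitrary: H \<psi> rule: less_induct)
  case less
  then have H: "subgroup H G" by (simp add: subgroup_character_def)
  show ?case
  proof (cases "H = carrier G")
    case False
    then obtain b where b: "b \<in> carrier G" "b \<notin> H" using subgroup.subset[OF H] by blast
    obtain k :: nat where k: "0 < k" "b [^] k \<in> H" "\<And>m. 0 < m \<Longrightarrow> m < k \<Longrightarrow> b [^] m \<notin> H"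
      using least_power_in_subgroup[OF fin H b(1)] by blast
    have "\<exists>w. w ^ k = \<psi> (b [^] k)"
    proof (cases "\<psi> (b [^] k) = 0")
      case True then show ?thesis using k(1) by (intro exI[of _ 0]) simp
    next
      case False
      then have "exp (Ln (\<psi> (b [^] k)) / of_nat k) ^ k = \<psi> (b [^] k)"
        using k(1) by (simp flip: exp_of_nat_mult)
      then show ?thesis by blast
    qed
    then obtain w where w: "w ^ k = \<psi> (b [^] k)" by blast
    obtain K \<xi> where K: "subgroup_character G K \<xi>" "insert b H \<subseteq> K" "\<forall>h\<in>H. \<xi> h = \<psi> h"
      using character_adjoin[OF less.prems b(1) k w] by blast
    have KG: "K \<subseteq> carrier G" using K(1) by (auto simp: subgroup_character_def dest: subgroup.subset)
    have "card H < card K" using b K(2) finite_subset[OF KG fin] by (intro psubset_card_mono) auto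
    moreover have "card K \<le> card (carrier G)" using KG fin by (rule card_mono[rotated])
    ultimately have "card (carrier G) - card K < card (carrier G) - card H" by linarith
    from less.hyps[OF this K(1)] obtain \<xi>' where
      "subgroup_character G (carrier G) \<xi>'" "\<forall>h\<in>K. \<xi>' h = \<xi> h" by blast
    then show ?thesis using K(2,3) by (intro exI[of _ \<xi>']) auto
  qed (use less.prems in blast)
qed

text \<open>On the cyclic group generated by \<open>a\<close>, whose order \<open>k\<close> exceeds
  1, send \<open>a\<close> to a primitive root of unity of order \<open>k\<close>, then
  extend.\<close>

lemma character_separates:
  assumes fin: "finite (carrier G)" and a: "a \<in> carrier G" "a \<noteq> \<one>"
  shows "\<exists>\<xi>. subgroup_character G (carrier G) \<xi> \<and> \<xi> a \<noteq> 1"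
proof -
  have H: "subgroup_character G {\<one>} (\<lambda>_. 1)" by (simp add: subgroup_character_def triv_subgroup)
  then have "subgroup {\<one>} G" by (simp add: subgroup_character_def)
  then obtain k :: nat where k: "0 < k" "a [^] k \<in> {\<one>}" "\<And>m. 0 < m \<Longrightarrow> m < k \<Longrightarrow> a [^] m \<notin> {\<one>}"
    using least_power_in_subgroup[OF fin _ a(1)] by blast
  define w where "w = exp (2 * of_real pi * \<i> * of_nat 1 / of_nat k)"
  have "w ^ k = 1" unfolding w_def using k(1) by (intro complex_root_unity) auto
  moreover have "k \<noteq> 1" using k(2) a by auto
  then have "w \<noteq> 1" unfolding w_def using k(1) complex_root_unity_eq_1[of k 1] by auto
  ultimately show ?thesis
    using character_adjoin[OF H a(1) k, of w] character_extend[OF fin]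
    by (metis insert_subset)
qed

end

text \<open>Pulled back from the abelianization. The values have norm 1 because each is a root of
  unity whose order divides the order of the group.\<close>

lemma (in group) character_separates_derived:
  assumes fin: "finite (carrier G)" and a: "a \<in> carrier G" "a \<notin> derived G (carrier G)"
  obtains \<xi> :: "'a \<Rightarrow> complex" where "\<And>x. x \<in> carrier G \<Longrightarrow> norm (\<xi> x) = 1"
    "\<And>x y. x \<in> carrier G \<Longrightarrow> y \<in> carrier G \<Longrightarrow> \<xi> (x \<otimes> y) = \<xi> x * \<xi> y" "\<xi> a \<noteq> 1"
proof -
  let ?D = "derived G (carrier G)"
  interpret N: normal ?D G by (rule derived_self_is_normal)
  interpret A: comm_group "G Mod ?D" by (rule derived_quot_is_comm_group)
  have "finite (carrier (G Mod ?D))" using fin by (auto simp: FactGroup_def RCOSETS_def)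
  moreover have "?D #> a \<in> carrier (G Mod ?D)" using a(1) by (auto simp: FactGroup_def RCOSETS_def)
  moreover have "?D #> a \<noteq> \<one>\<^bsub>G Mod ?D\<^esub>"
    using a rcos_self[OF a(1) N.is_subgroup] by auto
  ultimately obtain \<xi> where \<xi>: "subgroup_character (G Mod ?D) (carrier (G Mod ?D)) \<xi>" "\<xi> (?D #> a) \<noteq> 1"
    using A.character_separates by blast
  define \<psi> where "\<psi> x = \<xi> (?D #> x)" for x
  have mem: "?D #> x \<in> carrier (G Mod ?D)" if "x \<in> carrier G" for x
    using that by (auto simp: FactGroup_def RCOSETS_def)
  have mult: "\<psi> (x \<otimes> y) = \<psi> x * \<psi> y" if "x \<in> carrier G" "y \<in> carrier G" for x y
  proof -
    have "\<xi> ((?D #> x) \<otimes>\<^bsub>G Mod ?D\<^esub> (?D #> y)) = \<psi> x * \<psi> y"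
      using \<xi>(1) mem that unfolding \<psi>_def subgroup_character_def by blast
    then show ?thesis using N.rcos_sum[OF that] by (simp add: \<psi>_def)
  qed
  have one: "\<psi> \<one> = 1"
    using \<xi>(1) N.subset by (simp add: \<psi>_def subgroup_character_def)
  have pow: "\<psi> (x [^] n) = \<psi> x ^ n" if "x \<in> carrier G" for x and n :: nat
    using that by (induction n) (auto simp: one mult)
  have "norm (\<psi> x) = 1" if "x \<in> carrier G" for x
  proof -
    have "norm (\<psi> x) ^ order G = 1" using pow[OF that, of "order G"] pow_order_eq_1[OF that] one
      by (simp flip: norm_power)
    moreover have "order G > 0" using fin order_gt_0_iff_finite by blast
    ultimately show ?thesis using power_eq_1_iff[of "norm (\<psi> x)" "order G"] by auto
  qed
  with mult show ?thesis using \<xi>(2) by (intro that[of \<psi>]) (auto simp: \<psi>_def)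
qed

section \<open>Calculus in the half plane\<close>

lemma Ck_on_cong:
  assumes "open S" "\<And>x. x \<in> S \<Longrightarrow> f x = g x" "Ck_on k f S"
  shows "Ck_on k g S"
  using assms(2,3)
proof (induction k arbitrary: f g)
  case 0
  then show ?case using continuous_on_cong[of S S f g] by simp
next
  case (Suc k)
  have d: "(g has_derivative frechet_derivative f (at x)) (at x)" if "x \<in> S" for x
  proof (rule has_derivative_transform_within_open[OF _ \<open>open S\<close> that])
    show "(f has_derivative frechet_derivative f (at x)) (at x)"
      using Suc.prems(2) that by (simp add: frechet_derivative_works)
  qed (rule Suc.prems(1))
  then have "frechet_derivative f (at x) v = frechet_derivative g (at x) v" if "x \<in> S" for x v
    using that by (metis frechet_derivative_at)
  moreover have "Ck_on k (\<lambda>x. frechet_derivative f (at x) v) S" for v using Suc.prems(2) by simp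
  ultimately have "Ck_on k (\<lambda>x. frechet_derivative g (at x) v) S" for v
    using Suc.IH[of "\<lambda>x. frechet_derivative f (at x) v" "\<lambda>x. frechet_derivative g (at x) v"] by blast
  with d show ?case by (auto simp: differentiable_def)
qed

text \<open>Any family of derivatives may be exhibited in place of
  \<open>frechet_derivative\<close>, by uniqueness of derivatives on open sets.\<close>

lemma Ck_on_SucI:
  assumes "open S" "\<And>x. x \<in> S \<Longrightarrow> (f has_derivative f' x) (at x)" "\<And>v. Ck_on k (\<lambda>x. f' x v) S"
  shows "Ck_on (Suc k) f S"
proof -
  have "f' x v = frechet_derivative f (at x) v" if "x \<in> S" for x v
    using frechet_derivative_at[OF assms(2)[OF that]] by simp
  then have "Ck_on k (\<lambda>x. frechet_derivative f (at x) v) S" for v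
    by (rule Ck_on_cong[OF assms(1) _ assms(3)])
  then show ?thesis using assms(2) by (auto simp: differentiable_def)
qed

lemma Ck_on_SucD:
  assumes "Ck_on (Suc k) f S"
  shows "x \<in> S \<Longrightarrow> (f has_derivative frechet_derivative f (at x)) (at x)"
    "Ck_on k (\<lambda>x. frechet_derivative f (at x) v) S"
  using assms by (simp_all add: frechet_derivative_works)

lemma Ck_on_imp_continuous_on: "Ck_on k f S \<Longrightarrow> continuous_on S f"
  by (cases k) (auto intro!: continuous_at_imp_continuous_on differentiable_imp_continuous_within)

lemma Ck_on_pred: "Ck_on (Suc k) f S \<Longrightarrow> Ck_on k f S"
proof (induction k arbitrary: f)
  case 0
  then show ?case using Ck_on_imp_continuous_on[OF 0] by simp
next
  case (Suc k)
  have "Ck_on k (\<lambda>x. frechet_derivative f (at x) v) S" for v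
    using Suc.IH Suc.prems by simp
  then show ?case using Suc.prems by simp
qed

lemma Ck_on_subset: "Ck_on k f S \<Longrightarrow> T \<subseteq> S \<Longrightarrow> Ck_on k f T"
  by (induction k arbitrary: f) (auto intro: continuous_on_subset)

lemma Ck_on_const: "open S \<Longrightarrow> Ck_on k (\<lambda>x. c) S"
proof (induction k arbitrary: c)
  case (Suc k)
  show ?case by (rule Ck_on_SucI[OF Suc.prems, where f' = "\<lambda>x v. 0"]) (use Suc in auto)
qed simp

lemma Ck_on_linear: "open S \<Longrightarrow> bounded_linear f \<Longrightarrow> Ck_on k f S"
proof (cases k)
  case (Suc j)
  assume "open S" "bounded_linear f"
  then show ?thesis unfolding Suc
    by (intro Ck_on_SucI[where f' = "\<lambda>x. f"] Ck_on_const bounded_linear_imp_has_derivative)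
qed (simp add: linear_continuous_on)

lemma Ck_on_add: "open S \<Longrightarrow> Ck_on k f S \<Longrightarrow> Ck_on k g S \<Longrightarrow> Ck_on k (\<lambda>x. f x + g x) S"
proof (induction k arbitrary: f g)
  case (Suc k)
  show ?case
    by (rule Ck_on_SucI[OF Suc.prems(1), where f' = "\<lambda>x v. frechet_derivative f (at x) v + frechet_derivative g (at x) v"])
      (use Suc Ck_on_SucD[OF Suc.prems(2)] Ck_on_SucD[OF Suc.prems(3)] in \<open>auto intro: has_derivative_add\<close>)
qed (simp add: continuous_on_add)

lemma Ck_on_bilinear:
  assumes "bounded_bilinear (prd :: 'a::euclidean_space \<Rightarrow> 'b::euclidean_space \<Rightarrow> 'c::euclidean_space)" "open S"
  shows "Ck_on k f S \<Longrightarrow> Ck_on k g S \<Longrightarrow> Ck_on k (\<lambda>x. prd (f x) (g x)) S"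
proof (induction k arbitrary: f g)
  case 0
  then show ?case using bounded_bilinear.continuous_on[OF assms(1)] by simp
next
  case (Suc k)
  show ?case
  proof (rule Ck_on_SucI[OF assms(2), where f' = "\<lambda>x v. prd (f x) (frechet_derivative g (at x) v)
      + prd (frechet_derivative f (at x) v) (g x)"])
    show "((\<lambda>x. prd (f x) (g x)) has_derivative (\<lambda>v. prd (f x) (frechet_derivative g (at x) v)
      + prd (frechet_derivative f (at x) v) (g x))) (at x)" if "x \<in> S" for x
      using bounded_bilinear.FDERIV[OF assms(1) Ck_on_SucD(1)[OF Suc.prems(1) that] Ck_on_SucD(1)[OF Suc.prems(2) that]] .
    show "Ck_on k (\<lambda>x. prd (f x) (frechet_derivative g (at x) v) + prd (frechet_derivative f (at x) v) (g x)) S" for v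
      by (intro Ck_on_add[OF assms(2)] Suc.IH Ck_on_SucD(2) Suc.prems Ck_on_pred[OF Suc.prems(1)] Ck_on_pred[OF Suc.prems(2)])
  qed
qed

lemma Ck_on_sum:
  "open S \<Longrightarrow> (\<And>i. i \<in> I \<Longrightarrow> Ck_on k (f i) S) \<Longrightarrow> Ck_on k (\<lambda>x. \<Sum>i\<in>I. f i x) S"
  by (induction I rule: infinite_finite_induct) (auto intro: Ck_on_const Ck_on_add)

text \<open>\<open>Ck_on\<close> speaks of derivatives in a fixed direction, but the chain rule
  evaluates the derivative of \<open>g\<close> in the moving direction \<open>?f x v\<close>.
  Expanding that direction in the basis leaves fixed directions with coefficients of class
  \<open>k\<close>.\<close>

lemma Ck_on_compose:
  assumes "open S" "open T"
  shows "Ck_on k f S \<Longrightarrow> Ck_on k g T \<Longrightarrow> f ` S \<subseteq> T \<Longrightarrow> Ck_on k (\<lambda>x. g (f x)) S"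
proof (induction k arbitrary: g)
  case 0
  then show ?case using continuous_on_compose2[of T g S f] by simp
next
  case (Suc k)
  let ?f = "\<lambda>x. frechet_derivative f (at x)" and ?g = "\<lambda>y. frechet_derivative g (at y)"
  have lin: "?g (f x) (?f x v) = (\<Sum>b\<in>Basis. (?f x v \<bullet> b) *\<^sub>R ?g (f x) b)" if "x \<in> S" for x v
  proof -
    have "linear (?g (f x))"
      using Ck_on_SucD(1)[OF Suc.prems(2)] that Suc.prems(3) by (intro has_derivative_linear) blast
    then have "?g (f x) (\<Sum>b\<in>Basis. (?f x v \<bullet> b) *\<^sub>R b) = (\<Sum>b\<in>Basis. (?f x v \<bullet> b) *\<^sub>R ?g (f x) b)"
      by (simp add: linear_sum linear_scale)
    then show ?thesis by (simp add: euclidean_representation)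
  qed
  show ?case
  proof (rule Ck_on_SucI[OF assms(1), where f' = "\<lambda>x v. ?g (f x) (?f x v)"])
    show "((\<lambda>x. g (f x)) has_derivative (\<lambda>v. ?g (f x) (?f x v))) (at x)" if "x \<in> S" for x
    proof (rule has_derivative_compose[OF Ck_on_SucD(1)[OF Suc.prems(1) that] Ck_on_SucD(1)[OF Suc.prems(2)]])
      show "f x \<in> T" using that Suc.prems(3) by blast
    qed
    show "Ck_on k (\<lambda>x. ?g (f x) (?f x v)) S" for v
    proof (rule Ck_on_cong[OF assms(1) lin[symmetric]])
      show "Ck_on k (\<lambda>x. \<Sum>b\<in>Basis. (?f x v \<bullet> b) *\<^sub>R ?g (f x) b) S"
      proof (intro Ck_on_sum[OF assms(1)] Ck_on_bilinear[OF bounded_bilinear_scaleR assms(1)])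
        fix b :: 'b
        show "Ck_on k (\<lambda>x. ?f x v \<bullet> b) S"
          by (rule Ck_on_bilinear[OF bounded_bilinear_inner assms(1) Ck_on_SucD(2)[OF Suc.prems(1)] Ck_on_const[OF assms(1)]])
        show "Ck_on k (\<lambda>x. ?g (f x) b) S"
          by (rule Suc.IH[OF Ck_on_pred[OF Suc.prems(1)] Ck_on_SucD(2)[OF Suc.prems(2)] Suc.prems(3)])
      qed
    qed
  qed
qed

section \<open>Functions of class k on arbitrary sets, by local extension\<close>

definition Ck_ext :: "nat \<Rightarrow> 'a::euclidean_space set \<Rightarrow> ('a \<Rightarrow> 'b::euclidean_space) \<Rightarrow> bool" where
  "Ck_ext k S f \<longleftrightarrow> (\<forall>x\<in>S. \<exists>T g. open T \<and> x \<in> T \<and> Ck_on k g T \<and> (\<forall>y\<in>S \<inter> T. g y = f y))"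

lemma Ck_extE:
  assumes "Ck_ext k S f" "x \<in> S"
  obtains T g where "open T" "x \<in> T" "Ck_on k g T" "\<And>y. y \<in> S \<Longrightarrow> y \<in> T \<Longrightarrow> g y = f y"
proof -
  from assms obtain T g where "open T \<and> x \<in> T \<and> Ck_on k g T \<and> (\<forall>y\<in>S \<inter> T. g y = f y)"
    unfolding Ck_ext_def by (elim ballE[of _ _ x] exE) auto
  then show ?thesis by (intro that[of T g]) auto
qed

lemma smooth_on_imp_Ck_ext: "smooth_on S f \<Longrightarrow> Ck_ext k S f"
  unfolding smooth_on_def Ck_ext_def by fast

lemma Ck_ext_pred: "Ck_ext (Suc k) S f \<Longrightarrow> Ck_ext k S f"
  unfolding Ck_ext_def using Ck_on_pred by fast

lemma Ck_ext_subset: "Ck_ext k S f \<Longrightarrow> T \<subseteq> S \<Longrightarrow> Ck_ext k T f"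
  unfolding Ck_ext_def[of k T f]
proof
  fix x assume f: "Ck_ext k S f" and TS: "T \<subseteq> S" and x: "x \<in> T"
  obtain A g where "open A" "x \<in> A" "Ck_on k g A" "\<And>y. y \<in> S \<Longrightarrow> y \<in> A \<Longrightarrow> g y = f y"
    using Ck_extE[OF f] x TS by blast
  then show "\<exists>A g. open A \<and> x \<in> A \<and> Ck_on k g A \<and> (\<forall>y\<in>T \<inter> A. g y = f y)"
    using TS by (intro exI[of _ A] exI[of _ g]) (simp add: subset_iff)
qed

lemma Ck_ext_cong: "Ck_ext k S f \<Longrightarrow> (\<And>x. x \<in> S \<Longrightarrow> f x = g x) \<Longrightarrow> Ck_ext k S g"
  unfolding Ck_ext_def by simp

lemma Ck_ext_local:
  assumes "\<And>x. x \<in> S \<Longrightarrow> \<exists>T. open T \<and> x \<in> T \<and> Ck_ext k (S \<inter> T) f"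
  shows "Ck_ext k S f"
  unfolding Ck_ext_def
proof
  fix x assume x: "x \<in> S"
  from assms[OF x] obtain T where T: "open T" "x \<in> T" "Ck_ext k (S \<inter> T) f" by blast
  then obtain T' g where T': "open T'" "x \<in> T'" "Ck_on k g T'" "\<And>y. y \<in> S \<inter> T \<Longrightarrow> y \<in> T' \<Longrightarrow> g y = f y"
    using x by (elim Ck_extE[where x = x]) auto
  show "\<exists>T g. open T \<and> x \<in> T \<and> Ck_on k g T \<and> (\<forall>y\<in>S \<inter> T. g y = f y)"
    using T T' Ck_on_subset[OF T'(3), of "T \<inter> T'"] by (intro exI[of _ "T \<inter> T'"] exI[of _ g]) auto
qed

lemma Ck_ext_continuous_on: "Ck_ext k S f \<Longrightarrow> continuous_on S f"
proof (unfold continuous_on_eq_continuous_within, intro ballI)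
  fix x assume "Ck_ext k S f" "x \<in> S"
  then obtain T g where T: "open T" "x \<in> T" "Ck_on k g T" "\<And>y. y \<in> S \<Longrightarrow> y \<in> T \<Longrightarrow> g y = f y"
    by (auto elim: Ck_extE)
  have "continuous (at x) g"
    using Ck_on_imp_continuous_on[OF T(3)] T(1,2) by (simp add: continuous_on_eq_continuous_at)
  then have "continuous (at x within S) g" by (rule continuous_at_imp_continuous_at_within)
  then show "continuous (at x within S) f"
    by (rule continuous_transform_within_openin[where T = S and S = "S \<inter> T"])
      (use T \<open>x \<in> S\<close> in \<open>auto simp: openin_open_Int\<close>)
qed

lemma Ck_on_imp_Ck_ext: "open S \<Longrightarrow> Ck_on k f S \<Longrightarrow> Ck_ext k S f"
  unfolding Ck_ext_def by (intro ballI exI[of _ S] exI[of _ f]) simp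

lemma Ck_ext_const: "Ck_ext k S (\<lambda>x. c)"
  by (rule Ck_ext_subset[OF Ck_on_imp_Ck_ext[OF open_UNIV Ck_on_const[OF open_UNIV]]]) simp

lemma Ck_ext_linear: "bounded_linear f \<Longrightarrow> Ck_ext k S f"
  by (rule Ck_ext_subset[OF Ck_on_imp_Ck_ext[OF open_UNIV Ck_on_linear[OF open_UNIV]]]) simp_all

lemma Ck_ext_bilinear:
  assumes "bounded_bilinear (prd :: 'a::euclidean_space \<Rightarrow> 'b::euclidean_space \<Rightarrow> 'c::euclidean_space)"
    and "Ck_ext k S f" "Ck_ext k S g"
  shows "Ck_ext k S (\<lambda>x. prd (f x) (g x))"
  unfolding Ck_ext_def
proof
  fix x assume x: "x \<in> S"
  obtain T f' where T: "open T" "x \<in> T" "Ck_on k f' T" "\<And>y. y \<in> S \<Longrightarrow> y \<in> T \<Longrightarrow> f' y = f y"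
    using assms(2) x by (elim Ck_extE) auto
  obtain T' g' where T': "open T'" "x \<in> T'" "Ck_on k g' T'" "\<And>y. y \<in> S \<Longrightarrow> y \<in> T' \<Longrightarrow> g' y = g y"
    using assms(3) x by (elim Ck_extE) auto
  have "Ck_on k (\<lambda>x. prd (f' x) (g' x)) (T \<inter> T')"
    using T T' by (intro Ck_on_bilinear[OF assms(1)] Ck_on_subset[OF T(3)] Ck_on_subset[OF T'(3)]) auto
  then show "\<exists>T h. open T \<and> x \<in> T \<and> Ck_on k h T \<and> (\<forall>y\<in>S \<inter> T. h y = prd (f y) (g y))"
    using T T' by (intro exI[of _ "T \<inter> T'"] exI[of _ "\<lambda>x. prd (f' x) (g' x)"]) auto
qed

lemma Ck_ext_compose:
  assumes "Ck_ext k S f" "Ck_ext k T g" "\<And>x. x \<in> S \<Longrightarrow> f x \<in> T"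
  shows "Ck_ext k S (\<lambda>x. g (f x))"
  unfolding Ck_ext_def
proof
  fix x assume x: "x \<in> S"
  obtain A f' where A: "open A" "x \<in> A" "Ck_on k f' A" "\<And>y. y \<in> S \<Longrightarrow> y \<in> A \<Longrightarrow> f' y = f y"
    using assms(1) x by (elim Ck_extE) auto
  obtain B g' where B: "open B" "f x \<in> B" "Ck_on k g' B" "\<And>y. y \<in> T \<Longrightarrow> y \<in> B \<Longrightarrow> g' y = g y"
    using assms(2) assms(3)[OF x] by (elim Ck_extE) auto
  let ?C = "A \<inter> f' -` B"
  have "open ?C"
    using continuous_open_preimage[OF Ck_on_imp_continuous_on[OF A(3)] A(1) B(1)] by simp
  moreover from this have "Ck_on k (\<lambda>x. g' (f' x)) ?C"
    by (intro Ck_on_compose[OF _ B(1) Ck_on_subset[OF A(3)] B(3)]) auto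
  ultimately show "\<exists>T h. open T \<and> x \<in> T \<and> Ck_on k h T \<and> (\<forall>y\<in>S \<inter> T. h y = g (f y))"
    using A B x assms(3) by (intro exI[of _ ?C] exI[of _ "\<lambda>x. g' (f' x)"]) auto
qed

lemma Ck_ext_bounded_linear: "bounded_linear h \<Longrightarrow> Ck_ext k S f \<Longrightarrow> Ck_ext k S (\<lambda>x. h (f x))"
  by (rule Ck_ext_compose[OF _ Ck_ext_linear[where S = UNIV]]) auto

lemma Ck_ext_add:
  assumes "Ck_ext k S f" "Ck_ext k S g" shows "Ck_ext k S (\<lambda>x. f x + g x)"
  unfolding Ck_ext_def
proof
  fix x assume x: "x \<in> S"
  obtain T f' where T: "open T" "x \<in> T" "Ck_on k f' T" "\<And>y. y \<in> S \<Longrightarrow> y \<in> T \<Longrightarrow> f' y = f y"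
    using assms(1) x by (elim Ck_extE) auto
  obtain T' g' where T': "open T'" "x \<in> T'" "Ck_on k g' T'" "\<And>y. y \<in> S \<Longrightarrow> y \<in> T' \<Longrightarrow> g' y = g y"
    using assms(2) x by (elim Ck_extE) auto
  have "Ck_on k (\<lambda>x. f' x + g' x) (T \<inter> T')"
    using T T' by (intro Ck_on_add Ck_on_subset[OF T(3)] Ck_on_subset[OF T'(3)]) auto
  then show "\<exists>T h. open T \<and> x \<in> T \<and> Ck_on k h T \<and> (\<forall>y\<in>S \<inter> T. h y = f y + g y)"
    using T T' by (intro exI[of _ "T \<inter> T'"] exI[of _ "\<lambda>x. f' x + g' x"]) auto
qed

lemma Ck_ext_sum: "(\<And>i. i \<in> I \<Longrightarrow> Ck_ext k S (f i)) \<Longrightarrow> Ck_ext k S (\<lambda>x. \<Sum>i\<in>I. f i x)"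
  by (induction I rule: infinite_finite_induct) (auto intro: Ck_ext_const Ck_ext_add)

lemmas Ck_ext_scaleR = Ck_ext_bilinear[OF bounded_bilinear_scaleR]

lemma Ck_ext_mult:
  fixes f g :: "'a::euclidean_space \<Rightarrow> 'b::{euclidean_space, real_normed_algebra}"
  shows "Ck_ext k S f \<Longrightarrow> Ck_ext k S g \<Longrightarrow> Ck_ext k S (\<lambda>x. f x * g x)"
  by (rule Ck_ext_bilinear[OF bounded_bilinear_mult])

lemma Ck_ext_diff: "Ck_ext k S f \<Longrightarrow> Ck_ext k S g \<Longrightarrow> Ck_ext k S (\<lambda>x. f x - g x)"
  using Ck_ext_add[OF _ Ck_ext_bounded_linear[OF bounded_linear_minus[OF bounded_linear_ident]], of k S f g] by simp

text \<open>Serves for the transition functions of a flat bundle.\<close>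

lemma Ck_ext_locally_const:
  assumes "\<And>x. x \<in> S \<Longrightarrow> \<exists>T. open T \<and> x \<in> T \<and> (\<forall>y\<in>S \<inter> T. f y = f x)"
  shows "Ck_ext k S f"
  unfolding Ck_ext_def
proof
  fix x assume "x \<in> S"
  from assms[OF this] obtain T where T: "open T" "x \<in> T" "\<forall>y\<in>S \<inter> T. f y = f x" by blast
  then show "\<exists>T g. open T \<and> x \<in> T \<and> Ck_on k g T \<and> (\<forall>y\<in>S \<inter> T. g y = f y)"
    by (intro exI[of _ T] exI[of _ "\<lambda>_. f x"]) (simp add: Ck_on_const)
qed

section \<open>Partial derivatives on relatively open subsets of the half plane\<close>

abbreviation half_open :: "(real^2) set \<Rightarrow> bool" where
  "half_open \<equiv> openin (top_of_set half_plane)"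

text \<open>Derivatives within the half plane and within a relatively open subset of it agree, so
  \<open>pd\<close> carries no domain.\<close>

definition pd :: "2 \<Rightarrow> (real^2 \<Rightarrow> 'b::real_normed_vector) \<Rightarrow> real^2 \<Rightarrow> 'b" where
  "pd i f x = frechet_derivative f (at x within half_plane) (axis i 1)"

lemma at_within_half_open:
  assumes "half_open E" "x \<in> E" shows "at x within E = at x within half_plane"
proof -
  obtain T where T: "open T" "E = half_plane \<inter> T" using assms(1) by (auto simp: openin_open)
  show ?thesis by (rule at_within_nhd[of x T]) (use T assms(2) in auto)
qed

text \<open>A shift in the positive direction stays in the half plane; this makes derivatives unique
  even at boundary points.\<close>

lemma half_plane_directions:
  assumes "x \<in> half_plane" "i \<in> Basis" "0 < e"
  shows "\<exists>d. 0 < \<bar>d\<bar> \<and> \<bar>d\<bar> < e \<and> x + d *\<^sub>R i \<in> half_plane"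
proof -
  obtain j where "i = axis j 1" using assms(2) by (auto simp: Basis_vec_def)
  then show ?thesis using assms(1,3)
    by (intro exI[of _ "e / 2"]) (auto simp: half_plane_def axis_def)
qed

lemma half_plane_derivative_unique:
  fixes f :: "real^2 \<Rightarrow> 'b::euclidean_space"
  assumes "x \<in> half_plane" "(f has_derivative f') (at x within half_plane)"
  shows "frechet_derivative f (at x within half_plane) = f'"
proof -
  have "f differentiable (at x within half_plane)"
    using assms(2) by (auto simp: differentiable_def)
  then have "(f has_derivative frechet_derivative f (at x within half_plane)) (at x within half_plane)"
    by (simp flip: frechet_derivative_works)
  then show ?thesis
    using assms half_plane_directions by (intro frechet_derivative_unique_within[of f _ x half_plane f']) auto
qed

text \<open>The extension \<open>g\<close> is not unique, but its derivative at the points of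
  \<open>E\<close> is, as \<open>E\<close> is relatively open in the half plane. So one extension
  computes the derivative at all nearby points of \<open>E\<close>, and the derivatives inherit
  local extensions.\<close>

lemma Ck_ext_has_derivative:
  assumes f: "Ck_ext (Suc k) E f" and E: "half_open E" and x: "x \<in> E"
  shows "(f has_derivative frechet_derivative f (at x within half_plane)) (at x within half_plane)"
    "\<exists>T g. open T \<and> x \<in> T \<and> Ck_on (Suc k) g T \<and>
      (\<forall>y\<in>E \<inter> T. g y = f y \<and> frechet_derivative f (at y within half_plane) = frechet_derivative g (at y))"
proof -
  obtain T g where T: "open T" "x \<in> T" "Ck_on (Suc k) g T" "\<And>y. y \<in> E \<Longrightarrow> y \<in> T \<Longrightarrow> g y = f y"
    using Ck_extE[OF f x] by metis
  have EH: "E \<subseteq> half_plane" using openin_subset[OF E] by simp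
  have d: "(f has_derivative frechet_derivative g (at y)) (at y within half_plane)" if y: "y \<in> E" "y \<in> T" for y
  proof -
    have ET: "half_open (E \<inter> T)" using E T(1) by (simp add: openin_Int_open)
    have "(g has_derivative frechet_derivative g (at y)) (at y within (E \<inter> T))"
      by (rule has_derivative_at_withinI[OF Ck_on_SucD(1)[OF T(3) y(2)]])
    then have "(f has_derivative frechet_derivative g (at y)) (at y within (E \<inter> T))"
      by (rule has_derivative_transform[rotated 2]) (use y T(4) in auto)
    then show ?thesis using at_within_half_open[OF ET, of y] y by simp
  qed
  have eq: "frechet_derivative f (at y within half_plane) = frechet_derivative g (at y)" if "y \<in> E" "y \<in> T" for y
    using half_plane_derivative_unique[OF _ d[OF that]] that EH by blast
  show "(f has_derivative frechet_derivative f (at x within half_plane)) (at x within half_plane)"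
    using d[OF x T(2)] eq[OF x T(2)] by simp
  show "\<exists>T g. open T \<and> x \<in> T \<and> Ck_on (Suc k) g T \<and>
      (\<forall>y\<in>E \<inter> T. g y = f y \<and> frechet_derivative f (at y within half_plane) = frechet_derivative g (at y))"
    using T eq by (intro exI[of _ T] exI[of _ g]) simp
qed

lemma Ck_ext_pd:
  assumes f: "Ck_ext (Suc k) E f" and E: "half_open E"
  shows "Ck_ext k E (pd i f)"
  unfolding Ck_ext_def
proof
  fix x assume "x \<in> E"
  from Ck_ext_has_derivative(2)[OF f E this] obtain T g where T: "open T" "x \<in> T" "Ck_on (Suc k) g T"
      "\<forall>y\<in>E \<inter> T. g y = f y \<and> frechet_derivative f (at y within half_plane) = frechet_derivative g (at y)"
    by (elim exE conjE)
  then show "\<exists>T g. open T \<and> x \<in> T \<and> Ck_on k g T \<and> (\<forall>y\<in>E \<inter> T. g y = pd i f y)"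
    using Ck_on_SucD(2)[OF T(3)]
    by (intro exI[of _ T] exI[of _ "\<lambda>x. frechet_derivative g (at x) (axis i 1)"]) (simp add: pd_def)
qed

lemma vec2_expand: "(v :: real^2) = (v $ 1) *\<^sub>R axis 1 1 + (v $ 2) *\<^sub>R axis 2 1"
  by (simp add: vec_eq_iff forall_2 axis_def)

lemma frechet_eq_pd:
  assumes "Ck_ext (Suc k) E f" "half_open E" "x \<in> E"
  shows "frechet_derivative f (at x within half_plane) v = (v $ 1) *\<^sub>R pd 1 f x + (v $ 2) *\<^sub>R pd 2 f x"
proof -
  have l: "linear (frechet_derivative f (at x within half_plane))"
    by (rule has_derivative_linear[OF Ck_ext_has_derivative(1)[OF assms]])
  show ?thesis
    by (subst vec2_expand[of v]) (simp add: linear_add[OF l] linear_scale[OF l] pd_def)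
qed

lemma has_derivative_pd:
  assumes "Ck_ext (Suc k) E f" "half_open E" "x \<in> E"
  shows "(f has_derivative (\<lambda>v. (v $ 1) *\<^sub>R pd 1 f x + (v $ 2) *\<^sub>R pd 2 f x)) (at x within half_plane)"
proof -
  have "frechet_derivative f (at x within half_plane) = (\<lambda>v. (v $ 1) *\<^sub>R pd 1 f x + (v $ 2) *\<^sub>R pd 2 f x)"
    by (rule ext) (rule frechet_eq_pd[OF assms])
  then show ?thesis using Ck_ext_has_derivative(1)[OF assms] by simp
qed

lemma pd_unique:
  fixes f :: "real^2 \<Rightarrow> 'b::euclidean_space"
  assumes "x \<in> half_plane" "(f has_derivative f') (at x within half_plane)"
  shows "pd i f x = f' (axis i 1)"
  using half_plane_derivative_unique[OF assms] by (simp add: pd_def)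

lemma half_openD: "half_open E \<Longrightarrow> x \<in> E \<Longrightarrow> x \<in> half_plane"
  using openin_subset by fastforce

lemma half_open_transform:
  assumes "half_open E" "x \<in> E" "\<And>y. y \<in> E \<Longrightarrow> f y = g y"
    "(f has_derivative f') (at x within half_plane)"
  shows "(g has_derivative f') (at x within half_plane)"
proof -
  have "(f has_derivative f') (at x within E)"
    using assms(4) at_within_half_open[OF assms(1,2)] by simp
  then have "(g has_derivative f') (at x within E)"
    by (rule has_derivative_transform[rotated 2]) (use assms in auto)
  then show ?thesis using at_within_half_open[OF assms(1,2)] by simp
qed

lemma pd_cong:
  fixes f g :: "real^2 \<Rightarrow> 'b::euclidean_space"
  assumes "half_open E" "x \<in> E" "\<And>y. y \<in> E \<Longrightarrow> f y = g y"
  shows "pd i f x = pd i g x"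
proof -
  have "(f has_derivative f') (at x within half_plane) \<longleftrightarrow> (g has_derivative f') (at x within half_plane)" for f'
    using half_open_transform[OF assms(1,2)] assms(3) by metis
  then show ?thesis by (simp add: pd_def frechet_derivative_def)
qed

lemma pd_bilinear:
  fixes f :: "real^2 \<Rightarrow> 'a::euclidean_space" and g :: "real^2 \<Rightarrow> 'b::euclidean_space"
  assumes prd: "bounded_bilinear (prd :: 'a \<Rightarrow> 'b \<Rightarrow> 'c::euclidean_space)" and E: "half_open E" "x \<in> E"
    and f: "Ck_ext (Suc k) E f" and g: "Ck_ext (Suc l) E g"
  shows "pd i (\<lambda>x. prd (f x) (g x)) x = prd (pd i f x) (g x) + prd (f x) (pd i g x)"
  using pd_unique[OF half_openD[OF E] bounded_bilinear.FDERIV[OF prd Ck_ext_has_derivative(1)[OF f E] Ck_ext_has_derivative(1)[OF g E]], of i]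
  by (simp add: pd_def)

lemmas pd_mult = pd_bilinear[OF bounded_bilinear_mult]
lemmas pd_scaleR = pd_bilinear[OF bounded_bilinear_scaleR]

lemma pd_add:
  fixes f g :: "real^2 \<Rightarrow> 'b::euclidean_space"
  assumes E: "half_open E" "x \<in> E" and f: "Ck_ext (Suc k) E f" and g: "Ck_ext (Suc l) E g"
  shows "pd i (\<lambda>x. f x + g x) x = pd i f x + pd i g x"
  using pd_unique[OF half_openD[OF E] has_derivative_add[OF Ck_ext_has_derivative(1)[OF f E] Ck_ext_has_derivative(1)[OF g E]], of i]
  by (simp add: pd_def)

lemma pd_linear:
  fixes f :: "real^2 \<Rightarrow> 'a::euclidean_space"
  assumes "bounded_linear (h :: 'a \<Rightarrow> 'b::euclidean_space)" and E: "half_open E" "x \<in> E" and f: "Ck_ext (Suc k) E f"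
  shows "pd i (\<lambda>x. h (f x)) x = h (pd i f x)"
  using pd_unique[OF half_openD[OF E] bounded_linear.has_derivative[OF assms(1) Ck_ext_has_derivative(1)[OF f E]], of i]
  by (simp add: pd_def)

lemma pd_const: "x \<in> half_plane \<Longrightarrow> pd i (\<lambda>x. c :: 'b::euclidean_space) x = 0"
  by (subst pd_unique[OF _ has_derivative_const]) auto

lemma pd_sum:
  fixes f :: "'i \<Rightarrow> real^2 \<Rightarrow> 'b::euclidean_space"
  assumes E: "half_open E" "x \<in> E" and f: "\<And>j. j \<in> I \<Longrightarrow> Ck_ext (Suc k) E (f j)"
  shows "pd i (\<lambda>x. \<Sum>j\<in>I. f j x) x = (\<Sum>j\<in>I. pd i (f j) x)"
proof -
  have "((\<lambda>x. \<Sum>j\<in>I. f j x) has_derivative (\<lambda>v. \<Sum>j\<in>I. frechet_derivative (f j) (at x within half_plane) v)) (at x within half_plane)"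
    by (intro has_derivative_sum Ck_ext_has_derivative(1)[OF f E])
  from pd_unique[OF half_openD[OF E] this, of i] show ?thesis by (simp add: pd_def)
qed

lemma pd_chain:
  fixes F :: "real^2 \<Rightarrow> 'b::euclidean_space"
  assumes E: "half_open E" "x \<in> E" and E': "half_open E'" and \<tau>: "\<And>y. y \<in> E \<Longrightarrow> \<tau> y \<in> E'"
    and F: "Ck_ext (Suc k) E' F" and d: "(\<tau> has_derivative D) (at x within half_plane)"
  shows "pd i (\<lambda>x. F (\<tau> x)) x = (D (axis i 1) $ 1) *\<^sub>R pd 1 F (\<tau> x) + (D (axis i 1) $ 2) *\<^sub>R pd 2 F (\<tau> x)"
proof -
  have d': "(\<tau> has_derivative D) (at x within E)" using d at_within_half_open[OF E] by simp
  have "((\<lambda>x. F (\<tau> x)) has_derivative (\<lambda>v. frechet_derivative F (at (\<tau> x) within half_plane) (D v))) (at x within E)"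
  proof (rule has_derivative_in_compose2[where t = E', OF _ _ E(2) d'])
    fix y assume y: "y \<in> E'"
    show "(F has_derivative frechet_derivative F (at y within half_plane)) (at y within E')"
      using Ck_ext_has_derivative(1)[OF F E' y] at_within_half_open[OF E' y] by simp
  qed (use \<tau> in blast)
  then have "((\<lambda>x. F (\<tau> x)) has_derivative (\<lambda>v. frechet_derivative F (at (\<tau> x) within half_plane) (D v))) (at x within half_plane)"
    using at_within_half_open[OF E] by simp
  from pd_unique[OF half_openD[OF E] this, of i] show ?thesis
    using frechet_eq_pd[OF F E' \<tau>[OF E(2)]] by simp
qed

lemma second_difference:
  fixes g :: "real^2 \<Rightarrow> real"
  assumes g: "Ck_on 2 g T" and s: "0 < s" and box: "\<And>t u. t \<in> {0..s} \<Longrightarrow> u \<in> {0..s} \<Longrightarrow> x + t *\<^sub>R a + u *\<^sub>R b \<in> T"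
  shows "\<exists>t\<in>{0..s}. \<exists>u\<in>{0..s}. g (x + s *\<^sub>R a + s *\<^sub>R b) - g (x + s *\<^sub>R a) - g (x + s *\<^sub>R b) + g x
    = s^2 * frechet_derivative (\<lambda>y. frechet_derivative g (at y) a) (at (x + t *\<^sub>R a + u *\<^sub>R b)) b"
proof -
  let ?ga = "\<lambda>y. frechet_derivative g (at y) a"
  have g2: "Ck_on (Suc (Suc 0)) g T" using g by (simp add: numeral_2_eq_2)
  have ga: "Ck_on (Suc 0) ?ga T" by (rule Ck_on_SucD(2)[OF g2])
  have da: "((\<lambda>t. g (x + t *\<^sub>R a + u *\<^sub>R b)) has_real_derivative ?ga (x + t *\<^sub>R a + u *\<^sub>R b)) (at t)"
    if "t \<in> {0..s}" "u \<in> {0..s}" for t u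
  proof -
    let ?D = "frechet_derivative g (at (x + t *\<^sub>R a + u *\<^sub>R b))"
    have D: "(g has_derivative ?D) (at (x + t *\<^sub>R a + u *\<^sub>R b))"
      by (rule Ck_on_SucD(1)[OF g2 box[OF that]])
    have "((\<lambda>t. g (x + t *\<^sub>R a + u *\<^sub>R b)) has_derivative (\<lambda>h. ?D (h *\<^sub>R a))) (at t)"
      by (rule has_derivative_compose[where f = "\<lambda>t. x + t *\<^sub>R a + u *\<^sub>R b", OF _ D]) (auto intro!: derivative_eq_intros)
    then show ?thesis
      using linear_scale[OF has_derivative_linear[OF D]] by (simp add: has_field_derivative_def mult_commute_abs)
  qed
  have db: "((\<lambda>u. ?ga (x + t *\<^sub>R a + u *\<^sub>R b)) has_real_derivative
      frechet_derivative ?ga (at (x + t *\<^sub>R a + u *\<^sub>R b)) b) (at u)"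
    if "t \<in> {0..s}" "u \<in> {0..s}" for t u
  proof -
    let ?D = "frechet_derivative ?ga (at (x + t *\<^sub>R a + u *\<^sub>R b))"
    have D: "(?ga has_derivative ?D) (at (x + t *\<^sub>R a + u *\<^sub>R b))"
      by (rule Ck_on_SucD(1)[OF ga box[OF that]])
    have "((\<lambda>u. ?ga (x + t *\<^sub>R a + u *\<^sub>R b)) has_derivative (\<lambda>h. ?D (h *\<^sub>R b))) (at u)"
      by (rule has_derivative_compose[where f = "\<lambda>u. x + t *\<^sub>R a + u *\<^sub>R b", OF _ D]) (auto intro!: derivative_eq_intros)
    then show ?thesis
      using linear_scale[OF has_derivative_linear[OF D]] by (simp add: has_field_derivative_def mult_commute_abs)
  qed
  have "\<exists>t>0. t < s \<and> (g (x + s *\<^sub>R a + s *\<^sub>R b) - g (x + s *\<^sub>R a + 0 *\<^sub>R b)) - (g (x + 0 *\<^sub>R a + s *\<^sub>R b) - g (x + 0 *\<^sub>R a + 0 *\<^sub>R b))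
    = (s - 0) * (?ga (x + t *\<^sub>R a + s *\<^sub>R b) - ?ga (x + t *\<^sub>R a + 0 *\<^sub>R b))"
    using s by (intro MVT2) (auto intro!: DERIV_diff da da[of _ 0, simplified])
  then obtain t where t: "0 < t" "t < s" "g (x + s *\<^sub>R a + s *\<^sub>R b) - g (x + s *\<^sub>R a) - g (x + s *\<^sub>R b) + g x
    = s * (?ga (x + t *\<^sub>R a + s *\<^sub>R b) - ?ga (x + t *\<^sub>R a + 0 *\<^sub>R b))" by auto
  have "\<exists>u>0. u < s \<and> ?ga (x + t *\<^sub>R a + s *\<^sub>R b) - ?ga (x + t *\<^sub>R a + 0 *\<^sub>R b)
    = (s - 0) * frechet_derivative ?ga (at (x + t *\<^sub>R a + u *\<^sub>R b)) b"
    using s t(1,2) by (intro MVT2 db) auto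
  then obtain u where "0 < u" "u < s" "?ga (x + t *\<^sub>R a + s *\<^sub>R b) - ?ga (x + t *\<^sub>R a + 0 *\<^sub>R b)
    = s * frechet_derivative ?ga (at (x + t *\<^sub>R a + u *\<^sub>R b)) b" by auto
  with t show ?thesis by (intro bexI[of _ t] bexI[of _ u]) (auto simp: power2_eq_square)
qed

text \<open>The second difference over a small parallelogram spanned by multiples of
  \<open>a\<close> and \<open>b\<close> is symmetric in \<open>a\<close> and \<open>b\<close>. By
  \<open>second_difference\<close>, in either order, it is a multiple of either mixed derivative at
  a nearby point, and both are continuous.\<close>

lemma mixed_derivatives_real:
  fixes g :: "real^2 \<Rightarrow> real"
  assumes g: "Ck_on 2 g T" and T: "open T" "x \<in> T"
  shows "frechet_derivative (\<lambda>y. frechet_derivative g (at y) a) (at x) b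
       = frechet_derivative (\<lambda>y. frechet_derivative g (at y) b) (at x) a"
proof (rule ccontr)
  let ?h = "\<lambda>a b y. frechet_derivative (\<lambda>y. frechet_derivative g (at y) a) (at y) b"
  assume ne: "?h a b x \<noteq> ?h b a x"
  define e where "e = \<bar>?h a b x - ?h b a x\<bar> / 2"
  have "e > 0" using ne by (simp add: e_def)
  have g2: "Ck_on (Suc (Suc 0)) g T" using g by (simp add: numeral_2_eq_2)
  have "continuous_on T (?h a b)" for a b
    using Ck_on_SucD(2)[OF Ck_on_SucD(2)[OF g2]] by simp
  then have c: "continuous (at x) (?h a b)" for a b
    using T by (simp add: continuous_on_eq_continuous_at)
  obtain d1 where d1: "d1 > 0" "\<And>y. dist y x < d1 \<Longrightarrow> dist (?h a b y) (?h a b x) < e"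
    using c[of a b] \<open>e > 0\<close> unfolding continuous_at_eps_delta by metis
  obtain d2 where d2: "d2 > 0" "\<And>y. dist y x < d2 \<Longrightarrow> dist (?h b a y) (?h b a x) < e"
    using c[of b a] \<open>e > 0\<close> unfolding continuous_at_eps_delta by metis
  obtain d3 where d3: "d3 > 0" "ball x d3 \<subseteq> T" using T open_contains_ball by metis
  define d where "d = min d1 (min d2 d3)"
  \<comment> \<open>Every point of the parallelogram is then at distance at most
    \<open>d / 2\<close> from \<open>x\<close>; the summand 1 covers
    \<open>a = b = 0\<close>.\<close>
  define s where "s = d / (2 * (norm a + norm b + 1))"
  have "d > 0" using d1 d2 d3 by (simp add: d_def)
  have nab: "norm a + norm b + 1 > 0" by (simp add: add_nonneg_pos)
  then have s: "s > 0" using \<open>d > 0\<close> by (simp add: s_def)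
  have near: "dist (x + t *\<^sub>R a + u *\<^sub>R b) x < d" if "t \<in> {0..s}" "u \<in> {0..s}" for t u
  proof -
    have "norm (t *\<^sub>R a + u *\<^sub>R b) \<le> s * norm a + s * norm b"
      using that by (intro norm_triangle_le add_mono) (auto intro!: mult_right_mono)
    also have "\<dots> \<le> s * (norm a + norm b + 1)" using s by (simp add: algebra_simps)
    also have "\<dots> = d / 2" using nab unfolding s_def by (simp add: field_simps)
    also have "\<dots> < d" using \<open>d > 0\<close> by simp
    finally show ?thesis by (simp add: dist_norm add.assoc)
  qed
  have near': "dist (x + u *\<^sub>R b + t *\<^sub>R a) x < d" if "t \<in> {0..s}" "u \<in> {0..s}" for t u
    using near[OF that] by (simp add: algebra_simps)
  have inT: "y \<in> T" if "dist y x < d" for y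
    using that d3 by (auto simp: d_def dist_commute)
  obtain t u where 1: "t \<in> {0..s}" "u \<in> {0..s}"
     "g (x + s *\<^sub>R a + s *\<^sub>R b) - g (x + s *\<^sub>R a) - g (x + s *\<^sub>R b) + g x = s^2 * ?h a b (x + t *\<^sub>R a + u *\<^sub>R b)"
    using second_difference[OF g s inT[OF near]] by blast
  obtain t' u' where 2: "t' \<in> {0..s}" "u' \<in> {0..s}"
     "g (x + s *\<^sub>R b + s *\<^sub>R a) - g (x + s *\<^sub>R b) - g (x + s *\<^sub>R a) + g x = s^2 * ?h b a (x + t' *\<^sub>R b + u' *\<^sub>R a)"
    using second_difference[OF g s, of x b a] inT[OF near'] by blast
  have "x + s *\<^sub>R b + s *\<^sub>R a = x + s *\<^sub>R a + s *\<^sub>R b" by (simp add: algebra_simps)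
  then have "g (x + s *\<^sub>R b + s *\<^sub>R a) = g (x + s *\<^sub>R a + s *\<^sub>R b)" by (rule arg_cong)
  then have "s^2 * ?h a b (x + t *\<^sub>R a + u *\<^sub>R b) = s^2 * ?h b a (x + t' *\<^sub>R b + u' *\<^sub>R a)"
    using 1(3) 2(3) by linarith
  then have "?h a b (x + t *\<^sub>R a + u *\<^sub>R b) = ?h b a (x + t' *\<^sub>R b + u' *\<^sub>R a)" using s by simp
  moreover have "dist (?h a b (x + t *\<^sub>R a + u *\<^sub>R b)) (?h a b x) < e"
    using near[OF 1(1,2)] by (intro d1(2)) (simp add: d_def)
  moreover have "dist (?h b a (x + t' *\<^sub>R b + u' *\<^sub>R a)) (?h b a x) < e"
    using near'[OF 2(2,1)] by (intro d2(2)) (simp add: d_def)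
  ultimately show False unfolding e_def dist_real_def by argo
qed

lemma mixed_derivatives:
  fixes g :: "real^2 \<Rightarrow> 'b::euclidean_space"
  assumes g: "Ck_on 2 g T" and T: "open T" "x \<in> T"
  shows "frechet_derivative (\<lambda>y. frechet_derivative g (at y) a) (at x) b
       = frechet_derivative (\<lambda>y. frechet_derivative g (at y) b) (at x) a"
proof (rule euclidean_eqI)
  fix w :: 'b
  have g2: "Ck_on (Suc (Suc 0)) g T" using g by (simp add: numeral_2_eq_2)
  have gw: "Ck_on 2 (\<lambda>y. g y \<bullet> w) T"
    by (rule Ck_on_bilinear[OF bounded_bilinear_inner T(1) g Ck_on_const[OF T(1)]])
  have fr: "frechet_derivative (\<lambda>y. h y \<bullet> w) (at y) v = frechet_derivative h (at y) v \<bullet> w"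
    if "(h has_derivative frechet_derivative h (at y)) (at y)" for h :: "real^2 \<Rightarrow> 'b" and y v
    using frechet_derivative_at[OF bounded_linear.has_derivative[OF bounded_linear_inner_left that]] by metis
  have "frechet_derivative (\<lambda>y. frechet_derivative (\<lambda>y. g y \<bullet> w) (at y) a) (at x) b
     = frechet_derivative (\<lambda>y. frechet_derivative g (at y) a) (at x) b \<bullet> w" for a b
  proof -
    have "((\<lambda>y. frechet_derivative g (at y) a \<bullet> w) has_derivative
        (\<lambda>v. frechet_derivative (\<lambda>y. frechet_derivative g (at y) a) (at x) v \<bullet> w)) (at x)"
      by (rule bounded_linear.has_derivative[OF bounded_linear_inner_left Ck_on_SucD(1)[OF Ck_on_SucD(2)[OF g2] T(2)]])
    then have "((\<lambda>y. frechet_derivative (\<lambda>y. g y \<bullet> w) (at y) a) has_derivative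
        (\<lambda>v. frechet_derivative (\<lambda>y. frechet_derivative g (at y) a) (at x) v \<bullet> w)) (at x)"
      by (rule has_derivative_transform_within_open[OF _ T]) (use fr[OF Ck_on_SucD(1)[OF g2]] in simp)
    from frechet_derivative_at[OF this] show ?thesis by metis
  qed
  then show "frechet_derivative (\<lambda>y. frechet_derivative g (at y) a) (at x) b \<bullet> w
      = frechet_derivative (\<lambda>y. frechet_derivative g (at y) b) (at x) a \<bullet> w"
    using mixed_derivatives_real[OF gw T] by metis
qed

lemma pd_commute:
  fixes f :: "real^2 \<Rightarrow> 'b::euclidean_space"
  assumes f: "Ck_ext 2 E f" and E: "half_open E" "x \<in> E"
  shows "pd i (pd j f) x = pd j (pd i f) x"
proof -
  have f2: "Ck_ext (Suc (Suc 0)) E f" using f by (simp add: numeral_2_eq_2)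
  obtain T g where T: "open T" "x \<in> T" "Ck_on 2 g T"
      "\<And>y. y \<in> E \<inter> T \<Longrightarrow> frechet_derivative f (at y within half_plane) = frechet_derivative g (at y)"
    using Ck_ext_has_derivative(2)[OF f2 E] by (auto simp: numeral_2_eq_2 simp del: Ck_on.simps)
  have g2: "Ck_on (Suc (Suc 0)) g T" using T(3) by (simp add: numeral_2_eq_2)
  have "pd i (pd j f) x = frechet_derivative (\<lambda>y. frechet_derivative g (at y) (axis j 1)) (at x) (axis i 1)" for i j
  proof -
    let ?G = "\<lambda>y. frechet_derivative g (at y) (axis j 1)"
    have "(?G has_derivative frechet_derivative ?G (at x)) (at x within half_plane)"
      by (rule has_derivative_at_withinI[OF Ck_on_SucD(1)[OF Ck_on_SucD(2)[OF g2] T(2)]])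
    then have "(pd j f has_derivative frechet_derivative ?G (at x)) (at x within half_plane)"
    proof (rule half_open_transform[of "E \<inter> T", rotated 3])
      show "half_open (E \<inter> T)" using E(1) T(1) by (simp add: openin_Int_open)
    qed (use E T in \<open>auto simp: pd_def\<close>)
    from pd_unique[OF half_openD[OF E] this] show ?thesis .
  qed
  then show ?thesis using mixed_derivatives[OF T(3,1,2)] by simp
qed

section \<open>Green's formula\<close>

abbreviation pt :: "real \<Rightarrow> real \<Rightarrow> real^2" where "pt x y \<equiv> vector [x, y]"

lemma pt_eta: "pt (v $ 1) (v $ 2) = v"
  by (simp add: vec_eq_iff forall_2)

lemma pt_eq: "pt x y = x *\<^sub>R axis 1 1 + y *\<^sub>R axis 2 1"
  by (simp add: vec_eq_iff forall_2 axis_def)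

lemma mem_cbox_pt: "v \<in> cbox (pt a c) (pt b d) \<longleftrightarrow> a \<le> v $ 1 \<and> v $ 1 \<le> b \<and> c \<le> v $ 2 \<and> v $ 2 \<le> d"
  by (auto simp: mem_box_cart forall_2)

lemma continuous_on_pt: "continuous_on S (\<lambda>p. pt (fst p) (snd p))"
  unfolding pt_eq by (intro continuous_intros)

text \<open>Fubini's theorem in \<open>real \<times> real\<close>, carried over to
  \<open>real^2\<close> by the bijection of coordinates, which preserves the content of
  boxes.\<close>

lemma integral_cbox_pt:
  fixes f :: "real^2 \<Rightarrow> real"
  assumes f: "continuous_on (cbox (pt a c) (pt b d)) f"
  shows "integral (cbox (pt a c) (pt b d)) f = integral {a..b} (\<lambda>x. integral {c..d} (\<lambda>y. f (pt x y)))"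
    "integral (cbox (pt a c) (pt b d)) f = integral {c..d} (\<lambda>y. integral {a..b} (\<lambda>x. f (pt x y)))"
proof -
  let ?g = "\<lambda>p. pt (fst p) (snd p)" and ?h = "\<lambda>v::real^2. (v $ 1, v $ 2)"
  have img: "?h ` cbox u v = cbox (?h u) (?h v)" for u v
  proof (intro subset_antisym subsetI)
    fix p assume "p \<in> cbox (?h u) (?h v)"
    then have "?g p \<in> cbox u v" by (cases p) (auto simp: mem_box_cart forall_2)
    then show "p \<in> ?h ` cbox u v" by (intro image_eqI[of _ _ "?g p"]) auto
  qed (auto simp: mem_box_cart)
  have gimg: "?g ` cbox u v = cbox (?g u) (?g v)" for u v
  proof (intro subset_antisym subsetI)
    fix p assume "p \<in> cbox (?g u) (?g v)"
    then have "?h p \<in> cbox u v" by (cases u, cases v) (auto simp: mem_box_cart forall_2)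
    then show "p \<in> ?g ` cbox u v" by (intro image_eqI[of _ _ "?h p"]) (auto simp: pt_eta)
  next
    fix p assume "p \<in> ?g ` cbox u v"
    then show "p \<in> cbox (?g u) (?g v)" by (cases u, cases v) (auto simp: mem_box_cart forall_2)
  qed
  have cont: "measure lborel (?g ` cbox u v) = 1 * measure lborel (cbox u v)" for u v
  proof -
    obtain u1 u2 v1 v2 where uv: "u = (u1, u2)" "v = (v1, v2)" by (cases u, cases v)
    have e: "cbox (pt u1 u2) (pt v1 v2) = {} \<longleftrightarrow> v1 < u1 \<or> v2 < u2"
    proof -
      have "cbox (pt u1 u2) (pt v1 v2) = ?g ` (cbox u1 v1 \<times> cbox u2 v2)"
        using gimg[of "(u1, u2)" "(v1, v2)"] by (simp add: cbox_Pair_eq)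
      then show ?thesis by auto
    qed
    have p: "(\<Prod>i\<in>UNIV. pt v1 v2 $ i - pt u1 u2 $ i) = (v1 - u1) * (v2 - u2)"
      by (simp add: UNIV_2)
    show ?thesis
      unfolding gimg unfolding uv prod.sel content_cbox_if_cart e p content_Pair
      by auto
  qed
  have "f integrable_on cbox (pt a c) (pt b d)" by (rule integrable_continuous[OF f])
  then have "((\<lambda>p. f (?g p)) has_integral (1 / 1) *\<^sub>R integral (cbox (pt a c) (pt b d)) f) (?h ` cbox (pt a c) (pt b d))"
  proof (intro has_integral_twiddle[OF _ _ _ _ _ _ cont])
    show "continuous (at x) ?g" for x
      using continuous_on_pt[of UNIV] by (cases x) (simp add: continuous_on_eq_continuous_at)
  qed (use img gimg in \<open>auto simp: pt_eta has_integral_integral\<close>)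
  then have 1: "integral (cbox (a, c) (b, d)) (\<lambda>p. f (?g p)) = integral (cbox (pt a c) (pt b d)) f"
    unfolding img by (simp add: integral_unique)
  have "?g p \<in> cbox (pt a c) (pt b d)" if "p \<in> cbox (a, c) (b, d)" for p
    using that by (cases p) (auto simp: mem_cbox_pt)
  then have c: "continuous_on (cbox (a, c) (b, d)) (\<lambda>p. f (?g p))"
    by (intro continuous_on_compose2[OF f continuous_on_pt]) auto
  show e: "integral (cbox (pt a c) (pt b d)) f = integral {a..b} (\<lambda>x. integral {c..d} (\<lambda>y. f (pt x y)))"
    using integral_prod_continuous[OF c] 1 by simp
  have "continuous_on (cbox (a, c) (b, d)) (\<lambda>(x, y). f (pt x y))"
    using c by (simp add: case_prod_unfold)
  from integral_swap_continuous[OF this] e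
  show "integral (cbox (pt a c) (pt b d)) f = integral {c..d} (\<lambda>y. integral {a..b} (\<lambda>x. f (pt x y)))"
    by simp
qed

lemma line_derivative:
  fixes Q :: "real^2 \<Rightarrow> 'b::euclidean_space"
  assumes Q: "Ck_ext (Suc k) E Q" and E: "half_open E"
  shows "(\<And>t. t \<in> {a..b} \<Longrightarrow> pt t y \<in> E) \<Longrightarrow> x \<in> {a..b} \<Longrightarrow>
      ((\<lambda>t. Q (pt t y)) has_vector_derivative pd 1 Q (pt x y)) (at x within {a..b})"
    "(\<And>t. t \<in> {a..b} \<Longrightarrow> pt y t \<in> E) \<Longrightarrow> x \<in> {a..b} \<Longrightarrow>
      ((\<lambda>t. Q (pt y t)) has_vector_derivative pd 2 Q (pt y x)) (at x within {a..b})"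
proof -
  have d: "(Q has_derivative (\<lambda>v. (v $ 1) *\<^sub>R pd 1 Q z + (v $ 2) *\<^sub>R pd 2 Q z)) (at z within E)" if "z \<in> E" for z
    using has_derivative_pd[OF Q E that] at_within_half_open[OF E that] by simp
  show "((\<lambda>t. Q (pt t y)) has_vector_derivative pd 1 Q (pt x y)) (at x within {a..b})"
    if "\<And>t. t \<in> {a..b} \<Longrightarrow> pt t y \<in> E" "x \<in> {a..b}"
  proof -
    have "((\<lambda>t. pt t y) has_derivative (\<lambda>h. h *\<^sub>R axis 1 1)) (at x within {a..b})"
      unfolding pt_eq by (auto intro!: derivative_eq_intros)
    from has_derivative_in_compose2[OF d image_subsetI[OF that(1)] that(2) this] show ?thesis
      by (simp add: has_vector_derivative_def axis_def)
  qed
  show "((\<lambda>t. Q (pt y t)) has_vector_derivative pd 2 Q (pt y x)) (at x within {a..b})"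
    if "\<And>t. t \<in> {a..b} \<Longrightarrow> pt y t \<in> E" "x \<in> {a..b}"
  proof -
    have "((\<lambda>t. pt y t) has_derivative (\<lambda>h. h *\<^sub>R axis 2 1)) (at x within {a..b})"
      unfolding pt_eq by (auto intro!: derivative_eq_intros)
    from has_derivative_in_compose2[OF d image_subsetI[OF that(1)] that(2) this] show ?thesis
      by (simp add: has_vector_derivative_def axis_def)
  qed
qed

text \<open>Each partial derivative is integrated first in its own variable, by the fundamental
  theorem of calculus.\<close>

lemma green_rectangle:
  fixes P Q :: "real^2 \<Rightarrow> real"
  assumes P: "Ck_ext 1 E P" and Q: "Ck_ext 1 E Q" and E: "half_open E"
    and sub: "cbox (pt a c) (pt b d) \<subseteq> E" and le: "a \<le> b" "c \<le> d"
  shows "integral (cbox (pt a c) (pt b d)) (\<lambda>z. pd 1 Q z - pd 2 P z) =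
    integral {c..d} (\<lambda>y. Q (pt b y) - Q (pt a y)) - integral {a..b} (\<lambda>x. P (pt x d) - P (pt x c))"
proof -
  have P': "Ck_ext (Suc 0) E P" and Q': "Ck_ext (Suc 0) E Q" using P Q by simp_all
  have cP: "continuous_on (cbox (pt a c) (pt b d)) (pd 2 P)" and cQ: "continuous_on (cbox (pt a c) (pt b d)) (pd 1 Q)"
    using continuous_on_subset[OF Ck_ext_continuous_on sub] Ck_ext_pd[OF P' E] Ck_ext_pd[OF Q' E] by blast+
  have inE: "pt x y \<in> E" if "x \<in> {a..b}" "y \<in> {c..d}" for x y
    using that sub by (force simp: mem_cbox_pt)
  have "integral (cbox (pt a c) (pt b d)) (\<lambda>z. pd 1 Q z - pd 2 P z) =
     integral (cbox (pt a c) (pt b d)) (pd 1 Q) - integral (cbox (pt a c) (pt b d)) (pd 2 P)"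
    by (intro integral_diff integrable_continuous cP cQ)
  also have "integral (cbox (pt a c) (pt b d)) (pd 1 Q) = integral {c..d} (\<lambda>y. integral {a..b} (\<lambda>x. pd 1 Q (pt x y)))"
    by (rule integral_cbox_pt(2)[OF cQ])
  also have "\<dots> = integral {c..d} (\<lambda>y. Q (pt b y) - Q (pt a y))"
  proof (rule integral_cong)
    fix y assume "y \<in> {c..d}"
    then show "integral {a..b} (\<lambda>x. pd 1 Q (pt x y)) = Q (pt b y) - Q (pt a y)"
      by (intro integral_unique fundamental_theorem_of_calculus le line_derivative(1)[OF Q' E]) (auto intro: inE)
  qed
  also have "integral (cbox (pt a c) (pt b d)) (pd 2 P) = integral {a..b} (\<lambda>x. integral {c..d} (\<lambda>y. pd 2 P (pt x y)))"
    by (rule integral_cbox_pt(1)[OF cP])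
  also have "\<dots> = integral {a..b} (\<lambda>x. P (pt x d) - P (pt x c))"
  proof (rule integral_cong)
    fix x assume "x \<in> {a..b}"
    then show "integral {c..d} (\<lambda>y. pd 2 P (pt x y)) = P (pt x d) - P (pt x c)"
      by (intro integral_unique fundamental_theorem_of_calculus le line_derivative(2)[OF P' E]) (auto intro: inE)
  qed
  finally show ?thesis .
qed

lemma absolutely_integrable_compact_support:
  fixes g :: "'a::euclidean_space \<Rightarrow> real"
  assumes g: "continuous_on C g" and C: "compact C" "C \<subseteq> E" and z: "\<And>x. x \<in> E - C \<Longrightarrow> g x = 0"
    and S: "S \<in> sets lebesgue" "S \<subseteq> E"
  shows "g absolutely_integrable_on S"
proof -
  have "integrable lborel (\<lambda>x. indicator C x *\<^sub>R g x)"
    by (rule borel_integrable_compact[OF C(1) g])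
  then have "set_integrable lebesgue C g"
    unfolding set_integrable_def by (simp add: integrable_completion borel_measurable_integrable)
  moreover have "C \<inter> S \<in> sets lebesgue"
    using S(1) borel_compact[OF C(1)] by (intro sets.Int) auto
  ultimately have "g absolutely_integrable_on (C \<inter> S)"
    by (rule set_integrable_subset) simp
  then show ?thesis
    by (rule absolutely_integrable_spike_set_eq[THEN iffD1, rotated 2])
      (use z S(2) in \<open>auto intro: negligible_subset[OF negligible_empty]\<close>)
qed

text \<open>The integrand is passed through \<open>real^1\<close> to use the vector valued form of
  the formula.\<close>

lemma change_of_variables_real:
  fixes f :: "real^2 \<Rightarrow> real" and g :: "real^2 \<Rightarrow> real^2"
  assumes S: "S \<in> sets lebesgue"
    and der_g: "\<And>x. x \<in> S \<Longrightarrow> (g has_derivative g' x) (at x within S)" and inj: "inj_on g S"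
    and int: "(\<lambda>x. \<bar>det (matrix (g' x))\<bar> * f (g x)) absolutely_integrable_on S"
  shows "integral S (\<lambda>x. \<bar>det (matrix (g' x))\<bar> * f (g x)) = integral (g ` S) f"
proof -
  let ?v = "vec :: real \<Rightarrow> real^1" and ?J = "\<lambda>x. \<bar>det (matrix (g' x))\<bar> * f (g x)"
  have v: "bounded_linear ?v" by (intro linear_linear[THEN iffD2] linear_vec)
  have eq: "?v \<circ> ?J = (\<lambda>x. \<bar>det (matrix (g' x))\<bar> *\<^sub>R (?v \<circ> f) (g x))"
    by (auto simp: fun_eq_iff vec_eq_iff)
  have 1: "(?v \<circ> ?J) absolutely_integrable_on S" by (rule absolutely_integrable_linear[OF int v])
  then have 2: "(?v \<circ> f) absolutely_integrable_on (g ` S)" "integral (g ` S) (?v \<circ> f) = integral S (?v \<circ> ?J)"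
    using has_absolute_integral_change_of_variables[OF S der_g inj, of "?v \<circ> f" "integral S (?v \<circ> ?J)"]
    unfolding eq by blast+
  have "((\<lambda>w. w $ 1) \<circ> (?v \<circ> f)) integrable_on (g ` S)"
    by (intro integrable_linear[OF _ bounded_linear_vec_nth]) (use 2(1) in \<open>simp add: absolutely_integrable_on_def\<close>)
  then have f: "f integrable_on (g ` S)" by (simp add: o_def)
  have J: "?J integrable_on S" using int by (simp add: absolutely_integrable_on_def)
  have "?v (integral (g ` S) f) = ?v (integral S ?J)"
    using 2(2) unfolding integral_linear[OF f v] integral_linear[OF J v] .
  then have "?v (integral (g ` S) f) $ 1 = ?v (integral S ?J) $ 1" by (rule arg_cong)
  then show ?thesis by simp
qed

text \<open>With \<open>L\<close> the integral of \<open>F' / F\<close>, the function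
  \<open>F * exp (- L)\<close> has derivative 0. Hence \<open>F b = F a * exp (L b)\<close>, and
  taking \<open>sgn\<close> keeps only the imaginary part of \<open>L b\<close>, the change of the
  argument of \<open>F\<close>.\<close>

lemma cis_integral_log_derivative:
  fixes F :: "real \<Rightarrow> complex"
  assumes ab: "a \<le> b" and F: "\<And>t. t \<in> {a..b} \<Longrightarrow> (F has_vector_derivative F' t) (at t within {a..b})"
    and F': "continuous_on {a..b} F'" and nz: "\<And>t. t \<in> {a..b} \<Longrightarrow> F t \<noteq> 0"
  shows "cis (integral {a..b} (\<lambda>t. Im (F' t / F t))) * sgn (F a) = sgn (F b)"
proof -
  have cF: "continuous_on {a..b} F"
    using F by (intro continuous_on_vector_derivative) auto
  have c: "continuous_on {a..b} (\<lambda>t. F' t / F t)"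
    using cF F' nz by (intro continuous_on_divide) auto
  define L where "L u = integral {a..u} (\<lambda>t. F' t / F t)" for u
  have L: "(L has_vector_derivative F' t / F t) (at t within {a..b})" if "t \<in> {a..b}" for t
    unfolding L_def by (rule integral_has_vector_derivative[OF c that])
  define G where "G t = F t * exp (- L t)" for t
  have "(G has_vector_derivative 0) (at t within {a..b})" if t: "t \<in> {a..b}" for t
  proof -
    have "((\<lambda>t. exp (- L t)) has_vector_derivative (- (F' t / F t)) * exp (- L t)) (at t within {a..b})"
      using field_vector_diff_chain_within[OF has_vector_derivative_minus[OF L[OF t]] has_field_derivative_at_within[OF DERIV_exp]]
      by (simp add: o_def mult.commute)
    from has_vector_derivative_mult[OF F[OF t] this] show ?thesis
      using nz[OF t] unfolding G_def by (simp add: field_simps)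
  qed
  then have "G b = G a"
    using has_vector_derivative_zero_constant[of "{a..b}" G] ab by (metis atLeastAtMost_iff convex_closed_interval order_refl)
  then have "F b * exp (- L b) = F a" by (simp add: G_def L_def)
  then have "F b = F a * exp (L b)" by (simp add: exp_minus field_simps)
  then have "sgn (F b) = sgn (F a) * sgn (exp (L b))" by (simp add: sgn_mult)
  also have "sgn (exp (L b)) = cis (Im (L b))"
    by (simp add: sgn_eq exp_eq_polar norm_mult scaleR_conv_of_real)
  also have "Im (L b) = integral {a..b} (\<lambda>t. Im (F' t / F t))"
    using integral_linear[OF integrable_continuous_real[OF c] bounded_linear_Im] by (simp add: L_def o_def)
  finally show ?thesis by (simp add: mult.commute)
qed

lemma openin_Diff_compact: "half_open E \<Longrightarrow> compact C \<Longrightarrow> half_open (E - C)"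
  by (metis Diff_eq compact_imp_closed open_Compl openin_Int_open)

lemma Ck_ext_zero_extension:
  fixes f :: "real^2 \<Rightarrow> 'b::euclidean_space"
  assumes f: "Ck_ext k E f" and E: "half_open E" and C: "compact C" "C \<subseteq> E" and z: "\<And>x. x \<in> E - C \<Longrightarrow> f x = 0"
  shows "Ck_ext k half_plane (\<lambda>x. if x \<in> E then f x else 0)"
proof (rule Ck_ext_local)
  fix x :: "real^2" assume x: "x \<in> half_plane"
  obtain T where T: "open T" "E = half_plane \<inter> T" using E by (auto simp: openin_open)
  show "\<exists>T. open T \<and> x \<in> T \<and> Ck_ext k (half_plane \<inter> T) (\<lambda>x. if x \<in> E then f x else 0)"
  proof (cases "x \<in> E")
    case True
    have "Ck_ext k E (\<lambda>x. if x \<in> E then f x else 0)" by (rule Ck_ext_cong[OF f]) simp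
    then show ?thesis using T True by (intro exI[of _ T]) auto
  next
    case False
    have "Ck_ext k (half_plane \<inter> - C) (\<lambda>x. if x \<in> E then f x else 0)"
      by (rule Ck_ext_cong[OF Ck_ext_const[of _ _ 0]]) (use z in auto)
    moreover have "open (- C)" using C(1) by (simp add: compact_imp_closed open_Compl)
    ultimately show ?thesis using False C(2) by (intro exI[of _ "- C"]) auto
  qed
qed

text \<open>Extended by zero, \<open>P\<close> and \<open>Q\<close> are of class 1 on the half
  plane. In Green's formula on a large box only the side on the boundary line can meet the
  support.\<close>

lemma green_half_plane:
  fixes P Q :: "real^2 \<Rightarrow> real"
  assumes P: "Ck_ext 1 E P" and Q: "Ck_ext 1 E Q" and E: "half_open E"
    and C: "compact C" "C \<subseteq> E" and z: "\<And>x. x \<in> E - C \<Longrightarrow> P x = 0 \<and> Q x = 0"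
  shows "integral E (\<lambda>z. pd 1 Q z - pd 2 P z) = integral {x. pt x 0 \<in> E} (\<lambda>x. P (pt x 0))"
proof -
  let ?P = "\<lambda>x. if x \<in> E then P x else 0" and ?Q = "\<lambda>x. if x \<in> E then Q x else 0"
  have EH: "E \<subseteq> half_plane" using openin_subset[OF E] by simp
  obtain r where r: "\<And>x. x \<in> C \<Longrightarrow> norm x \<le> r" using compact_imp_bounded[OF C(1)] by (auto simp: bounded_iff)
  \<comment> \<open>\<open>r\<close> may be negative if \<open>C\<close> is empty; the box of size
    \<open>R\<close> reaches strictly beyond \<open>C\<close>.\<close>
  define R where "R = \<bar>r\<bar> + 1"
  have far: "x \<notin> C" if "R \<le> \<bar>x $ i\<bar>" for x i
    using r[of x] component_le_norm_cart[of x i] that by (auto simp: R_def)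
  have z0: "?P x = 0" "?Q x = 0" if "R \<le> \<bar>x $ i\<bar>" for x i
    using z far[OF that] by auto
  have P': "Ck_ext 1 half_plane ?P" and Q': "Ck_ext 1 half_plane ?Q"
    using Ck_ext_zero_extension[OF P E C] Ck_ext_zero_extension[OF Q E C] z by blast+
  let ?B = "cbox (pt (- R) 0) (pt R R)"
  have R0: "0 \<le> R" by (simp add: R_def)
  have hh: "half_open half_plane" by simp
  have "?B \<subseteq> half_plane" by (auto simp: mem_cbox_pt half_plane_def)
  have "integral ?B (\<lambda>z. pd 1 ?Q z - pd 2 ?P z) =
      integral {0..R} (\<lambda>y. ?Q (pt R y) - ?Q (pt (- R) y)) - integral {- R..R} (\<lambda>x. ?P (pt x R) - ?P (pt x 0))"
    using green_rectangle[OF P' Q' hh \<open>?B \<subseteq> half_plane\<close>] R0 by simp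
  also have "integral {0..R} (\<lambda>y. ?Q (pt R y) - ?Q (pt (- R) y)) = integral {0..R} (\<lambda>y. 0)"
  proof (rule integral_cong)
    fix y show "?Q (pt R y) - ?Q (pt (- R) y) = 0"
      using z0(2)[of "pt R y" 1] z0(2)[of "pt (- R) y" 1] R0 by simp
  qed
  also have "integral {- R..R} (\<lambda>x. ?P (pt x R) - ?P (pt x 0)) = integral {- R..R} (\<lambda>x. - ?P (pt x 0))"
  proof (rule integral_cong)
    fix x show "?P (pt x R) - ?P (pt x 0) = - ?P (pt x 0)"
      using z0(1)[of "pt x R" 2] R0 by simp
  qed
  also have "\<dots> = - integral {- R..R} (\<lambda>x. ?P (pt x 0))" by simp
  also have "integral {- R..R} (\<lambda>x. ?P (pt x 0)) = integral {x. pt x 0 \<in> E} (\<lambda>x. ?P (pt x 0))"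
  proof (rule integral_spike_set)
    have 1: "?P (pt x 0) = 0" if "pt x 0 \<notin> E" for x using that by simp
    have 2: "?P (pt x 0) = 0" if "x \<notin> {- R..R}" for x using that z0(1)[of "pt x 0" 1] by fastforce
    show "negligible {x \<in> {- R..R} - {x. pt x 0 \<in> E}. ?P (pt x 0) \<noteq> 0}"
      using 1 by (intro negligible_subset[OF negligible_empty]) blast
    show "negligible {x \<in> {x. pt x 0 \<in> E} - {- R..R}. ?P (pt x 0) \<noteq> 0}"
      using 2 by (intro negligible_subset[OF negligible_empty]) blast
  qed
  also have "\<dots> = integral {x. pt x 0 \<in> E} (\<lambda>x. P (pt x 0))"
    by (rule integral_cong) simp
  finally have 1: "integral ?B (\<lambda>z. pd 1 ?Q z - pd 2 ?P z) = integral {x. pt x 0 \<in> E} (\<lambda>x. P (pt x 0))" by simp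
  have eqE: "pd 1 ?Q x - pd 2 ?P x = pd 1 Q x - pd 2 P x" if "x \<in> E" for x
    using pd_cong[OF E that, of ?Q Q 1] pd_cong[OF E that, of ?P P 2] by simp
  have zero: "pd 1 ?Q x - pd 2 ?P x = 0" if "x \<in> half_plane" "x \<notin> C" for x
  proof -
    have h: "half_open (half_plane - C)" using openin_Diff_compact[OF hh C(1)] .
    have "pd 1 ?Q x = pd 1 (\<lambda>x. 0 :: real) x" "pd 2 ?P x = pd 2 (\<lambda>x. 0 :: real) x"
      by (rule pd_cong[OF h]; use that z in auto)+
    then show ?thesis using pd_const[OF that(1), of _ "0::real"] by simp
  qed
  have "integral E (\<lambda>z. pd 1 Q z - pd 2 P z) = integral E (\<lambda>z. pd 1 ?Q z - pd 2 ?P z)"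
    by (rule integral_cong) (simp only: eqE)
  also have "\<dots> = integral ?B (\<lambda>z. pd 1 ?Q z - pd 2 ?P z)"
  proof (rule integral_spike_set)
    have 1: "pd 1 ?Q x - pd 2 ?P x = 0" if "x \<in> E - ?B" for x
    proof (rule zero)
      show "x \<in> half_plane" using that EH by blast
      have "R \<le> \<bar>x $ 1\<bar> \<or> R \<le> \<bar>x $ 2\<bar>"
        using that EH unfolding DiffD2 by (auto simp: mem_cbox_pt half_plane_def)
      then show "x \<notin> C" using far by blast
    qed
    have 2: "pd 1 ?Q x - pd 2 ?P x = 0" if "x \<in> ?B - E" for x
      using zero[of x] that \<open>?B \<subseteq> half_plane\<close> C(2) by blast
    show "negligible {z \<in> E - ?B. pd 1 ?Q z - pd 2 ?P z \<noteq> 0}"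
      using 1 by (intro negligible_subset[OF negligible_empty]) blast
    show "negligible {z \<in> ?B - E. pd 1 ?Q z - pd 2 ?P z \<noteq> 0}"
      using 2 by (intro negligible_subset[OF negligible_empty]) blast
  qed
  finally show ?thesis using 1 by simp
qed

section \<open>Generic perturbations and nondegenerate zeros\<close>

lemma Ck_on_inverse: "Ck_on k (inverse :: real \<Rightarrow> real) {0<..}"
proof (induction k)
  case 0
  show ?case by (auto intro!: continuous_intros)
next
  case (Suc k)
  show ?case
  proof (rule Ck_on_SucI[where f' = "\<lambda>y v. (inverse y * inverse y) * (- v)"])
    show "((inverse :: real \<Rightarrow> real) has_derivative (\<lambda>v. (inverse x * inverse x) * (- v))) (at x)" if "x \<in> {0<..}" for x :: real
      using that by (auto intro!: derivative_eq_intros)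
    show "Ck_on k (\<lambda>y::real. (inverse y * inverse y) * (- v)) {0<..}" for v
      by (intro Ck_on_bilinear[OF bounded_bilinear_mult] Suc Ck_on_const) auto
  qed auto
qed

lemma Ck_ext_inverse:
  fixes f :: "'a::euclidean_space \<Rightarrow> real"
  assumes "Ck_ext k S f" "\<And>x. x \<in> S \<Longrightarrow> 0 < f x"
  shows "Ck_ext k S (\<lambda>x. inverse (f x))"
  by (rule Ck_ext_compose[OF assms(1) Ck_on_imp_Ck_ext[OF _ Ck_on_inverse]]) (use assms(2) in auto)

text \<open>The Jacobian determinant of \<open>F\<close> as a map between planes.\<close>

definition jac :: "(real^2 \<Rightarrow> complex) \<Rightarrow> real^2 \<Rightarrow> real" where
  "jac F x = Im (cnj (pd 1 F x) * pd 2 F x)"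

abbreviation vec_of :: "complex \<Rightarrow> real^2" where "vec_of z \<equiv> pt (Re z) (Im z)"

lemma bounded_linear_vec_of: "bounded_linear vec_of"
  unfolding pt_eq by (intro bounded_linear_add bounded_linear_scaleR_left bounded_linear_compose[OF bounded_linear_scaleR_left]
    bounded_linear_Re bounded_linear_Im)

lemma norm_pt: "norm (pt x y) = cmod (Complex x y)"
  by (simp add: norm_vec_def L2_set_def UNIV_2 cmod_def)

lemma half_open_positive: "continuous_on E f \<Longrightarrow> half_open E \<Longrightarrow> half_open {x \<in> E. 0 < (f x :: real)}"
proof -
  assume f: "continuous_on E f" and E: "half_open E"
  have "{x \<in> E. 0 < f x} = E \<inter> f -` {0<..}" by auto
  then show ?thesis
    using openin_trans[OF continuous_openin_preimage_gen[OF f, of "{0<..}"] E] by simp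
qed

text \<open>Where \<open>\<Phi>\<close> is positive, the zeros of the perturbed function are the
  points with \<open>G x = c\<close> for \<open>G = - F / \<Phi>\<close>. By Sard's theorem the
  critical values of \<open>G\<close> are negligible, and so is the image of the boundary line; any
  small \<open>c\<close> outside both sets will do.\<close>

lemma generic_perturbation:
  assumes E: "half_open E" and F: "Ck_ext 1 E F" and \<Phi>: "Ck_ext 1 E \<Phi>" and \<delta>: "0 < (\<delta>::real)"
  shows "\<exists>c. cmod c < \<delta> \<and> (\<forall>x\<in>E. 0 < \<Phi> x \<and> F x + \<Phi> x *\<^sub>R c = 0 \<longrightarrow>
     x $ 2 \<noteq> 0 \<and> jac (\<lambda>x. F x + \<Phi> x *\<^sub>R c) x \<noteq> 0)"
proof -
  define E' where "E' = {x \<in> E. 0 < \<Phi> x}"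
  have E': "half_open E'" unfolding E'_def by (rule half_open_positive[OF Ck_ext_continuous_on[OF \<Phi>] E])
  have sub: "E' \<subseteq> E" by (auto simp: E'_def)
  define G where "G x = inverse (\<Phi> x) *\<^sub>R (- F x)" for x
  have \<Phi>': "Ck_ext (Suc 0) E' \<Phi>" using Ck_ext_subset[OF \<Phi> sub] by simp
  have G: "Ck_ext (Suc 0) E' G" unfolding G_def
    using Ck_ext_subset[OF F sub] \<Phi>'
    by (intro Ck_ext_scaleR Ck_ext_inverse Ck_ext_bounded_linear[OF bounded_linear_minus[OF bounded_linear_ident]])
      (auto simp: E'_def)
  let ?g = "\<lambda>x. vec_of (G x)" and ?g' = "\<lambda>x v. vec_of (frechet_derivative G (at x within half_plane) v)"
  have der: "(?g has_derivative ?g' x) (at x within half_plane)" if "x \<in> E'" for x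
    by (rule bounded_linear.has_derivative[OF bounded_linear_vec_of Ck_ext_has_derivative(1)[OF G E' that]])
  have det: "det (matrix (?g' x)) = jac G x" for x
    by (simp add: det_2 matrix_def jac_def pd_def)
  have E'H: "E' \<subseteq> half_plane" using openin_subset[OF E'] by simp
  have der': "(?g has_derivative ?g' x) (at x within T)" if "x \<in> E'" "T \<subseteq> E'" for x T
    by (rule has_derivative_subset[OF der[OF that(1)]]) (use that(2) E'H in blast)
  have "negligible (?g ` {x \<in> E'. jac G x = 0})"
  proof (rule baby_Sard[where f' = ?g'])
    fix x assume "x \<in> {x \<in> E'. jac G x = 0}"
    then show "(?g has_derivative ?g' x) (at x within {x \<in> E'. jac G x = 0})" "rank (matrix (?g' x)) < CARD(2)"
      using der'[of x "{x \<in> E'. jac G x = 0}"] det_eq_0_rank[of "matrix (?g' x)"] det[of x] by auto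
  qed simp
  moreover have "negligible (?g ` {x \<in> E'. x $ 2 = 0})"
  proof (rule negligible_differentiable_image_negligible)
    have "negligible {x::real^2. axis 2 1 \<bullet> x = 0}"
      by (rule negligible_hyperplane) (simp add: axis_eq_0_iff)
    then show "negligible {x \<in> E'. x $ 2 = 0}"
      by (rule negligible_subset) (auto simp: inner_axis' )
    show "?g differentiable_on {x \<in> E'. x $ 2 = 0}"
      unfolding differentiable_on_def
    proof
      fix x assume "x \<in> {x \<in> E'. x $ 2 = 0}"
      then show "?g differentiable at x within {x \<in> E'. x $ 2 = 0}"
        by (intro differentiableI[OF der']) auto
    qed
  qed simp
  ultimately have "negligible (?g ` {x \<in> E'. jac G x = 0} \<union> ?g ` {x \<in> E'. x $ 2 = 0})" (is "negligible ?N")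
    by (rule negligible_Un)
  from negligible_subset[OF this, of "ball 0 \<delta>"] have "\<not> ball 0 \<delta> \<subseteq> ?N"
    using open_not_negligible[OF open_ball, of "0 :: real^2" \<delta>] \<delta> by (metis ball_eq_empty linorder_not_less)
  then obtain w where w: "w \<in> ball 0 \<delta>" "w \<notin> ?N" by blast
  define c where "c = Complex (w $ 1) (w $ 2)"
  have wc: "vec_of c = w" by (simp add: c_def pt_eta)
  have "cmod c < \<delta>" using w(1) norm_pt[of "w $ 1" "w $ 2"] by (simp add: c_def pt_eta)
  moreover have "x $ 2 \<noteq> 0 \<and> jac (\<lambda>x. F x + \<Phi> x *\<^sub>R c) x \<noteq> 0"
    if x: "x \<in> E" "0 < \<Phi> x" "F x + \<Phi> x *\<^sub>R c = 0" for x
  proof -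
    have xE': "x \<in> E'" using x by (simp add: E'_def)
    have "F x = - (\<Phi> x *\<^sub>R c)" using x(3) by (simp add: eq_neg_iff_add_eq_0)
    then have Gx: "G x = c" using x(2) by (simp add: G_def)
    then have n: "x $ 2 \<noteq> 0" "jac G x \<noteq> 0" using w(2) wc xE' by auto
    \<comment> \<open>The perturbed function is \<open>\<Phi> x *\<^sub>R (c - G x)\<close>. At the
      zero the second factor vanishes, so only the derivative of \<open>G\<close> survives.\<close>
    have d: "pd i (\<lambda>x. F x + \<Phi> x *\<^sub>R c) x = - (\<Phi> x *\<^sub>R pd i G x)" for i
    proof -
      have "pd i (\<lambda>x. F x + \<Phi> x *\<^sub>R c) x = pd i (\<lambda>x. \<Phi> x *\<^sub>R (c - G x)) x"
        by (rule pd_cong[OF E' xE']) (auto simp: E'_def G_def algebra_simps)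
      also have "\<dots> = pd i \<Phi> x *\<^sub>R (c - G x) + \<Phi> x *\<^sub>R pd i (\<lambda>x. c - G x) x"
        by (rule pd_scaleR[OF E' xE' \<Phi>' Ck_ext_diff[OF Ck_ext_const G]])
      also have "pd i (\<lambda>x. c - G x) x = pd i (\<lambda>x. c + (- G x)) x" by simp
      also have "\<dots> = pd i (\<lambda>x. c) x + pd i (\<lambda>x. - G x) x"
        by (rule pd_add[OF E' xE' Ck_ext_const Ck_ext_bounded_linear[OF bounded_linear_minus[OF bounded_linear_ident] G]])
      also have "pd i (\<lambda>x. - G x) x = - pd i G x"
        by (rule pd_linear[OF bounded_linear_minus[OF bounded_linear_ident] E' xE' G])
      finally show ?thesis using Gx pd_const[of x i c] E'H xE' by auto
    qed
    have "jac (\<lambda>x. F x + \<Phi> x *\<^sub>R c) x = (\<Phi> x)\<^sup>2 * jac G x"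
      unfolding jac_def d by (simp add: power2_eq_square algebra_simps)
    with n x(2) show ?thesis by simp
  qed
  ultimately show ?thesis by blast
qed

text \<open>The pairs \<open>(c, x)\<close> with \<open>cmod c \<le> 1\<close> and \<open>x\<close>
  in \<open>S\<close> at which the conclusion fails form a compact set, the zero set of
  \<open>N\<close>. Its projection to \<open>c\<close> is closed and misses 0.\<close>

lemma stable_perturbation:
  assumes E: "half_open E" and F: "Ck_ext 1 E F" and \<Phi>: "Ck_ext 1 E \<Phi>" and S: "compact S" "S \<subseteq> E"
    and good: "\<And>x. x \<in> S \<Longrightarrow> F x = 0 \<Longrightarrow> x $ 2 \<noteq> 0 \<and> jac F x \<noteq> 0"
  shows "\<exists>\<delta>>0. \<forall>c. cmod c < \<delta> \<longrightarrow> (\<forall>x\<in>S. F x + \<Phi> x *\<^sub>R c = 0 \<longrightarrow>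
     x $ 2 \<noteq> 0 \<and> jac (\<lambda>x. F x + \<Phi> x *\<^sub>R c) x \<noteq> 0)"
proof -
  have F1: "Ck_ext (Suc 0) E F" and \<Phi>1: "Ck_ext (Suc 0) E \<Phi>" using F \<Phi> by simp_all
  let ?D = "\<lambda>i c x. pd i F x + pd i \<Phi> x *\<^sub>R (c::complex)"
  have pd: "pd i (\<lambda>x. F x + \<Phi> x *\<^sub>R c) x = ?D i c x" if "x \<in> E" for i c x
  proof -
    have "pd i (\<lambda>x. F x + \<Phi> x *\<^sub>R c) x = pd i F x + pd i (\<lambda>x. \<Phi> x *\<^sub>R c) x"
      by (rule pd_add[OF E that F1 Ck_ext_scaleR[OF \<Phi>1 Ck_ext_const]])
    also have "pd i (\<lambda>x. \<Phi> x *\<^sub>R c) x = pd i \<Phi> x *\<^sub>R c"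
      by (rule pd_linear[OF bounded_linear_scaleR_left E that \<Phi>1])
    finally show ?thesis .
  qed
  define N where "N p = cmod (F (snd p) + \<Phi> (snd p) *\<^sub>R fst p) +
     \<bar>snd p $ 2 * Im (cnj (?D 1 (fst p) (snd p)) * ?D 2 (fst p) (snd p))\<bar>" for p
  let ?K = "cball (0::complex) 1 \<times> S"
  have cont: "continuous_on ?K (\<lambda>p. h (snd p))" if "continuous_on E h" for h :: "real^2 \<Rightarrow> 'b::topological_space"
    by (rule continuous_on_compose2[OF that]) (use S(2) in \<open>auto intro!: continuous_intros\<close>)
  have "continuous_on ?K N" unfolding N_def
    by (intro continuous_intros cont Ck_ext_continuous_on[OF F] Ck_ext_continuous_on[OF \<Phi>]
      Ck_ext_continuous_on[OF Ck_ext_pd[OF F1 E]] Ck_ext_continuous_on[OF Ck_ext_pd[OF \<Phi>1 E]])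
  then have "closedin (top_of_set ?K) {p \<in> ?K. N p = 0}"
    by (rule continuous_closedin_preimage_constant)
  then have "compact {p \<in> ?K. N p = 0}"
    by (rule closedin_compact[rotated]) (intro compact_Times compact_cball S(1))
  then have cl: "closed (fst ` {p \<in> ?K. N p = 0})"
    by (intro compact_imp_closed compact_continuous_image continuous_intros)
  have "N (0, x) \<noteq> 0" if "x \<in> S" for x
    using good[OF that] unfolding N_def jac_def by (auto simp: add_nonneg_eq_0_iff)
  then have "0 \<notin> fst ` {p \<in> ?K. N p = 0}" by auto
  then obtain \<delta> where \<delta>: "\<delta> > 0" "ball 0 \<delta> \<subseteq> - fst ` {p \<in> ?K. N p = 0}"
    using openE[OF open_Compl[OF cl], of 0] by auto
  show ?thesis
  proof (intro exI[of _ "min \<delta> 1"] conjI allI impI ballI)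
    fix c x assume c: "cmod c < min \<delta> 1" and x: "x \<in> S" and 0: "F x + \<Phi> x *\<^sub>R c = 0"
    have "(c, x) \<in> ?K" using c x by simp
    moreover have "c \<notin> fst ` {p \<in> ?K. N p = 0}" using c \<delta>(2) by auto
    ultimately have "N (c, x) \<noteq> 0" by force
    then have "x $ 2 * Im (cnj (?D 1 c x) * ?D 2 c x) \<noteq> 0" using 0 by (auto simp: N_def)
    then show "x $ 2 \<noteq> 0" "jac (\<lambda>x. F x + \<Phi> x *\<^sub>R c) x \<noteq> 0"
      using S(2) x unfolding jac_def by (auto simp: pd subset_iff)
  qed (use \<delta>(1) in simp)
qed

text \<open>The derivative at \<open>x\<close> is injective, hence bounded below by a factor
  \<open>B\<close>. Close to \<open>x\<close> the remainder is at most half of this bound, so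
  \<open>F\<close> cannot vanish again.\<close>

lemma nondegenerate_zero_isolated:
  assumes E: "half_open E" "x \<in> E" and F: "Ck_ext 1 E F" and x: "F x = 0" "jac F x \<noteq> 0"
  shows "\<exists>d>0. \<forall>y\<in>E \<inter> ball x d. F y = 0 \<longrightarrow> y = x"
proof -
  let ?D = "\<lambda>v::real^2. (v $ 1) *\<^sub>R pd 1 F x + (v $ 2) *\<^sub>R pd 2 F x"
  have F1: "Ck_ext (Suc 0) E F" using F by simp
  have D: "(F has_derivative ?D) (at x within E)"
    using has_derivative_pd[OF F1 E] at_within_half_open[OF E] by simp
  have lin: "linear ?D" using has_derivative_linear[OF D] .
  have "v = 0" if "?D v = 0" for v
  proof -
    have "Im (cnj (pd 1 F x) * ?D v) = 0" "Im (cnj (pd 2 F x) * ?D v) = 0"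
      using that by (simp_all only: mult_zero_right zero_complex.sel)
    moreover have *: "Im (cnj (pd 1 F x) * ?D v) = (v $ 2) * jac F x" "Im (cnj (pd 2 F x) * ?D v) = - (v $ 1) * jac F x"
      by (simp_all add: jac_def algebra_simps)
    ultimately have "(v $ 2) * jac F x = 0" "- (v $ 1) * jac F x = 0" by simp_all
    then show ?thesis using x(2) by (simp add: vec_eq_iff forall_2)
  qed
  then have "inj ?D" using linear_injective_0[OF lin] by blast
  then obtain B where B: "B > 0" "\<And>v. B * norm v \<le> norm (?D v)"
    using linear_inj_bounded_below_pos[OF lin] by blast
  from D have "\<exists>d>0. \<forall>y\<in>E. norm (y - x) < d \<longrightarrow> norm (F y - F x - ?D (y - x)) \<le> B / 2 * norm (y - x)"
    unfolding has_derivative_within_alt using B(1) half_gt_zero by blast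
  then obtain d where d: "d > 0" "\<And>y. y \<in> E \<Longrightarrow> norm (y - x) < d \<Longrightarrow> norm (F y - F x - ?D (y - x)) \<le> B / 2 * norm (y - x)"
    by blast
  have "y = x" if y: "y \<in> E" "y \<in> ball x d" "F y = 0" for y
  proof -
    have "norm (y - x) < d" using y(2) by (simp add: dist_norm norm_minus_commute)
    from d(2)[OF y(1) this] have "norm (?D (y - x)) \<le> B / 2 * norm (y - x)"
      unfolding y(3) x(1) diff_self diff_0 norm_minus_cancel .
    with B(2)[of "y - x"] have "B * norm (y - x) \<le> B / 2 * norm (y - x)" by linarith
    then show ?thesis using B(1) by (simp add: field_simps)
  qed
  then show ?thesis using d(1) by blast
qed

section \<open>The cut-off angular form\<close>

lemma has_derivative_pos_power:
  "((\<lambda>s::real. (max 0 s) ^ Suc (Suc n)) has_derivative (\<lambda>v. of_nat (Suc (Suc n)) * (max 0 s) ^ Suc n * v)) (at s)"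
proof -
  have "((\<lambda>s::real. (max 0 s) ^ Suc (Suc n)) has_real_derivative of_nat (Suc (Suc n)) * (max 0 s) ^ Suc n) (at s)"
  proof (cases s "0::real" rule: linorder_cases)
    case less
    have "((\<lambda>s::real. 0) has_real_derivative of_nat (Suc (Suc n)) * (max 0 s) ^ Suc n) (at s)"
      using less by (simp add: max_def)
    then show ?thesis
      by (rule has_field_derivative_transform_within_open[where S = "{..<0}"]) (use less in \<open>auto simp: max_def\<close>)
  next
    case greater
    have "((\<lambda>s::real. s ^ Suc (Suc n)) has_real_derivative of_nat (Suc (Suc n)) * (max 0 s) ^ Suc n) (at s)"
      using DERIV_pow[of "Suc (Suc n)" s] greater by (simp add: max_def)
    then show ?thesis
      by (rule has_field_derivative_transform_within_open[where S = "{0<..}"]) (use greater in \<open>auto simp: max_def\<close>)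
  next
    case equal
    have "(\<lambda>h::real. (max 0 h) ^ Suc (Suc n) / h) \<midarrow>0\<rightarrow> 0"
    proof (rule Lim_null_comparison)
      show "\<forall>\<^sub>F h in at 0. norm ((max 0 h) ^ Suc (Suc n) / h) \<le> \<bar>h\<bar> ^ Suc n"
      proof (rule always_eventually, rule allI)
        fix h :: real
        show "norm ((max 0 h) ^ Suc (Suc n) / h) \<le> \<bar>h\<bar> ^ Suc n"
        proof (cases "0 < h")
          case False
          then have "max 0 h = 0" by simp
          then show ?thesis by (simp only: power_0_Suc div_0 norm_zero zero_le_power abs_ge_zero)
        qed (simp add: max_def)
      qed
      show "(\<lambda>h::real. \<bar>h\<bar> ^ Suc n) \<midarrow>0\<rightarrow> 0" by (auto intro!: tendsto_eq_intros)
    qed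
    then show ?thesis unfolding equal DERIV_def by simp
  qed
  then show ?thesis by (simp add: has_field_derivative_def)
qed

text \<open>These one sided powers serve for all cut-offs: exponent 2 in
  \<open>reciprocal_cutoff\<close>, exponent 3 in the bump functions.\<close>

lemma Ck_on_pos_power: "Ck_on n (\<lambda>s::real. (max 0 s) ^ Suc n) UNIV"
proof (induction n)
  case 0
  show ?case by (auto intro!: continuous_intros)
next
  case (Suc n)
  have "Ck_on n (\<lambda>s::real. (max 0 s) ^ Suc n * (real (Suc (Suc n)) * v)) UNIV" for v
    by (rule Ck_on_bilinear[OF bounded_bilinear_mult open_UNIV Suc Ck_on_const[OF open_UNIV]])
  then have "Ck_on n (\<lambda>s::real. of_nat (Suc (Suc n)) * (max 0 s) ^ Suc n * v) UNIV" for v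
    by (simp only: mult_ac)
  from Ck_on_SucI[OF open_UNIV has_derivative_pos_power this] show ?case by simp
qed

lemma reciprocal_cutoff:
  assumes d: "0 < (d::real)"
  obtains h where "Ck_ext 1 UNIV h" "\<And>s. d \<le> s \<Longrightarrow> h s = 1 / s"
proof -
  \<comment> \<open>\<open>(2 * d - s) / d\<^sup>2\<close> is the tangent of \<open>1 / s\<close> at
    \<open>d\<close>, and \<open>1 / s\<close> exceeds it by
    \<open>(s - d)\<^sup>2 / (d\<^sup>2 * s)\<close>. Switching this excess off below
    \<open>d\<close> gives a function of class 1 on the whole line.\<close>
  define h where "h s = (2 * d - s) / d\<^sup>2 + (max 0 (s - d)) ^ Suc 1 * inverse (d\<^sup>2 * s)" for s
  have "Ck_ext 1 UNIV h"
  proof (rule Ck_ext_local)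
    fix s :: real
    have lin: "Ck_ext 1 S (\<lambda>s. (2 * d - s) / d\<^sup>2)" for S
    proof -
      have "Ck_ext 1 S (\<lambda>s. (2 * d) / d\<^sup>2 - s * (1 / d\<^sup>2))"
        by (intro Ck_ext_diff Ck_ext_const Ck_ext_mult Ck_ext_linear[OF bounded_linear_ident])
      then show ?thesis by (simp add: diff_divide_distrib)
    qed
    show "\<exists>T. open T \<and> s \<in> T \<and> Ck_ext 1 (UNIV \<inter> T) h"
    proof (cases "s < d")
      case True
      have "Ck_ext 1 (UNIV \<inter> {..<d}) h"
        by (rule Ck_ext_cong[OF lin]) (auto simp: h_def max_def)
      then show ?thesis using True by (intro exI[of _ "{..<d}"]) auto
    next
      case False
      have p: "Ck_ext 1 {0<..} (\<lambda>s. (max 0 (s - d)) ^ Suc 1)"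
        by (rule Ck_ext_compose[OF _ Ck_on_imp_Ck_ext[OF open_UNIV Ck_on_pos_power]])
          (auto intro!: Ck_ext_diff Ck_ext_const Ck_ext_linear[OF bounded_linear_ident])
      have "Ck_ext 1 {0<..} (\<lambda>s. inverse (d\<^sup>2 * s))"
        by (intro Ck_ext_inverse Ck_ext_mult Ck_ext_const Ck_ext_linear[OF bounded_linear_ident]) (use d in auto)
      then have "Ck_ext 1 {0<..} h" unfolding h_def
        by (intro Ck_ext_add lin Ck_ext_mult p)
      then show ?thesis using False d by (intro exI[of _ "{0<..}"]) auto
    qed
  qed
  moreover have "h s = 1 / s" if "d \<le> s" for s
    using that d by (simp add: h_def max_def field_simps power2_eq_square)
  ultimately show ?thesis by (rule that)
qed

text \<open>\<open>d arg F\<close> where \<open>h s = 1 / s\<close>; a cut-off \<open>h\<close> removes the poles at the zeros of \<open>F\<close>.\<close>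

definition angular :: "(real \<Rightarrow> real) \<Rightarrow> (real^2 \<Rightarrow> complex) \<Rightarrow> 2 \<Rightarrow> real^2 \<Rightarrow> real" where
  "angular h F i x = h ((cmod (F x))\<^sup>2) * Im (cnj (F x) * pd i F x)"

lemma cmod_power2_Re: "(cmod z)\<^sup>2 = Re (z * cnj z)"
  by (metis Re_complex_of_real complex_norm_square)

lemma Ck_ext_cnj: "Ck_ext k E F \<Longrightarrow> Ck_ext k E (\<lambda>x. cnj (F x))"
  by (rule Ck_ext_bounded_linear[OF bounded_linear_cnj])

lemma angular_Ck:
  assumes h: "Ck_ext 1 UNIV h" and F: "Ck_ext 2 E F" and E: "half_open E"
  shows "Ck_ext 1 E (angular h F i)"
proof -
  have F1: "Ck_ext 1 E F" using Ck_ext_pred[of 1 E F] F by (simp add: numeral_2_eq_2)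
  have "Ck_ext 1 E (pd i F)" using Ck_ext_pd[of 1 E F i] F E by (simp add: numeral_2_eq_2)
  moreover have "Ck_ext 1 E (\<lambda>x. h ((cmod (F x))\<^sup>2))"
    unfolding cmod_power2_Re
    by (rule Ck_ext_compose[OF Ck_ext_bounded_linear[OF bounded_linear_Re Ck_ext_mult[OF F1 Ck_ext_cnj[OF F1]]] h]) simp
  ultimately show ?thesis unfolding angular_def
    by (intro Ck_ext_mult Ck_ext_bounded_linear[OF bounded_linear_Im] Ck_ext_cnj F1)
qed

text \<open>The curl of \<open>Im (cnj F * d F)\<close> is \<open>2 * jac F\<close>, since the mixed
  second derivatives cancel. The derivative of the factor \<open>h\<close> contributes
  \<open>2 * jac F\<close> once more, with weight \<open>(cmod (F x))\<^sup>2 * h'\<close>.\<close>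

lemma angular_curl:
  assumes h: "Ck_ext 1 UNIV h" and h': "(h has_real_derivative h') (at ((cmod (F x))\<^sup>2))"
    and F: "Ck_ext 2 E F" and E: "half_open E" "x \<in> E"
  shows "pd 1 (angular h F 2) x - pd 2 (angular h F 1) x = 2 * (h ((cmod (F x))\<^sup>2) + (cmod (F x))\<^sup>2 * h') * jac F x"
proof -
  have F2: "Ck_ext (Suc 1) E F" using F by (simp add: numeral_2_eq_2)
  have F1: "Ck_ext (Suc 0) E F" using Ck_ext_pred[OF F2] by simp
  have G: "Ck_ext (Suc 0) E (pd i F)" for i using Ck_ext_pd[OF F2 E(1), of i] by simp
  have C: "Ck_ext (Suc 0) E (\<lambda>x. cnj (F x))" by (rule Ck_ext_cnj[OF F1])
  let ?s = "\<lambda>x. (cmod (F x))\<^sup>2"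
  have s1: "Ck_ext (Suc 0) E ?s"
    unfolding cmod_power2_Re by (intro Ck_ext_bounded_linear[OF bounded_linear_Re] Ck_ext_mult C F1)
  have pc: "pd i (\<lambda>x. cnj (F x)) x = cnj (pd i F x)" for i
    by (rule pd_linear[OF bounded_linear_cnj E F1])
  have ps: "pd i ?s x = 2 * Re (cnj (F x) * pd i F x)" for i
  proof -
    have "pd i ?s x = Re (pd i (\<lambda>x. F x * cnj (F x)) x)"
      unfolding cmod_power2_Re by (rule pd_linear[OF bounded_linear_Re E Ck_ext_mult[OF F1 C]])
    also have "pd i (\<lambda>x. F x * cnj (F x)) x = pd i F x * cnj (F x) + F x * cnj (pd i F x)"
      using pd_mult[OF E F1 C, of i] pc by simp
    finally show ?thesis by (simp add: algebra_simps)
  qed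
  have ph: "pd i (\<lambda>x. h (?s x)) x = h' * pd i ?s x" for i
  proof -
    have "(h has_derivative (*) h') (at (?s x))" using h' by (simp add: has_field_derivative_def)
    from has_derivative_compose[where f = ?s, OF Ck_ext_has_derivative(1)[OF s1 E] this]
    show ?thesis using pd_unique[OF half_openD[OF E]] by (metis (no_types, lifting) pd_def)
  qed
  have hs: "Ck_ext (Suc 0) E (\<lambda>x. h (?s x))"
    by (rule Ck_ext_compose[OF s1]) (use h in auto)
  have pI: "pd i (\<lambda>x. Im (cnj (F x) * pd j F x)) x = Im (cnj (pd i F x) * pd j F x + cnj (F x) * pd i (pd j F) x)" for i j
  proof -
    have "pd i (\<lambda>x. Im (cnj (F x) * pd j F x)) x = Im (pd i (\<lambda>x. cnj (F x) * pd j F x) x)"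
      by (rule pd_linear[OF bounded_linear_Im E Ck_ext_mult[OF C G]])
    then show ?thesis using pd_mult[OF E C G, of i j] pc by simp
  qed
  have pa: "pd i (angular h F j) x = h' * (2 * Re (cnj (F x) * pd i F x)) * Im (cnj (F x) * pd j F x)
      + h (?s x) * Im (cnj (pd i F x) * pd j F x + cnj (F x) * pd i (pd j F) x)" for i j
    unfolding angular_def
    using pd_mult[OF E hs Ck_ext_bounded_linear[OF bounded_linear_Im Ck_ext_mult[OF C G]], of i j] ph ps pI by simp
  have c: "pd 1 (pd 2 F) x = pd 2 (pd 1 F) x" by (rule pd_commute[OF F E])
  have sq: "?s x = Re (F x) * Re (F x) + Im (F x) * Im (F x)" by (simp add: cmod_power2_Re)
  \<comment> \<open>\<open>a\<close>, \<open>b\<close> are the real and imaginary part of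
    \<open>F x\<close>, the \<open>p\<close> and \<open>q\<close> those of its partial derivatives,
    and \<open>w\<close> stands for the mixed second derivative, which is common to both terms of
    the curl.\<close>
  have alg: "h' * (2 * (a * p1 + b * q1)) * (a * q2 - b * p2) + H * (p1 * q2 - q1 * p2 + w)
    - (h' * (2 * (a * p2 + b * q2)) * (a * q1 - b * p1) + H * (p2 * q1 - q2 * p1 + w))
    = 2 * (H + (a * a + b * b) * h') * (p1 * q2 - q1 * p2)" for a b p1 q1 p2 q2 H w :: real
    by (simp add: algebra_simps)
  show ?thesis unfolding pa c sq jac_def
    using alg[of "Re (F x)" "Re (pd 1 F x)" "Im (F x)" "Im (pd 1 F x)" "Im (pd 2 F x)" "Re (pd 2 F x)" "h (Re (F x) * Re (F x) + Im (F x) * Im (F x))"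
      "Im (cnj (F x) * pd 2 (pd 1 F) x)"]
    by (simp add: algebra_simps)
qed

text \<open>For \<open>h s = 1 / s\<close> the factor \<open>h s + s * h'\<close> in
  \<open>angular_curl\<close> vanishes. The strict bound gives this form of \<open>h\<close> on a
  neighbourhood, as its derivative requires.\<close>

lemma angular_closed:
  assumes h: "Ck_ext 1 UNIV h" "\<And>s. d \<le> s \<Longrightarrow> h s = 1 / s" and d: "0 < d" "d < (cmod (F x))\<^sup>2"
    and F: "Ck_ext 2 E F" and E: "half_open E" "x \<in> E"
  shows "pd 1 (angular h F 2) x - pd 2 (angular h F 1) x = 0"
proof -
  let ?s = "(cmod (F x))\<^sup>2"
  have "((\<lambda>s. 1 / s) has_real_derivative - (1 / ?s\<^sup>2)) (at ?s)"
    using d by (auto intro!: derivative_eq_intros simp: power2_eq_square)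
  then have "(h has_real_derivative - (1 / ?s\<^sup>2)) (at ?s)"
    by (rule has_field_derivative_transform_within_open[where S = "{d<..}"]) (use d h in auto)
  from angular_curl[OF h(1) this F E] show ?thesis
    using h(2)[of ?s] d by (simp add: power2_eq_square)
qed

section \<open>Generic sections of flat line bundles\<close>

text \<open>Charts, a partition of unity and a flat unitary line bundle over a bare set of points:
  all topological facts are expressed in coordinates, so that the analysis stays in
  \<open>real^2\<close>. \<open>separated\<close> is the Hausdorff property,
  \<open>\<phi>_away\<close> says that the weights vanish near points outside their charts, and
  \<open>\<epsilon> k l\<close> converts coordinates in frame \<open>l\<close> to coordinates in
  frame \<open>k\<close>.\<close>

locale flat_line_bundle =
  fixes N :: nat and P :: "'p set" and U :: "nat \<Rightarrow> 'p set" and u :: "nat \<Rightarrow> 'p \<Rightarrow> real^2"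
    and \<phi> :: "nat \<Rightarrow> 'p \<Rightarrow> real" and \<epsilon> :: "nat \<Rightarrow> nat \<Rightarrow> 'p \<Rightarrow> complex"
  assumes U_sub: "\<And>k. k < N \<Longrightarrow> U k \<subseteq> P"
    and u_inj: "\<And>k. k < N \<Longrightarrow> inj_on (u k) (U k)"
    and overlap_open: "\<And>k l. k < N \<Longrightarrow> l < N \<Longrightarrow> half_open (u k ` (U k \<inter> U l))"
    and transition_Ck: "\<And>k l. k < N \<Longrightarrow> l < N \<Longrightarrow> Ck_ext 2 (u k ` (U k \<inter> U l)) (\<lambda>x. u l (inv_into (U k) (u k) x))"
    and transition_det: "\<And>k l x. k < N \<Longrightarrow> l < N \<Longrightarrow> x \<in> u k ` (U k \<inter> U l) \<Longrightarrow>
      0 < det (matrix (frechet_derivative (\<lambda>x. u l (inv_into (U k) (u k) x)) (at x within half_plane)))"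
    and boundary_invariant: "\<And>k l p. k < N \<Longrightarrow> l < N \<Longrightarrow> p \<in> U k \<inter> U l \<Longrightarrow> u k p $ 2 = 0 \<longleftrightarrow> u l p $ 2 = 0"
    and separated: "\<And>k l p q. k < N \<Longrightarrow> l < N \<Longrightarrow> p \<in> U k \<Longrightarrow> q \<in> U l \<Longrightarrow> p \<noteq> q \<Longrightarrow>
      \<exists>A B. open A \<and> open B \<and> u k p \<in> A \<and> u l q \<in> B \<and> (\<forall>x\<in>U k \<inter> U l. \<not> (u k x \<in> A \<and> u l x \<in> B))"
    and \<phi>_nonneg: "\<And>k p. 0 \<le> \<phi> k p"
    and \<phi>_sum: "\<And>p. p \<in> P \<Longrightarrow> (\<Sum>k<N. \<phi> k p) = 1"
    and \<phi>_outside: "\<And>k p. k < N \<Longrightarrow> p \<notin> U k \<Longrightarrow> \<phi> k p = 0"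
    and \<phi>_Ck: "\<And>k l. k < N \<Longrightarrow> l < N \<Longrightarrow> Ck_ext 2 (u k ` U k) (\<lambda>x. \<phi> l (inv_into (U k) (u k) x))"
    and \<phi>_support: "\<And>k. k < N \<Longrightarrow> \<exists>C. compact C \<and> C \<subseteq> u k ` U k \<and> (\<forall>p\<in>U k. u k p \<notin> C \<longrightarrow> \<phi> k p = 0)"
    and \<phi>_away: "\<And>k l p. k < N \<Longrightarrow> l < N \<Longrightarrow> p \<in> U k - U l \<Longrightarrow>
      \<exists>A. open A \<and> u k p \<in> A \<and> (\<forall>q\<in>U k. u k q \<in> A \<longrightarrow> \<phi> l q = 0)"
    and \<epsilon>_norm: "\<And>k l p. k < N \<Longrightarrow> l < N \<Longrightarrow> p \<in> U k \<inter> U l \<Longrightarrow> cmod (\<epsilon> k l p) = 1"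
    and \<epsilon>_cocycle: "\<And>k l m p. k < N \<Longrightarrow> l < N \<Longrightarrow> m < N \<Longrightarrow> p \<in> U k \<inter> U l \<inter> U m \<Longrightarrow>
      \<epsilon> k l p * \<epsilon> l m p = \<epsilon> k m p"
    and \<epsilon>_locally_const: "\<And>k l p. k < N \<Longrightarrow> l < N \<Longrightarrow> p \<in> U k \<inter> U l \<Longrightarrow>
      \<exists>A. open A \<and> u k p \<in> A \<and> (\<forall>q\<in>U k \<inter> U l. u k q \<in> A \<longrightarrow> \<epsilon> k l q = \<epsilon> k l p)"
begin

abbreviation "v k \<equiv> inv_into (U k) (u k)"
abbreviation "E k \<equiv> u k ` U k"
abbreviation "ov k l \<equiv> u k ` (U k \<inter> U l)"
abbreviation "\<tau> k l \<equiv> (\<lambda>x. u l (v k x))"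
abbreviation "D\<tau> k l x \<equiv> frechet_derivative (\<tau> k l) (at x within half_plane)"

lemma v_u: "k < N \<Longrightarrow> p \<in> U k \<Longrightarrow> v k (u k p) = p"
  by (simp add: inv_into_f_f u_inj)

lemma v_in: "x \<in> E k \<Longrightarrow> v k x \<in> U k"
  by (rule inv_into_into)

lemma u_v: "x \<in> E k \<Longrightarrow> u k (v k x) = x"
  by (rule f_inv_into_f)

lemma ov_iff: "k < N \<Longrightarrow> x \<in> ov k l \<longleftrightarrow> x \<in> E k \<and> v k x \<in> U l"
  using v_u by (auto intro: image_eqI[of _ _ "v k x" for x])

lemma ov_sub: "ov k l \<subseteq> E k" by blast

lemma E_open: "k < N \<Longrightarrow> half_open (E k)"
  using overlap_open[of k k] by simp

lemma E_half_plane: "k < N \<Longrightarrow> x \<in> E k \<Longrightarrow> x \<in> half_plane"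
  using half_openD[OF E_open] by blast

lemma \<tau>_in: "k < N \<Longrightarrow> x \<in> ov k l \<Longrightarrow> \<tau> k l x \<in> ov l k"
  by (auto simp: v_u)

lemma v_\<tau>: "k < N \<Longrightarrow> l < N \<Longrightarrow> x \<in> ov k l \<Longrightarrow> v l (\<tau> k l x) = v k x"
  by (auto simp: v_u)

lemma \<tau>_derivative:
  assumes "k < N" "l < N" "x \<in> ov k l"
  shows "(\<tau> k l has_derivative D\<tau> k l x) (at x within half_plane)"
proof -
  have "Ck_ext (Suc 1) (ov k l) (\<tau> k l)"
    using transition_Ck[OF assms(1,2)] by (simp add: numeral_2_eq_2)
  from Ck_ext_has_derivative(1)[OF this overlap_open[OF assms(1,2)] assms(3)] show ?thesis .
qed

lemma det_\<tau>: "det (matrix (D\<tau> k l x)) = D\<tau> k l x (axis 1 1) $ 1 * D\<tau> k l x (axis 2 1) $ 2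
    - D\<tau> k l x (axis 2 1) $ 1 * D\<tau> k l x (axis 1 1) $ 2"
  by (simp add: det_2 matrix_def)

lemma pd_\<tau>:
  fixes F :: "real^2 \<Rightarrow> 'b::euclidean_space"
  assumes kl: "k < N" "l < N" "x \<in> ov k l" and F: "Ck_ext (Suc j) (E l) F"
  shows "pd i (\<lambda>x. F (\<tau> k l x)) x = (D\<tau> k l x (axis i 1) $ 1) *\<^sub>R pd 1 F (\<tau> k l x)
      + (D\<tau> k l x (axis i 1) $ 2) *\<^sub>R pd 2 F (\<tau> k l x)"
  by (rule pd_chain[OF overlap_open[OF kl(1,2)] kl(3) E_open[OF kl(2)] _ F \<tau>_derivative[OF kl]])
    (use \<tau>_in[OF kl(1)] ov_sub in blast)

lemma \<epsilon>_self: "k < N \<Longrightarrow> p \<in> U k \<Longrightarrow> \<epsilon> k k p = 1"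
  using \<epsilon>_cocycle[of k k k p] \<epsilon>_norm[of k k p] by (metis Int_iff mult_cancel_right1 norm_eq_zero zero_neq_one)

text \<open>Flat local sections, with constant coordinate \<open>a l\<close> in frame
  \<open>l\<close>, patched together by the partition of unity and read in frame
  \<open>k\<close>.\<close>

definition sec :: "(nat \<Rightarrow> complex) \<Rightarrow> nat \<Rightarrow> 'p \<Rightarrow> complex" where
  "sec a k p = (\<Sum>l<N. \<phi> l p *\<^sub>R (a l * \<epsilon> k l p))"

abbreviation "F a k \<equiv> (\<lambda>x. sec a k (v k x))"

text \<open>On the overlap the factor \<open>\<epsilon> k l\<close> is locally constant. Off
  \<open>U l\<close> nothing is known about it, but there the whole summand vanishes on a
  neighbourhood by \<open>\<phi>_away\<close>.\<close>

lemma F_Ck: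
  assumes k: "k < N" shows "Ck_ext 2 (E k) (F a k)"
  unfolding sec_def
proof (rule Ck_ext_sum)
  fix l assume "l \<in> {..<N}"
  then have l: "l < N" by simp
  show "Ck_ext 2 (E k) (\<lambda>x. \<phi> l (v k x) *\<^sub>R (a l * \<epsilon> k l (v k x)))"
  proof (rule Ck_ext_local)
    fix x assume x: "x \<in> E k"
    show "\<exists>T. open T \<and> x \<in> T \<and> Ck_ext 2 (E k \<inter> T) (\<lambda>x. \<phi> l (v k x) *\<^sub>R (a l * \<epsilon> k l (v k x)))"
    proof (cases "v k x \<in> U l")
      case True
      then have xo: "x \<in> ov k l" using x ov_iff[OF k] by blast
      obtain T where T: "open T" "ov k l = half_plane \<inter> T"
        using overlap_open[OF k l] by (auto simp: openin_open)
      have sub: "E k \<inter> T \<subseteq> ov k l" using T E_half_plane[OF k] by blast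
      have "Ck_ext 2 (ov k l) (\<lambda>x. \<epsilon> k l (v k x))"
      proof (rule Ck_ext_locally_const)
        fix y assume y: "y \<in> ov k l"
        then have p: "v k y \<in> U k \<inter> U l" using ov_iff[OF k] v_in by blast
        obtain A where A: "open A" "u k (v k y) \<in> A" "\<And>q. q \<in> U k \<inter> U l \<Longrightarrow> u k q \<in> A \<Longrightarrow> \<epsilon> k l q = \<epsilon> k l (v k y)"
          using \<epsilon>_locally_const[OF k l p] by metis
        have "\<epsilon> k l (v k z) = \<epsilon> k l (v k y)" if "z \<in> ov k l \<inter> A" for z
        proof (rule A(3))
          have z: "z \<in> E k" "v k z \<in> U l" using that ov_iff[OF k] by blast+
          show "v k z \<in> U k \<inter> U l" using z v_in by blast
          show "u k (v k z) \<in> A" using u_v[OF z(1)] that by simp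
        qed
        moreover have "y \<in> A" using A(2) u_v y ov_sub by (metis subsetD)
        ultimately show "\<exists>T. open T \<and> y \<in> T \<and> (\<forall>z\<in>ov k l \<inter> T. \<epsilon> k l (v k z) = \<epsilon> k l (v k y))"
          using A(1) by (intro exI[of _ A]) simp
      qed
      then have "Ck_ext 2 (ov k l) (\<lambda>x. \<phi> l (v k x) *\<^sub>R (a l * \<epsilon> k l (v k x)))"
        by (intro Ck_ext_scaleR Ck_ext_mult Ck_ext_const Ck_ext_subset[OF \<phi>_Ck[OF k l] ov_sub])
      from Ck_ext_subset[OF this sub] show ?thesis using T xo by (intro exI[of _ T]) auto
    next
      case False
      obtain A where A: "open A" "u k (v k x) \<in> A" "\<And>q. q \<in> U k \<Longrightarrow> u k q \<in> A \<Longrightarrow> \<phi> l q = 0"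
        using \<phi>_away[OF k l, of "v k x"] False v_in[OF x] by auto
      have "Ck_ext 2 (E k \<inter> A) (\<lambda>x. \<phi> l (v k x) *\<^sub>R (a l * \<epsilon> k l (v k x)))"
      proof (rule Ck_ext_cong[OF Ck_ext_const[of _ _ 0]])
        fix y assume y: "y \<in> E k \<inter> A"
        then have "\<phi> l (v k y) = 0" using A(3)[of "v k y"] v_in u_v by auto
        then show "0 = \<phi> l (v k y) *\<^sub>R (a l * \<epsilon> k l (v k y))" by simp
      qed
      then show ?thesis using A(1,2) u_v[OF x] by (intro exI[of _ A]) simp
    qed
  qed
qed

lemma sec_change:
  assumes "k < N" "l < N" "p \<in> U k \<inter> U l"
  shows "sec a k p = \<epsilon> k l p * sec a l p"
  unfolding sec_def sum_distrib_left
proof (rule sum.cong)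
  fix m assume "m \<in> {..<N}"
  then show "\<phi> m p *\<^sub>R (a m * \<epsilon> k m p) = \<epsilon> k l p * (\<phi> m p *\<^sub>R (a m * \<epsilon> l m p))"
    using \<epsilon>_cocycle[OF assms(1,2), of m p] \<phi>_outside[of m p] assms(3)
    by (cases "p \<in> U m") (auto simp: algebra_simps)
qed simp

lemma sec_norm:
  "k < N \<Longrightarrow> l < N \<Longrightarrow> p \<in> U k \<inter> U l \<Longrightarrow> cmod (sec a k p) = cmod (sec a l p)"
  using sec_change[of k l p a] \<epsilon>_norm[of k l p] by (simp add: norm_mult)

text \<open>The transition factor is locally constant and passes through the derivative; this is
  where flatness enters.\<close>

lemma F_pd_change:
  assumes kl: "k < N" "l < N" "x \<in> ov k l"
  shows "pd i (F a k) x = \<epsilon> k l (v k x) * ((D\<tau> k l x (axis i 1) $ 1) *\<^sub>R pd 1 (F a l) (\<tau> k l x)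
      + (D\<tau> k l x (axis i 1) $ 2) *\<^sub>R pd 2 (F a l) (\<tau> k l x))"
proof -
  have p: "v k x \<in> U k \<inter> U l" using kl(3) ov_iff[OF kl(1)] v_in by blast
  obtain A where A: "open A" "u k (v k x) \<in> A" "\<And>q. q \<in> U k \<inter> U l \<Longrightarrow> u k q \<in> A \<Longrightarrow> \<epsilon> k l q = \<epsilon> k l (v k x)"
    using \<epsilon>_locally_const[OF kl(1,2) p] by metis
  have xA: "x \<in> ov k l \<inter> A" using A(2) u_v kl(3) by auto
  have o: "half_open (ov k l \<inter> A)" using overlap_open[OF kl(1,2)] A(1) by (rule openin_Int_open)
  have F2: "Ck_ext (Suc 1) (E l) (F a l)" using F_Ck[OF kl(2)] by (simp add: numeral_2_eq_2)
  have "Ck_ext 2 (ov k l) (\<lambda>x. F a l (\<tau> k l x))"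
    by (rule Ck_ext_compose[OF transition_Ck[OF kl(1,2)] F_Ck[OF kl(2)]]) (use \<tau>_in[OF kl(1)] in blast)
  then have C: "Ck_ext (Suc 1) (ov k l) (\<lambda>x. F a l (\<tau> k l x))" by (simp add: numeral_2_eq_2)
  have "pd i (F a k) x = pd i (\<lambda>y. \<epsilon> k l (v k x) * F a l (\<tau> k l y)) x"
  proof (rule pd_cong[OF o xA])
    fix y assume y: "y \<in> ov k l \<inter> A"
    then have q: "v k y \<in> U k \<inter> U l" using ov_iff[OF kl(1)] v_in by blast
    have "u k (v k y) \<in> A" using y u_v by auto
    then show "F a k y = \<epsilon> k l (v k x) * F a l (\<tau> k l y)"
      using sec_change[OF kl(1,2) q] A(3)[OF q] v_\<tau>[OF kl(1,2), of y] y by simp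
  qed
  also have "\<dots> = \<epsilon> k l (v k x) * pd i (\<lambda>y. F a l (\<tau> k l y)) x"
    by (rule pd_linear[OF bounded_linear_mult_right overlap_open[OF kl(1,2)] kl(3) C])
  also have "pd i (\<lambda>y. F a l (\<tau> k l y)) x = (D\<tau> k l x (axis i 1) $ 1) *\<^sub>R pd 1 (F a l) (\<tau> k l x)
      + (D\<tau> k l x (axis i 1) $ 2) *\<^sub>R pd 2 (F a l) (\<tau> k l x)"
    by (rule pd_\<tau>[OF kl F2])
  finally show ?thesis .
qed

text \<open>The factor of norm 1 cancels against its conjugate and leaves the Jacobian of the
  transition map, so nondegeneracy of a zero does not depend on the chart.\<close>

lemma jac_change:
  assumes kl: "k < N" "l < N" "x \<in> ov k l"
  shows "jac (F a k) x = det (matrix (D\<tau> k l x)) * jac (F a l) (\<tau> k l x)"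
proof -
  have p: "v k x \<in> U k \<inter> U l" using kl(3) ov_iff[OF kl(1)] v_in by blast
  let ?e = "\<epsilon> k l (v k x)"
  have e: "cnj ?e * ?e = 1" using \<epsilon>_norm[OF kl(1,2) p] by (metis complex_norm_square mult.commute of_real_1 power_one)
  have "cnj (pd 1 (F a k) x) * pd 2 (F a k) x = cnj ?e * ?e *
    (cnj ((D\<tau> k l x (axis 1 1) $ 1) *\<^sub>R pd 1 (F a l) (\<tau> k l x) + (D\<tau> k l x (axis 1 1) $ 2) *\<^sub>R pd 2 (F a l) (\<tau> k l x))
     * ((D\<tau> k l x (axis 2 1) $ 1) *\<^sub>R pd 1 (F a l) (\<tau> k l x) + (D\<tau> k l x (axis 2 1) $ 2) *\<^sub>R pd 2 (F a l) (\<tau> k l x)))"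
    unfolding F_pd_change[OF kl] by (simp only: complex_cnj_mult mult_ac)
  then show ?thesis unfolding jac_def e det_\<tau> by (simp add: algebra_simps)
qed

text \<open>A zero is good if it lies off the boundary and is nondegenerate. The perturbation \<open>a\<close> is chosen
  one chart at a time by Sard's theorem, good points of earlier charts staying good by compactness.\<close>

definition good :: "(nat \<Rightarrow> complex) \<Rightarrow> nat \<Rightarrow> real^2 \<Rightarrow> bool" where
  "good a k x \<longleftrightarrow> (F a k x = 0 \<longrightarrow> x $ 2 \<noteq> 0 \<and> jac (F a k) x \<noteq> 0)"

lemma good_transfer:
  assumes kl: "k < N" "l < N" and p: "p \<in> U k \<inter> U l" and g: "good a l (u l p)"
  shows "good a k (u k p)"
proof -
  have x: "u k p \<in> ov k l" using p by blast
  have t: "\<tau> k l (u k p) = u l p" using v_u[OF kl(1)] p by simp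
  have "F a k (u k p) = 0 \<longleftrightarrow> F a l (u l p) = 0"
    using sec_norm[OF kl p, of a] v_u kl p by (metis Int_iff norm_eq_zero)
  moreover have "jac (F a k) (u k p) \<noteq> 0 \<longleftrightarrow> jac (F a l) (u l p) \<noteq> 0"
    using jac_change[OF kl x, of a] transition_det[OF kl x] t by simp
  ultimately show ?thesis using g boundary_invariant[OF kl p] by (simp add: good_def)
qed

text \<open>Agreement on a neighbourhood, not just at \<open>x\<close>, because \<open>good\<close>
  involves derivatives.\<close>

lemma good_cong:
  assumes T: "half_open T" "x \<in> T" and eq: "\<And>y. y \<in> T \<Longrightarrow> F a k y = F b k y" and g: "good a k x"
  shows "good b k x"
  using g eq[OF T(2)] pd_cong[OF T eq] by (simp add: good_def jac_def)

text \<open>Of \<open>N\<close> weights with sum 1, one is at least \<open>1 / N\<close>. This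
  closed condition, in contrast to positivity of the weight, cuts out compact sets.\<close>

lemma P_covered: "p \<in> P \<Longrightarrow> \<exists>k<N. p \<in> U k \<and> 1 / real N \<le> \<phi> k p"
proof (rule ccontr)
  assume p: "p \<in> P" and no: "\<not> (\<exists>k<N. p \<in> U k \<and> 1 / real N \<le> \<phi> k p)"
  have N: "0 < N" using \<phi>_sum[OF p] by (cases N) auto
  have "\<phi> k p < 1 / real N" if "k < N" for k
  proof (cases "p \<in> U k")
    case False
    then show ?thesis using \<phi>_outside[OF that False] N by simp
  qed (use no that in auto)
  then have "(\<Sum>k<N. \<phi> k p) < (\<Sum>k<N. 1 / real N)"
    using N by (intro sum_strict_mono) auto
  then show False using \<phi>_sum[OF p] N by simp
qed

text \<open>Only the coefficient \<open>a m\<close> changes, by a number \<open>c\<close> that is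
  generic for chart \<open>m\<close> and so small that the points treated earlier stay good. Near
  points where \<open>\<phi> m\<close> vanishes identically the section is the old one.\<close>

lemma good_step:
  assumes m: "m < N" and a: "\<And>p k. p \<in> P \<Longrightarrow> \<exists>l<m. 1 / real N \<le> \<phi> l p \<Longrightarrow> k < N \<Longrightarrow> p \<in> U k \<Longrightarrow> good a k (u k p)"
  shows "\<exists>b. \<forall>p\<in>P. (\<exists>l<Suc m. 1 / real N \<le> \<phi> l p) \<longrightarrow> (\<forall>k<N. p \<in> U k \<longrightarrow> good b k (u k p))"
proof -
  let ?K = "\<lambda>p. \<exists>l<m. 1 / real N \<le> \<phi> l p"
  obtain C where C: "compact C" "C \<subseteq> E m" "\<And>p. p \<in> U m \<Longrightarrow> u m p \<notin> C \<Longrightarrow> \<phi> m p = 0"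
    using \<phi>_support[OF m] by metis
  \<comment> \<open>The points of the support of \<open>\<phi> m\<close> that were treated earlier:
    only here could the change of \<open>a m\<close> spoil a good point, and the set is
    compact.\<close>
  define S where "S = {x \<in> C. ?K (v m x)}"
  have Em: "half_open (E m)" by (rule E_open[OF m])
  have "S = (\<Union>l<m. {x \<in> C. 1 / real N \<le> \<phi> l (v m x)})" by (auto simp: S_def)
  moreover have "compact {x \<in> C. 1 / real N \<le> \<phi> l (v m x)}" if "l < m" for l
  proof -
    have "continuous_on C (\<lambda>x. \<phi> l (v m x))"
      using continuous_on_subset[OF Ck_ext_continuous_on[OF \<phi>_Ck[OF m, of l]] C(2)] that m by simp
    then have "closedin (top_of_set C) (C \<inter> (\<lambda>x. \<phi> l (v m x)) -` {1 / real N..})"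
      by (rule continuous_closedin_preimage) simp
    then have "compact (C \<inter> (\<lambda>x. \<phi> l (v m x)) -` {1 / real N..})" using C(1) by (rule closedin_compact[rotated])
    then show ?thesis by (simp add: vimage_def Int_def)
  qed
  ultimately have S: "compact S" by (simp only:) (intro compact_UN, auto)
  have SE: "S \<subseteq> E m" using C(2) by (auto simp: S_def)
  have F1: "Ck_ext 1 (E m) (F a m)" using F_Ck[OF m, of a] Ck_ext_pred[of 1] by (simp add: numeral_2_eq_2)
  have \<Phi>1: "Ck_ext 1 (E m) (\<lambda>x. \<phi> m (v m x))" using \<phi>_Ck[OF m m] Ck_ext_pred[of 1] by (simp add: numeral_2_eq_2)
  have "good a m x" if x: "x \<in> S" for x
  proof -
    have xE: "x \<in> E m" using x SE by blast
    have "good a m (u m (v m x))"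
      using a[of "v m x" m] x v_in[OF xE] U_sub[OF m] m unfolding S_def by auto
    then show ?thesis using u_v[OF xE] by simp
  qed
  then have g: "x $ 2 \<noteq> 0 \<and> jac (F a m) x \<noteq> 0" if "x \<in> S" "F a m x = 0" for x
    using that unfolding good_def by blast
  have "\<exists>\<delta>>0. \<forall>c. cmod c < \<delta> \<longrightarrow> (\<forall>x\<in>S. F a m x + \<phi> m (v m x) *\<^sub>R c = 0 \<longrightarrow>
      x $ 2 \<noteq> 0 \<and> jac (\<lambda>x. F a m x + \<phi> m (v m x) *\<^sub>R c) x \<noteq> 0)"
    by (rule stable_perturbation[OF Em F1 \<Phi>1 S SE]) (rule g)
  then obtain \<delta> where \<delta>: "\<delta> > 0"
    "\<forall>c. cmod c < \<delta> \<longrightarrow> (\<forall>x\<in>S. F a m x + \<phi> m (v m x) *\<^sub>R c = 0 \<longrightarrow>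
      x $ 2 \<noteq> 0 \<and> jac (\<lambda>x. F a m x + \<phi> m (v m x) *\<^sub>R c) x \<noteq> 0)"
    by (elim exE conjE) (rule that)
  from generic_perturbation[OF Em F1 \<Phi>1 \<delta>(1)] obtain c where c: "cmod c < \<delta>"
    "\<forall>x\<in>E m. 0 < \<phi> m (v m x) \<and> F a m x + \<phi> m (v m x) *\<^sub>R c = 0 \<longrightarrow>
      x $ 2 \<noteq> 0 \<and> jac (\<lambda>x. F a m x + \<phi> m (v m x) *\<^sub>R c) x \<noteq> 0"
    by (elim exE conjE) (rule that)
  define b where "b = a(m := a m + c)"
  have bsec: "sec b k p = sec a k p + \<phi> m p *\<^sub>R (c * \<epsilon> k m p)" for k p
  proof -
    have "sec b k p = (\<Sum>l<N. \<phi> l p *\<^sub>R (a l * \<epsilon> k l p) + (if l = m then \<phi> m p *\<^sub>R (c * \<epsilon> k m p) else 0))"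
      unfolding sec_def b_def by (intro sum.cong) (auto simp: algebra_simps)
    then show ?thesis using m by (simp add: sum.distrib sec_def)
  qed
  \<comment> \<open>\<open>\<epsilon> m m\<close> is 1, so in chart \<open>m\<close> the change is
    the perturbation \<open>\<Phi> x *\<^sub>R c\<close> of the two lemmas.\<close>
  have Fb: "F b m x = F a m x + \<phi> m (v m x) *\<^sub>R c" if "x \<in> E m" for x
    using bsec \<epsilon>_self[OF m v_in[OF that]] by simp
  have goodb: "good b m x" if "x \<in> E m" "0 < \<phi> m (v m x) \<or> x \<in> S" for x
  proof -
    have pdb: "pd i (F b m) x = pd i (\<lambda>x. F a m x + \<phi> m (v m x) *\<^sub>R c) x" for i
      by (rule pd_cong[OF Em that(1) Fb])
    show ?thesis unfolding good_def jac_def pdb Fb[OF that(1)]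
      using that c(2) \<delta>(2)[rule_format, OF c(1)] unfolding jac_def by blast
  qed
  have "good b k (u k p)" if p: "p \<in> P" "\<exists>l<Suc m. 1 / real N \<le> \<phi> l p" "k < N" "p \<in> U k" for p k
  proof (cases "0 < \<phi> m p")
    case True
    then have pm: "p \<in> U m" using \<phi>_outside[OF m, of p] by auto
    then have "good b m (u m p)" using goodb[of "u m p"] True v_u[OF m pm] by simp
    then show ?thesis using good_transfer[OF p(3) m] p(4) pm by blast
  next
    case False
    then have z: "\<phi> m p = 0" using \<phi>_nonneg[of m p] by simp
    have "0 < 1 / real N" using m by simp
    then have K: "?K p" using p(2) z by (metis less_SucE not_less)
    show ?thesis
    proof (cases "p \<in> U m")
      case pm: True
      have "good b m (u m p)"
      \<comment> \<open>Inside \<open>C\<close> the point belongs to \<open>S\<close>; outside,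
        \<open>\<phi> m\<close> vanishes on the relatively open set \<open>E m - C\<close>.\<close>
      proof (cases "u m p \<in> C")
        case True
        then show ?thesis using goodb[of "u m p"] pm K v_u[OF m pm] by (simp add: S_def)
      next
        case False
        have "half_open (E m - C)" by (rule openin_Diff_compact[OF Em C(1)])
        moreover have "u m p \<in> E m - C" using False pm by blast
        moreover have "F a m y = F b m y" if "y \<in> E m - C" for y
          using Fb[of y] that C(3)[OF v_in, of y] u_v[of y m] by auto
        ultimately show ?thesis using a[OF p(1) K m pm] by (rule good_cong)
      qed
      then show ?thesis using good_transfer[OF p(3) m] p(4) pm by blast
    next
      case False
      then obtain A where A: "open A" "u k p \<in> A" "\<And>q. q \<in> U k \<Longrightarrow> u k q \<in> A \<Longrightarrow> \<phi> m q = 0"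
        using \<phi>_away[OF p(3) m, of p] p(4) by auto
      have "half_open (E k \<inter> A)" using E_open[OF p(3)] A(1) by (rule openin_Int_open)
      moreover have "u k p \<in> E k \<inter> A" using A p(4) by blast
      moreover have "F a k y = F b k y" if "y \<in> E k \<inter> A" for y
        using bsec[of k "v k y"] A(3)[OF v_in, of y] that u_v[of y k] by auto
      ultimately show ?thesis using a[OF p(1) K p(3,4)] by (rule good_cong)
    qed
  qed
  then show ?thesis by blast
qed

theorem generic_section: "\<exists>a. \<forall>k<N. \<forall>x\<in>E k. good a k x"
proof -
  have "\<exists>a. \<forall>p\<in>P. (\<exists>l<m. 1 / real N \<le> \<phi> l p) \<longrightarrow> (\<forall>k<N. p \<in> U k \<longrightarrow> good a k (u k p))" if "m \<le> N" for m
    using that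
  proof (induction m)
    case (Suc m)
    then obtain a where "\<forall>p\<in>P. (\<exists>l<m. 1 / real N \<le> \<phi> l p) \<longrightarrow> (\<forall>k<N. p \<in> U k \<longrightarrow> good a k (u k p))" by auto
    then show ?case using good_step[of m a] Suc.prems by auto
  qed simp
  then obtain a where a: "\<And>p k. p \<in> P \<Longrightarrow> (\<exists>l<N. 1 / real N \<le> \<phi> l p) \<Longrightarrow> k < N \<Longrightarrow> p \<in> U k \<Longrightarrow> good a k (u k p)"
    by blast
  have "good a k x" if "k < N" "x \<in> E k" for k x
  proof -
    have "v k x \<in> P" using v_in[OF that(2)] U_sub[OF that(1)] by blast
    then show ?thesis using a[of "v k x" k] P_covered[of "v k x"] that v_in[OF that(2)] u_v[OF that(2)] by auto
  qed
  then show ?thesis by blast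
qed

end

section \<open>Zeros of the generic section and squares around them\<close>

lemma half_open_borel: "half_open E \<Longrightarrow> E \<in> sets lebesgue"
proof -
  assume "half_open E"
  then obtain T where "open T" "E = half_plane \<inter> T" by (auto simp: openin_open)
  moreover have "closed half_plane" unfolding half_plane_def by (intro closed_Collect_le continuous_intros)
  ultimately show ?thesis by auto
qed

lemma integral_zero_outside:
  fixes f :: "'a::euclidean_space \<Rightarrow> 'b::banach"
  assumes "S \<subseteq> T" "\<And>x. x \<in> T - S \<Longrightarrow> f x = 0"
  shows "integral T f = integral S f"
proof (rule integral_spike_set)
  show "negligible {x \<in> T - S. f x \<noteq> 0}" "negligible {x \<in> S - T. f x \<noteq> 0}"
    using assms by (intro negligible_subset[OF negligible_empty]; blast)+
qed

context flat_line_bundle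
begin

text \<open>Compact pieces of the charts which, by \<open>P_covered\<close>, still cover
  \<open>P\<close>.\<close>

definition core :: "nat \<Rightarrow> (real^2) set" where
  "core k = {x \<in> E k. 1 / real N \<le> \<phi> k (v k x)}"

lemma core_compact: assumes k: "k < N" shows "compact (core k)"
proof -
  obtain C where C: "compact C" "C \<subseteq> E k" "\<And>p. p \<in> U k \<Longrightarrow> u k p \<notin> C \<Longrightarrow> \<phi> k p = 0"
    using \<phi>_support[OF k] by metis
  have pos: "0 < 1 / real N" using k by simp
  have "x \<in> C" if "x \<in> E k" "1 / real N \<le> \<phi> k (v k x)" for x
  proof (rule ccontr)
    assume "x \<notin> C"
    then have "\<phi> k (v k x) = 0" using C(3)[OF v_in[OF that(1)]] u_v[OF that(1)] by simp
    then show False using that(2) pos by simp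
  qed
  then have eq: "core k = C \<inter> (\<lambda>x. \<phi> k (v k x)) -` {1 / real N..}" using C(2) by (auto simp: core_def)
  have "continuous_on C (\<lambda>x. \<phi> k (v k x))"
    using continuous_on_subset[OF Ck_ext_continuous_on[OF \<phi>_Ck[OF k k]] C(2)] .
  then have "closedin (top_of_set C) (core k)"
    unfolding eq by (rule continuous_closedin_preimage) simp
  then show ?thesis using C(1) by (rule closedin_compact[rotated])
qed

lemma core_point:
  assumes "p \<in> P" obtains l where "l < N" "p \<in> U l" "u l p \<in> core l"
  using P_covered[OF assms] v_u that unfolding core_def by auto

definition zeros :: "(nat \<Rightarrow> complex) \<Rightarrow> 'p set" where
  "zeros a = {p \<in> P. \<exists>k<N. p \<in> U k \<and> sec a k p = 0}"

text \<open>Coordinates in different frames have the same norm, so vanishing can be tested in any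
  chart.\<close>

lemma zeros_iff: "k < N \<Longrightarrow> p \<in> U k \<Longrightarrow> p \<in> zeros a \<longleftrightarrow> sec a k p = 0"
proof
  assume k: "k < N" "p \<in> U k" and "p \<in> zeros a"
  then obtain l where l: "l < N" "p \<in> U l" "sec a l p = 0" by (auto simp: zeros_def)
  then have "cmod (sec a k p) = 0" using sec_norm[OF k(1) l(1), of p a] k(2) by simp
  then show "sec a k p = 0" by simp
qed (use U_sub in \<open>auto simp: zeros_def\<close>)

end

locale generic_flat_section = flat_line_bundle N P U u \<phi> \<epsilon>
  for N and P :: "'p set" and U u \<phi> \<epsilon> +
  fixes a :: "nat \<Rightarrow> complex"
  assumes good: "\<And>k x. k < N \<Longrightarrow> x \<in> u k ` U k \<Longrightarrow> good a k x"
begin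

lemma F_Ck1: "k < N \<Longrightarrow> Ck_ext 1 (E k) (F a k)"
  using F_Ck[of k a] Ck_ext_pred[of 1] by (simp add: numeral_2_eq_2)

text \<open>Infinitely many zeros in a compact core would accumulate at a zero, which contradicts
  its nondegeneracy.\<close>

lemma finite_core_zeros: assumes k: "k < N" shows "finite {x \<in> core k. F a k x = 0}"
proof -
  let ?A = "{x \<in> core k. F a k x = 0}"
  have sub: "core k \<subseteq> E k" by (auto simp: core_def)
  have cF: "continuous_on (core k) (F a k)"
    by (rule continuous_on_subset[OF Ck_ext_continuous_on[OF F_Ck[OF k]] sub])
  have "closedin (top_of_set (core k)) ?A" using cF by (rule continuous_closedin_preimage_constant)
  then have chart_dom: "compact ?A" by (rule closedin_compact[OF core_compact[OF k]])
  have nl: "\<not> z islimpt ?A" for z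
  proof
    assume z: "z islimpt ?A"
    then have "z \<in> ?A" using compact_imp_closed[OF chart_dom] by (meson closed_limpt)
    then have zE: "z \<in> E k" "F a k z = 0" using sub by auto
    then have "jac (F a k) z \<noteq> 0" using good[OF k zE(1)] by (simp add: good_def)
    from nondegenerate_zero_isolated[OF E_open[OF k] zE(1) F_Ck1[OF k] zE(2) this]
    obtain d where d: "d > 0" "\<forall>y\<in>E k \<inter> ball z d. F a k y = 0 \<longrightarrow> y = z" by blast
    from z d(1) obtain y where "y \<in> ?A" "y \<noteq> z" "dist y z < d" unfolding islimpt_approachable by blast
    then show False using d(2) sub by (auto simp: dist_commute)
  qed
  show ?thesis
  proof (rule ccontr)
    assume "infinite ?A"
    then obtain z where "z islimpt ?A" using Heine_Borel_imp_Bolzano_Weierstrass[OF chart_dom _ subset_refl] by blast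
    with nl show False by blast
  qed
qed

lemma finite_zeros: "finite (zeros a)"
proof (rule finite_subset)
  show "zeros a \<subseteq> (\<Union>k<N. v k ` {x \<in> core k. F a k x = 0})"
  proof
    fix p assume p: "p \<in> zeros a"
    then obtain l where l: "l < N" "p \<in> U l" "u l p \<in> core l" using core_point[of p] by (auto simp: zeros_def)
    then have "F a l (u l p) = 0" using zeros_iff[OF l(1,2)] p v_u by simp
    then show "p \<in> (\<Union>k<N. v k ` {x \<in> core k. F a k x = 0})"
      using l v_u[OF l(1,2)] by (intro UN_I[of l] image_eqI[of _ _ "u l p"]) auto
  qed
qed (use finite_core_zeros in auto)

definition ch :: "'p \<Rightarrow> nat" where "ch z = (SOME k. k < N \<and> z \<in> U k)"

text \<open>A square rather than a disc, so that Green's formula for rectangles applies around the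
  zero.\<close>

definition sq :: "real \<Rightarrow> 'p \<Rightarrow> (real^2) set" where
  "sq r z = (let c = u (ch z) z in cbox (pt (c $ 1 - r) (c $ 2 - r)) (pt (c $ 1 + r) (c $ 2 + r)))"

definition isq :: "real \<Rightarrow> 'p \<Rightarrow> (real^2) set" where
  "isq r z = (let c = u (ch z) z in box (pt (c $ 1 - r) (c $ 2 - r)) (pt (c $ 1 + r) (c $ 2 + r)))"

lemma ch: "z \<in> zeros a \<Longrightarrow> ch z < N \<and> z \<in> U (ch z)"
  unfolding ch_def by (rule someI_ex) (auto simp: zeros_def)

lemma isq_sub_sq: "isq r z \<subseteq> sq r z"
  unfolding isq_def sq_def Let_def by (rule box_subset_cbox)

lemma sq_in_ball: assumes "0 < r" "2 * r < e" shows "sq r z \<subseteq> ball (u (ch z) z) e"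
proof
  fix x assume "x \<in> sq r z"
  then have "\<bar>(x - u (ch z) z) $ 1\<bar> \<le> r" "\<bar>(x - u (ch z) z) $ 2\<bar> \<le> r"
    by (auto simp: sq_def Let_def mem_cbox_pt abs_le_iff)
  moreover have "norm (x - u (ch z) z) \<le> (\<Sum>i\<in>UNIV. \<bar>(x - u (ch z) z) $ i\<bar>)" by (rule norm_le_l1_cart)
  ultimately have "norm (x - u (ch z) z) \<le> r + r" by (simp add: sum_2)
  then show "x \<in> ball (u (ch z) z) e" using assms by (simp add: dist_norm norm_minus_commute)
qed

lemma center_isq: "0 < r \<Longrightarrow> u (ch z) z \<in> isq r z"
  by (simp add: isq_def Let_def mem_box_cart forall_2)

text \<open>There are finitely many zeros, so one size serves all of them: the squares fit into the
  charts, avoid the boundary because good zeros do, and are disjoint by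
  \<open>separated\<close>.\<close>

lemma squares_exist:
  obtains r where "0 < r"
    "\<And>z. z \<in> zeros a \<Longrightarrow> sq r z \<subseteq> E (ch z)"
    "\<And>z x. z \<in> zeros a \<Longrightarrow> x \<in> sq r z \<Longrightarrow> 0 < x $ 2"
    "\<And>z z' p. z \<in> zeros a \<Longrightarrow> z' \<in> zeros a \<Longrightarrow> z \<noteq> z' \<Longrightarrow> p \<in> U (ch z) \<inter> U (ch z') \<Longrightarrow>
      u (ch z) p \<in> sq r z \<Longrightarrow> u (ch z') p \<in> sq r z' \<Longrightarrow> False"
proof -
  let ?c = "\<lambda>z. u (ch z) z"
  have "\<exists>e>0. ball (?c z) e \<subseteq> E (ch z) \<and> (\<forall>x\<in>ball (?c z) e. 0 < x $ 2)" if z: "z \<in> zeros a" for z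
  proof -
    have k: "ch z < N" "z \<in> U (ch z)" using ch[OF z] by auto
    have cE: "?c z \<in> E (ch z)" using k by blast
    have "F a (ch z) (?c z) = 0" using zeros_iff[OF k] z v_u[OF k] by simp
    then have "?c z $ 2 \<noteq> 0" using good[OF k(1) cE] by (simp add: good_def)
    then have "0 < ?c z $ 2" using E_half_plane[OF k(1) cE] by (simp add: half_plane_def)
    obtain T where T: "open T" "E (ch z) = half_plane \<inter> T" using E_open[OF k(1)] by (auto simp: openin_open)
    have "open (T \<inter> {x. 0 < x $ 2})" using T(1) by (intro open_Int open_Collect_less continuous_intros)
    moreover have "?c z \<in> T \<inter> {x. 0 < x $ 2}" using \<open>0 < ?c z $ 2\<close> cE T by blast
    ultimately obtain e where "e > 0" "ball (?c z) e \<subseteq> T \<inter> {x. 0 < x $ 2}" by (rule openE)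
    then show ?thesis using T(2) by (intro exI[of _ e]) (auto simp: half_plane_def subset_iff less_imp_le)
  qed
  then obtain e1 where e1: "\<And>z. z \<in> zeros a \<Longrightarrow> 0 < e1 z \<and> ball (?c z) (e1 z) \<subseteq> E (ch z) \<and> (\<forall>x\<in>ball (?c z) (e1 z). 0 < x $ 2)"
    by metis
  have "\<exists>e>0. z \<noteq> z' \<longrightarrow> (\<forall>p\<in>U (ch z) \<inter> U (ch z'). \<not> (u (ch z) p \<in> ball (?c z) e \<and> u (ch z') p \<in> ball (?c z') e))"
    if zz: "z \<in> zeros a" "z' \<in> zeros a" for z z'
  proof (cases "z = z'")
    case True
    then show ?thesis by (intro exI[of _ 1]) simp
  next
    case False
    have k: "ch z < N" "ch z' < N" "z \<in> U (ch z)" "z' \<in> U (ch z')" using ch zz by auto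
    obtain A B where AB: "open A" "open B" "?c z \<in> A" "?c z' \<in> B"
      "\<forall>x\<in>U (ch z) \<inter> U (ch z'). \<not> (u (ch z) x \<in> A \<and> u (ch z') x \<in> B)"
      using separated[OF k False] by blast
    obtain d d' where "d > 0" "ball (?c z) d \<subseteq> A" "d' > 0" "ball (?c z') d' \<subseteq> B"
      using openE[OF AB(1,3)] openE[OF AB(2,4)] by metis
    moreover have "ball (?c z) (min d d') \<subseteq> ball (?c z) d" "ball (?c z') (min d d') \<subseteq> ball (?c z') d'" by auto
    ultimately show ?thesis using AB(5) by (intro exI[of _ "min d d'"]) (meson min_less_iff_conj subsetD)
  qed
  then obtain e2 where e2: "\<And>z z'. z \<in> zeros a \<Longrightarrow> z' \<in> zeros a \<Longrightarrow> 0 < e2 z z' \<and> (z \<noteq> z' \<longrightarrow>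
      (\<forall>p\<in>U (ch z) \<inter> U (ch z'). \<not> (u (ch z) p \<in> ball (?c z) (e2 z z') \<and> u (ch z') p \<in> ball (?c z') (e2 z z'))))"
    by metis
  define X where "X = insert 1 (e1 ` zeros a \<union> (\<lambda>(z, z'). e2 z z') ` (zeros a \<times> zeros a))"
  have fX: "finite X" "X \<noteq> {}" using finite_zeros by (auto simp: X_def)
  have "0 < Min X" using fX e1 e2 by (subst Min_gr_iff) (auto simp: X_def)
  \<comment> \<open>\<open>sq_in_ball\<close> needs \<open>2 * r\<close> below every radius in
    \<open>X\<close>.\<close>
  define r where "r = Min X / 3"
  have r: "0 < r" using \<open>0 < Min X\<close> by (simp add: r_def)
  have small: "2 * r < x" if "x \<in> X" for x
    using Min_le[OF fX(1) that] \<open>0 < Min X\<close> unfolding r_def by linarith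
  have s1: "sq r z \<subseteq> ball (?c z) (e1 z)" if "z \<in> zeros a" for z
    by (rule sq_in_ball[OF r small]) (use that in \<open>auto simp: X_def\<close>)
  have s2: "sq r y \<subseteq> ball (?c y) (e2 z z')" if "z \<in> zeros a" "z' \<in> zeros a" for y z z'
    by (rule sq_in_ball[OF r small]) (use that in \<open>auto simp: X_def\<close>)
  show ?thesis
  proof (rule that[OF r])
    show "sq r z \<subseteq> E (ch z)" if "z \<in> zeros a" for z using s1[OF that] e1[OF that] by blast
    show "0 < x $ 2" if "z \<in> zeros a" "x \<in> sq r z" for z x using s1[OF that(1)] e1[OF that(1)] that(2) by blast
    show False if "z \<in> zeros a" "z' \<in> zeros a" "z \<noteq> z'" "p \<in> U (ch z) \<inter> U (ch z')"
      "u (ch z) p \<in> sq r z" "u (ch z') p \<in> sq r z'" for z z' p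
      using e2[OF that(1,2)] s2[OF that(1,2), of z] s2[OF that(1,2), of z'] that(3-6) by blast
  qed
qed

text \<open>The part of the open square around \<open>z\<close> that chart \<open>k\<close> sees, in
  the coordinates of chart \<open>k\<close>.\<close>

definition hole :: "real \<Rightarrow> nat \<Rightarrow> 'p \<Rightarrow> (real^2) set" where
  "hole r k z = {x \<in> ov k (ch z). \<tau> k (ch z) x \<in> isq r z}"

lemma hole_open: assumes "k < N" "z \<in> zeros a" shows "half_open (hole r k z)"
proof -
  have l: "ch z < N" using ch[OF assms(2)] by simp
  have "hole r k z = ov k (ch z) \<inter> \<tau> k (ch z) -` isq r z" by (auto simp: hole_def)
  moreover have "openin (top_of_set (ov k (ch z))) (ov k (ch z) \<inter> \<tau> k (ch z) -` isq r z)"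
    by (rule continuous_openin_preimage_gen[OF Ck_ext_continuous_on[OF transition_Ck[OF assms(1) l]]])
      (simp add: isq_def Let_def open_box)
  ultimately show ?thesis using openin_trans overlap_open[OF assms(1) l] by metis
qed

text \<open>On a compact core without the holes the section has no zero, hence its norm has a
  positive minimum. As the norm is the same in all frames, the finitely many cores control every
  chart.\<close>

lemma bounded_below_off_holes:
  assumes r: "0 < r"
  obtains \<delta> where "0 < \<delta>" "\<And>k x. k < N \<Longrightarrow> x \<in> E k \<Longrightarrow> (\<forall>z\<in>zeros a. x \<notin> hole r k z) \<Longrightarrow> \<delta> \<le> cmod (F a k x)"
proof -
  have "\<exists>\<delta>>0. \<forall>x\<in>core k. (\<forall>z\<in>zeros a. x \<notin> hole r k z) \<longrightarrow> \<delta> \<le> cmod (F a k x)" if k: "k < N" for k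
  proof -
    let ?B = "{x \<in> core k. \<forall>z\<in>zeros a. x \<notin> hole r k z}"
    have sub: "core k \<subseteq> E k" by (auto simp: core_def)
    have "\<exists>T. open T \<and> hole r k z = half_plane \<inter> T" if "z \<in> zeros a" for z
      using hole_open[OF k that, of r] by (auto simp: openin_open)
    then obtain T where T: "\<And>z. z \<in> zeros a \<Longrightarrow> open (T z) \<and> hole r k z = half_plane \<inter> T z" by metis
    have "x \<in> hole r k z \<longleftrightarrow> x \<in> T z" if "x \<in> core k" "z \<in> zeros a" for x z
      using T[OF that(2)] E_half_plane[OF k, of x] that(1) sub by (metis IntD2 IntI subsetD)
    then have "?B = core k - (\<Union>z\<in>zeros a. T z)" by auto
    moreover have "open (\<Union>z\<in>zeros a. T z)" using T by blast
    ultimately have chart_img: "compact ?B" using core_compact[OF k] by (simp add: compact_diff)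
    have c: "continuous_on ?B (\<lambda>x. cmod (F a k x))"
      by (intro continuous_on_norm continuous_on_subset[OF Ck_ext_continuous_on[OF F_Ck[OF k]]]) (use sub in blast)
    have nz: "F a k x \<noteq> 0" if "x \<in> ?B" for x
    proof
      assume 0: "F a k x = 0"
      have xE: "x \<in> E k" using that sub by blast
      then have z: "v k x \<in> zeros a" using zeros_iff[OF k v_in[OF xE]] 0 by simp
      have "x \<in> hole r k (v k x)"
        using xE ch[OF z] ov_iff[OF k] center_isq[OF r, of "v k x"] unfolding hole_def by simp
      then show False using that z by blast
    qed
    show ?thesis
    proof (cases "?B = {}")
      case True then show ?thesis by (intro exI[of _ 1]) auto
    next
      case False
      obtain y where y: "y \<in> ?B" "\<forall>x\<in>?B. cmod (F a k y) \<le> cmod (F a k x)"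
        using continuous_attains_inf[OF chart_img False c] by blast
      then show ?thesis using nz[OF y(1)] by (intro exI[of _ "cmod (F a k y)"]) simp
    qed
  qed
  then obtain d where d: "\<And>k. k < N \<Longrightarrow> 0 < d k \<and> (\<forall>x\<in>core k. (\<forall>z\<in>zeros a. x \<notin> hole r k z) \<longrightarrow> d k \<le> cmod (F a k x))"
    by metis
  define \<delta> where "\<delta> = Min (insert 1 (d ` {..<N}))"
  have "0 < \<delta>" unfolding \<delta>_def using d by (subst Min_gr_iff) auto
  moreover have "\<delta> \<le> cmod (F a k x)" if k: "k < N" and x: "x \<in> E k" and h: "\<forall>z\<in>zeros a. x \<notin> hole r k z" for k x
  proof -
    have p: "v k x \<in> U k" "v k x \<in> P" using v_in[OF x] U_sub[OF k] by auto
    obtain l where l: "l < N" "v k x \<in> U l" "u l (v k x) \<in> core l" using core_point[OF p(2)] by blast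
    have "u l (v k x) \<notin> hole r l z" if z: "z \<in> zeros a" for z
    proof
      assume "u l (v k x) \<in> hole r l z"
      then have "v k x \<in> U (ch z)" "u (ch z) (v k x) \<in> isq r z"
        using v_u[OF l(1,2)] ov_iff[OF l(1)] unfolding hole_def by auto
      then have "x \<in> hole r k z" using ov_iff[OF k] x unfolding hole_def by simp
      then show False using h z by blast
    qed
    then have "d l \<le> cmod (F a l (u l (v k x)))" using d[OF l(1)] l(3) by blast
    also have "\<dots> = cmod (F a k x)" using sec_norm[OF l(1) k, of "v k x" a] v_u[OF l(1,2)] l(2) p(1) by simp
    finally show ?thesis using l(1) unfolding \<delta>_def by (meson Min_le finite.insertI finite_imageI finite_lessThan image_eqI insertCI lessThan_iff order_trans)
  qed
  ultimately show ?thesis by (rule that)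
qed

end

section \<open>Change of the argument around a rectangle\<close>

lemma cis_sum: "finite I \<Longrightarrow> cis (\<Sum>i\<in>I. f i) = (\<Prod>i\<in>I. cis (f i))"
  by (induction I rule: finite_induct) (auto simp flip: cis_mult)

lemma cis_add_sgn:
  assumes "cis A * sgn x = sgn y" "cis B * sgn y = sgn z"
  shows "cis (A + B) * sgn x = sgn z"
  using assms by (metis cis_mult mult.commute mult.left_commute)

text \<open>On the sides \<open>h\<close> is the true reciprocal, so the integrals measure changes
  of the argument of \<open>F\<close>. Both ways from the corner \<open>pt a c\<close> to the corner
  \<open>pt b d\<close> lead to the same value of \<open>F\<close>, so the two changes agree modulo
  2 \<pi>.\<close>

lemma sides_index:
  fixes F :: "real^2 \<Rightarrow> complex"
  assumes F: "Ck_ext 2 E F" and E: "half_open E" and sub: "cbox (pt a c) (pt b d) \<subseteq> E" and le: "a \<le> b" "c \<le> d"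
    and nz: "\<And>x. x \<in> cbox (pt a c) (pt b d) - box (pt a c) (pt b d) \<Longrightarrow> e \<le> (cmod (F x))\<^sup>2" and e: "0 < e"
    and h: "Ck_ext 1 UNIV h" "\<And>s. e \<le> s \<Longrightarrow> h s = 1 / s"
  shows "cis (integral {c..d} (\<lambda>y. angular h F 2 (pt b y) - angular h F 2 (pt a y))
    - integral {a..b} (\<lambda>x. angular h F 1 (pt x d) - angular h F 1 (pt x c))) = 1"
proof -
  have F2: "Ck_ext (Suc 1) E F" using F by (simp add: numeral_2_eq_2)
  have F1: "Ck_ext (Suc 0) E F" using Ck_ext_pred[OF F2] by simp
  have inE: "pt x y \<in> E" if "x \<in> {a..b}" "y \<in> {c..d}" for x y
    using that sub by (force simp: mem_cbox_pt)
  have ang: "angular h F i x = Im (pd i F x / F x)" and ne: "F x \<noteq> 0"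
    if "x \<in> cbox (pt a c) (pt b d) - box (pt a c) (pt b d)" for x i
  proof -
    show "F x \<noteq> 0" using nz[OF that] e by auto
    have "pd i F x / F x = (pd i F x * cnj (F x)) / of_real ((cmod (F x))\<^sup>2)"
      using complex_div_cnj[of "pd i F x" "F x"] by simp
    then have "Im (pd i F x / F x) = Im (cnj (F x) * pd i F x) / (cmod (F x))\<^sup>2"
      by (simp only: Im_divide_of_real mult.commute)
    then show "angular h F i x = Im (pd i F x / F x)"
      using h(2)[OF nz[OF that]] by (simp add: angular_def)
  qed
  have cpd: "continuous_on E (pd i F)" for i by (rule Ck_ext_continuous_on[OF Ck_ext_pd[OF F1 E]])
  have cpt: "continuous_on S (\<lambda>t. pt t y)" "continuous_on S (\<lambda>t. pt y t)" for S y
    unfolding pt_eq by (intro continuous_intros)+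
  have ca: "continuous_on E (angular h F i)" for i
    by (rule Ck_ext_continuous_on[OF angular_Ck[OF h(1) F E]])
  have edge: "pt x y \<in> cbox (pt a c) (pt b d) - box (pt a c) (pt b d)"
    if "x \<in> {a..b}" "y \<in> {c..d}" "x = a \<or> x = b \<or> y = c \<or> y = d" for x y
    using that by (auto simp: mem_cbox_pt mem_box_cart forall_2)
  have H: "cis (integral {a..b} (\<lambda>x. angular h F 1 (pt x y))) * sgn (F (pt a y)) = sgn (F (pt b y))"
    if y: "y = c \<or> y = d" for y
  proof -
    have yy: "y \<in> {c..d}" using y le by auto
    have "cis (integral {a..b} (\<lambda>x. Im (pd 1 F (pt x y) / F (pt x y)))) * sgn (F (pt a y)) = sgn (F (pt b y))"
    proof (rule cis_integral_log_derivative[OF le(1)])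
      show "((\<lambda>x. F (pt x y)) has_vector_derivative pd 1 F (pt t y)) (at t within {a..b})" if "t \<in> {a..b}" for t
        by (rule line_derivative(1)[OF F1 E _ that]) (rule inE[OF _ yy])
      show "continuous_on {a..b} (\<lambda>x. pd 1 F (pt x y))"
        by (rule continuous_on_compose2[OF cpd cpt(1)]) (use inE yy in auto)
      show "F (pt t y) \<noteq> 0" if "t \<in> {a..b}" for t using ne[OF edge[OF that yy]] y by blast
    qed
    also have "integral {a..b} (\<lambda>x. Im (pd 1 F (pt x y) / F (pt x y))) = integral {a..b} (\<lambda>x. angular h F 1 (pt x y))"
      by (rule integral_cong) (use ang[OF edge[OF _ yy]] y in auto)
    finally show ?thesis .
  qed
  have V: "cis (integral {c..d} (\<lambda>y. angular h F 2 (pt x y))) * sgn (F (pt x c)) = sgn (F (pt x d))"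
    if x: "x = a \<or> x = b" for x
  proof -
    have xx: "x \<in> {a..b}" using x le by auto
    have "cis (integral {c..d} (\<lambda>y. Im (pd 2 F (pt x y) / F (pt x y)))) * sgn (F (pt x c)) = sgn (F (pt x d))"
    proof (rule cis_integral_log_derivative[OF le(2)])
      show "((\<lambda>y. F (pt x y)) has_vector_derivative pd 2 F (pt x t)) (at t within {c..d})" if "t \<in> {c..d}" for t
        by (rule line_derivative(2)[OF F1 E _ that]) (rule inE[OF xx])
      show "continuous_on {c..d} (\<lambda>y. pd 2 F (pt x y))"
        by (rule continuous_on_compose2[OF cpd cpt(2)]) (use inE xx in auto)
      show "F (pt x t) \<noteq> 0" if "t \<in> {c..d}" for t using ne[OF edge[OF xx that]] x by blast
    qed
    also have "integral {c..d} (\<lambda>y. Im (pd 2 F (pt x y) / F (pt x y))) = integral {c..d} (\<lambda>y. angular h F 2 (pt x y))"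
      by (rule integral_cong) (use ang[OF edge[OF xx]] x in auto)
    finally show ?thesis .
  qed
  have intH: "(\<lambda>x. angular h F 1 (pt x y)) integrable_on {a..b}" if "y = c \<or> y = d" for y
    by (intro integrable_continuous_real continuous_on_compose2[OF ca cpt(1)]) (use inE that le in auto)
  have intV: "(\<lambda>y. angular h F 2 (pt x y)) integrable_on {c..d}" if "x = a \<or> x = b" for x
    by (intro integrable_continuous_real continuous_on_compose2[OF ca cpt(2)]) (use inE that le in auto)
  \<comment> \<open>Right, left, top and bottom side.\<close>
  define R L T B where "R = integral {c..d} (\<lambda>y. angular h F 2 (pt b y))" and "L = integral {c..d} (\<lambda>y. angular h F 2 (pt a y))"
    and "T = integral {a..b} (\<lambda>x. angular h F 1 (pt x d))" and "B = integral {a..b} (\<lambda>x. angular h F 1 (pt x c))"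
  have "cis (B + R) * sgn (F (pt a c)) = sgn (F (pt b d))"
    unfolding B_def R_def by (rule cis_add_sgn[OF H V]) auto
  moreover have "cis (L + T) * sgn (F (pt a c)) = sgn (F (pt b d))"
    unfolding L_def T_def by (rule cis_add_sgn[OF V H]) auto
  moreover have "sgn (F (pt a c)) \<noteq> 0" using ne[OF edge[of a c]] le by (simp add: sgn_zero_iff)
  ultimately have "cis (B + R) = cis (L + T)" by (metis mult_cancel_right)
  then have "cis (B + R - (L + T)) = 1" by (simp flip: cis_divide)
  moreover have "B + R - (L + T) = (R - L) - (T - B)" by simp
  moreover have "integral {c..d} (\<lambda>y. angular h F 2 (pt b y) - angular h F 2 (pt a y)) = R - L"
    unfolding R_def L_def by (rule integral_diff) (auto intro: intV)
  moreover have "integral {a..b} (\<lambda>x. angular h F 1 (pt x d) - angular h F 1 (pt x c)) = T - B"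
    unfolding T_def B_def by (rule integral_diff) (auto intro: intH)
  ultimately show ?thesis by metis
qed

section \<open>Transformation of the forms under a change of chart\<close>

context flat_line_bundle
begin

lemma \<tau>_inj: "k < N \<Longrightarrow> l < N \<Longrightarrow> inj_on (\<tau> k l) (ov k l)"
  by (rule inj_onI) (metis ov_sub subsetD u_v v_\<tau>)

text \<open>Transition maps preserve orientation, so the absolute value in the change of variables
  formula disappears.\<close>

lemma chart_change_integral:
  assumes kl: "k < N" "l < N" and S: "S \<subseteq> ov k l" "S \<in> sets lebesgue"
    and tr: "\<And>x. x \<in> S \<Longrightarrow> \<alpha> x = det (matrix (D\<tau> k l x)) * \<beta> (\<tau> k l x)"
    and int: "\<alpha> absolutely_integrable_on S"
  shows "integral S \<alpha> = integral (\<tau> k l ` S) \<beta>"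
proof -
  have eq: "\<bar>det (matrix (D\<tau> k l x))\<bar> * \<beta> (\<tau> k l x) = \<alpha> x" if "x \<in> S" for x
    using transition_det[OF kl, of x] tr[OF that] that S(1) by (simp add: subset_iff)
  have SH: "S \<subseteq> half_plane" using S(1) half_openD[OF overlap_open[OF kl]] by blast
  have "integral S (\<lambda>x. \<bar>det (matrix (D\<tau> k l x))\<bar> * \<beta> (\<tau> k l x)) = integral (\<tau> k l ` S) \<beta>"
  proof (rule change_of_variables_real[OF S(2)])
    show "(\<tau> k l has_derivative D\<tau> k l x) (at x within S)" if "x \<in> S" for x
      by (rule has_derivative_subset[OF \<tau>_derivative[OF kl] SH]) (use that S(1) in blast)
    show "inj_on (\<tau> k l) S" by (rule inj_on_subset[OF \<tau>_inj[OF kl] S(1)])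
    show "(\<lambda>x. \<bar>det (matrix (D\<tau> k l x))\<bar> * \<beta> (\<tau> k l x)) absolutely_integrable_on S"
      by (rule set_integrable_cong[OF refl refl eq, THEN iffD2, OF _ int])
  qed
  then show ?thesis using integral_cong[of S "\<lambda>x. \<bar>det (matrix (D\<tau> k l x))\<bar> * \<beta> (\<tau> k l x)" \<alpha>] eq by simp
qed

text \<open>\<open>angular\<close> transforms as a 1-form: the transition factor is locally constant
  of norm 1 and drops out of \<open>Im (cnj F * d F)\<close>.\<close>

lemma angular_change:
  assumes kl: "k < N" "l < N" "x \<in> ov k l"
  shows "angular h (F a k) i x = D\<tau> k l x (axis i 1) $ 1 * angular h (F a l) 1 (\<tau> k l x)
    + D\<tau> k l x (axis i 1) $ 2 * angular h (F a l) 2 (\<tau> k l x)"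
proof -
  have p: "v k x \<in> U k \<inter> U l" using kl(3) ov_iff[OF kl(1)] v_in by blast
  let ?e = "\<epsilon> k l (v k x)"
  have e: "cnj ?e * ?e = 1" using \<epsilon>_norm[OF kl(1,2) p] by (metis complex_norm_square mult.commute of_real_1 power_one)
  have F: "F a k x = ?e * F a l (\<tau> k l x)" using sec_change[OF kl(1,2) p] v_\<tau>[OF kl] by simp
  have n: "cmod (F a k x) = cmod (F a l (\<tau> k l x))" using sec_norm[OF kl(1,2) p, of a] v_\<tau>[OF kl] by simp
  have "cnj (F a k x) * pd i (F a k) x = cnj ?e * ?e * (cnj (F a l (\<tau> k l x)) *
     ((D\<tau> k l x (axis i 1) $ 1) *\<^sub>R pd 1 (F a l) (\<tau> k l x) + (D\<tau> k l x (axis i 1) $ 2) *\<^sub>R pd 2 (F a l) (\<tau> k l x)))"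
    unfolding F_pd_change[OF kl] F by (simp only: complex_cnj_mult mult_ac)
  then show ?thesis unfolding angular_def n e by (simp add: algebra_simps)
qed

text \<open>The coefficient of the exterior product of the differential of \<open>\<phi> m\<close>
  with the angular form.\<close>

definition wedge :: "(real \<Rightarrow> real) \<Rightarrow> (nat \<Rightarrow> complex) \<Rightarrow> nat \<Rightarrow> nat \<Rightarrow> real^2 \<Rightarrow> real" where
  "wedge h a m k x = pd 1 (\<lambda>x. \<phi> m (v k x)) x * angular h (F a k) 2 x - pd 2 (\<lambda>x. \<phi> m (v k x)) x * angular h (F a k) 1 x"

lemma wedge_change:
  assumes kl: "k < N" "l < N" "x \<in> ov k l" and m: "m < N"
  shows "wedge h a m k x = det (matrix (D\<tau> k l x)) * wedge h a m l (\<tau> k l x)"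
proof -
  have P: "Ck_ext (Suc 1) (E l) (\<lambda>x. \<phi> m (v l x))" using \<phi>_Ck[OF kl(2) m] by (simp add: numeral_2_eq_2)
  have "pd i (\<lambda>x. \<phi> m (v k x)) x = pd i (\<lambda>y. \<phi> m (v l (\<tau> k l y))) x" for i
    by (rule pd_cong[OF overlap_open[OF kl(1,2)] kl(3)]) (use v_\<tau>[OF kl(1,2)] in metis)
  then have "pd i (\<lambda>x. \<phi> m (v k x)) x = (D\<tau> k l x (axis i 1) $ 1) * pd 1 (\<lambda>x. \<phi> m (v l x)) (\<tau> k l x)
      + (D\<tau> k l x (axis i 1) $ 2) * pd 2 (\<lambda>x. \<phi> m (v l x)) (\<tau> k l x)" for i
    using pd_\<tau>[OF kl P, of i] by simp
  then show ?thesis unfolding wedge_def angular_change[OF kl] det_\<tau> by (simp add: algebra_simps)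
qed

text \<open>The coefficient of the exterior derivative of the angular form.\<close>

definition curl :: "(real \<Rightarrow> real) \<Rightarrow> (nat \<Rightarrow> complex) \<Rightarrow> nat \<Rightarrow> real^2 \<Rightarrow> real" where
  "curl h a k x = pd 1 (angular h (F a k) 2) x - pd 2 (angular h (F a k) 1) x"

text \<open>By \<open>angular_curl\<close> the curl is \<open>jac\<close> times a function of the
  norm of the section. So \<open>jac_change\<close> suffices, and second derivatives of the
  transition map never appear.\<close>

lemma curl_change:
  assumes kl: "k < N" "l < N" "x \<in> ov k l" and h: "Ck_ext 1 UNIV h"
  shows "curl h a k x = det (matrix (D\<tau> k l x)) * curl h a l (\<tau> k l x)"
proof -
  have p: "v k x \<in> U k \<inter> U l" using kl(3) ov_iff[OF kl(1)] v_in by blast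
  have n: "cmod (F a k x) = cmod (F a l (\<tau> k l x))" using sec_norm[OF kl(1,2) p, of a] v_\<tau>[OF kl] by simp
  have x: "x \<in> E k" "\<tau> k l x \<in> E l" using kl(3) \<tau>_in[OF kl(1,3)] by blast+
  have "Ck_ext (Suc 0) UNIV h" using h by simp
  then obtain T g where T: "open T" "(cmod (F a k x))\<^sup>2 \<in> T" "Ck_on (Suc 0) g T" "\<And>y. y \<in> UNIV \<Longrightarrow> y \<in> T \<Longrightarrow> g y = h y"
    using Ck_extE[of "Suc 0" UNIV h "(cmod (F a k x))\<^sup>2"] by blast
  have "(g has_derivative frechet_derivative g (at ((cmod (F a k x))\<^sup>2))) (at ((cmod (F a k x))\<^sup>2))"
    by (rule Ck_on_SucD(1)[OF T(3,2)])
  then have "(h has_derivative frechet_derivative g (at ((cmod (F a k x))\<^sup>2))) (at ((cmod (F a k x))\<^sup>2))"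
    by (rule has_derivative_transform_within_open[OF _ T(1,2)]) (use T(4) in simp)
  then obtain h' where h': "(h has_real_derivative h') (at ((cmod (F a k x))\<^sup>2))"
    using has_real_derivative by blast
  show ?thesis unfolding curl_def
    using angular_curl[OF h h' F_Ck[OF kl(1)] E_open[OF kl(1)] x(1)]
      angular_curl[OF h h'[unfolded n] F_Ck[OF kl(2)] E_open[OF kl(2)] x(2)] jac_change[OF kl, of a] n
    by simp
qed

text \<open>The condition for vanishing is stated on neighbourhoods so that it covers integrands
  with derivatives of \<open>\<phi> k\<close>.\<close>

lemma \<phi>_integrable:
  fixes g :: "real^2 \<Rightarrow> real"
  assumes k: "k < N" and g: "continuous_on (E k) g" and S: "S \<in> sets lebesgue" "S \<subseteq> E k"
    and z: "\<And>x. x \<in> E k \<Longrightarrow> (\<exists>A. open A \<and> x \<in> A \<and> (\<forall>y\<in>E k \<inter> A. \<phi> k (v k y) = 0)) \<Longrightarrow> g x = 0"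
  shows "g absolutely_integrable_on S"
proof -
  obtain C where C: "compact C" "C \<subseteq> E k" "\<And>p. p \<in> U k \<Longrightarrow> u k p \<notin> C \<Longrightarrow> \<phi> k p = 0"
    using \<phi>_support[OF k] by metis
  show ?thesis
  proof (rule absolutely_integrable_compact_support[where C = C and E = "E k"])
    fix x assume x: "x \<in> E k - C"
    have "\<phi> k (v k y) = 0" if "y \<in> E k \<inter> - C" for y
      using C(3)[OF v_in, of y] u_v[of y k] that by auto
    moreover have "open (- C)" using C(1) by (simp add: compact_imp_closed open_Compl)
    ultimately show "g x = 0" using x by (intro z) auto
  qed (use continuous_on_subset[OF g C(2)] C S in auto)
qed

lemma wedge_continuous:
  assumes k: "k < N" and m: "m < N" and h: "Ck_ext 1 UNIV h" shows "continuous_on (E k) (wedge h a m k)"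
proof -
  have "Ck_ext 1 (E k) (pd i (\<lambda>x. \<phi> m (v k x)))" for i
    using Ck_ext_pd[of 1 "E k"] \<phi>_Ck[OF k m] E_open[OF k] by (simp add: numeral_2_eq_2)
  then show ?thesis unfolding wedge_def
    by (intro continuous_intros Ck_ext_continuous_on[OF angular_Ck[OF h F_Ck[OF k] E_open[OF k]]] Ck_ext_continuous_on[where k = 1])
qed

lemma wedge_zero:
  assumes k: "k < N" and x: "x \<in> E k" and A: "open A" "x \<in> A" "\<And>y. y \<in> E k \<inter> A \<Longrightarrow> \<phi> m (v k y) = 0"
  shows "wedge h a m k x = 0"
proof -
  have o: "half_open (E k \<inter> A)" using E_open[OF k] A(1) by (rule openin_Int_open)
  have "pd i (\<lambda>x. \<phi> m (v k x)) x = pd i (\<lambda>x. 0 :: real) x" for i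
    by (rule pd_cong[OF o]) (use x A in auto)
  then show ?thesis unfolding wedge_def using pd_const[OF E_half_plane[OF k x], of _ "0::real"] by simp
qed

lemma wedge_sum_zero:
  assumes l: "l < N" and x: "x \<in> E l" shows "(\<Sum>m<N. wedge h a m l x) = 0"
proof -
  have "(\<Sum>m<N. pd i (\<lambda>x. \<phi> m (v l x)) x) = 0" for i
  proof -
    have "(\<Sum>m<N. pd i (\<lambda>x. \<phi> m (v l x)) x) = pd i (\<lambda>x. \<Sum>m<N. \<phi> m (v l x)) x"
      by (rule pd_sum[OF E_open[OF l] x, symmetric, where k = 1]) (use \<phi>_Ck[OF l] in \<open>simp add: numeral_2_eq_2\<close>)
    also have "\<dots> = pd i (\<lambda>x. 1 :: real) x"
      by (rule pd_cong[OF E_open[OF l] x]) (use \<phi>_sum v_in U_sub[OF l] in blast)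
    finally show ?thesis using pd_const[OF E_half_plane[OF l x]] by simp
  qed
  then show ?thesis unfolding wedge_def by (simp add: sum_subtractf flip: sum_distrib_right)
qed

text \<open>Cut the integral over chart \<open>k\<close> by a second copy \<open>\<phi> l\<close> of
  the partition of unity and move the piece over the overlap to chart \<open>l\<close>. There the
  sum over \<open>k\<close> is the exterior product with the differential of the constant 1.\<close>

lemma wedge_integral_zero:
  assumes h: "Ck_ext 1 UNIV h"
  shows "(\<Sum>k<N. integral (E k) (wedge h a k k)) = 0"
proof -
  let ?I = "\<lambda>k l. integral (E l) (\<lambda>x. \<phi> l (v l x) * wedge h a k l x)"
  have Eb: "E k \<in> sets lebesgue" if "k < N" for k by (rule half_open_borel[OF E_open[OF that]])
  have c: "continuous_on (E k) (\<lambda>x. \<phi> l (v k x) * wedge h a m k x)" if "k < N" "l < N" "m < N" for k l m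
    using that by (intro continuous_on_mult Ck_ext_continuous_on[OF \<phi>_Ck] wedge_continuous h)
  have int: "(\<lambda>x. \<phi> l (v k x) * wedge h a k k x) absolutely_integrable_on S"
    if "k < N" "l < N" "S \<in> sets lebesgue" "S \<subseteq> E k" for k l S
    by (rule \<phi>_integrable[OF that(1) c[OF that(1,2,1)] that(3,4)]) (use wedge_zero[OF that(1)] in auto)
  have int': "(\<lambda>x. \<phi> l (v l x) * wedge h a m l x) absolutely_integrable_on E l" if "l < N" "m < N" for l m
    by (rule \<phi>_integrable[OF that(1) c[OF that(1,1,2)] Eb[OF that(1)] subset_refl]) auto
  \<comment> \<open>Off the overlap the integrand vanishes on both sides: in chart \<open>k\<close>
    through the factor \<open>\<phi> l\<close>, in chart \<open>l\<close> through the differential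
    of \<open>\<phi> k\<close>.\<close>
  have sw: "integral (E k) (\<lambda>x. \<phi> l (v k x) * wedge h a k k x) = ?I k l" if kl: "k < N" "l < N" for k l
  proof -
    have "integral (E k) (\<lambda>x. \<phi> l (v k x) * wedge h a k k x) = integral (ov k l) (\<lambda>x. \<phi> l (v k x) * wedge h a k k x)"
    proof (rule integral_zero_outside[OF ov_sub])
      fix x assume "x \<in> E k - ov k l"
      then show "\<phi> l (v k x) * wedge h a k k x = 0" using ov_iff[OF kl(1), of x l] \<phi>_outside[OF kl(2)] by simp
    qed
    also have "\<dots> = integral (\<tau> k l ` ov k l) (\<lambda>x. \<phi> l (v l x) * wedge h a k l x)"
    proof (rule chart_change_integral[OF kl subset_refl half_open_borel[OF overlap_open[OF kl]]])
      fix x assume x: "x \<in> ov k l"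
      show "\<phi> l (v k x) * wedge h a k k x = det (matrix (D\<tau> k l x)) * (\<phi> l (v l (\<tau> k l x)) * wedge h a k l (\<tau> k l x))"
        unfolding wedge_change[OF kl x kl(1)] v_\<tau>[OF kl x] by simp
    qed (rule int[OF kl half_open_borel[OF overlap_open[OF kl]] ov_sub])
    also have "\<tau> k l ` ov k l = ov l k"
    proof (intro subset_antisym subsetI)
      fix y assume y: "y \<in> ov l k"
      then have "\<tau> l k y \<in> ov k l" "\<tau> k l (\<tau> l k y) = y"
        using \<tau>_in[OF kl(2)] v_\<tau>[OF kl(2,1)] u_v ov_sub by (blast, metis subsetD)
      then show "y \<in> \<tau> k l ` ov k l" by (metis imageI)
    qed (use \<tau>_in[OF kl(1)] in blast)
    also have "integral (ov l k) (\<lambda>x. \<phi> l (v l x) * wedge h a k l x) = ?I k l"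
    proof (rule integral_zero_outside[OF ov_sub, symmetric])
      fix y assume y: "y \<in> E l - ov l k"
      then have "v l y \<in> U l - U k" using ov_iff[OF kl(2)] v_in by blast
      then obtain A where A: "open A" "u l (v l y) \<in> A" "\<forall>q\<in>U l. u l q \<in> A \<longrightarrow> \<phi> k q = 0"
        using \<phi>_away[OF kl(2,1)] by metis
      have "wedge h a k l y = 0"
      proof (rule wedge_zero[OF kl(2) _ A(1)])
        show "y \<in> E l" "y \<in> A" using y A(2) u_v by auto
        show "\<phi> k (v l z) = 0" if "z \<in> E l \<inter> A" for z using A(3) v_in[of z l] u_v[of z l] that by auto
      qed
      then show "\<phi> l (v l y) * wedge h a k l y = 0" by simp
    qed
    finally show ?thesis .
  qed
  have "integral (E k) (wedge h a k k) = (\<Sum>l<N. ?I k l)" if k: "k < N" for k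
  proof -
    have "integral (E k) (wedge h a k k) = integral (E k) (\<lambda>x. \<Sum>l<N. \<phi> l (v k x) * wedge h a k k x)"
    proof (rule integral_cong)
      fix x assume "x \<in> E k"
      then show "wedge h a k k x = (\<Sum>l<N. \<phi> l (v k x) * wedge h a k k x)"
        using \<phi>_sum[of "v k x"] v_in U_sub[OF k] by (simp add: subset_iff flip: sum_distrib_right)
    qed
    also have "\<dots> = (\<Sum>l<N. integral (E k) (\<lambda>x. \<phi> l (v k x) * wedge h a k k x))"
      by (rule integral_sum) (use int[OF k _ Eb[OF k]] in \<open>auto simp: absolutely_integrable_on_def\<close>)
    finally show ?thesis using sw[OF k] by simp
  qed
  then have "(\<Sum>k<N. integral (E k) (wedge h a k k)) = (\<Sum>l<N. \<Sum>k<N. ?I k l)"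
    using sum.swap[of "\<lambda>k l. ?I k l" "{..<N}" "{..<N}"] by simp
  also have "\<dots> = 0"
  proof (rule sum.neutral, rule ballI)
    fix l assume "l \<in> {..<N}"
    then have l: "l < N" by simp
    have "(\<Sum>k<N. ?I k l) = integral (E l) (\<lambda>x. \<Sum>k<N. \<phi> l (v l x) * wedge h a k l x)"
      by (rule integral_sum[symmetric]) (use int'[OF l] in \<open>auto simp: absolutely_integrable_on_def\<close>)
    also have "\<dots> = integral (E l) (\<lambda>x. 0)"
      by (rule integral_cong) (simp add: wedge_sum_zero[OF l] flip: sum_distrib_left)
    finally show "(\<Sum>k<N. ?I k l) = 0" by simp
  qed
  finally show ?thesis .
qed

end

section \<open>Stokes' theorem and the index of the section\<close>

context flat_line_bundle
begin

text \<open>\<open>\<phi> k\<close> times the angular form has compact support in the chart, so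
  Green's formula in the half plane applies; the product rule splits its exterior derivative into
  the two integrands.\<close>

lemma stokes_chart:
  assumes k: "k < N" and h: "Ck_ext 1 UNIV h"
  shows "integral {x. pt x 0 \<in> E k} (\<lambda>x. \<phi> k (v k (pt x 0)) * angular h (F a k) 1 (pt x 0)) =
     integral (E k) (wedge h a k k) + integral (E k) (\<lambda>x. \<phi> k (v k x) * curl h a k x)"
    and "(\<lambda>x. \<phi> k (v k x) * curl h a k x) absolutely_integrable_on E k"
proof -
  obtain C where C: "compact C" "C \<subseteq> E k" "\<And>p. p \<in> U k \<Longrightarrow> u k p \<notin> C \<Longrightarrow> \<phi> k p = 0"
    using \<phi>_support[OF k] by metis
  have Ek: "half_open (E k)" by (rule E_open[OF k])
  have C0: "\<phi> k (v k x) = 0" if "x \<in> E k - C" for x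
    using C(3)[OF v_in, of x] u_v[of x k] that by auto
  have W: "Ck_ext (Suc 0) (E k) (angular h (F a k) i)" for i
    using angular_Ck[OF h F_Ck[OF k] Ek] by simp
  have P2: "Ck_ext (Suc 1) (E k) (\<lambda>x. \<phi> k (v k x))" using \<phi>_Ck[OF k k] by (simp add: numeral_2_eq_2)
  then have P: "Ck_ext (Suc 0) (E k) (\<lambda>x. \<phi> k (v k x))" using Ck_ext_pred[of 1] by simp
  let ?P = "\<lambda>i x. \<phi> k (v k x) * angular h (F a k) i x"
  have PW: "Ck_ext 1 (E k) (?P i)" for i using Ck_ext_mult[OF P W] by simp
  have "integral (E k) (\<lambda>z. pd 1 (?P 2) z - pd 2 (?P 1) z) = integral {x. pt x 0 \<in> E k} (\<lambda>x. ?P 1 (pt x 0))"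
    by (rule green_half_plane[OF PW PW Ek C(1,2)]) (use C0 in simp)
  moreover have "integral (E k) (\<lambda>z. pd 1 (?P 2) z - pd 2 (?P 1) z) =
      integral (E k) (\<lambda>z. wedge h a k k z + \<phi> k (v k z) * curl h a k z)"
  proof (rule integral_cong)
    fix z assume z: "z \<in> E k"
    show "pd 1 (?P 2) z - pd 2 (?P 1) z = wedge h a k k z + \<phi> k (v k z) * curl h a k z"
      unfolding wedge_def curl_def pd_mult[OF Ek z P W] by (simp add: algebra_simps)
  qed
  moreover have cc: "continuous_on (E k) (curl h a k)"
    unfolding curl_def by (intro continuous_intros Ck_ext_continuous_on[OF Ck_ext_pd[OF W Ek]])
  have i1: "wedge h a k k absolutely_integrable_on E k"
    by (rule \<phi>_integrable[OF k wedge_continuous[OF k k h] half_open_borel[OF Ek] subset_refl])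
      (use wedge_zero[OF k] in blast)
  moreover show i2: "(\<lambda>x. \<phi> k (v k x) * curl h a k x) absolutely_integrable_on E k"
    by (rule \<phi>_integrable[OF k continuous_on_mult[OF Ck_ext_continuous_on[OF P] cc] half_open_borel[OF Ek] subset_refl])
      auto
  ultimately show "integral {x. pt x 0 \<in> E k} (\<lambda>x. \<phi> k (v k (pt x 0)) * angular h (F a k) 1 (pt x 0)) =
     integral (E k) (wedge h a k k) + integral (E k) (\<lambda>x. \<phi> k (v k x) * curl h a k x)"
    using integral_add[of "wedge h a k k" "E k" "\<lambda>x. \<phi> k (v k x) * curl h a k x"]
    by (simp add: absolutely_integrable_on_def)
qed

end

context generic_flat_section
begin

text \<open>In the sum of \<open>stokes_chart\<close> over all charts the terms with
  \<open>wedge\<close> cancel. The curl lives in the holes; each hole is moved to the chart of its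
  zero, where the weights \<open>\<phi> k\<close> add up to 1 and leave the curl integrated over one
  square. By Green's formula and \<open>sides_index\<close> the \<open>cis\<close> of this integral
  is 1.\<close>

lemma index_theorem:
  "\<exists>e h. 0 < e \<and> Ck_ext 1 UNIV h \<and> (\<forall>s\<ge>e. h s = 1 / s) \<and> (\<forall>k<N. \<forall>x\<in>E k. x $ 2 = 0 \<longrightarrow> e \<le> (cmod (F a k x))\<^sup>2) \<and>
    cis (\<Sum>k<N. integral {x. pt x 0 \<in> E k} (\<lambda>x. \<phi> k (v k (pt x 0)) * angular h (F a k) 1 (pt x 0))) = 1"
proof -
  obtain r where r: "0 < r"
    "\<And>z. z \<in> zeros a \<Longrightarrow> sq r z \<subseteq> E (ch z)"
    "\<And>z x. z \<in> zeros a \<Longrightarrow> x \<in> sq r z \<Longrightarrow> 0 < x $ 2"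
    "\<And>z z' p. z \<in> zeros a \<Longrightarrow> z' \<in> zeros a \<Longrightarrow> z \<noteq> z' \<Longrightarrow> p \<in> U (ch z) \<inter> U (ch z') \<Longrightarrow>
      u (ch z) p \<in> sq r z \<Longrightarrow> u (ch z') p \<in> sq r z' \<Longrightarrow> False"
    using squares_exist by metis
  obtain \<delta> where \<delta>: "0 < \<delta>" "\<And>k x. k < N \<Longrightarrow> x \<in> E k \<Longrightarrow> (\<forall>z\<in>zeros a. x \<notin> hole r k z) \<Longrightarrow> \<delta> \<le> cmod (F a k x)"
    using bounded_below_off_holes[OF r(1)] by metis
  \<comment> \<open>Half of \<open>\<delta>\<^sup>2\<close>, for the strict inequality that
    \<open>angular_closed\<close> asks for.\<close>
  define e where "e = \<delta>\<^sup>2 / 2"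
  have e: "0 < e" using \<delta>(1) by (simp add: e_def)
  obtain h where h: "Ck_ext 1 UNIV h" "\<And>s. e \<le> s \<Longrightarrow> h s = 1 / s"
    using reciprocal_cutoff[OF e] by metis
  have big: "e < (cmod (F a k x))\<^sup>2" if "k < N" "x \<in> E k" "\<forall>z\<in>zeros a. x \<notin> hole r k z" for k x
  proof -
    have "\<delta>\<^sup>2 \<le> (cmod (F a k x))\<^sup>2" using \<delta>(2)[OF that] \<delta>(1) by (intro power_mono) auto
    moreover have "e < \<delta>\<^sup>2" using \<delta>(1) by (simp add: e_def)
    ultimately show ?thesis by linarith
  qed
  have curl0: "curl h a k x = 0" if "k < N" "x \<in> E k" "\<forall>z\<in>zeros a. x \<notin> hole r k z" for k x
    unfolding curl_def by (rule angular_closed[OF h e big[OF that] F_Ck[OF that(1)] E_open[OF that(1)] that(2)])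
  \<comment> \<open>The frontier of a square lies in no hole: not in its own, which comes from the
    open square, and not in another one, because the closed squares are disjoint.\<close>
  have sq_frontier: "\<forall>z'\<in>zeros a. x \<notin> hole r (ch z) z'" if z: "z \<in> zeros a" and x: "x \<in> sq r z - isq r z" for z x
  proof
    fix z' assume z': "z' \<in> zeros a"
    have xE: "x \<in> E (ch z)" using r(2)[OF z] x by blast
    show "x \<notin> hole r (ch z) z'"
    proof
      assume "x \<in> hole r (ch z) z'"
      then have i: "v (ch z) x \<in> U (ch z')" "u (ch z') (v (ch z) x) \<in> isq r z'"
        using ov_iff[of "ch z" x] ch[OF z] by (auto simp: hole_def)
      show False
      proof (cases "z' = z")
        case True
        then show False using i u_v[OF xE] x by auto
      next
        case False
        then show False using r(4)[OF z z' _, of "v (ch z) x"] i v_in[OF xE] u_v[OF xE] x isq_sub_sq by auto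
      qed
    qed
  qed
  have N: "ch z < N" if "z \<in> zeros a" for z using ch[OF that] by simp
  have sqi: "cis (integral (isq r z) (curl h a (ch z))) = 1" if z: "z \<in> zeros a" for z
  proof -
    let ?F = "F a (ch z)" and ?c = "u (ch z) z"
    have W: "Ck_ext 1 (E (ch z)) (angular h ?F i)" for i
      by (rule angular_Ck[OF h(1) F_Ck[OF N[OF z]] E_open[OF N[OF z]]])
    have "integral (isq r z) (curl h a (ch z)) = integral (sq r z) (curl h a (ch z))"
      by (rule integral_zero_outside[OF isq_sub_sq, symmetric])
        (use curl0[OF N[OF z]] sq_frontier[OF z] r(2)[OF z] in blast)
    also have "\<dots> = integral {?c $ 2 - r..?c $ 2 + r} (\<lambda>y. angular h ?F 2 (pt (?c $ 1 + r) y) - angular h ?F 2 (pt (?c $ 1 - r) y))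
      - integral {?c $ 1 - r..?c $ 1 + r} (\<lambda>x. angular h ?F 1 (pt x (?c $ 2 + r)) - angular h ?F 1 (pt x (?c $ 2 - r)))"
      unfolding sq_def Let_def curl_def
      by (rule green_rectangle[OF W W E_open[OF N[OF z]]]) (use r(2)[OF z] r(1) in \<open>auto simp: sq_def Let_def\<close>)
    also have "cis \<dots> = 1"
    proof (rule sides_index[OF F_Ck[OF N[OF z]] E_open[OF N[OF z]] _ _ _ _ e h])
      show "cbox (pt (?c $ 1 - r) (?c $ 2 - r)) (pt (?c $ 1 + r) (?c $ 2 + r)) \<subseteq> E (ch z)"
        using r(2)[OF z] by (simp add: sq_def Let_def)
      show "e \<le> (cmod (?F x))\<^sup>2" if "x \<in> cbox (pt (?c $ 1 - r) (?c $ 2 - r)) (pt (?c $ 1 + r) (?c $ 2 + r))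
          - box (pt (?c $ 1 - r) (?c $ 2 - r)) (pt (?c $ 1 + r) (?c $ 2 + r))" for x
      proof -
        have x: "x \<in> sq r z - isq r z" using that by (simp add: sq_def isq_def Let_def)
        then have "x \<in> E (ch z)" using r(2)[OF z] by blast
        from big[OF N[OF z] this sq_frontier[OF z x]] show ?thesis by simp
      qed
    qed (use r(1) in auto)
    finally show ?thesis .
  qed
  have hole_ov: "hole r k z \<subseteq> ov k (ch z)" for k z by (auto simp: hole_def)
  have hb: "hole r k z \<in> sets lebesgue" if "k < N" "z \<in> zeros a" for k z
    by (rule half_open_borel[OF hole_open[OF that]])
  have disj: "z = z'" if "k < N" "z \<in> zeros a" "z' \<in> zeros a" "x \<in> hole r k z" "x \<in> hole r k z'" for k x z z'
  proof (rule ccontr)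
    assume "z \<noteq> z'"
    then show False
      using r(4)[OF that(2,3), of "v k x"] that(4,5) ov_iff[OF that(1)] isq_sub_sq unfolding hole_def by blast
  qed
  let ?g = "\<lambda>k x. \<phi> k (v k x) * curl h a k x"
  \<comment> \<open>The hole in chart \<open>k\<close> is only the part of the square that lies in
    \<open>U k\<close>; on the rest of the square \<open>\<phi> k\<close> vanishes.\<close>
  have hole_int: "integral (hole r k z) (?g k) = integral (isq r z) (\<lambda>y. \<phi> k (v (ch z) y) * curl h a (ch z) y)"
    if k: "k < N" and z: "z \<in> zeros a" for k z
  proof -
    have "?g k absolutely_integrable_on hole r k z"
      by (rule set_integrable_subset[OF stokes_chart(2)[OF k h(1)] hb[OF k z]]) (use hole_ov ov_sub in blast)
    then have "integral (hole r k z) (?g k) =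
        integral (\<tau> k (ch z) ` hole r k z) (\<lambda>y. \<phi> k (v (ch z) y) * curl h a (ch z) y)"
    proof (rule chart_change_integral[OF k N[OF z] hole_ov hb[OF k z], rotated])
      fix x assume "x \<in> hole r k z"
      then have x: "x \<in> ov k (ch z)" using hole_ov by blast
      show "?g k x = det (matrix (D\<tau> k (ch z) x)) *
          (\<phi> k (v (ch z) (\<tau> k (ch z) x)) * curl h a (ch z) (\<tau> k (ch z) x))"
        unfolding curl_change[OF k N[OF z] x h(1)] v_\<tau>[OF k N[OF z] x] by simp
    qed
    also have "\<dots> = integral (isq r z) (\<lambda>y. \<phi> k (v (ch z) y) * curl h a (ch z) y)"
    proof (rule integral_zero_outside[symmetric])
      show "\<tau> k (ch z) ` hole r k z \<subseteq> isq r z" by (auto simp: hole_def)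
      fix y assume y: "y \<in> isq r z - \<tau> k (ch z) ` hole r k z"
      have yE: "y \<in> E (ch z)" using y isq_sub_sq r(2)[OF z] by blast
      have "v (ch z) y \<notin> U k"
      proof
        assume "v (ch z) y \<in> U k"
        then have yo: "y \<in> ov (ch z) k" using ov_iff[OF N[OF z]] yE by blast
        let ?x = "\<tau> (ch z) k y"
        have x: "?x \<in> ov k (ch z)" "\<tau> k (ch z) ?x = y"
          using \<tau>_in[OF N[OF z] yo] v_\<tau>[OF N[OF z] k yo] u_v[OF yE] by auto
        then have "?x \<in> hole r k z" using y by (simp add: hole_def)
        then show False using x(2) y by (metis DiffD2 imageI)
      qed
      then show "\<phi> k (v (ch z) y) * curl h a (ch z) y = 0" using \<phi>_outside[OF k] by simp
    qed
    finally show ?thesis .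
  qed
  have chart: "integral (E k) (?g k) = (\<Sum>z\<in>zeros a. integral (isq r z) (\<lambda>y. \<phi> k (v (ch z) y) * curl h a (ch z) y))"
    if k: "k < N" for k
  proof -
    have hE: "hole r k z \<subseteq> E k" for z using hole_ov ov_sub by blast
    \<comment> \<open>At each point at most one summand survives, by \<open>disj\<close>; off the
      holes the curl is 0.\<close>
    have "integral (E k) (?g k) = integral (E k) (\<lambda>x. \<Sum>z\<in>zeros a. if x \<in> hole r k z then ?g k x else 0)"
    proof (rule integral_cong)
      fix x assume x: "x \<in> E k"
      show "?g k x = (\<Sum>z\<in>zeros a. if x \<in> hole r k z then ?g k x else 0)"
      proof (cases "\<exists>z\<in>zeros a. x \<in> hole r k z")
        case True
        then obtain z where z: "z \<in> zeros a" "x \<in> hole r k z" by blast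
        have "(\<Sum>z'\<in>zeros a. if x \<in> hole r k z' then ?g k x else 0) = (\<Sum>z'\<in>zeros a. if z' = z then ?g k x else 0)"
          using disj[OF k] z by (intro sum.cong) auto
        then show ?thesis using z(1) finite_zeros by simp
      next
        case False
        then show ?thesis using curl0[OF k x] by simp
      qed
    qed
    also have "\<dots> = (\<Sum>z\<in>zeros a. integral (E k) (\<lambda>x. if x \<in> hole r k z then ?g k x else 0))"
    proof (rule integral_sum[OF finite_zeros])
      fix z assume z: "z \<in> zeros a"
      have "?g k absolutely_integrable_on hole r k z"
        by (rule set_integrable_subset[OF stokes_chart(2)[OF k h(1)] hb[OF k z] hE])
      then show "(\<lambda>x. if x \<in> hole r k z then ?g k x else 0) integrable_on E k"
        using integrable_restrict_Int[of "hole r k z" "?g k" "E k"] hE[of z]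
        by (simp add: absolutely_integrable_on_def Int_absorb2)
    qed
    also have "\<dots> = (\<Sum>z\<in>zeros a. integral (hole r k z) (?g k))"
      using hE by (intro sum.cong refl) (simp add: integral_restrict_Int Int_absorb1 Int_absorb2)
    also have "\<dots> = (\<Sum>z\<in>zeros a. integral (isq r z) (\<lambda>y. \<phi> k (v (ch z) y) * curl h a (ch z) y))"
      using hole_int[OF k] by (intro sum.cong refl) simp
    finally show ?thesis .
  qed
  have "(\<Sum>k<N. integral (E k) (?g k)) =
      (\<Sum>z\<in>zeros a. \<Sum>k<N. integral (isq r z) (\<lambda>y. \<phi> k (v (ch z) y) * curl h a (ch z) y))"
    using chart by (subst sum.swap) simp
  also have "\<dots> = (\<Sum>z\<in>zeros a. integral (isq r z) (curl h a (ch z)))"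
  proof (rule sum.cong[OF refl])
    fix z assume z: "z \<in> zeros a"
    have W: "Ck_ext (Suc 0) (E (ch z)) (angular h (F a (ch z)) i)" for i
      using angular_Ck[OF h(1) F_Ck[OF N[OF z]] E_open[OF N[OF z]]] by simp
    have cc: "continuous_on (E (ch z)) (curl h a (ch z))"
      unfolding curl_def by (intro continuous_intros Ck_ext_continuous_on[OF Ck_ext_pd[OF W E_open[OF N[OF z]]]])
    have "(\<lambda>y. \<phi> k (v (ch z) y) * curl h a (ch z) y) integrable_on isq r z" if k: "k < N" for k
    proof -
      have "continuous_on (E (ch z)) (\<lambda>y. \<phi> k (v (ch z) y) * curl h a (ch z) y)"
        by (intro continuous_on_mult Ck_ext_continuous_on[OF \<phi>_Ck[OF N[OF z] k]] cc)
      then have "continuous_on (sq r z) (\<lambda>y. \<phi> k (v (ch z) y) * curl h a (ch z) y)"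
        by (rule continuous_on_subset) (rule r(2)[OF z])
      then have "(\<lambda>y. \<phi> k (v (ch z) y) * curl h a (ch z) y) absolutely_integrable_on isq r z"
        by (rule absolutely_integrable_compact_support[where E = "sq r z"])
          (use isq_sub_sq in \<open>auto simp: sq_def isq_def Let_def\<close>)
      then show ?thesis by (simp add: absolutely_integrable_on_def)
    qed
    then have "(\<Sum>k<N. integral (isq r z) (\<lambda>y. \<phi> k (v (ch z) y) * curl h a (ch z) y))
        = integral (isq r z) (\<lambda>y. \<Sum>k<N. \<phi> k (v (ch z) y) * curl h a (ch z) y)"
      by (intro integral_sum[symmetric]) auto
    also have "\<dots> = integral (isq r z) (curl h a (ch z))"
    proof (rule integral_cong)
      fix y assume "y \<in> isq r z"
      then have "v (ch z) y \<in> P" using isq_sub_sq r(2)[OF z] v_in U_sub[OF N[OF z]] by blast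
      then show "(\<Sum>k<N. \<phi> k (v (ch z) y) * curl h a (ch z) y) = curl h a (ch z) y"
        using \<phi>_sum by (simp flip: sum_distrib_right)
    qed
    finally show "(\<Sum>k<N. integral (isq r z) (\<lambda>y. \<phi> k (v (ch z) y) * curl h a (ch z) y)) = integral (isq r z) (curl h a (ch z))" .
  qed
  finally have tot: "(\<Sum>k<N. integral (E k) (?g k)) = (\<Sum>z\<in>zeros a. integral (isq r z) (curl h a (ch z)))" .
  have "(\<Sum>k<N. integral {x. pt x 0 \<in> E k} (\<lambda>x. \<phi> k (v k (pt x 0)) * angular h (F a k) 1 (pt x 0)))
      = (\<Sum>k<N. integral (E k) (wedge h a k k) + integral (E k) (?g k))"
    by (rule sum.cong[OF refl]) (simp add: stokes_chart(1)[OF _ h(1)])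
  also have "\<dots> = (\<Sum>z\<in>zeros a. integral (isq r z) (curl h a (ch z)))"
    using wedge_integral_zero[OF h(1)] tot by (simp add: sum.distrib)
  finally have "cis (\<Sum>k<N. integral {x. pt x 0 \<in> E k} (\<lambda>x. \<phi> k (v k (pt x 0)) * angular h (F a k) 1 (pt x 0))) = 1"
    using sqi by (simp add: cis_sum[OF finite_zeros])
  \<comment> \<open>The squares stay off the boundary, so boundary points lie in no hole.\<close>
  moreover have "e \<le> (cmod (F a k x))\<^sup>2" if k: "k < N" and x: "x \<in> E k" "x $ 2 = 0" for k x
  proof -
    have "\<forall>z\<in>zeros a. x \<notin> hole r k z"
    proof (intro ballI notI)
      fix z assume z: "z \<in> zeros a" and "x \<in> hole r k z"
      then have "v k x \<in> U k \<inter> U (ch z)" "0 < u (ch z) (v k x) $ 2"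
        using ov_iff[OF k] v_in[OF x(1)] r(3)[OF z subsetD[OF isq_sub_sq]] by (auto simp: hole_def)
      then show False using boundary_invariant[OF k N[OF z], of "v k x"] u_v[OF x(1)] x(2) by simp
    qed
    from big[OF k x(1) this] show ?thesis by simp
  qed
  ultimately show ?thesis using e h by (intro exI[of _ e] exI[of _ h]) simp
qed

end

lemma (in flat_line_bundle) boundary_index:
  "\<exists>a e h. 0 < e \<and> Ck_ext 1 UNIV h \<and> (\<forall>s\<ge>e. h s = 1 / s) \<and> (\<forall>k<N. \<forall>x\<in>E k. x $ 2 = 0 \<longrightarrow> e \<le> (cmod (F a k x))\<^sup>2) \<and>
    cis (\<Sum>k<N. integral {x. pt x 0 \<in> E k} (\<lambda>x. \<phi> k (v k (pt x 0)) * angular h (F a k) 1 (pt x 0))) = 1"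
proof -
  obtain a where "\<forall>k<N. \<forall>x\<in>E k. good a k x" using generic_section by blast
  then interpret generic_flat_section N P U u \<phi> \<epsilon> a by unfold_locales blast
  show ?thesis using index_theorem by blast
qed

section \<open>Holonomy along the boundary\<close>

text \<open>The curve \<open>b j\<close> runs once around a boundary circle while the parameter runs
  through \<open>{0..<1}\<close>, with or against the boundary orientation according to
  \<open>s j\<close>. Along it, multiplication by \<open>\<eta> j k t\<close> turns coordinates in
  frame \<open>k\<close> into coordinates in a parallel frame; one turn multiplies these by
  \<open>c j\<close>.\<close>

locale flat_line_bundle_boundary = flat_line_bundle N P U u \<phi> \<epsilon>
  for N and P :: "'p set" and U u \<phi> \<epsilon> +
  fixes J :: "'j set" and s :: "'j \<Rightarrow> real" and b :: "'j \<Rightarrow> real \<Rightarrow> 'p"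
    and \<eta> :: "'j \<Rightarrow> nat \<Rightarrow> real \<Rightarrow> complex" and c :: "'j \<Rightarrow> complex"
  assumes J_finite: "finite J" and sign: "\<And>j. j \<in> J \<Longrightarrow> s j = 1 \<or> s j = -1"
    and b_bij: "bij_betw (\<lambda>(j, t). b j t) (J \<times> {0..<1}) {p \<in> P. \<exists>k<N. p \<in> U k \<and> u k p $ 2 = 0}"
    and b_in: "\<And>j t. j \<in> J \<Longrightarrow> b j t \<in> P"
    and b_flat: "\<And>j k t. j \<in> J \<Longrightarrow> k < N \<Longrightarrow> b j t \<in> U k \<Longrightarrow> u k (b j t) $ 2 = 0"
    and b_closed: "\<And>j. j \<in> J \<Longrightarrow> b j 1 = b j 0"
    and b_open: "\<And>j k. j \<in> J \<Longrightarrow> k < N \<Longrightarrow> open {t. b j t \<in> U k}"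
    and b_derivative: "\<And>j k t. j \<in> J \<Longrightarrow> k < N \<Longrightarrow> b j t \<in> U k \<Longrightarrow>
      \<exists>d. ((\<lambda>t. u k (b j t)) has_vector_derivative d) (at t) \<and> 0 < s j * d $ 1"
    and b_C1: "\<And>j k. j \<in> J \<Longrightarrow> k < N \<Longrightarrow>
      continuous_on {t. b j t \<in> U k} (\<lambda>t. vector_derivative (\<lambda>t. u k (b j t)) (at t))"
    and \<eta>_norm: "\<And>j k t. j \<in> J \<Longrightarrow> k < N \<Longrightarrow> b j t \<in> U k \<Longrightarrow> cmod (\<eta> j k t) = 1"
    and \<eta>_change: "\<And>j k l t. j \<in> J \<Longrightarrow> k < N \<Longrightarrow> l < N \<Longrightarrow> b j t \<in> U k \<inter> U l \<Longrightarrow>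
      \<eta> j k t * \<epsilon> k l (b j t) = \<eta> j l t"
    and \<eta>_locally_const: "\<And>j k t. j \<in> J \<Longrightarrow> k < N \<Longrightarrow> b j t \<in> U k \<Longrightarrow>
      \<exists>A. open A \<and> t \<in> A \<and> (\<forall>t'\<in>A. b j t' \<in> U k \<and> \<eta> j k t' = \<eta> j k t)"
    and \<eta>_monodromy: "\<And>j k. j \<in> J \<Longrightarrow> k < N \<Longrightarrow> b j 0 \<in> U k \<Longrightarrow> \<eta> j k 1 = c j * \<eta> j k 0"
begin

abbreviation "w j k \<equiv> (\<lambda>t. u k (b j t))"
abbreviation "dw j k t \<equiv> vector_derivative (w j k) (at t)"

lemma chart_at: assumes "j \<in> J" obtains k where "k < N" "b j t \<in> U k"
  using P_covered[OF b_in[OF assms]] by blast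

lemma b_injective:
  "j \<in> J \<Longrightarrow> j' \<in> J \<Longrightarrow> t \<in> {0..<1} \<Longrightarrow> t' \<in> {0..<1} \<Longrightarrow> b j t = b j' t' \<Longrightarrow> j = j' \<and> t = t'"
  using inj_onD[OF bij_betw_imp_inj_on[OF b_bij], of "(j, t)" "(j', t')"] by simp

lemma w_derivative:
  assumes j: "j \<in> J" and k: "k < N" "b j t \<in> U k"
  shows "(w j k has_vector_derivative dw j k t) (at t)" "0 < s j * dw j k t $ 1" "dw j k t $ 2 = 0"
proof -
  obtain d where d: "(w j k has_vector_derivative d) (at t)" "0 < s j * d $ 1" using b_derivative[OF assms] by blast
  have dw: "dw j k t = d" by (rule vector_derivative_at[OF d(1)])
  show "(w j k has_vector_derivative dw j k t) (at t)" "0 < s j * dw j k t $ 1" using d dw by simp_all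
  have 1: "((\<lambda>t. w j k t $ 2) has_vector_derivative d $ 2) (at t)"
    by (rule bounded_linear.has_vector_derivative[OF bounded_linear_vec_nth d(1)])
  have "((\<lambda>t. 0) has_vector_derivative d $ 2) (at t)"
    by (rule has_vector_derivative_transform_within_open[OF 1 b_open[OF j k(1)]]) (use k(2) b_flat[OF j k(1)] in auto)
  moreover have "((\<lambda>t. 0 :: real) has_vector_derivative 0) (at t)" by simp
  ultimately show "dw j k t $ 2 = 0" unfolding dw by (rule vector_derivative_unique_at)
qed

lemma w_continuous: "j \<in> J \<Longrightarrow> k < N \<Longrightarrow> continuous_on {t. b j t \<in> U k} (w j k)"
  by (rule continuous_at_imp_continuous_on) (use has_vector_derivative_continuous w_derivative(1) in blast)

lemma w_pt: "j \<in> J \<Longrightarrow> k < N \<Longrightarrow> b j t \<in> U k \<Longrightarrow> pt (w j k t $ 1) 0 = w j k t"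
  using b_flat[of j k t] by (simp add: vec_eq_iff forall_2)

lemma \<phi>_b_continuous: assumes j: "j \<in> J" and l: "l < N" shows "continuous_on UNIV (\<lambda>t. \<phi> l (b j t))"
proof (rule continuous_at_imp_continuous_on, rule ballI)
  fix t
  obtain k where k: "k < N" "b j t \<in> U k" using chart_at[OF j] by blast
  have "continuous_on {t. b j t \<in> U k} (\<lambda>t. \<phi> l (v k (w j k t)))"
    by (rule continuous_on_compose2[OF Ck_ext_continuous_on[OF \<phi>_Ck[OF k(1) l]] w_continuous[OF j k(1)]]) auto
  then have "continuous_on {t. b j t \<in> U k} (\<lambda>t. \<phi> l (b j t))"
    by (rule continuous_on_eq) (use v_u[OF k(1)] in simp)
  then show "isCont (\<lambda>t. \<phi> l (b j t)) t"
    using b_open[OF j k(1)] k(2) by (simp add: continuous_on_eq_continuous_at)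
qed

text \<open>The section along \<open>b j\<close> in the parallel frame. In contrast to its
  coordinates in the charts it is one function on the whole line, and its monodromy
  \<open>c j\<close> is visible in \<open>lift_closed\<close>.\<close>

definition lift :: "(nat \<Rightarrow> complex) \<Rightarrow> 'j \<Rightarrow> real \<Rightarrow> complex" where
  "lift a j t = (\<Sum>l<N. \<phi> l (b j t) *\<^sub>R (a l * \<eta> j l t))"

lemma lift_eq:
  assumes j: "j \<in> J" and k: "k < N" "b j t \<in> U k"
  shows "lift a j t = \<eta> j k t * F a k (w j k t)"
  unfolding lift_def v_u[OF k] sec_def sum_distrib_left
proof (rule sum.cong)
  fix m assume "m \<in> {..<N}"
  then show "\<phi> m (b j t) *\<^sub>R (a m * \<eta> j m t) = \<eta> j k t * (\<phi> m (b j t) *\<^sub>R (a m * \<epsilon> k m (b j t)))"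
    using \<eta>_change[OF j k(1), of m t] \<phi>_outside[of m "b j t"] k(2)
    by (cases "b j t \<in> U m") (auto simp: algebra_simps)
qed simp

definition lift' :: "(nat \<Rightarrow> complex) \<Rightarrow> 'j \<Rightarrow> real \<Rightarrow> complex" where
  "lift' a j t = vector_derivative (lift a j) (at t)"

lemma lift_derivative:
  assumes j: "j \<in> J" and k: "k < N" "b j t \<in> U k"
  shows "(lift a j has_vector_derivative \<eta> j k t * (dw j k t $ 1 *\<^sub>R pd 1 (F a k) (w j k t))) (at t)"
proof -
  obtain A where A: "open A" "t \<in> A" "\<forall>t'\<in>A. b j t' \<in> U k \<and> \<eta> j k t' = \<eta> j k t"
    using \<eta>_locally_const[OF j k] by blast
  have F1: "Ck_ext (Suc 1) (E k) (F a k)" using F_Ck[OF k(1)] by (simp add: numeral_2_eq_2)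
  have D: "(F a k has_derivative (\<lambda>v. (v $ 1) *\<^sub>R pd 1 (F a k) x + (v $ 2) *\<^sub>R pd 2 (F a k) x)) (at x within E k)" if "x \<in> E k" for x
    using has_derivative_pd[OF F1 E_open[OF k(1)] that] at_within_half_open[OF E_open[OF k(1)] that] by simp
  have "(w j k has_derivative (\<lambda>h. h *\<^sub>R dw j k t)) (at t within A)"
    using has_derivative_at_withinI[OF w_derivative(1)[OF j k, unfolded has_vector_derivative_def]] .
  from has_derivative_in_compose2[OF D _ A(2) this]
  have "((\<lambda>t. F a k (w j k t)) has_derivative (\<lambda>h. (h * dw j k t $ 1) *\<^sub>R pd 1 (F a k) (w j k t))) (at t within A)"
    using A(3) w_derivative(3)[OF j k] by (simp add: image_subset_iff)
  then have "((\<lambda>t. F a k (w j k t)) has_vector_derivative (dw j k t $ 1 *\<^sub>R pd 1 (F a k) (w j k t))) (at t)"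
    unfolding has_vector_derivative_def at_within_open[OF A(2,1)] by simp
  then have "((\<lambda>t'. \<eta> j k t * F a k (w j k t')) has_vector_derivative \<eta> j k t * (dw j k t $ 1 *\<^sub>R pd 1 (F a k) (w j k t))) (at t)"
    by (rule has_vector_derivative_mult_right)
  then show ?thesis
    by (rule has_vector_derivative_transform_within_open[OF _ A(1,2)]) (use A(3) lift_eq[OF j k(1)] in auto)
qed

lemma lift'_eq:
  "j \<in> J \<Longrightarrow> k < N \<Longrightarrow> b j t \<in> U k \<Longrightarrow> lift' a j t = \<eta> j k t * (dw j k t $ 1 *\<^sub>R pd 1 (F a k) (w j k t))"
  unfolding lift'_def by (rule vector_derivative_at[OF lift_derivative])

lemma lift_has_derivative: assumes j: "j \<in> J" shows "(lift a j has_vector_derivative lift' a j t) (at t)"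
proof -
  obtain k where k: "k < N" "b j t \<in> U k" using chart_at[OF j] by blast
  show ?thesis using lift_derivative[OF j k] lift'_eq[OF j k] by simp
qed

lemma lift'_continuous: assumes j: "j \<in> J" shows "continuous_on UNIV (lift' a j)"
proof (rule continuous_at_imp_continuous_on, rule ballI)
  fix t
  obtain k where k: "k < N" "b j t \<in> U k" using chart_at[OF j] by blast
  obtain A where A: "open A" "t \<in> A" "\<forall>t'\<in>A. b j t' \<in> U k \<and> \<eta> j k t' = \<eta> j k t"
    using \<eta>_locally_const[OF j k] by blast
  have sub: "A \<subseteq> {t. b j t \<in> U k}" using A(3) by blast
  have F1: "Ck_ext (Suc 1) (E k) (F a k)" using F_Ck[OF k(1)] by (simp add: numeral_2_eq_2)
  have "continuous_on A (\<lambda>t. pd 1 (F a k) (w j k t))"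
    by (rule continuous_on_compose2[OF Ck_ext_continuous_on[OF Ck_ext_pd[OF F1 E_open[OF k(1)]]]
      continuous_on_subset[OF w_continuous[OF j k(1)] sub]]) (use sub in auto)
  then have "continuous_on A (\<lambda>t'. \<eta> j k t * (dw j k t' $ 1 *\<^sub>R pd 1 (F a k) (w j k t')))"
    by (intro continuous_intros continuous_on_subset[OF b_C1[OF j k(1)] sub])
  then have "continuous_on A (lift' a j)"
    by (rule continuous_on_eq) (use A(3) lift'_eq[OF j k(1)] in auto)
  then show "isCont (lift' a j) t" using A by (simp add: continuous_on_eq_continuous_at)
qed

lemma c_norm: assumes j: "j \<in> J" shows "cmod (c j) = 1"
proof -
  obtain k where k: "k < N" "b j 0 \<in> U k" using chart_at[OF j] by blast
  then show ?thesis
    using \<eta>_monodromy[OF j k] \<eta>_norm[OF j k] \<eta>_norm[OF j k(1), of 1] b_closed[OF j] by (simp add: norm_mult)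
qed

lemma lift_closed: assumes j: "j \<in> J" shows "lift a j 1 = c j * lift a j 0"
proof -
  obtain k where k: "k < N" "b j 0 \<in> U k" using chart_at[OF j] by blast
  show ?thesis
    using lift_eq[OF j k] lift_eq[OF j k(1), of 1] \<eta>_monodromy[OF j k] b_closed[OF j] k by simp
qed

text \<open>The boundary integral of \<open>boundary_index\<close> is the sum over \<open>j\<close>
  of \<open>s j\<close> times the change of the argument of \<open>lift a j\<close> over one period,
  and \<open>cis\<close> of that change is \<open>c j\<close>.\<close>

theorem boundary_holonomy: "(\<Prod>j\<in>J. if s j = 1 then c j else inverse (c j)) = 1"
proof -
  from boundary_index obtain a e h where e: "0 < e" and h: "Ck_ext 1 UNIV h" "\<forall>s\<ge>e. h s = 1 / s"
    and big': "\<forall>k<N. \<forall>x\<in>E k. x $ 2 = 0 \<longrightarrow> e \<le> (cmod (F a k x))\<^sup>2"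
    and cis1: "cis (\<Sum>k<N. integral {x. pt x 0 \<in> E k} (\<lambda>x. \<phi> k (v k (pt x 0)) * angular h (F a k) 1 (pt x 0))) = 1"
    by (elim exE conjE) (rule that)
  note big = big'[rule_format] and h = h(1) h(2)[rule_format]
  \<comment> \<open>The derivative of the argument of the lift.\<close>
  define \<Theta> where "\<Theta> j t = Im (lift' a j t / lift a j t)" for j t
  have wE: "w j k t \<in> E k" if "b j t \<in> U k" for j k t using that by blast
  have lnz: "lift a j t \<noteq> 0" if j: "j \<in> J" for j t
  proof -
    obtain k where k: "k < N" "b j t \<in> U k" using chart_at[OF j] by blast
    have "F a k (w j k t) \<noteq> 0" using big[OF k(1) wE[OF k(2)] b_flat[OF j k]] e by auto
    moreover have "\<eta> j k t \<noteq> 0" using \<eta>_norm[OF j k] by auto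
    ultimately show ?thesis using lift_eq[OF j k] by simp
  qed
  \<comment> \<open>The locally constant factor \<open>\<eta> j k t\<close> cancels in the quotient,
    so this is the angular form pulled back along the curve.\<close>
  have \<Theta>_chart: "\<Theta> j t = dw j k t $ 1 * angular h (F a k) 1 (w j k t)" if j: "j \<in> J" and k: "k < N" "b j t \<in> U k" for j k t
  proof -
    let ?F = "F a k (w j k t)" and ?F' = "pd 1 (F a k) (w j k t)"
    have b: "e \<le> (cmod ?F)\<^sup>2" by (rule big[OF k(1) wE[OF k(2)] b_flat[OF j k]])
    have "\<eta> j k t \<noteq> 0" using \<eta>_norm[OF j k] by auto
    then have "lift' a j t / lift a j t = dw j k t $ 1 *\<^sub>R (?F' / ?F)"
      unfolding lift_eq[OF j k] lift'_eq[OF j k] by (simp add: scaleR_conv_of_real)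
    moreover have "?F' / ?F = (?F' * cnj ?F) / of_real ((cmod ?F)\<^sup>2)"
      using complex_div_cnj[of ?F' ?F] by simp
    then have "Im (?F' / ?F) = Im (cnj ?F * ?F') / (cmod ?F)\<^sup>2"
      by (simp only: Im_divide_of_real mult.commute)
    ultimately show ?thesis using h(2)[OF b] unfolding \<Theta>_def angular_def by simp
  qed
  have c\<Theta>: "continuous_on UNIV (\<Theta> j)" if j: "j \<in> J" for j
  proof -
    have "continuous_on UNIV (lift a j)"
      using lift_has_derivative[OF j] by (intro continuous_at_imp_continuous_on) (blast intro: has_vector_derivative_continuous)
    then show ?thesis unfolding \<Theta>_def using lift'_continuous[OF j] lnz[OF j] by (intro continuous_intros) auto
  qed
  have hol: "cis (integral {0..1} (\<Theta> j)) = c j" if j: "j \<in> J" for j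
  proof -
    have "cis (integral {0..1} (\<Theta> j)) * sgn (lift a j 0) = sgn (lift a j 1)"
      unfolding \<Theta>_def
    proof (rule cis_integral_log_derivative)
      show "(lift a j has_vector_derivative lift' a j t) (at t within {0..1})" for t
        by (rule has_vector_derivative_at_within[OF lift_has_derivative[OF j]])
    qed (use lnz[OF j] continuous_on_subset[OF lift'_continuous[OF j]] in auto)
    also have "\<dots> = c j * sgn (lift a j 0)"
      unfolding lift_closed[OF j] sgn_mult using c_norm[OF j] by (simp add: sgn_eq)
    finally show ?thesis using lnz[OF j] by (simp add: sgn_zero_iff)
  qed
  define T where "T j k = {t \<in> {0..<1}. b j t \<in> U k}" for j k
  let ?g = "\<lambda>k x. \<phi> k (v k (pt x 0)) * angular h (F a k) 1 (pt x 0)"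
  let ?r = "\<lambda>j k t. w j k t $ 1"
  have Tb: "T j k \<in> sets lebesgue" if "j \<in> J" "k < N" for j k
  proof -
    have "T j k = {0..<1} \<inter> {t. b j t \<in> U k}" by (auto simp: T_def)
    then show ?thesis using b_open[OF that] by auto
  qed
  have ci: "(\<lambda>t. \<phi> k (b j t) * \<Theta> j t) absolutely_integrable_on {0..1}" if "j \<in> J" "k < N" for j k
    by (intro absolutely_integrable_continuous_real continuous_on_subset[OF continuous_on_mult[OF \<phi>_b_continuous[OF that] c\<Theta>[OF that(1)]]]) simp
  \<comment> \<open>Substitution along the part of circle \<open>j\<close> in chart
    \<open>k\<close>. The derivative of the first coordinate has the sign \<open>s j\<close>, which
    comes out of the absolute value in the formula.\<close>
  have arc: "?g k absolutely_integrable_on (?r j k ` T j k) \<and>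
      integral (?r j k ` T j k) (?g k) = s j * integral {0..1} (\<lambda>t. \<phi> k (b j t) * \<Theta> j t)"
    if j: "j \<in> J" and k: "k < N" for j k
  proof -
    have tT: "b j t \<in> U k" if "t \<in> T j k" for t using that by (simp add: T_def)
    have val: "\<bar>dw j k t $ 1\<bar> *\<^sub>R ?g k (?r j k t) = s j * (\<phi> k (b j t) * \<Theta> j t)" if t: "t \<in> T j k" for t
    proof -
      have "\<bar>dw j k t $ 1\<bar> = s j * dw j k t $ 1"
        using sign[OF j] w_derivative(2)[OF j k tT[OF t]] by auto
      then show ?thesis using \<Theta>_chart[OF j k tT[OF t]] w_pt[OF j k tT[OF t]] v_u[OF k tT[OF t]] by simp
    qed
    have der: "(?r j k has_field_derivative dw j k t $ 1) (at t within T j k)" if "t \<in> T j k" for t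
      using has_vector_derivative_at_within[OF bounded_linear.has_vector_derivative[OF bounded_linear_vec_nth w_derivative(1)[OF j k tT[OF that]]]]
      by (simp add: has_real_derivative_iff_has_vector_derivative)
    have inj: "inj_on (?r j k) (T j k)"
    proof (rule inj_onI)
      fix t t' assume t: "t \<in> T j k" "t' \<in> T j k" "?r j k t = ?r j k t'"
      from arg_cong[OF t(3), of "\<lambda>x. pt x 0"] have "w j k t = w j k t'"
        unfolding w_pt[OF j k tT[OF t(1)]] w_pt[OF j k tT[OF t(2)]] .
      from arg_cong[OF this, of "v k"] have "b j t = b j t'"
        unfolding v_u[OF k tT[OF t(1)]] v_u[OF k tT[OF t(2)]] .
      then show "t = t'" using b_injective[OF j j, of t t'] t(1,2) by (simp add: T_def)
    qed
    have "(\<lambda>t. \<phi> k (b j t) * \<Theta> j t) absolutely_integrable_on T j k"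
      by (rule set_integrable_subset[OF ci[OF j k] Tb[OF j k]]) (auto simp: T_def)
    then have "(\<lambda>t. s j * (\<phi> k (b j t) * \<Theta> j t)) absolutely_integrable_on T j k"
      by (intro set_integrable_mult_right) auto
    moreover have "(\<lambda>t. \<bar>dw j k t $ 1\<bar> *\<^sub>R ?g k (?r j k t)) absolutely_integrable_on T j k \<longleftrightarrow>
        (\<lambda>t. s j * (\<phi> k (b j t) * \<Theta> j t)) absolutely_integrable_on T j k"
      by (rule set_integrable_cong[OF refl refl]) (rule val)
    ultimately have "(\<lambda>t. \<bar>dw j k t $ 1\<bar> *\<^sub>R ?g k (?r j k t)) absolutely_integrable_on T j k"
      by blast
    then have "?g k absolutely_integrable_on (?r j k ` T j k) \<and> integral (?r j k ` T j k) (?g k)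
        = integral (T j k) (\<lambda>t. \<bar>dw j k t $ 1\<bar> *\<^sub>R ?g k (?r j k t))"
      using has_absolute_integral_change_of_variables_1'[OF Tb[OF j k] der inj, of "?g k"] by auto
    moreover have "integral (T j k) (\<lambda>t. \<bar>dw j k t $ 1\<bar> *\<^sub>R ?g k (?r j k t)) = integral (T j k) (\<lambda>t. s j * (\<phi> k (b j t) * \<Theta> j t))"
      by (rule integral_cong[OF val])
    moreover have "\<dots> = s j * integral (T j k) (\<lambda>t. \<phi> k (b j t) * \<Theta> j t)" by simp
    moreover have "integral (T j k) (\<lambda>t. \<phi> k (b j t) * \<Theta> j t) = integral {0..1} (\<lambda>t. \<phi> k (b j t) * \<Theta> j t)"
    proof (rule integral_spike_set)
      \<comment> \<open>\<open>T j k\<close> lies in \<open>{0..<1}\<close> to make the curve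
        injective; the end point 1 is negligible.\<close>
      have "{t \<in> {0..1} - T j k. \<phi> k (b j t) * \<Theta> j t \<noteq> 0} \<subseteq> {1}"
        using \<phi>_outside[OF k] by (auto simp: T_def)
      then show "negligible {t \<in> {0..1} - T j k. \<phi> k (b j t) * \<Theta> j t \<noteq> 0}"
        using negligible_subset negligible_sing by blast
      have "{t \<in> T j k - {0..1}. \<phi> k (b j t) * \<Theta> j t \<noteq> 0} = {}" by (auto simp: T_def)
      then show "negligible {t \<in> T j k - {0..1}. \<phi> k (b j t) * \<Theta> j t \<noteq> 0}" by (simp only: negligible_empty)
    qed
    ultimately show ?thesis by simp
  qed
  have chart: "integral {x. pt x 0 \<in> E k} (?g k) = (\<Sum>j\<in>J. s j * integral {0..1} (\<lambda>t. \<phi> k (b j t) * \<Theta> j t))"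
    if k: "k < N" for k
  proof -
    let ?X = "{x. pt x 0 \<in> E k}"
    have ex: "\<exists>j\<in>J. x \<in> ?r j k ` T j k" if x: "x \<in> ?X" for x
    proof -
      have p: "v k (pt x 0) \<in> U k" "u k (v k (pt x 0)) = pt x 0" using x v_in u_v by auto
      then have "v k (pt x 0) \<in> {p \<in> P. \<exists>k<N. p \<in> U k \<and> u k p $ 2 = 0}"
        using U_sub[OF k] k by (intro CollectI conjI exI[of _ k]) auto
      then have "v k (pt x 0) \<in> (\<lambda>(j, t). b j t) ` (J \<times> {0..<1})" using bij_betw_imp_surj_on[OF b_bij] by simp
      then obtain j t where jt: "j \<in> J" "t \<in> {0..<1}" "b j t = v k (pt x 0)" by auto
      then have "t \<in> T j k" "?r j k t = x" using p by (auto simp: T_def)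
      then show ?thesis using jt(1) by blast
    qed
    have un: "j = j'" if jj: "j \<in> J" "j' \<in> J" "x \<in> ?r j k ` T j k" "x \<in> ?r j' k ` T j' k" for x j j'
    proof -
      obtain t t' where t: "t \<in> T j k" "t' \<in> T j' k" "?r j k t = ?r j' k t'" using jj(3,4) by auto
      have in_U: "b j t \<in> U k" "b j' t' \<in> U k" using t(1,2) by (simp_all add: T_def)
      from arg_cong[OF t(3), of "\<lambda>x. pt x 0"] have "w j k t = w j' k t'"
        unfolding w_pt[OF jj(1) k in_U(1)] w_pt[OF jj(2) k in_U(2)] .
      moreover note in_U
      ultimately have "b j t = b j' t'" using u_inj[OF k] by (meson inj_onD)
      then show ?thesis using b_injective[OF jj(1,2), of t t'] t(1,2) by (simp add: T_def)
    qed
    have sub: "?r j k ` T j k \<subseteq> ?X" if j: "j \<in> J" for j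
    proof
      fix x assume "x \<in> ?r j k ` T j k"
      then obtain t where "t \<in> T j k" "x = ?r j k t" by blast
      then show "x \<in> ?X" using w_pt[OF j k, of t] wE[of j t k] by (simp add: T_def)
    qed
    \<comment> \<open>Each point of the boundary line in chart \<open>k\<close> lies on exactly one
      arc, by \<open>ex\<close> and \<open>un\<close>.\<close>
    have "integral ?X (?g k) = integral ?X (\<lambda>x. \<Sum>j\<in>J. if x \<in> ?r j k ` T j k then ?g k x else 0)"
    proof (rule integral_cong)
      fix x assume "x \<in> ?X"
      then obtain j where j: "j \<in> J" "x \<in> ?r j k ` T j k" using ex by blast
      have "(\<Sum>j'\<in>J. if x \<in> ?r j' k ` T j' k then ?g k x else 0) = (\<Sum>j'\<in>J. if j' = j then ?g k x else 0)"
        using un j by (intro sum.cong) auto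
      then show "?g k x = (\<Sum>j'\<in>J. if x \<in> ?r j' k ` T j' k then ?g k x else 0)"
        using j(1) J_finite by simp
    qed
    also have "\<dots> = (\<Sum>j\<in>J. integral ?X (\<lambda>x. if x \<in> ?r j k ` T j k then ?g k x else 0))"
    proof (rule integral_sum[OF J_finite])
      fix j assume j: "j \<in> J"
      show "(\<lambda>x. if x \<in> ?r j k ` T j k then ?g k x else 0) integrable_on ?X"
        using integrable_restrict_Int[of "?r j k ` T j k" "?g k" ?X] arc[OF j k] Int_absorb2[OF sub[OF j]]
        by (simp add: absolutely_integrable_on_def)
    qed
    also have "\<dots> = (\<Sum>j\<in>J. integral (?r j k ` T j k) (?g k))"
    proof (rule sum.cong[OF refl])
      fix j assume j: "j \<in> J"
      show "integral ?X (\<lambda>x. if x \<in> ?r j k ` T j k then ?g k x else 0) = integral (?r j k ` T j k) (?g k)"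
        unfolding integral_restrict_Int using Int_absorb2[OF sub[OF j]] by (simp add: Int_commute)
    qed
    also have "\<dots> = (\<Sum>j\<in>J. s j * integral {0..1} (\<lambda>t. \<phi> k (b j t) * \<Theta> j t))"
      using arc k by (intro sum.cong) auto
    finally show ?thesis .
  qed
  have tot: "(\<Sum>k<N. integral {0..1} (\<lambda>t. \<phi> k (b j t) * \<Theta> j t)) = integral {0..1} (\<Theta> j)" if j: "j \<in> J" for j
  proof -
    have "(\<Sum>k<N. integral {0..1} (\<lambda>t. \<phi> k (b j t) * \<Theta> j t)) = integral {0..1} (\<lambda>t. \<Sum>k<N. \<phi> k (b j t) * \<Theta> j t)"
      by (rule integral_sum[symmetric]) (use ci[OF j] in \<open>auto simp: absolutely_integrable_on_def\<close>)
    also have "\<dots> = integral {0..1} (\<Theta> j)"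
      by (rule integral_cong) (simp add: \<phi>_sum b_in[OF j] flip: sum_distrib_right)
    finally show ?thesis .
  qed
  have "(\<Sum>k<N. integral {x. pt x 0 \<in> E k} (?g k)) = (\<Sum>k<N. \<Sum>j\<in>J. s j * integral {0..1} (\<lambda>t. \<phi> k (b j t) * \<Theta> j t))"
    using chart by simp
  also have "\<dots> = (\<Sum>j\<in>J. s j * (\<Sum>k<N. integral {0..1} (\<lambda>t. \<phi> k (b j t) * \<Theta> j t)))"
    by (subst sum.swap) (simp add: sum_distrib_left)
  also have "\<dots> = (\<Sum>j\<in>J. s j * integral {0..1} (\<Theta> j))" using tot by simp
  finally have "(\<Prod>j\<in>J. cis (s j * integral {0..1} (\<Theta> j))) = 1"
    using cis1 by (simp add: cis_sum[OF J_finite])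
  moreover have "cis (s j * integral {0..1} (\<Theta> j)) = (if s j = 1 then c j else inverse (c j))" if j: "j \<in> J" for j
    using sign[OF j] hol[OF j] by (auto simp flip: cis_inverse)
  ultimately show ?thesis by simp
qed

end

section \<open>The flat line bundle of a cobordism and a character\<close>

lemma half_openE:
  assumes "half_open E" obtains T where "open T" "E = half_plane \<inter> T"
  using assms by (auto simp: openin_open)

context
  fixes M :: "'p surface"
  assumes M: "smooth_surface M"
begin

lemma atlas_chart:
  assumes "(D, d) \<in> Atlas M"
  shows "openin (Top M) D" "half_open (d ` D)" "homeomorphic_map (subtopology (Top M) D) (top_of_set (d ` D)) d"
    "inj_on d D"
proof -
  have "chart_of (Top M) (D, d)" using M assms by (auto simp: smooth_surface_def)
  then show D: "openin (Top M) D" "half_open (d ` D)" "homeomorphic_map (subtopology (Top M) D) (top_of_set (d ` D)) d"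
    by (auto simp: chart_of_def)
  show "inj_on d D"
    using homeomorphic_imp_injective_map[OF D(3)] openin_subset[OF D(1)] by (simp add: Int_absorb1)
qed

lemma chart_image_open:
  assumes D: "(D, d) \<in> Atlas M" and V: "openin (Top M) V" "V \<subseteq> D"
  shows "half_open (d ` V)"
proof -
  have "openin (subtopology (Top M) D) V"
    using V by (metis inf.absorb_iff2 openin_subtopology_Int2 openin_subtopology_self inf_commute openin_open_subtopology atlas_chart(1)[OF D])
  then have "openin (top_of_set (d ` D)) (d ` V)"
    using homeomorphic_imp_open_map[OF atlas_chart(3)[OF D]] by (simp add: open_map_def)
  then show ?thesis using openin_trans atlas_chart(2)[OF D] by blast
qed

lemma chart_neighbourhood:
  assumes D: "(D, d) \<in> Atlas M" and V: "openin (Top M) V" "p \<in> V" "p \<in> D"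
  obtains A where "open A" "d p \<in> A" "\<And>q. q \<in> D \<Longrightarrow> d q \<in> A \<Longrightarrow> q \<in> V"
proof -
  have "half_open (d ` (D \<inter> V))"
    by (rule chart_image_open[OF D]) (use V atlas_chart(1)[OF D] in auto)
  then obtain A where A: "open A" "d ` (D \<inter> V) = half_plane \<inter> A" by (rule half_openE)
  show ?thesis
  proof (rule that[OF A(1)])
    show "d p \<in> A" using A(2) V by blast
    fix q assume q: "q \<in> D" "d q \<in> A"
    have "d q \<in> half_plane" using half_openD[OF atlas_chart(2)[OF D]] q(1) by blast
    then have "d q \<in> d ` (D \<inter> V)" using A(2) q(2) by blast
    then show "q \<in> V" using inj_onD[OF atlas_chart(4)[OF D]] q(1) by auto
  qed
qed

lemma chart_inverse_continuous:
  assumes D: "(D, d) \<in> Atlas M"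
  shows "continuous_map (top_of_set (d ` D)) (Top M) (inv_into D d)"
proof -
  obtain g where g: "homeomorphic_maps (subtopology (Top M) D) (top_of_set (d ` D)) d g"
    using atlas_chart(3)[OF D] homeomorphic_map_maps by blast
  have "continuous_map (top_of_set (d ` D)) (Top M) g"
    using g by (simp add: homeomorphic_maps_def continuous_map_in_subtopology)
  moreover have "g y = inv_into D d y" if "y \<in> topspace (top_of_set (d ` D))" for y
  proof -
    have gy: "d (g y) = y" "g y \<in> D"
      using g that openin_subset[OF atlas_chart(1)[OF D]]
      by (auto simp: homeomorphic_maps_def continuous_map_def Pi_iff)
    then show ?thesis using inv_into_f_f[OF atlas_chart(4)[OF D] gy(2)] by simp
  qed
  ultimately show ?thesis by (rule continuous_map_eq)
qed

lemma transition_smooth: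
  assumes "(D, d) \<in> Atlas M" "(D', d') \<in> Atlas M"
  shows "smooth_on (d ` (D \<inter> D')) (\<lambda>x. d' (inv_into D d x))"
proof -
  have "smooth_on (coord_dom (\<lambda>p. p) (D, d) (D', d')) (coord_rep (\<lambda>p. p) (D, d) (D', d'))"
    using M assms by (auto simp: smooth_surface_def smooth_map_def)
  moreover have "coord_dom (\<lambda>p. p) (D, d) (D', d') = d ` (D \<inter> D')" by (auto simp: coord_dom_def)
  moreover have "coord_rep (\<lambda>p. p) (D, d) (D', d') = (\<lambda>x. d' (inv_into D d x))" by (simp add: coord_rep_def o_def)
  ultimately show ?thesis by simp
qed

text \<open>If \<open>p\<close> were interior in one chart and on the boundary in the other,
  invariance of domain would make the image of a neighbourhood of \<open>p\<close> open in the
  plane, yet that image stays in the half plane.\<close>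

lemma boundary_point_iff:
  assumes "(D, d) \<in> Atlas M" "(D', d') \<in> Atlas M" "p \<in> D" "p \<in> D'"
  shows "d p $ 2 = 0 \<longleftrightarrow> d' p $ 2 = 0"
proof -
  have *: "d p $ 2 = 0" if D: "(D, d) \<in> Atlas M" "(D', d') \<in> Atlas M" "p \<in> D" "p \<in> D'" and z: "d' p $ 2 = 0" for D d D' d'
  proof (rule ccontr)
    assume nz: "d p $ 2 \<noteq> 0"
    have "half_open (d ` (D \<inter> D'))"
      by (rule chart_image_open[OF D(1)]) (use atlas_chart(1)[OF D(1)] atlas_chart(1)[OF D(2)] in auto)
    then obtain A where A: "open A" "d ` (D \<inter> D') = half_plane \<inter> A" by (rule half_openE)
    have dp: "d p \<in> half_plane \<inter> A" using A(2) D by blast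
    let ?B = "A \<inter> {x. 0 < x $ 2}" and ?g = "\<lambda>x. d' (inv_into D d x)"
    have "open ?B" using A(1) by (intro open_Int open_Collect_less continuous_intros)
    moreover have sub: "?B \<subseteq> d ` (D \<inter> D')" unfolding A(2) by (auto simp: half_plane_def less_imp_le)
    moreover have "continuous_on ?B ?g"
      using continuous_on_subset[OF Ck_ext_continuous_on[OF smooth_on_imp_Ck_ext[OF transition_smooth[OF D(1,2)]]] sub] .
    moreover have "inj_on ?g ?B"
    proof (rule inj_onI)
      fix x y assume xy: "x \<in> ?B" "y \<in> ?B" "?g x = ?g y"
      obtain q q' where q: "x = d q" "q \<in> D \<inter> D'" "y = d q'" "q' \<in> D \<inter> D'" using xy sub by blast
      then have "d' q = d' q'" using xy(3) inv_into_f_f[OF atlas_chart(4)[OF D(1)]] by simp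
      then show "x = y" using inj_onD[OF atlas_chart(4)[OF D(2)], of q q'] q by simp
    qed
    ultimately have "open (?g ` ?B)" by (intro invariance_of_domain)
    moreover have "d p \<in> ?B" using dp nz by (auto simp: half_plane_def)
    then have "d' p \<in> ?g ` ?B" using inv_into_f_f[OF atlas_chart(4)[OF D(1)] D(3)] by (metis imageI)
    ultimately obtain e where e: "e > 0" "ball (d' p) e \<subseteq> ?g ` ?B" by (auto elim: openE)
    \<comment> \<open>A point just below the boundary line: in the image by openness, but not in the
      half plane.\<close>
    let ?y = "d' p - (e / 2) *\<^sub>R axis 2 1"
    have "?y \<in> ball (d' p) e" using e(1) by (simp add: dist_norm)
    then obtain x where x: "x \<in> ?B" "?y = ?g x" using e(2) by blast
    then obtain q where "x = d q" "q \<in> D \<inter> D'" using sub by blast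
    then have "?y \<in> d' ` D'" using x(2) inv_into_f_f[OF atlas_chart(4)[OF D(1)]] by simp
    then have "?y \<in> half_plane" using half_openD[OF atlas_chart(2)[OF D(2)]] by blast
    then show False using z e(1) by (simp add: half_plane_def)
  qed
  show ?thesis using *[OF assms] *[OF assms(2,1,4,3)] by blast
qed

end

section \<open>Partitions of unity from finite covers by half balls\<close>

locale ball_cover =
  fixes M :: "'p surface" and N :: nat and U :: "nat \<Rightarrow> 'p set" and u :: "nat \<Rightarrow> 'p \<Rightarrow> real^2"
    and ctr :: "nat \<Rightarrow> real^2" and rad :: "nat \<Rightarrow> real"
  assumes oriented: "oriented_smooth_surface M"
    and U_open: "\<And>k. k < N \<Longrightarrow> openin (Top M) (U k)"
    and in_atlas: "\<And>k. k < N \<Longrightarrow> \<exists>D. (D, u k) \<in> Atlas M \<and> U k \<subseteq> D"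
    and cball_sub: "\<And>k. k < N \<Longrightarrow> cball (ctr k) (rad k) \<inter> half_plane \<subseteq> u k ` U k"
    and rad_pos: "\<And>k. k < N \<Longrightarrow> 0 < rad k"
    and covered: "\<And>p. p \<in> pts M \<Longrightarrow> \<exists>k<N. p \<in> U k \<and> dist (u k p) (ctr k) < rad k"
begin

lemma smooth: "smooth_surface M"
  using oriented by (simp add: oriented_smooth_surface_def)

lemma chart_inj: "k < N \<Longrightarrow> inj_on (u k) (U k)"
  using in_atlas atlas_chart(4)[OF smooth] by (meson inj_on_subset)

lemma image_open: "k < N \<Longrightarrow> openin (Top M) V \<Longrightarrow> V \<subseteq> U k \<Longrightarrow> half_open (u k ` V)"
  using in_atlas chart_image_open[OF smooth] by (meson order_trans)

lemma neighbourhood: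
  assumes "k < N" "openin (Top M) V" "p \<in> V" "p \<in> U k"
  obtains A where "open A" "u k p \<in> A" "\<And>q. q \<in> U k \<Longrightarrow> u k q \<in> A \<Longrightarrow> q \<in> V"
proof -
  obtain D where D: "(D, u k) \<in> Atlas M" "U k \<subseteq> D" using in_atlas[OF assms(1)] by blast
  then have "p \<in> D" using assms by blast
  from chart_neighbourhood[OF smooth D(1) assms(2,3) this] obtain A where
    "open A" "u k p \<in> A" "\<And>q. q \<in> D \<Longrightarrow> u k q \<in> A \<Longrightarrow> q \<in> V" by blast
  then show ?thesis using D(2) by (intro that[of A]) auto
qed

lemma overlap_half_open: "k < N \<Longrightarrow> l < N \<Longrightarrow> half_open (u k ` (U k \<inter> U l))"
  by (rule image_open) (auto intro: U_open)

lemma transition_facts: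
  assumes k: "k < N" and l: "l < N"
  shows "Ck_ext j (u k ` (U k \<inter> U l)) (\<lambda>x. u l (inv_into (U k) (u k) x))"
    and "x \<in> u k ` (U k \<inter> U l) \<Longrightarrow>
      0 < det (matrix (frechet_derivative (\<lambda>x. u l (inv_into (U k) (u k) x)) (at x within half_plane)))"
proof -
  obtain D where D: "(D, u k) \<in> Atlas M" "U k \<subseteq> D" using in_atlas[OF k] by blast
  obtain D' where D': "(D', u l) \<in> Atlas M" "U l \<subseteq> D'" using in_atlas[OF l] by blast
  let ?f = "\<lambda>x. u l (inv_into D (u k) x)" and ?g = "\<lambda>x. u l (inv_into (U k) (u k) x)"
  \<comment> \<open>\<open>U k\<close> may be smaller than the domain \<open>D\<close> of its chart
    in the atlas, so two inverses of \<open>u k\<close> occur.\<close>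
  have inv: "inv_into D (u k) x = inv_into (U k) (u k) x" if x: "x \<in> u k ` (U k \<inter> U l)" for x
  proof -
    obtain p where "x = u k p" "p \<in> U k" using x by blast
    then show ?thesis using inv_into_f_f[OF chart_inj[OF k]] inv_into_f_f[OF atlas_chart(4)[OF smooth D(1)], of p] D(2) by auto
  qed
  have "Ck_ext j (u k ` (U k \<inter> U l)) ?f"
    by (rule Ck_ext_subset[OF smooth_on_imp_Ck_ext[OF transition_smooth[OF smooth D(1) D'(1)]]]) (use D D' in blast)
  then show "Ck_ext j (u k ` (U k \<inter> U l)) ?g" by (rule Ck_ext_cong) (simp add: inv)
  assume x: "x \<in> u k ` (U k \<inter> U l)"
  have xD: "x \<in> coord_dom (\<lambda>p. p) (D, u k) (D', u l)" using x D D' by (auto simp: coord_dom_def)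
  have cd: "coord_dom (\<lambda>p. p) (D, u k) (D', u l) = u k ` (D \<inter> D')" by (auto simp: coord_dom_def)
  have "orientation_preserving M M (\<lambda>p. p)" using oriented by (simp add: oriented_smooth_surface_def)
  then obtain L where L: "(coord_rep (\<lambda>p. p) (D, u k) (D', u l) has_derivative L) (at x within coord_dom (\<lambda>p. p) (D, u k) (D', u l))"
    "0 < det (matrix L)"
    using xD D(1) D'(1) unfolding orientation_preserving_def by blast
  have "coord_rep (\<lambda>p. p) (D, u k) (D', u l) = ?f" by (simp add: coord_rep_def o_def)
  moreover have "half_open (u k ` (D \<inter> D'))"
    by (rule chart_image_open[OF smooth D(1)]) (use atlas_chart(1)[OF smooth D(1)] atlas_chart(1)[OF smooth D'(1)] in auto)
  ultimately have "(?f has_derivative L) (at x within half_plane)"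
    using L(1) at_within_half_open[of "u k ` (D \<inter> D')" x] xD unfolding cd by simp
  then have "(?g has_derivative L) (at x within half_plane)"
    by (rule half_open_transform[OF overlap_half_open[OF k l] x, rotated]) (simp add: inv)
  then have "frechet_derivative ?g (at x within half_plane) = L"
    by (rule half_plane_derivative_unique[OF half_openD[OF overlap_half_open[OF k l] x]])
  then show "0 < det (matrix (frechet_derivative ?g (at x within half_plane)))" using L(2) by simp
qed

text \<open>The cube makes the function of class 2 across the circle of radius
  \<open>rad k\<close>.\<close>

definition bump :: "nat \<Rightarrow> 'p \<Rightarrow> real" where
  "bump k p = (if k < N \<and> p \<in> U k then (max 0 ((rad k)\<^sup>2 - (u k p - ctr k) \<bullet> (u k p - ctr k))) ^ Suc 2 else 0)"

lemma bump_zero: "k < N \<Longrightarrow> p \<in> U k \<Longrightarrow> u k p \<notin> cball (ctr k) (rad k) \<Longrightarrow> bump k p = 0"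
  using rad_pos[of k] by (auto simp: bump_def dist_norm norm_minus_commute dot_square_norm max_def abs_le_square_iff simp flip: abs_le_square_iff)

lemma bump_pos: "k < N \<Longrightarrow> p \<in> U k \<Longrightarrow> dist (u k p) (ctr k) < rad k \<Longrightarrow> 0 < bump k p"
  by (auto simp: bump_def dist_norm dot_square_norm power_strict_mono intro!: zero_less_power)

lemma bump_nonneg: "0 \<le> bump k p"
  by (simp add: bump_def)

text \<open>The closed half ball in chart \<open>l\<close> is compact in the surface, hence closed
  by the Hausdorff property. Its complement is a neighbourhood of every point outside
  \<open>U l\<close>, and \<open>bump l\<close> vanishes there.\<close>

lemma bump_away:
  assumes k: "k < N" and l: "l < N" and p: "p \<in> U k - U l"
  shows "\<exists>A. open A \<and> u k p \<in> A \<and> (\<forall>q\<in>U k. u k q \<in> A \<longrightarrow> bump l q = 0)"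
proof -
  obtain D where D: "(D, u l) \<in> Atlas M" "U l \<subseteq> D" using in_atlas[OF l] by blast
  let ?C = "cball (ctr l) (rad l) \<inter> half_plane" and ?K = "inv_into D (u l) ` (cball (ctr l) (rad l) \<inter> half_plane)"
  have CE: "?C \<subseteq> u l ` D" using cball_sub[OF l] D(2) by blast
  have "closed half_plane" unfolding half_plane_def by (intro closed_Collect_le continuous_intros)
  then have "compact ?C" by (intro compact_Int_closed compact_cball)
  then have "compactin (top_of_set (u l ` D)) ?C" using CE by (simp add: compactin_subtopology)
  from image_compactin[OF this chart_inverse_continuous[OF smooth D(1)]]
  have "compactin (Top M) ?K" .
  then have "closedin (Top M) ?K"
    using compactin_imp_closedin smooth by (auto simp: smooth_surface_def)
  then have "openin (Top M) (pts M - ?K)" by (rule openin_diff[OF openin_topspace])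
  moreover have "p \<notin> ?K"
  proof
    assume "p \<in> ?K"
    then obtain x where x: "x \<in> ?C" "p = inv_into D (u l) x" by blast
    then obtain q where "q \<in> U l" "x = u l q" using cball_sub[OF l] by blast
    then have "p = q" using x(2) inv_into_f_f[OF atlas_chart(4)[OF smooth D(1)], of q] D(2) by auto
    then show False using p \<open>q \<in> U l\<close> by blast
  qed
  moreover have "p \<in> pts M" using p openin_subset[OF U_open[OF k]] by blast
  ultimately obtain A where A: "open A" "u k p \<in> A" "\<And>q. q \<in> U k \<Longrightarrow> u k q \<in> A \<Longrightarrow> q \<in> pts M - ?K"
    using neighbourhood[OF k, of "pts M - ?K" p] p by blast
  have "bump l q = 0" if q: "q \<in> U k" "u k q \<in> A" for q
  proof (cases "q \<in> U l")
    case True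
    have "u l q \<notin> cball (ctr l) (rad l)"
    proof
      assume "u l q \<in> cball (ctr l) (rad l)"
      moreover have "u l q \<in> half_plane" using half_openD[OF atlas_chart(2)[OF smooth D(1)]] True D(2) by blast
      moreover have "q = inv_into D (u l) (u l q)"
        using inv_into_f_f[OF atlas_chart(4)[OF smooth D(1)], of q] True D(2) by auto
      ultimately show False using A(3)[OF q] by blast
    qed
    then show ?thesis by (rule bump_zero[OF l True])
  qed (simp add: bump_def)
  then show ?thesis using A by blast
qed

lemma bump_Ck:
  assumes k: "k < N" and l: "l < N" shows "Ck_ext 2 (u k ` U k) (\<lambda>x. bump l (inv_into (U k) (u k) x))"
proof (rule Ck_ext_local)
  fix x assume "x \<in> u k ` U k"
  then obtain p where p: "p \<in> U k" "x = u k p" by blast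
  have inv: "inv_into (U k) (u k) (u k q) = q" if "q \<in> U k" for q using chart_inj[OF k] that by simp
  show "\<exists>T. open T \<and> x \<in> T \<and> Ck_ext 2 (u k ` U k \<inter> T) (\<lambda>x. bump l (inv_into (U k) (u k) x))"
  proof (cases "p \<in> U l")
    case True
    let ?\<tau> = "\<lambda>x. u l (inv_into (U k) (u k) x)" and ?O = "u k ` (U k \<inter> U l)"
    obtain T where T: "open T" "?O = half_plane \<inter> T" using overlap_half_open[OF k l] by (rule half_openE)
    have sub: "u k ` U k \<inter> T \<subseteq> ?O"
      unfolding T(2) using half_openD[OF image_open[OF k U_open[OF k] subset_refl]] by blast
    have "Ck_ext 2 ?O (\<lambda>x. ?\<tau> x - ctr l)" by (intro Ck_ext_diff transition_facts(1)[OF k l] Ck_ext_const)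
    then have i: "Ck_ext 2 ?O (\<lambda>x. (rad l)\<^sup>2 - (?\<tau> x - ctr l) \<bullet> (?\<tau> x - ctr l))"
      by (intro Ck_ext_diff[OF Ck_ext_const] Ck_ext_bilinear[OF bounded_bilinear_inner])
    have "Ck_ext 2 ?O (\<lambda>x. (max 0 ((rad l)\<^sup>2 - (?\<tau> x - ctr l) \<bullet> (?\<tau> x - ctr l))) ^ Suc 2)"
      by (rule Ck_ext_compose[OF i Ck_on_imp_Ck_ext[OF open_UNIV Ck_on_pos_power]]) simp
    then have "Ck_ext 2 ?O (\<lambda>x. bump l (inv_into (U k) (u k) x))"
      by (rule Ck_ext_cong) (use l inv in \<open>auto simp: bump_def\<close>)
    from Ck_ext_subset[OF this sub] show ?thesis using T p True by (intro exI[of _ T]) auto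
  next
    case False
    then obtain A where A: "open A" "u k p \<in> A" "\<forall>q\<in>U k. u k q \<in> A \<longrightarrow> bump l q = 0"
      using bump_away[OF k l, of p] p by blast
    have "Ck_ext 2 (u k ` U k \<inter> A) (\<lambda>x. bump l (inv_into (U k) (u k) x))"
      by (rule Ck_ext_cong[OF Ck_ext_const[of _ _ 0]]) (use A inv in auto)
    then show ?thesis using A p by (intro exI[of _ A]) auto
  qed
qed

definition pou :: "nat \<Rightarrow> 'p \<Rightarrow> real" where
  "pou k p = bump k p * inverse (\<Sum>l<N. bump l p)"

lemma bump_sum_pos: "p \<in> pts M \<Longrightarrow> 0 < (\<Sum>l<N. bump l p)"
proof -
  assume "p \<in> pts M"
  then obtain k where "k < N" "p \<in> U k" "dist (u k p) (ctr k) < rad k" using covered by blast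
  then show ?thesis using bump_pos[of k p] bump_nonneg by (intro sum_pos2[of _ k]) auto
qed

text \<open>Local constancy of the transition functions is asked for on open sets of the surface and
  moved to coordinates by \<open>neighbourhood\<close>.\<close>

lemma flat_line_bundleI:
  assumes \<epsilon>_norm: "\<And>k l p. k < N \<Longrightarrow> l < N \<Longrightarrow> p \<in> U k \<inter> U l \<Longrightarrow> cmod (\<epsilon> k l p) = 1"
    and \<epsilon>_cocycle: "\<And>k l m p. k < N \<Longrightarrow> l < N \<Longrightarrow> m < N \<Longrightarrow> p \<in> U k \<inter> U l \<inter> U m \<Longrightarrow>
      \<epsilon> k l p * \<epsilon> l m p = \<epsilon> k m p"
    and \<epsilon>_locally_const: "\<And>k l p. k < N \<Longrightarrow> l < N \<Longrightarrow> p \<in> U k \<inter> U l \<Longrightarrow>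
      \<exists>V. openin (Top M) V \<and> p \<in> V \<and> (\<forall>q\<in>U k \<inter> U l \<inter> V. \<epsilon> k l q = \<epsilon> k l p)"
  shows "flat_line_bundle N (pts M) U u pou \<epsilon>"
proof
  fix k l assume k: "k < N"
  show "U k \<subseteq> pts M" using openin_subset[OF U_open[OF k]] .
  show "inj_on (u k) (U k)" by (rule chart_inj[OF k])
  show "pou k p = 0" if "p \<notin> U k" for p using that by (simp add: pou_def bump_def)
  show "\<exists>C. compact C \<and> C \<subseteq> u k ` U k \<and> (\<forall>p\<in>U k. u k p \<notin> C \<longrightarrow> pou k p = 0)"
  proof (intro exI conjI ballI impI)
    have "closed half_plane" unfolding half_plane_def by (intro closed_Collect_le continuous_intros)
    then show "compact (cball (ctr k) (rad k) \<inter> half_plane)" by (intro compact_Int_closed compact_cball)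
    show "cball (ctr k) (rad k) \<inter> half_plane \<subseteq> u k ` U k" by (rule cball_sub[OF k])
    fix p assume p: "p \<in> U k" "u k p \<notin> cball (ctr k) (rad k) \<inter> half_plane"
    then have "u k p \<notin> cball (ctr k) (rad k)" using half_openD[OF image_open[OF k U_open[OF k] subset_refl]] by blast
    then show "pou k p = 0" using bump_zero[OF k p(1)] by (simp add: pou_def)
  qed
  assume l: "l < N"
  show "half_open (u k ` (U k \<inter> U l))" by (rule overlap_half_open[OF k l])
  show "Ck_ext 2 (u k ` (U k \<inter> U l)) (\<lambda>x. u l (inv_into (U k) (u k) x))" by (rule transition_facts(1)[OF k l])
  show "0 < det (matrix (frechet_derivative (\<lambda>x. u l (inv_into (U k) (u k) x)) (at x within half_plane)))"
    if "x \<in> u k ` (U k \<inter> U l)" for x by (rule transition_facts(2)[OF k l that])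
  show "u k p $ 2 = 0 \<longleftrightarrow> u l p $ 2 = 0" if "p \<in> U k \<inter> U l" for p
  proof -
    obtain D D' where "(D, u k) \<in> Atlas M" "U k \<subseteq> D" "(D', u l) \<in> Atlas M" "U l \<subseteq> D'" using in_atlas k l by meson
    then show ?thesis using boundary_point_iff[OF smooth, of D "u k" D' "u l" p] that by blast
  qed
  show "\<exists>A B. open A \<and> open B \<and> u k p \<in> A \<and> u l q \<in> B \<and> (\<forall>x\<in>U k \<inter> U l. \<not> (u k x \<in> A \<and> u l x \<in> B))"
    if p: "p \<in> U k" "q \<in> U l" "p \<noteq> q" for p q
  proof -
    have "Hausdorff_space (Top M)" using smooth by (simp add: smooth_surface_def)
    moreover have pq: "p \<in> pts M" "q \<in> pts M" using p openin_subset[OF U_open[OF k]] openin_subset[OF U_open[OF l]] by blast+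
    ultimately obtain V V' where V: "openin (Top M) V" "openin (Top M) V'" "p \<in> V" "q \<in> V'" "disjnt V V'"
      using p(3) pq unfolding Hausdorff_space_def by metis
    obtain A where A: "open A" "u k p \<in> A" "\<And>q. q \<in> U k \<Longrightarrow> u k q \<in> A \<Longrightarrow> q \<in> V"
      using neighbourhood[OF k V(1,3) p(1)] by blast
    obtain B where B: "open B" "u l q \<in> B" "\<And>x. x \<in> U l \<Longrightarrow> u l x \<in> B \<Longrightarrow> x \<in> V'"
      using neighbourhood[OF l V(2,4) p(2)] by blast
    show ?thesis using A B V(5) unfolding disjnt_iff by (intro exI[of _ A] exI[of _ B]) blast
  qed
  show "Ck_ext 2 (u k ` U k) (\<lambda>x. pou l (inv_into (U k) (u k) x))"
    unfolding pou_def
  proof (rule Ck_ext_mult[OF bump_Ck[OF k l] Ck_ext_inverse])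
    show "Ck_ext 2 (u k ` U k) (\<lambda>x. \<Sum>l<N. bump l (inv_into (U k) (u k) x))"
      by (rule Ck_ext_sum) (simp add: bump_Ck[OF k])
    fix x assume "x \<in> u k ` U k"
    then have "inv_into (U k) (u k) x \<in> pts M"
      using subsetD[OF openin_subset[OF U_open[OF k]] inv_into_into] by fast
    then show "0 < (\<Sum>l<N. bump l (inv_into (U k) (u k) x))" by (rule bump_sum_pos)
  qed
  show "\<exists>A. open A \<and> u k p \<in> A \<and> (\<forall>q\<in>U k. u k q \<in> A \<longrightarrow> pou l q = 0)" if "p \<in> U k - U l" for p
    using bump_away[OF k l that] by (auto simp: pou_def)
  show "\<exists>A. open A \<and> u k p \<in> A \<and> (\<forall>q\<in>U k \<inter> U l. u k q \<in> A \<longrightarrow> \<epsilon> k l q = \<epsilon> k l p)" if p: "p \<in> U k \<inter> U l" for p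
  proof -
    obtain V where V: "openin (Top M) V" "p \<in> V" "\<forall>q\<in>U k \<inter> U l \<inter> V. \<epsilon> k l q = \<epsilon> k l p"
      using \<epsilon>_locally_const[OF k l p] by blast
    obtain A where "open A" "u k p \<in> A" "\<And>q. q \<in> U k \<Longrightarrow> u k q \<in> A \<Longrightarrow> q \<in> V"
      using neighbourhood[OF k V(1,2)] p by blast
    then show ?thesis using V(3) by (intro exI[of _ A]) blast
  qed
  show "cmod (\<epsilon> k l p) = 1" if "p \<in> U k \<inter> U l" for p by (rule \<epsilon>_norm[OF k l that])
  show "\<epsilon> k l p * \<epsilon> l m p = \<epsilon> k m p" if "m < N" "p \<in> U k \<inter> U l \<inter> U m" for m p
    by (rule \<epsilon>_cocycle[OF k l that])
next
  show "0 \<le> pou k p" for k p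
    unfolding pou_def using bump_nonneg by (intro mult_nonneg_nonneg) (auto intro: sum_nonneg)
  show "(\<Sum>k<N. pou k p) = 1" if "p \<in> pts M" for p
    using bump_sum_pos[OF that] unfolding pou_def by (simp flip: sum_distrib_right)
qed

end

section \<open>The associated line bundle of a principal bundle\<close>

lemma periodic_frac:
  fixes f :: "real \<Rightarrow> 'a"
  assumes "\<And>t. f (t + 1) = f t" shows "f t = f (frac t)"
proof -
  have "f (t + of_int n) = f t" for n :: int and t
  proof (induction n arbitrary: t rule: int_induct[where k = 0])
    case (step1 n)
    have "f (t + of_int (n + 1)) = f ((t + of_int n) + 1)" by (simp add: add.assoc)
    then show ?case using assms step1 by simp
  next
    case (step2 n)
    have "f (t + of_int (n - 1)) = f ((t + of_int (n - 1)) + 1)" by (rule assms[symmetric])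
    also have "\<dots> = f (t + of_int n)" by (simp add: algebra_simps)
    finally show ?case using step2 by simp
  qed simp
  from this[of "frac t" "\<lfloor>t\<rfloor>"] show ?thesis by (simp add: frac_def)
qed

text \<open>A local extension has a continuous derivative, and on the open set \<open>S\<close> it
  is that of \<open>f\<close>.\<close>

lemma Ck_ext_vector_derivative:
  fixes f :: "real \<Rightarrow> 'b::euclidean_space"
  assumes f: "Ck_ext (Suc 0) S f" and S: "open S"
  shows "continuous_on S (\<lambda>t. vector_derivative f (at t))"
proof (rule continuous_at_imp_continuous_on, rule ballI)
  fix t assume t: "t \<in> S"
  obtain T g where T: "open T" "t \<in> T" "Ck_on (Suc 0) g T" "\<And>y. y \<in> S \<Longrightarrow> y \<in> T \<Longrightarrow> g y = f y"
    using Ck_extE[OF f t] by blast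
  have eq: "frechet_derivative g (at y) 1 = vector_derivative f (at y)" if y: "y \<in> S \<inter> T" for y
  proof -
    have D: "(g has_derivative frechet_derivative g (at y)) (at y)" using Ck_on_SucD(1)[OF T(3)] y by blast
    have "frechet_derivative g (at y) h = h *\<^sub>R frechet_derivative g (at y) 1" for h
      using linear_scale[OF has_derivative_linear[OF D], of h 1] by simp
    then have "frechet_derivative g (at y) = (\<lambda>h. h *\<^sub>R frechet_derivative g (at y) 1)" by (rule ext)
    then have "(g has_vector_derivative frechet_derivative g (at y) 1) (at y)"
      using D by (simp add: has_vector_derivative_def)
    then have "(f has_vector_derivative frechet_derivative g (at y) 1) (at y)"
      by (rule has_vector_derivative_transform_within_open[of _ _ _ "S \<inter> T"]) (use y S T in auto)
    then show ?thesis by (rule vector_derivative_at[symmetric])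
  qed
  have "continuous_on (S \<inter> T) (\<lambda>y. frechet_derivative g (at y) 1)"
    using Ck_on_SucD(2)[OF T(3)] by (auto intro: continuous_on_subset)
  then have "continuous_on (S \<inter> T) (\<lambda>t. vector_derivative f (at t))"
    by (rule continuous_on_eq) (rule eq)
  then show "isCont (\<lambda>t. vector_derivative f (at t)) t"
    using S T t by (simp add: continuous_on_eq_continuous_at open_Int)
qed

text \<open>A local trivialization, given by its \<open>G\<close>-coordinate \<open>lev\<close> and its unit section \<open>sc\<close>.\<close>

definition level_data ::
    "('g, 'r) monoid_scheme \<Rightarrow> ('p, 'q, 'g) gcob \<Rightarrow> 'p set \<Rightarrow> ('q \<Rightarrow> 'g) \<Rightarrow> ('p \<Rightarrow> 'q) \<Rightarrow> bool" where
  "level_data G W U lev sc \<longleftrightarrow>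
     (\<forall>x\<in>U. sc x \<in> pts (tot W) \<and> proj W (sc x) = x \<and> lev (sc x) = \<one>\<^bsub>G\<^esub>) \<and>
     (\<forall>q\<in>pts (tot W). proj W q \<in> U \<longrightarrow> lev q \<in> carrier G \<and>
        (\<forall>g\<in>carrier G. act W g q \<in> pts (tot W) \<and> proj W (act W g q) = proj W q \<and> lev (act W g q) = g \<otimes>\<^bsub>G\<^esub> lev q)) \<and>
     (\<forall>q\<in>pts (tot W). \<forall>q'\<in>pts (tot W). proj W q \<in> U \<and> proj W q = proj W q' \<and> lev q = lev q' \<longrightarrow> q = q') \<and>
     (\<forall>y. openin (Top (tot W)) {q \<in> pts (tot W). proj W q \<in> U \<and> lev q = y}) \<and>
     continuous_map (subtopology (Top (base W)) U) (Top (tot W)) sc"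

text \<open>\<open>lev\<close> is the group component of the inverse of a local trivialization and
  \<open>sc\<close> is the trivialization at the unit. Intersecting with \<open>D\<close> puts the
  open set inside a given chart.\<close>

lemma level_data_exists:
  fixes G (structure)
  assumes G: "group G" and W: "principal_bundle G W" and p: "p \<in> pts (base W)" "p \<in> D" "openin (Top (base W)) D"
  obtains U lev sc where "openin (Top (base W)) U" "p \<in> U" "U \<subseteq> D" "level_data G W U lev sc"
proof -
  interpret group G by (rule G)
  let ?Q = "pts (tot W)" and ?P = "pts (base W)"
  have ex0: "\<exists>T \<tau>. openin (Top (base W)) T \<and> p \<in> T \<and>
        diffeo (times_discrete (restrict_surface (base W) T) (carrier G))
               (restrict_surface (tot W) {q \<in> ?Q. proj W q \<in> T}) \<tau> \<and>
        (\<forall>u\<in>T. \<forall>y\<in>carrier G. proj W (\<tau> (u, y)) = u \<and>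
           (\<forall>g\<in>carrier G. act W g (\<tau> (u, y)) = \<tau> (u, g \<otimes> y)))"
    using W p(1) unfolding principal_bundle_def by (elim conjE) (erule bspec)
  obtain T \<tau> where T: "openin (Top (base W)) T" "p \<in> T"
    and dif: "diffeo (times_discrete (restrict_surface (base W) T) (carrier G))
               (restrict_surface (tot W) {q \<in> ?Q. proj W q \<in> T}) \<tau>"
    and \<tau>0: "\<forall>u\<in>T. \<forall>y\<in>carrier G. proj W (\<tau> (u, y)) = u \<and>
           (\<forall>g\<in>carrier G. act W g (\<tau> (u, y)) = \<tau> (u, g \<otimes> y))"
    using ex0 by (elim exE conjE) (rule that)
  have \<tau>: "proj W (\<tau> (x, y)) = x" "\<And>g. g \<in> carrier G \<Longrightarrow> act W g (\<tau> (x, y)) = \<tau> (x, g \<otimes> y)"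
    if "x \<in> T" "y \<in> carrier G" for x y
    using bspec[OF bspec[OF \<tau>0 that(1)] that(2)] by auto
  let ?total_top = "{q \<in> ?Q. proj W q \<in> T}"
  have TP: "T \<subseteq> ?P" using openin_subset[OF T(1)] .
  have pts1: "pts (times_discrete (restrict_surface (base W) T) (carrier G)) = T \<times> carrier G"
    using TP by (auto simp: times_discrete_def restrict_surface_def)
  have pts2: "pts (restrict_surface (tot W) ?total_top) = ?total_top" by (auto simp: restrict_surface_def)
  have bij: "bij_betw \<tau> (T \<times> carrier G) ?total_top" using dif unfolding diffeo_def pts1 pts2 by blast
  define \<iota> where "\<iota> = inv_into (T \<times> carrier G) \<tau>"
  have c\<tau>: "continuous_map (prod_topology (subtopology (Top (base W)) T) (discrete_topology (carrier G))) (subtopology (Top (tot W)) ?total_top) \<tau>"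
    using dif by (simp add: diffeo_def smooth_map_def times_discrete_def restrict_surface_def)
  have c\<iota>: "continuous_map (subtopology (Top (tot W)) ?total_top) (prod_topology (subtopology (Top (base W)) T) (discrete_topology (carrier G))) \<iota>"
  proof -
    have "continuous_map (Top (restrict_surface (tot W) ?total_top)) (Top (times_discrete (restrict_surface (base W) T) (carrier G))) \<iota>"
      using dif unfolding diffeo_def smooth_map_def \<iota>_def pts1 by blast
    then show ?thesis by (simp add: times_discrete_def restrict_surface_def)
  qed
  have \<iota>\<tau>: "\<iota> (\<tau> (x, y)) = (x, y)" if "x \<in> T" "y \<in> carrier G" for x y
    unfolding \<iota>_def using bij_betw_imp_inj_on[OF bij] that by (intro inv_into_f_f) auto
  have ex: "\<exists>x y. x \<in> T \<and> y \<in> carrier G \<and> q = \<tau> (x, y)" if "q \<in> ?total_top" for q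
  proof -
    have "q \<in> \<tau> ` (T \<times> carrier G)" using bij_betw_imp_surj_on[OF bij] that by simp
    then show ?thesis by auto
  qed
  have \<tau>Q: "\<tau> (x, y) \<in> ?total_top" if "x \<in> T" "y \<in> carrier G" for x y
    using bij_betwE[OF bij] that by blast
  define U where "U = T \<inter> D"
  define lev where "lev q = snd (\<iota> q)" for q
  define sc where "sc x = \<tau> (x, \<one>)" for x
  have lev\<tau>: "lev (\<tau> (x, y)) = y" if "x \<in> T" "y \<in> carrier G" for x y
    using \<iota>\<tau>[OF that] by (simp add: lev_def)
  have UT: "U \<subseteq> T" by (simp add: U_def)
  have Uo: "openin (Top (base W)) U" unfolding U_def by (rule openin_Int[OF T(1) p(3)])
  have c\<pi>: "continuous_map (Top (tot W)) (Top (base W)) (proj W)"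
    using W by (simp add: principal_bundle_def smooth_map_def)
  have total_top: "openin (Top (tot W)) ?total_top" by (rule openin_continuous_map_preimage[OF c\<pi> T(1)])
  have QU: "openin (Top (tot W)) {q \<in> ?Q. proj W q \<in> U}" by (rule openin_continuous_map_preimage[OF c\<pi> Uo])
  have "level_data G W U lev sc"
    unfolding level_data_def
  proof (intro conjI ballI impI allI)
    fix x assume "x \<in> U"
    then have x: "x \<in> T" using UT by blast
    show "sc x \<in> ?Q" "proj W (sc x) = x" "lev (sc x) = \<one>"
      using \<tau>Q[OF x one_closed] lev\<tau>[OF x one_closed] \<tau>(1)[OF x one_closed] by (auto simp: sc_def)
  next
    fix q assume q: "q \<in> ?Q" "proj W q \<in> U"
    then have "q \<in> ?total_top" using UT by blast
    from ex[OF this] obtain x y where xy: "x \<in> T" "y \<in> carrier G" "q = \<tau> (x, y)" by blast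
    show "lev q \<in> carrier G" using lev\<tau>[OF xy(1,2)] xy by simp
    fix g assume g: "g \<in> carrier G"
    have gy: "g \<otimes> y \<in> carrier G" using g xy(2) by simp
    show "act W g q \<in> ?Q" "proj W (act W g q) = proj W q" "lev (act W g q) = g \<otimes> lev q"
      unfolding xy(3) \<tau>(2)[OF xy(1,2) g] using \<tau>Q[OF xy(1) gy] \<tau>(1)[OF xy(1)] gy xy(2) lev\<tau>[OF xy(1)] by auto
  next
    fix q q' assume q: "q \<in> ?Q" "q' \<in> ?Q" and e: "proj W q \<in> U \<and> proj W q = proj W q' \<and> lev q = lev q'"
    then have "q \<in> ?total_top" "q' \<in> ?total_top" using UT by auto
    from ex[OF this(1)] ex[OF this(2)] obtain x y x' y' where
      xy: "x \<in> T" "y \<in> carrier G" "q = \<tau> (x, y)" "x' \<in> T" "y' \<in> carrier G" "q' = \<tau> (x', y')" by blast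
    then show "q = q'" using e \<tau>(1)[OF xy(1,2)] \<tau>(1)[OF xy(4,5)] lev\<tau>[OF xy(1,2)] lev\<tau>[OF xy(4,5)] by simp
  next
    fix y
    have "continuous_map (subtopology (Top (tot W)) ?total_top) (discrete_topology (carrier G)) lev"
      using continuous_map_compose[OF c\<iota> continuous_map_snd] by (simp add: o_def lev_def[abs_def])
    then have "openin (subtopology (Top (tot W)) ?total_top) {q \<in> topspace (subtopology (Top (tot W)) ?total_top). lev q \<in> {y} \<inter> carrier G}"
      by (rule openin_continuous_map_preimage) simp
    then have "openin (Top (tot W)) {q \<in> topspace (subtopology (Top (tot W)) ?total_top). lev q \<in> {y} \<inter> carrier G}"
      by (rule openin_trans_full[OF _ total_top])
    from openin_Int[OF QU this]
    have "openin (Top (tot W)) ({q \<in> ?Q. proj W q \<in> U} \<inter> {q \<in> topspace (subtopology (Top (tot W)) ?total_top). lev q \<in> {y} \<inter> carrier G})" .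
    moreover have "{q \<in> ?Q. proj W q \<in> U} \<inter> {q \<in> topspace (subtopology (Top (tot W)) ?total_top). lev q \<in> {y} \<inter> carrier G}
        = {q \<in> ?Q. proj W q \<in> U \<and> lev q = y}"
    proof -
      have "lev q \<in> carrier G" if "q \<in> ?total_top" for q using ex[OF that] lev\<tau> by auto
      then show ?thesis using UT by auto
    qed
    ultimately show "openin (Top (tot W)) {q \<in> ?Q. proj W q \<in> U \<and> lev q = y}" by simp
  next
    have "continuous_map (subtopology (Top (base W)) T) (prod_topology (subtopology (Top (base W)) T) (discrete_topology (carrier G))) (\<lambda>x. (x, \<one>))"
      by (intro continuous_map_pairedI) (auto simp: continuous_map_const)
    from continuous_map_compose[OF this c\<tau>]
    have "continuous_map (subtopology (Top (base W)) T) (Top (tot W)) sc"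
      by (simp add: o_def sc_def[abs_def] continuous_map_in_subtopology)
    then show "continuous_map (subtopology (Top (base W)) U) (Top (tot W)) sc"
      by (rule continuous_map_from_subtopology_mono) (rule UT)
  qed
  then show ?thesis using T(2) p(2) Uo by (intro that[of U lev sc]) (auto simp: U_def)
qed

lemma circles_carrier: "X \<in> bundle_seqs G \<Longrightarrow> i \<in> circles X \<Longrightarrow> the (X ! i) \<in> carrier G"
  unfolding bundle_seqs_def circles_def by (auto dest: nth_mem)

lemma finite_circles: "finite (circles X)"
  unfolding circles_def by simp

lemma smooth_curve_facts:
  assumes c: "smooth_curve M b" and D: "(D, d) \<in> Atlas M" "openin (Top M) V" "V \<subseteq> D"
  shows "open {t. b t \<in> V}" "continuous_on {t. b t \<in> V} (\<lambda>t. vector_derivative (\<lambda>t. d (b t)) (at t))"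
proof -
  have cm: "continuous_map euclideanreal (Top M) b" using c by (simp add: smooth_curve_def)
  show o: "open {t. b t \<in> V}"
    using openin_continuous_map_preimage[OF cm D(2)] by simp
  have "smooth_on {t. b t \<in> D} (d \<circ> b)" using c D(1) by (auto simp: smooth_curve_def)
  then have "Ck_ext (Suc 0) {t. b t \<in> D} (\<lambda>t. d (b t))" using smooth_on_imp_Ck_ext by (fastforce simp: o_def)
  then have "Ck_ext (Suc 0) {t. b t \<in> V} (\<lambda>t. d (b t))" by (rule Ck_ext_subset) (use D(3) in blast)
  from Ck_ext_vector_derivative[OF this o]
  show "continuous_on {t. b t \<in> V} (\<lambda>t. vector_derivative (\<lambda>t. d (b t)) (at t))" .
qed

text \<open>Frame \<open>k\<close> of the associated line bundle comes from the section
  \<open>sc k\<close>, so the transition functions are \<open>\<xi>\<close> applied to group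
  coordinates; they are locally constant because the level sets of \<open>lev\<close> are open. The
  boundary curves \<open>\<beta> j t \<one>\<close> provide the parallel frames.\<close>

theorem cobordism_character:
  fixes G (structure) and \<xi> :: "'g \<Rightarrow> complex" and W :: "('p, 'q, 'g) gcob"
  assumes G: "group G" and \<xi>_norm: "\<And>x. x \<in> carrier G \<Longrightarrow> cmod (\<xi> x) = 1"
    and \<xi>_mult: "\<And>x y. x \<in> carrier G \<Longrightarrow> y \<in> carrier G \<Longrightarrow> \<xi> (x \<otimes> y) = \<xi> x * \<xi> y"
    and X: "X \<in> bundle_seqs G" and Y: "Y \<in> bundle_seqs G" and W: "W \<in> cobordisms G X Y"
  shows "(\<Prod>i\<in>circles X. \<xi> (the (X ! i))) = (\<Prod>i\<in>circles Y. \<xi> (the (Y ! i)))"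
proof -
  interpret group G by (rule G)
  let ?M = "base W" and ?P = "pts (base W)" and ?Q = "pts (tot W)"
  have oriented: "oriented_smooth_surface ?M" and comp: "compact_space (Top ?M)" and pbun: "principal_bundle G W"
    using W by (auto simp: cobordisms_def)
  have smooth: "smooth_surface ?M" using oriented by (simp add: oriented_smooth_surface_def)
  \<comment> \<open>All data at a point form one tuple, so that a single choice provides
    them.\<close>
  define ok where "ok p = (\<lambda>(U, u, c, r, lev, sc). openin (Top ?M) U \<and> (\<exists>D. (D, u) \<in> Atlas ?M \<and> U \<subseteq> D) \<and>
      cball c r \<inter> half_plane \<subseteq> u ` U \<and> 0 < r \<and> p \<in> U \<and> dist (u p) c < r \<and> level_data G W U lev sc)" for p
  have "\<exists>d. ok p d" if p: "p \<in> ?P" for p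
  proof -
    have "p \<in> (\<Union>c\<in>Atlas ?M. fst c)" using smooth p by (simp add: smooth_surface_def)
    then obtain D u where D: "(D, u) \<in> Atlas ?M" "p \<in> D" by auto
    obtain U lev sc where U: "openin (Top ?M) U" "p \<in> U" "U \<subseteq> D" "level_data G W U lev sc"
      using level_data_exists[OF G pbun p D(2) atlas_chart(1)[OF smooth D(1)]] by metis
    obtain T where T: "open T" "u ` U = half_plane \<inter> T"
      using chart_image_open[OF smooth D(1) U(1,3)] by (rule half_openE)
    have "u p \<in> T" using T(2) U(2) by blast
    then obtain r where "r > 0" "cball (u p) r \<subseteq> T" using T(1) open_contains_cball by blast
    then have "ok p (U, u, u p, r, lev, sc)" unfolding ok_def using U D T by auto
    then show ?thesis by blast
  qed
  then obtain d where d: "\<And>p. p \<in> ?P \<Longrightarrow> ok p (d p)" by metis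
  define Up where "Up p = fst (d p)" for p
  define up where "up p = fst (snd (d p))" for p
  define cp where "cp p = fst (snd (snd (d p)))" for p
  define rp where "rp p = fst (snd (snd (snd (d p))))" for p
  define lp where "lp p = fst (snd (snd (snd (snd (d p)))))" for p
  define sp where "sp p = snd (snd (snd (snd (snd (d p)))))" for p
  have dp: "openin (Top ?M) (Up p)" "\<exists>D. (D, up p) \<in> Atlas ?M \<and> Up p \<subseteq> D"
      "cball (cp p) (rp p) \<inter> half_plane \<subseteq> up p ` Up p" "0 < rp p" "p \<in> Up p" "dist (up p p) (cp p) < rp p"
      "level_data G W (Up p) (lp p) (sp p)" if "p \<in> ?P" for p
    using d[OF that] unfolding ok_def Up_def up_def cp_def rp_def lp_def sp_def by (auto split: prod.splits)
  \<comment> \<open>By compactness finitely many of these open half balls cover the surface, while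
    the closed ones still fit into the charts.\<close>
  define B where "B p = {q \<in> Up p. dist (up p q) (cp p) < rp p}" for p
  have Bo: "openin (Top ?M) (B p)" if p: "p \<in> ?P" for p
  proof -
    obtain D where D: "(D, up p) \<in> Atlas ?M" "Up p \<subseteq> D" using dp(2)[OF p] by blast
    have "continuous_map (subtopology (Top ?M) D) euclidean (up p)"
      using homeomorphic_imp_continuous_map[OF atlas_chart(3)[OF smooth D(1)]] by (simp add: continuous_map_in_subtopology)
    then have "continuous_map (subtopology (Top ?M) (Up p)) euclidean (up p)"
      by (rule continuous_map_from_subtopology_mono) (rule D(2))
    from openin_continuous_map_preimage[OF this, of "ball (cp p) (rp p)"]
    have "openin (subtopology (Top ?M) (Up p)) {q \<in> topspace (subtopology (Top ?M) (Up p)). up p q \<in> ball (cp p) (rp p)}" by simp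
    then have "openin (Top ?M) {q \<in> topspace (subtopology (Top ?M) (Up p)). up p q \<in> ball (cp p) (rp p)}"
      by (rule openin_trans_full[OF _ dp(1)[OF p]])
    moreover have "{q \<in> topspace (subtopology (Top ?M) (Up p)). up p q \<in> ball (cp p) (rp p)} = B p"
      using openin_subset[OF dp(1)[OF p]] by (auto simp: B_def dist_commute)
    ultimately show ?thesis by simp
  qed
  have "compactin (Top ?M) ?P" using comp by (simp add: compact_space_def)
  moreover have "?P \<subseteq> \<Union>(B ` ?P)" using dp(5,6) unfolding B_def by blast
  ultimately obtain \<F> where \<F>: "finite \<F>" "\<F> \<subseteq> B ` ?P" "?P \<subseteq> \<Union>\<F>"
    using compactinD[of "Top ?M" ?P "B ` ?P"] Bo by auto
  then obtain S where S: "S \<subseteq> ?P" "finite S" "?P \<subseteq> \<Union>(B ` S)"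
    using finite_subset_image[OF \<F>(1,2)] by metis
  obtain pk where pk: "bij_betw pk {0..<card S} S" using ex_bij_betw_nat_finite[OF S(2)] by blast
  define N where "N = card S"
  have pkS: "pk k \<in> ?P" if "k < N" for k using bij_betwE[OF pk] that S(1) by (auto simp: N_def)
  define U u lev sc where "U k = Up (pk k)" and "u k = up (pk k)" and "lev k = lp (pk k)" and "sc k = sp (pk k)" for k
  have lev: "level_data G W (U k) (lev k) (sc k)" if "k < N" for k
    using dp(7)[OF pkS[OF that]] by (simp add: U_def lev_def sc_def)
  interpret ball_cover ?M N U u "\<lambda>k. cp (pk k)" "\<lambda>k. rp (pk k)"
  proof
    show "oriented_smooth_surface ?M" by (rule oriented)
    show "\<exists>k<N. p \<in> U k \<and> dist (u k p) (cp (pk k)) < rp (pk k)" if p0: "p \<in> ?P" for p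
    proof -
      obtain q where q: "q \<in> S" "p \<in> B q" using S(3) p0 by blast
      then obtain k where "k < N" "q = pk k" using bij_betw_imp_surj_on[OF pk] by (force simp: N_def)
      then show ?thesis using q(2) by (auto simp: B_def U_def u_def)
    qed
  qed (use dp pkS in \<open>auto simp: U_def u_def\<close>)
  have scQ: "sc k x \<in> ?Q" "proj W (sc k x) = x" "lev k (sc k x) = \<one>" if "k < N" "x \<in> U k" for k x
    using lev[OF that(1)] that(2) by (auto simp: level_data_def)
  have lvl: "lev k q \<in> carrier G" "\<And>g. g \<in> carrier G \<Longrightarrow> act W g q \<in> ?Q" "\<And>g. g \<in> carrier G \<Longrightarrow> proj W (act W g q) = proj W q"
      "\<And>g. g \<in> carrier G \<Longrightarrow> lev k (act W g q) = g \<otimes> lev k q"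
    if "k < N" "q \<in> ?Q" "proj W q \<in> U k" for k q
    using lev[OF that(1)] that(2,3) by (auto simp: level_data_def)
  \<comment> \<open>\<open>q\<close> is the translate of \<open>sc k (proj W q)\<close> by
    \<open>lev k q\<close>, as both have the same projection and the same
    \<open>k\<close>-coordinate; now apply \<open>lev l\<close>.\<close>
  have lev_change: "lev l q = lev k q \<otimes> lev l (sc k (proj W q))"
    if kl: "k < N" "l < N" and q: "q \<in> ?Q" "proj W q \<in> U k" "proj W q \<in> U l" for k l q
  proof -
    let ?g = "lev k q" and ?s = "sc k (proj W q)"
    have g: "?g \<in> carrier G" by (rule lvl(1)[OF kl(1) q(1,2)])
    have s: "?s \<in> ?Q" "proj W ?s = proj W q" "lev k ?s = \<one>" using scQ[OF kl(1) q(2)] by auto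
    have sU: "proj W ?s \<in> U k" "proj W ?s \<in> U l" using s(2) q by auto
    have "act W ?g ?s = q"
    proof -
      have "act W ?g ?s \<in> ?Q" "proj W (act W ?g ?s) = proj W q" "lev k (act W ?g ?s) = lev k q"
        using lvl(2-4)[OF kl(1) s(1) sU(1) g] s g by auto
      then show ?thesis using lev[OF kl(1)] q by (auto simp: level_data_def)
    qed
    then show ?thesis using lvl(4)[OF kl(2) s(1) sU(2) g] by simp
  qed
  define \<epsilon> where "\<epsilon> k l x = \<xi> (lev l (sc k x))" for k l x
  interpret flat_line_bundle N ?P U u pou \<epsilon>
  proof (rule flat_line_bundleI)
    fix k l p assume kl: "k < N" "l < N" and p: "p \<in> U k \<inter> U l"
    have s: "sc k p \<in> ?Q" "proj W (sc k p) = p" using scQ[OF kl(1)] p by auto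
    show "cmod (\<epsilon> k l p) = 1" unfolding \<epsilon>_def using lvl(1)[OF kl(2) s(1)] s p by (intro \<xi>_norm) auto
    have o: "openin (Top ?M) {x \<in> topspace (subtopology (Top ?M) (U k)). sc k x \<in> {q \<in> ?Q. proj W q \<in> U l \<and> lev l q = lev l (sc k p)}}"
    proof (rule openin_trans_full[OF openin_continuous_map_preimage U_open[OF kl(1)]])
      show "continuous_map (subtopology (Top ?M) (U k)) (Top (tot W)) (sc k)" using lev[OF kl(1)] by (simp add: level_data_def)
      show "openin (Top (tot W)) {q \<in> ?Q. proj W q \<in> U l \<and> lev l q = lev l (sc k p)}" using lev[OF kl(2)] by (simp add: level_data_def)
    qed
    have "p \<in> ?P" using p openin_subset[OF U_open[OF kl(1)]] by blast
    then show "\<exists>V. openin (Top ?M) V \<and> p \<in> V \<and> (\<forall>q\<in>U k \<inter> U l \<inter> V. \<epsilon> k l q = \<epsilon> k l p)"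
      by - (intro exI conjI, rule o, use s p in \<open>auto simp: \<epsilon>_def\<close>)
  next
    fix k l m p assume klm: "k < N" "l < N" "m < N" and p: "p \<in> U k \<inter> U l \<inter> U m"
    have s: "sc k p \<in> ?Q" "proj W (sc k p) = p" using scQ[OF klm(1)] p by auto
    have s': "sc l p \<in> ?Q" "proj W (sc l p) = p" using scQ[OF klm(2)] p by auto
    have "lev m (sc k p) = lev l (sc k p) \<otimes> lev m (sc l p)"
      using lev_change[OF klm(2,3) s(1)] s p by simp
    then show "\<epsilon> k l p * \<epsilon> l m p = \<epsilon> k m p"
      unfolding \<epsilon>_def using lvl(1)[OF klm(2) s(1)] lvl(1)[OF klm(3) s'(1)] s s' p by (simp add: \<xi>_mult)
  qed
  \<comment> \<open>Source and target circles are treated together; targets have the sign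
    -1.\<close>
  define J where "J = circles X <+> circles Y"
  define s where "s = case_sum (\<lambda>i::nat. 1::real) (\<lambda>i::nat. -1)"
  define b where "b = case_sum (in_base W) (out_base W)"
  define \<beta> where "\<beta> = case_sum (in_total W) (out_total W)"
  define x where "x = case_sum (\<lambda>i. the (X ! i)) (\<lambda>i. the (Y ! i))"
  have xG: "x j \<in> carrier G" if "j \<in> J" for j
    using that circles_carrier[OF X] circles_carrier[OF Y] by (auto simp: J_def x_def)
  have bX: "bundle_seq_map G X W (in_base W) (in_total W)" and bY: "bundle_seq_map G Y W (out_base W) (out_total W)"
    using W by (auto simp: cobordisms_def)
  have b_curve: "smooth_curve ?M (b j)" and b_per: "\<And>t. b j (t + 1) = b j t" if "j \<in> J" for j
    using that bX bY by (auto simp: J_def b_def bundle_seq_map_def)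
  have \<beta>_curve: "smooth_curve (tot W) (\<lambda>t. \<beta> j t y)"
    and \<beta>_per: "\<And>t. \<beta> j (t + 1) (y \<otimes> x j) = \<beta> j t y" and \<beta>_proj: "\<And>t. proj W (\<beta> j t y) = b j t"
    and \<beta>_act: "\<And>t g. g \<in> carrier G \<Longrightarrow> act W g (\<beta> j t y) = \<beta> j t (g \<otimes> y)"
    if "j \<in> J" "y \<in> carrier G" for j y
    using that bX bY by (auto simp: J_def b_def \<beta>_def x_def bundle_seq_map_def)
  have \<beta>_cont: "continuous_map euclideanreal (Top (tot W)) (\<lambda>t. \<beta> j t \<one>)" if "j \<in> J" for j
    using \<beta>_curve[OF that one_closed] by (simp add: smooth_curve_def)
  have \<beta>Q: "\<beta> j t \<one> \<in> ?Q" if "j \<in> J" for j t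
    using \<beta>_cont[OF that] by (auto simp: continuous_map_def Pi_iff)
  have b_cont: "continuous_map euclideanreal (Top ?M) (b j)" if "j \<in> J" for j
    using b_curve[OF that] by (simp add: smooth_curve_def)
  have dirb: "boundary_direction (s j) ?M (b j)" if "j \<in> J" for j
    using that W by (auto simp: J_def s_def b_def cobordisms_def)
  define \<eta> where "\<eta> j k t = \<xi> (lev k (\<beta> j t \<one>))" for j k t
  have bij0: "bij_betw (case_sum (\<lambda>(i, t). in_base W i t) (\<lambda>(i, t). out_base W i t))
       ((circles X \<times> {0..<1}) <+> (circles Y \<times> {0..<1})) (surface_boundary ?M)"
    using W by (simp add: cobordisms_def)
  have bij: "bij_betw (\<lambda>(j, t). b j t) (J \<times> {0..<1}) (surface_boundary ?M)"
  proof -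
    let ?h = "\<lambda>(j, t). case j of Inl i \<Rightarrow> Inl (i, t) | Inr i \<Rightarrow> Inr (i, t)"
    have "bij_betw ?h (J \<times> {0..<1::real}) ((circles X \<times> {0..<1}) <+> (circles Y \<times> {0..<1}))"
      unfolding J_def
      by (rule bij_betwI[where g = "\<lambda>z. case z of Inl (i, t) \<Rightarrow> (Inl i, t) | Inr (i, t) \<Rightarrow> (Inr i, t)"])
        (auto split: sum.splits)
    from bij_betw_trans[OF this bij0]
    show ?thesis
      by (rule bij_betw_cong[THEN iffD1, rotated]) (auto simp: J_def b_def)
  qed
  have bd: "surface_boundary ?M = {p \<in> ?P. \<exists>k<N. p \<in> U k \<and> u k p $ 2 = 0}"
  proof (intro subset_antisym subsetI)
    fix p assume "p \<in> surface_boundary ?M"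
    then obtain D d where D: "(D, d) \<in> Atlas ?M" "p \<in> D" "d p $ 2 = 0" by (auto simp: surface_boundary_def)
    have p: "p \<in> ?P" using openin_subset[OF atlas_chart(1)[OF smooth D(1)]] D(2) by blast
    then obtain k where k: "k < N" "p \<in> U k" using covered by blast
    obtain D' where "(D', u k) \<in> Atlas ?M" "U k \<subseteq> D'" using in_atlas[OF k(1)] by blast
    then have "u k p $ 2 = 0" using boundary_point_iff[OF smooth D(1), of D' "u k" p] D k by blast
    then show "p \<in> {p \<in> ?P. \<exists>k<N. p \<in> U k \<and> u k p $ 2 = 0}" using p k by blast
  next
    fix p assume "p \<in> {p \<in> ?P. \<exists>k<N. p \<in> U k \<and> u k p $ 2 = 0}"
    then obtain k where k: "k < N" "p \<in> U k" "u k p $ 2 = 0" by blast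
    obtain D' where "(D', u k) \<in> Atlas ?M" "U k \<subseteq> D'" using in_atlas[OF k(1)] by blast
    then show "p \<in> surface_boundary ?M" using k unfolding surface_boundary_def by blast
  qed
  \<comment> \<open>The boundary bijection covers one period, and periodicity does the rest.\<close>
  have b_bd: "b j t \<in> surface_boundary ?M" if "j \<in> J" for j t
  proof -
    have "b j (frac t) \<in> surface_boundary ?M"
      using bij_betwE[OF bij] that frac_ge_0[of t] frac_lt_1[of t] by force
    then show ?thesis using periodic_frac[of "b j" t] b_per[OF that] by simp
  qed
  interpret flat_line_bundle_boundary N ?P U u pou \<epsilon> J s b \<eta> "\<lambda>j. \<xi> (inv (x j))"
  proof
    show "finite J" by (simp add: J_def finite_circles)
    show "bij_betw (\<lambda>(j, t). b j t) (J \<times> {0..<1}) {p \<in> ?P. \<exists>k<N. p \<in> U k \<and> u k p $ 2 = 0}"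
      using bij by (simp add: bd)
    fix j assume j: "j \<in> J"
    show "s j = 1 \<or> s j = - 1" by (cases j) (auto simp: s_def)
    show "b j t \<in> ?P" for t using b_cont[OF j] by (auto simp: continuous_map_def Pi_iff)
    show "b j 1 = b j 0" using b_per[OF j, of 0] by simp
    fix k assume k: "k < N"
    obtain D where D: "(D, u k) \<in> Atlas ?M" "U k \<subseteq> D" using in_atlas[OF k] by blast
    show "open {t. b j t \<in> U k}" "continuous_on {t. b j t \<in> U k} (\<lambda>t. vector_derivative (\<lambda>t. u k (b j t)) (at t))"
      by (rule smooth_curve_facts[OF b_curve[OF j] D(1) U_open[OF k] D(2)])+
    show "\<eta> j k 1 = \<xi> (inv x j) * \<eta> j k 0" if "b j 0 \<in> U k"
    proof -
      have i: "inv x j \<in> carrier G" using xG[OF j] by simp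
      \<comment> \<open>The gluing relation at the fibre coordinate \<open>inv x j\<close>: one turn
        multiplies the group coordinate on the left by the inverse of the monodromy.\<close>
      have "\<beta> j 1 \<one> = \<beta> j 0 (inv x j)" using \<beta>_per[OF j i, of 0] xG[OF j] by simp
      also have "\<dots> = act W (inv x j) (\<beta> j 0 \<one>)" using \<beta>_act[OF j one_closed i] i by simp
      finally have "lev k (\<beta> j 1 \<one>) = inv x j \<otimes> lev k (\<beta> j 0 \<one>)"
        using lvl(4)[OF k \<beta>Q[OF j] _ i] \<beta>_proj[OF j one_closed] that by simp
      then show ?thesis unfolding \<eta>_def using lvl(1)[OF k \<beta>Q[OF j]] \<beta>_proj[OF j one_closed] that i by (simp add: \<xi>_mult)
    qed
    fix t
    show "\<eta> j k t * \<epsilon> k l (b j t) = \<eta> j l t" if l: "l < N" and bt: "b j t \<in> U k \<inter> U l" for l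
    proof -
      have s: "sc k (b j t) \<in> ?Q" "proj W (sc k (b j t)) = b j t" using scQ[OF k] bt by auto
      have "lev l (\<beta> j t \<one>) = lev k (\<beta> j t \<one>) \<otimes> lev l (sc k (b j t))"
        using lev_change[OF k l \<beta>Q[OF j]] \<beta>_proj[OF j one_closed] bt by simp
      then show ?thesis
        unfolding \<eta>_def \<epsilon>_def using lvl(1)[OF k \<beta>Q[OF j]] lvl(1)[OF l s(1)] \<beta>_proj[OF j one_closed] s bt by (simp add: \<xi>_mult)
    qed
    assume bt: "b j t \<in> U k"
    show "u k (b j t) $ 2 = 0"
    proof -
      obtain D' d' where D': "(D', d') \<in> Atlas ?M" "b j t \<in> D'" "d' (b j t) $ 2 = 0"
        using b_bd[OF j, of t] by (auto simp: surface_boundary_def)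
      then show ?thesis using boundary_point_iff[OF smooth D'(1) D(1)] D(2) bt by blast
    qed
    show "\<exists>d. ((\<lambda>t. u k (b j t)) has_vector_derivative d) (at t) \<and> 0 < s j * d $ 1"
      using dirb[OF j] D bt unfolding boundary_direction_def by (fastforce simp: o_def)
    show "cmod (\<eta> j k t) = 1"
      unfolding \<eta>_def using lvl(1)[OF k \<beta>Q[OF j]] \<beta>_proj[OF j one_closed] bt by (intro \<xi>_norm) auto
    show "\<exists>A. open A \<and> t \<in> A \<and> (\<forall>t'\<in>A. b j t' \<in> U k \<and> \<eta> j k t' = \<eta> j k t)"
    proof (intro exI conjI ballI)
      let ?A = "{t'. \<beta> j t' \<one> \<in> {q \<in> ?Q. proj W q \<in> U k \<and> lev k q = lev k (\<beta> j t \<one>)}}"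
      have "openin (Top (tot W)) {q \<in> ?Q. proj W q \<in> U k \<and> lev k q = lev k (\<beta> j t \<one>)}"
        using lev[OF k] by (simp add: level_data_def)
      from openin_continuous_map_preimage[OF \<beta>_cont[OF j] this] show "open ?A" by simp
      show "t \<in> ?A" using \<beta>Q[OF j] \<beta>_proj[OF j one_closed] bt by simp
      show "b j t' \<in> U k" "\<eta> j k t' = \<eta> j k t" if "t' \<in> ?A" for t'
        using that \<beta>_proj[OF j one_closed] by (auto simp: \<eta>_def)
    qed
  qed
  have one: "\<xi> \<one> = 1"
    using \<xi>_mult[OF one_closed one_closed] \<xi>_norm[OF one_closed] by (metis l_one mult_cancel_right1 norm_zero one_closed zero_neq_one)
  have inv: "\<xi> (inv g) = inverse (\<xi> g)" if "g \<in> carrier G" for g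
    using \<xi>_mult[of g "inv g"] that one by (simp add: inverse_unique)
  have "(\<Prod>j\<in>J. if s j = 1 then \<xi> (inv (x j)) else inverse (\<xi> (inv (x j)))) = 1" by (rule boundary_holonomy)
  then have "(\<Prod>i\<in>circles X. \<xi> (inv (the (X ! i)))) * (\<Prod>i\<in>circles Y. inverse (\<xi> (inv (the (Y ! i))))) = 1"
    unfolding J_def by (simp add: prod.Plus finite_circles s_def x_def)
  moreover have "(\<Prod>i\<in>circles X. \<xi> (inv (the (X ! i)))) = inverse (\<Prod>i\<in>circles X. \<xi> (the (X ! i)))"
    using inv circles_carrier[OF X] by (simp flip: prod_inversef)
  moreover have "(\<Prod>i\<in>circles Y. inverse (\<xi> (inv (the (Y ! i))))) = (\<Prod>i\<in>circles Y. \<xi> (the (Y ! i)))"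
    using inv circles_carrier[OF Y] by simp
  moreover have "(\<Prod>i\<in>circles X. \<xi> (the (X ! i))) \<noteq> 0"
  proof -
    have "\<xi> (the (X ! i)) \<noteq> 0" if "i \<in> circles X" for i using \<xi>_norm[OF circles_carrier[OF X that]] by auto
    then show ?thesis by (simp add: finite_circles)
  qed
  ultimately show ?thesis by (simp add: field_simps)
qed

section \<open>Bundles from locally constant transition functions\<close>

lemma smooth_on_cong_subset:
  assumes f: "smooth_on S f" and T: "T \<subseteq> S" "\<And>x. x \<in> T \<Longrightarrow> f x = g x"
  shows "smooth_on T g"
  unfolding smooth_on_def
proof
  fix x assume x: "x \<in> T"
  then have "x \<in> S" using T(1) by blast
  then have "\<exists>A h. open A \<and> x \<in> A \<and> (\<forall>k. Ck_on k h A) \<and> (\<forall>y\<in>S \<inter> A. h y = f y)"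
    using f unfolding smooth_on_def by (rule bspec[rotated])
  then obtain A h where A: "open A" "x \<in> A" "\<forall>k. Ck_on k h A" "\<forall>y\<in>S \<inter> A. h y = f y"
    by (elim exE conjE) (rule that)
  show "\<exists>A h. open A \<and> x \<in> A \<and> (\<forall>k. Ck_on k h A) \<and> (\<forall>y\<in>T \<inter> A. h y = g y)"
    using A T by (intro exI[of _ A] exI[of _ h]) auto
qed

text \<open>The charts of \<open>S\<close> are charts of \<open>B\<close> composed with
  \<open>\<pi>\<close>, so that coordinates above and below agree.\<close>

definition lies_over :: "('q \<Rightarrow> 'p) \<Rightarrow> 'q surface \<Rightarrow> 'p surface \<Rightarrow> bool" where
  "lies_over \<pi> S B \<longleftrightarrow> (\<forall>(U', v)\<in>Atlas S. U' \<subseteq> pts S \<and>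
     (\<exists>(U, u)\<in>Atlas B. inj_on \<pi> U' \<and> \<pi> ` U' \<subseteq> U \<and> (\<forall>p\<in>U'. v p = u (\<pi> p))))"

lemma lies_overE:
  assumes "lies_over \<pi> S B" "(U', v) \<in> Atlas S"
  obtains U u where "(U, u) \<in> Atlas B" "inj_on \<pi> U'" "\<pi> ` U' \<subseteq> U" "\<And>p. p \<in> U' \<Longrightarrow> v p = u (\<pi> p)" "U' \<subseteq> pts S"
  using assms unfolding lies_over_def by fastforce

lemma lies_over_self: "smooth_surface B \<Longrightarrow> lies_over (\<lambda>p. p) B B"
  unfolding lies_over_def smooth_surface_def chart_of_def using openin_subset by fastforce

text \<open>In coordinates a map over the identity of \<open>B\<close> is a restriction of a
  transition map of \<open>B\<close>, so continuity is all that remains to be checked.\<close>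

lemma over_smooth_map:
  assumes B: "smooth_surface B" and S: "lies_over p S B" and T: "lies_over q T B"
    and F: "continuous_map (Top S) (Top T) F" "\<And>x. x \<in> pts S \<Longrightarrow> q (F x) = p x"
  shows "smooth_map S T F"
  unfolding smooth_map_def
proof (intro conjI ballI F(1))
  fix c d assume cd: "c \<in> Atlas S" "d \<in> Atlas T"
  obtain U' v V' w where c: "c = (U', v)" and d: "d = (V', w)" by fastforce
  obtain U u where U: "(U, u) \<in> Atlas B" "inj_on p U'" "p ` U' \<subseteq> U" "\<And>a. a \<in> U' \<Longrightarrow> v a = u (p a)" "U' \<subseteq> pts S"
    using lies_overE[OF S, of U' v] cd c by blast
  obtain V z where V: "(V, z) \<in> Atlas B" "inj_on q V'" "q ` V' \<subseteq> V" "\<And>a. a \<in> V' \<Longrightarrow> w a = z (q a)" "V' \<subseteq> pts T"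
    using lies_overE[OF T, of V' w] cd d by blast
  have inju: "inj_on u U" using atlas_chart(4)[OF B U(1)] .
  have injv: "inj_on v U'"
  proof (rule inj_onI)
    fix a b assume ab: "a \<in> U'" "b \<in> U'" "v a = v b"
    then have "p a = p b" using inj_onD[OF inju, of "p a" "p b"] U(3,4) by auto
    then show "a = b" using inj_onD[OF U(2)] ab by blast
  qed
  have eq: "y \<in> u ` (U \<inter> V) \<and> z (inv_into U u y) = coord_rep F c d y" if y: "y \<in> coord_dom F c d" for y
  proof -
    obtain a where a: "a \<in> U'" "F a \<in> V'" "y = v a" using y unfolding coord_dom_def c d by auto
    have qa: "q (F a) = p a" using F(2) U(5) a(1) by blast
    have pa: "p a \<in> U" "p a \<in> V" using U(3) a(1) V(3) a(2) qa by force+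
    have "y = u (p a)" using a U(4) by simp
    then have "inv_into U u y = p a" "inv_into U' v y = a"
      using inv_into_f_f[OF inju pa(1)] inv_into_f_f[OF injv a(1)] a(3) by simp_all
    then show ?thesis using pa qa V(4)[OF a(2)] \<open>y = u (p a)\<close> by (simp add: coord_rep_def c d)
  qed
  show "smooth_on (coord_dom F c d) (coord_rep F c d)"
    by (rule smooth_on_cong_subset[OF transition_smooth[OF B U(1) V(1)]]) (use eq in auto)
qed

lemma over_smooth_curve:
  assumes S: "lies_over \<pi> S B" and b: "continuous_map euclideanreal (Top S) b" "smooth_curve B (\<lambda>t. \<pi> (b t))"
  shows "smooth_curve S b"
  unfolding smooth_curve_def
proof (intro conjI b(1) ballI, clarify)
  fix U' v assume "(U', v) \<in> Atlas S"
  from lies_overE[OF S this] obtain U u where U: "(U, u) \<in> Atlas B" "\<pi> ` U' \<subseteq> U" "\<And>a. a \<in> U' \<Longrightarrow> v a = u (\<pi> a)" by metis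
  have "smooth_on {t. \<pi> (b t) \<in> U} (u \<circ> (\<lambda>t. \<pi> (b t)))" using b(2) U(1) unfolding smooth_curve_def by auto
  then show "smooth_on {t. b t \<in> U'} (v \<circ> b)" by (rule smooth_on_cong_subset) (use U in auto)
qed

lemma lies_over_restrict:
  assumes S: "lies_over \<pi> S B" and W: "W \<subseteq> pts S"
  shows "lies_over \<pi> (restrict_surface S W) B"
  unfolding lies_over_def
proof clarify
  fix U' v assume "(U', v) \<in> Atlas (restrict_surface S W)"
  then obtain V where V: "(V, v) \<in> Atlas S" "U' = V \<inter> W" by (auto simp: restrict_surface_def)
  from lies_overE[OF S V(1)] obtain U u where
    U: "(U, u) \<in> Atlas B" "inj_on \<pi> V" "\<pi> ` V \<subseteq> U" "\<And>p. p \<in> V \<Longrightarrow> v p = u (\<pi> p)" by metis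
  show "U' \<subseteq> pts (restrict_surface S W) \<and>
      (\<exists>(U, u)\<in>Atlas B. inj_on \<pi> U' \<and> \<pi> ` U' \<subseteq> U \<and> (\<forall>p\<in>U'. v p = u (\<pi> p)))"
    using U(2-4) W unfolding V(2)
    by (intro conjI bexI[OF _ U(1)]) (auto simp: restrict_surface_def inj_on_def)
qed

lemma lies_over_times: "lies_over \<pi> S B \<Longrightarrow> lies_over (\<lambda>x. \<pi> (fst x)) (times_discrete S A) B"
  unfolding lies_over_def
proof clarify
  fix U' v assume S: "\<forall>(U', v)\<in>Atlas S. U' \<subseteq> pts S \<and>
       (\<exists>(U, u)\<in>Atlas B. inj_on \<pi> U' \<and> \<pi> ` U' \<subseteq> U \<and> (\<forall>p\<in>U'. v p = u (\<pi> p)))" "(U', v) \<in> Atlas (times_discrete S A)"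
  then obtain V w a where V: "(V, w) \<in> Atlas S" "a \<in> A" "U' = V \<times> {a}" "v = w \<circ> fst" by (auto simp: times_discrete_def)
  obtain U u where "(U, u) \<in> Atlas B" "inj_on \<pi> V" "\<pi> ` V \<subseteq> U" "\<forall>p\<in>V. w p = u (\<pi> p)" "V \<subseteq> pts S"
    using S(1) V(1) by fastforce
  then show "U' \<subseteq> pts (times_discrete S A) \<and> (\<exists>(U, u)\<in>Atlas B. inj_on (\<lambda>x. \<pi> (fst x)) U' \<and> (\<lambda>x. \<pi> (fst x)) ` U' \<subseteq> U \<and>
       (\<forall>p\<in>U'. v p = u (\<pi> (fst p))))"
    using V by (intro conjI bexI[of _ "(U, u)"]) (auto simp: times_discrete_def inj_on_def)
qed

text \<open>As a set the total space is a product with points \<open>e x y\<close>, but its sheets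
  over \<open>A i\<close> are given by \<open>e x (y \<otimes> \<kappa> i x)\<close>. The twist is
  on the right and so commutes with the left action. Local constancy is asked of the quotients of
  the \<open>\<kappa> i\<close>; a single \<open>\<kappa> i\<close> may jump, and this allows
  nontrivial bundles.\<close>

locale etale_bundle =
  fixes G :: "('g, 'r) monoid_scheme" (structure) and B :: "'p surface" and e :: "'p \<Rightarrow> 'g \<Rightarrow> 'q" and \<pi> :: "'q \<Rightarrow> 'p" and lev :: "'q \<Rightarrow> 'g"
    and I :: "'i set" and A :: "'i \<Rightarrow> 'p set" and \<kappa> :: "'i \<Rightarrow> 'p \<Rightarrow> 'g"
  assumes G: "group G" and finG: "finite (carrier G)" and finI: "finite I" and B: "smooth_surface B"
    and \<pi>_e: "\<And>x y. x \<in> pts B \<Longrightarrow> y \<in> carrier G \<Longrightarrow> \<pi> (e x y) = x"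
    and lev_e: "\<And>x y. x \<in> pts B \<Longrightarrow> y \<in> carrier G \<Longrightarrow> lev (e x y) = y"
    and A_open: "\<And>i. i \<in> I \<Longrightarrow> openin (Top B) (A i)" and A_cover: "(\<Union>i\<in>I. A i) = pts B"
    and \<kappa>_closed: "\<And>i x. i \<in> I \<Longrightarrow> x \<in> A i \<Longrightarrow> \<kappa> i x \<in> carrier G"
    and locally_const: "\<And>i j g. i \<in> I \<Longrightarrow> j \<in> I \<Longrightarrow> openin (Top B) {x \<in> A i \<inter> A j. \<kappa> i x \<otimes> inv (\<kappa> j x) = g}"
begin

interpretation group G by (rule G)

definition s :: "'i \<Rightarrow> 'g \<Rightarrow> 'p \<Rightarrow> 'q" where "s i y x = e x (y \<otimes> \<kappa> i x)"

definition Q :: "'q set" where "Q = {e x y | x y. x \<in> pts B \<and> y \<in> carrier G}"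

text \<open>The finest topology in which all local sections \<open>s i y\<close> are
  continuous.\<close>

definition total_top :: "'q topology" where
  "total_top = topology (\<lambda>N. N \<subseteq> Q \<and> (\<forall>i\<in>I. \<forall>y\<in>carrier G. openin (Top B) {x \<in> A i. s i y x \<in> N}))"

definition E :: "'q surface" where
  "E = \<lparr>Top = total_top, Atlas = {(s i y ` (A i \<inter> D), d \<circ> \<pi>) | i y D d. i \<in> I \<and> y \<in> carrier G \<and> (D, d) \<in> Atlas B}\<rparr>"

text \<open>Restricted to \<open>Q\<close> because \<open>BijGroup\<close> consists of extensional
  functions.\<close>

definition translate :: "'g \<Rightarrow> 'q \<Rightarrow> 'q" where "translate g = (\<lambda>q\<in>Q. e (\<pi> q) (g \<otimes> lev q))"

lemma A_pts: "i \<in> I \<Longrightarrow> x \<in> A i \<Longrightarrow> x \<in> pts B"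
  using A_cover by blast

lemma e_Q: "x \<in> pts B \<Longrightarrow> y \<in> carrier G \<Longrightarrow> e x y \<in> Q"
  by (auto simp: Q_def)

lemma Q_cases: "q \<in> Q \<Longrightarrow> \<pi> q \<in> pts B \<and> lev q \<in> carrier G \<and> e (\<pi> q) (lev q) = q"
  by (auto simp: Q_def \<pi>_e lev_e)

lemma e_eq_iff: "x \<in> pts B \<Longrightarrow> y \<in> carrier G \<Longrightarrow> x' \<in> pts B \<Longrightarrow> y' \<in> carrier G \<Longrightarrow> e x y = e x' y' \<longleftrightarrow> x = x' \<and> y = y'"
  using \<pi>_e lev_e by metis

lemma s_facts:
  assumes "i \<in> I" "y \<in> carrier G" "x \<in> A i"
  shows "s i y x \<in> Q" "\<pi> (s i y x) = x" "lev (s i y x) = y \<otimes> \<kappa> i x"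
  using A_pts[OF assms(1,3)] \<kappa>_closed[OF assms(1,3)] assms(2) by (simp_all add: s_def e_Q \<pi>_e lev_e)

lemma s_surj:
  assumes q: "q \<in> Q" and i: "i \<in> I" "\<pi> q \<in> A i"
  shows "q = s i (lev q \<otimes> inv (\<kappa> i (\<pi> q))) (\<pi> q)"
  using Q_cases[OF q] \<kappa>_closed[OF i] by (simp add: s_def m_assoc)

lemma s_eq_iff:
  assumes i: "i \<in> I" "x \<in> A i" "y \<in> carrier G" and j: "j \<in> I" "x \<in> A j" "y' \<in> carrier G"
  shows "s i y x = s j y' x \<longleftrightarrow> \<kappa> i x \<otimes> inv (\<kappa> j x) = inv y \<otimes> y'"
proof -
  have k: "\<kappa> i x \<in> carrier G" "\<kappa> j x \<in> carrier G" using \<kappa>_closed i j by auto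
  have "s i y x = s j y' x \<longleftrightarrow> y \<otimes> \<kappa> i x = y' \<otimes> \<kappa> j x"
    using A_pts[OF i(1,2)] k i(3) j(3) by (simp add: s_def e_eq_iff)
  also have "\<dots> \<longleftrightarrow> inv y \<otimes> (y \<otimes> \<kappa> i x) \<otimes> inv (\<kappa> j x) = inv y \<otimes> (y' \<otimes> \<kappa> j x) \<otimes> inv (\<kappa> j x)"
    using k i(3) j(3) by (simp only: right_cancel Units_l_cancel Units_eq inv_closed m_closed)
  also have "inv y \<otimes> (y \<otimes> \<kappa> i x) = \<kappa> i x"
    using k i(3) by (simp flip: m_assoc)
  also have "inv y \<otimes> (y' \<otimes> \<kappa> j x) \<otimes> inv (\<kappa> j x) = inv y \<otimes> y'"
    using k i(3) j(3) by (simp add: m_assoc)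
  finally show ?thesis .
qed

text \<open>Two sections agree where a locally constant function takes a given value. This openness
  makes the sheets open and the sections homeomorphisms onto them.\<close>

lemma s_agree_open:
  assumes "i \<in> I" "y \<in> carrier G" "j \<in> I" "y' \<in> carrier G"
  shows "openin (Top B) {x \<in> A i \<inter> A j. s i y x = s j y' x}"
proof -
  have "{x \<in> A i \<inter> A j. s i y x = s j y' x} = {x \<in> A i \<inter> A j. \<kappa> i x \<otimes> inv (\<kappa> j x) = inv y \<otimes> y'}"
    using s_eq_iff assms by blast
  then show ?thesis using locally_const[OF assms(1,3)] by simp
qed

lemma openin_total_top: "openin total_top N \<longleftrightarrow> N \<subseteq> Q \<and> (\<forall>i\<in>I. \<forall>y\<in>carrier G. openin (Top B) {x \<in> A i. s i y x \<in> N})"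
proof -
  have "istopology (\<lambda>N. N \<subseteq> Q \<and> (\<forall>i\<in>I. \<forall>y\<in>carrier G. openin (Top B) {x \<in> A i. s i y x \<in> N}))"
    unfolding istopology_def
  proof (intro conjI allI impI ballI)
    fix S T i y
    assume "S \<subseteq> Q \<and> (\<forall>i\<in>I. \<forall>y\<in>carrier G. openin (Top B) {x \<in> A i. s i y x \<in> S})"
      "T \<subseteq> Q \<and> (\<forall>i\<in>I. \<forall>y\<in>carrier G. openin (Top B) {x \<in> A i. s i y x \<in> T})" and i: "i \<in> I" "y \<in> carrier G"
    then have "openin (Top B) ({x \<in> A i. s i y x \<in> S} \<inter> {x \<in> A i. s i y x \<in> T})" by blast
    moreover have "{x \<in> A i. s i y x \<in> S} \<inter> {x \<in> A i. s i y x \<in> T} = {x \<in> A i. s i y x \<in> S \<inter> T}" by blast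
    ultimately show "openin (Top B) {x \<in> A i. s i y x \<in> S \<inter> T}" by simp
  next
    fix \<K> i y
    assume K: "\<forall>K\<in>\<K>. K \<subseteq> Q \<and> (\<forall>i\<in>I. \<forall>y\<in>carrier G. openin (Top B) {x \<in> A i. s i y x \<in> K})" and i: "i \<in> I" "y \<in> carrier G"
    then have "openin (Top B) (\<Union>K\<in>\<K>. {x \<in> A i. s i y x \<in> K})" by blast
    moreover have "(\<Union>K\<in>\<K>. {x \<in> A i. s i y x \<in> K}) = {x \<in> A i. s i y x \<in> \<Union>\<K>}" by blast
    ultimately show "openin (Top B) {x \<in> A i. s i y x \<in> \<Union>\<K>}" by simp
  qed auto
  then show ?thesis by (simp add: total_top_def)
qed

lemma topspace_total_top: "topspace total_top = Q"
proof -
  have "openin total_top Q"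
  proof -
    have "{x \<in> A i. s i y x \<in> Q} = A i" if "i \<in> I" "y \<in> carrier G" for i y using s_facts(1)[OF that] by blast
    then show ?thesis using A_open by (simp add: openin_total_top)
  qed
  then show ?thesis using openin_total_top openin_topspace openin_subset by (metis subset_antisym)
qed

lemma pts_E: "pts E = Q"
  by (simp add: E_def topspace_total_top)

lemma \<pi>_continuous: "continuous_map total_top (Top B) \<pi>"
  unfolding continuous_map_def
proof (intro conjI allI impI)
  show "\<pi> \<in> topspace total_top \<rightarrow> pts B" using Q_cases by (auto simp: topspace_total_top)
  fix V assume V: "openin (Top B) V"
  have "{x \<in> A i. s i y x \<in> {q \<in> Q. \<pi> q \<in> V}} = A i \<inter> V" if "i \<in> I" "y \<in> carrier G" for i y
    using s_facts[OF that] by auto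
  then show "openin total_top {q \<in> topspace total_top. \<pi> q \<in> V}" using A_open V by (auto simp: openin_total_top topspace_total_top)
qed

lemma s_open:
  assumes i: "i \<in> I" "y \<in> carrier G" and V: "openin (Top B) V" "V \<subseteq> A i"
  shows "openin total_top (s i y ` V)"
  unfolding openin_total_top
proof (intro conjI ballI)
  show "s i y ` V \<subseteq> Q" using s_facts(1)[OF i] V(2) by blast
  fix j y' assume j: "j \<in> I" "y' \<in> carrier G"
  have "{x \<in> A j. s j y' x \<in> s i y ` V} = V \<inter> {x \<in> A i \<inter> A j. s i y x = s j y' x}"
  proof (intro subset_antisym subsetI)
    fix x assume x: "x \<in> {x \<in> A j. s j y' x \<in> s i y ` V}"
    then obtain x' where x': "x' \<in> V" "s j y' x = s i y x'" by blast
    then have "x = x'" using s_facts(2)[OF j, of x] s_facts(2)[OF i, of x'] x V(2) by auto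
    then show "x \<in> V \<inter> {x \<in> A i \<inter> A j. s i y x = s j y' x}" using x x' V(2) by auto
  qed (auto intro: rev_image_eqI)
  then show "openin (Top B) {x \<in> A j. s j y' x \<in> s i y ` V}" using openin_Int[OF V(1) s_agree_open[OF i j]] by (simp only:)
qed

lemma s_homeomorphic:
  assumes i: "i \<in> I" "y \<in> carrier G" and V: "openin (Top B) V" "V \<subseteq> A i"
  shows "homeomorphic_maps (subtopology (Top B) V) (subtopology total_top (s i y ` V)) (s i y) \<pi>"
  unfolding homeomorphic_maps_def
proof (intro conjI)
  have VB: "V \<subseteq> pts B" using openin_subset[OF V(1)] .
  show "continuous_map (subtopology (Top B) V) (subtopology total_top (s i y ` V)) (s i y)"
    unfolding continuous_map_in_subtopology
  proof
    show "continuous_map (subtopology (Top B) V) total_top (s i y)"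
      unfolding continuous_map_def
    proof (intro conjI allI impI)
      show "s i y \<in> topspace (subtopology (Top B) V) \<rightarrow> topspace total_top"
        using s_facts(1)[OF i] V(2) by (auto simp: topspace_total_top)
      fix N assume "openin total_top N"
      then have "openin (Top B) {x \<in> A i. s i y x \<in> N}" using i by (simp add: openin_total_top)
      moreover have "{x \<in> topspace (subtopology (Top B) V). s i y x \<in> N} = {x \<in> A i. s i y x \<in> N} \<inter> V" using V(2) VB by auto
      ultimately show "openin (subtopology (Top B) V) {x \<in> topspace (subtopology (Top B) V). s i y x \<in> N}"
        by (auto simp: openin_subtopology)
    qed
  qed auto
  show "continuous_map (subtopology total_top (s i y ` V)) (subtopology (Top B) V) \<pi>"
    unfolding continuous_map_in_subtopology using s_facts(2)[OF i] V(2)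
    by (auto intro: continuous_map_from_subtopology[OF \<pi>_continuous])
  show "\<forall>x\<in>topspace (subtopology (Top B) V). \<pi> (s i y x) = x" using s_facts(2)[OF i] V(2) by auto
  then show "\<forall>q\<in>topspace (subtopology total_top (s i y ` V)). s i y (\<pi> q) = q" using VB by auto
qed

lemma E_chart:
  assumes "c \<in> Atlas E" shows "chart_of total_top c"
proof -
  obtain i y D d where i: "i \<in> I" "y \<in> carrier G" and D: "(D, d) \<in> Atlas B" and c: "c = (s i y ` (A i \<inter> D), d \<circ> \<pi>)"
    using assms by (auto simp: E_def)
  let ?V = "A i \<inter> D"
  have V: "openin (Top B) ?V" using A_open[OF i(1)] atlas_chart(1)[OF B D] by blast
  have im: "(d \<circ> \<pi>) ` s i y ` ?V = d ` ?V" using s_facts(2)[OF i] by (force simp: image_iff)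
  have sp: "homeomorphic_map (subtopology total_top (s i y ` ?V)) (subtopology (Top B) ?V) \<pi>"
    using s_homeomorphic[OF i V] homeomorphic_maps_map by blast
  have "homeomorphic_map (subtopology (subtopology (Top B) D) ?V) (subtopology (top_of_set (d ` D)) (d ` ?V)) d"
    by (rule homeomorphic_map_subtopologies[OF atlas_chart(3)[OF B D]])
      (use openin_subset[OF V] in auto)
  then have "homeomorphic_map (subtopology (Top B) ?V) (top_of_set (d ` ?V)) d"
    by (simp add: subtopology_subtopology Int_absorb1 image_mono inf.absorb2)
  from homeomorphic_map_compose[OF sp this]
  have "homeomorphic_map (subtopology total_top (s i y ` ?V)) (top_of_set (d ` ?V)) (d \<circ> \<pi>)" .
  then show ?thesis
    unfolding chart_of_def c using s_open[OF i V] chart_image_open[OF B D V] im by simp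
qed

lemma E_over: "lies_over \<pi> E B"
  unfolding lies_over_def
proof clarify
  fix U' v assume "(U', v) \<in> Atlas E"
  then obtain i y D d where i: "i \<in> I" "y \<in> carrier G" and D: "(D, d) \<in> Atlas B" and c: "U' = s i y ` (A i \<inter> D)" "v = d \<circ> \<pi>"
    by (auto simp: E_def)
  have p: "\<pi> (s i y x) = x" if "x \<in> A i" for x using s_facts(2)[OF i that] .
  show "U' \<subseteq> pts E \<and> (\<exists>(U, u)\<in>Atlas B. inj_on \<pi> U' \<and> \<pi> ` U' \<subseteq> U \<and> (\<forall>p\<in>U'. v p = u (\<pi> p)))"
    using s_facts(1)[OF i] p c by (intro conjI bexI[OF _ D]) (auto simp: pts_E inj_on_def)
qed

lemma E_smooth: "smooth_surface E"
  unfolding smooth_surface_def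
proof (intro conjI)
  have T: "Top E = total_top" by (simp add: E_def)
  show "\<forall>c\<in>Atlas E. chart_of (Top E) c" using E_chart T by simp
  show "smooth_map E E (\<lambda>p. p)" by (rule over_smooth_map[OF B E_over E_over]) auto
  show "(\<Union>c\<in>Atlas E. fst c) = pts E"
  proof (intro subset_antisym subsetI)
    fix q assume "q \<in> (\<Union>c\<in>Atlas E. fst c)"
    then show "q \<in> pts E" using E_over by (fastforce simp: lies_over_def)
  next
    fix q assume "q \<in> pts E"
    then have q: "q \<in> Q" by (simp add: pts_E)
    obtain i where i: "i \<in> I" "\<pi> q \<in> A i" using Q_cases[OF q] A_cover by blast
    have "\<pi> q \<in> (\<Union>c\<in>Atlas B. fst c)" using B Q_cases[OF q] by (simp add: smooth_surface_def)
    then obtain D d where D: "(D, d) \<in> Atlas B" "\<pi> q \<in> D" by auto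
    have y: "lev q \<otimes> inv (\<kappa> i (\<pi> q)) \<in> carrier G" using Q_cases[OF q] \<kappa>_closed[OF i] by simp
    have "(s i (lev q \<otimes> inv (\<kappa> i (\<pi> q))) ` (A i \<inter> D), d \<circ> \<pi>) \<in> Atlas E" using i y D by (auto simp: E_def)
    moreover have "q \<in> s i (lev q \<otimes> inv (\<kappa> i (\<pi> q))) ` (A i \<inter> D)"
      by (rule image_eqI[where x = "\<pi> q"], rule s_surj[OF q i]) (use i D in simp)
    ultimately show "q \<in> (\<Union>c\<in>Atlas E. fst c)" by (intro UN_I[of "(_, _)"]) auto
  qed
  show "Hausdorff_space (Top E)"
    unfolding Hausdorff_space_def T topspace_total_top
  proof (intro allI impI, elim conjE)
    fix q q' assume q: "q \<in> Q" "q' \<in> Q" "q \<noteq> q'"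
    show "\<exists>U V. openin total_top U \<and> openin total_top V \<and> q \<in> U \<and> q' \<in> V \<and> disjnt U V"
    \<comment> \<open>Points over different base points are separated in the base; over the same
      base point the sheets through \<open>q\<close> and \<open>q'\<close> are disjoint.\<close>
    proof (cases "\<pi> q = \<pi> q'")
      case False
      have "Hausdorff_space (Top B)" using B by (simp add: smooth_surface_def)
      then obtain U V where UV: "openin (Top B) U" "openin (Top B) V" "\<pi> q \<in> U" "\<pi> q' \<in> V" "disjnt U V"
        using False Q_cases[OF q(1)] Q_cases[OF q(2)] unfolding Hausdorff_space_def by metis
      show ?thesis
        by (intro exI conjI, rule openin_continuous_map_preimage[OF \<pi>_continuous UV(1)],
            rule openin_continuous_map_preimage[OF \<pi>_continuous UV(2)])
          (use UV(3-5) q in \<open>auto simp: topspace_total_top disjnt_iff\<close>)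
    next
      case True
      obtain i where i: "i \<in> I" "\<pi> q \<in> A i" using Q_cases[OF q(1)] A_cover by blast
      let ?y = "lev q \<otimes> inv (\<kappa> i (\<pi> q))" and ?y' = "lev q' \<otimes> inv (\<kappa> i (\<pi> q))"
      have y: "?y \<in> carrier G" "?y' \<in> carrier G" using Q_cases[OF q(1)] Q_cases[OF q(2)] \<kappa>_closed[OF i] by auto
      have qs: "q = s i ?y (\<pi> q)" "q' = s i ?y' (\<pi> q)" using s_surj[OF q(1) i] s_surj[OF q(2) i(1)] i(2) True by auto
      have "s i ?y x \<noteq> s i ?y' x'" if x: "x \<in> A i" "x' \<in> A i" for x x'
      proof
        assume eq: "s i ?y x = s i ?y' x'"
        then have "x = x'" using s_facts(2)[OF i(1) y(1) x(1)] s_facts(2)[OF i(1) y(2) x(2)] by simp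
        then have "?y \<otimes> \<kappa> i x = ?y' \<otimes> \<kappa> i x"
          using eq s_facts(3)[OF i(1) y(1) x(1)] s_facts(3)[OF i(1) y(2) x(2)] by simp
        then have "?y = ?y'" using right_cancel[OF \<kappa>_closed[OF i(1) x(1)] y] by simp
        then show False using qs q(3) by metis
      qed
      then have "disjnt (s i ?y ` A i) (s i ?y' ` A i)" by (force simp: disjnt_iff)
      moreover have "q \<in> s i ?y ` A i" "q' \<in> s i ?y' ` A i" using qs i(2) by blast+
      ultimately show ?thesis using s_open[OF i(1) y(1) A_open[OF i(1)] subset_refl] s_open[OF i(1) y(2) A_open[OF i(1)] subset_refl]
        by blast
    qed
  qed
  show "second_countable (Top E)"
  proof -
    have "second_countable (Top B)" using B by (simp add: smooth_surface_def)
    then obtain \<B> where \<B>: "countable \<B>" "\<forall>V\<in>\<B>. openin (Top B) V"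
        "\<forall>U x. openin (Top B) U \<and> x \<in> U \<longrightarrow> (\<exists>V\<in>\<B>. x \<in> V \<and> V \<subseteq> U)"
      unfolding second_countable_def by (elim exE conjE) (rule that)
    \<comment> \<open>Finitely many sections, applied to a countable base of the topology
      below.\<close>
    define C where "C = (\<lambda>(i, y, V). s i y ` V) ` {(i, y, V). i \<in> I \<and> y \<in> carrier G \<and> V \<in> \<B> \<and> V \<subseteq> A i}"
    have "countable (I \<times> carrier G \<times> \<B>)" using countable_finite[OF finI] countable_finite[OF finG] \<B>(1) by simp
    then have cC: "countable C" unfolding C_def by (intro countable_image) (rule countable_subset[rotated], auto)
    have oC: "openin total_top N" if "N \<in> C" for N using that[unfolded C_def] s_open \<B>(2) by auto
    have bC: "\<exists>V\<in>C. q \<in> V \<and> V \<subseteq> N" if N: "openin total_top N" "q \<in> N" for N q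
    proof -
      have q: "q \<in> Q" using N openin_subset topspace_total_top by blast
      obtain i where i: "i \<in> I" "\<pi> q \<in> A i" using Q_cases[OF q] A_cover by blast
      let ?y = "lev q \<otimes> inv (\<kappa> i (\<pi> q))"
      have y: "?y \<in> carrier G" using Q_cases[OF q] \<kappa>_closed[OF i] by simp
      have "openin (Top B) {x \<in> A i. s i ?y x \<in> N}" using N(1) i(1) y by (simp add: openin_total_top)
      moreover have "\<pi> q \<in> {x \<in> A i. s i ?y x \<in> N}" using i(2) s_surj[OF q i] N(2) by simp
      ultimately obtain V where V: "V \<in> \<B>" "\<pi> q \<in> V" "V \<subseteq> {x \<in> A i. s i ?y x \<in> N}" using \<B>(3) by meson
      have "s i ?y ` V \<in> C" unfolding C_def by (rule image_eqI[where x = "(i, ?y, V)"]) (use V i y in auto)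
      moreover have "q \<in> s i ?y ` V" using s_surj[OF q i] V(2) by blast
      moreover have "s i ?y ` V \<subseteq> N" using V(3) by blast
      ultimately show ?thesis by (intro bexI conjI)
    qed
    show ?thesis unfolding second_countable_def T
      by (intro exI[of _ C] conjI ballI allI impI) (rule cC, erule oC, elim conjE, erule (1) bC)
  qed
qed

lemma translate_facts:
  assumes "g \<in> carrier G" "q \<in> Q"
  shows "translate g q \<in> Q" "\<pi> (translate g q) = \<pi> q" "lev (translate g q) = g \<otimes> lev q"
  using Q_cases[OF assms(2)] assms by (simp_all add: translate_def e_Q \<pi>_e lev_e)

lemma translate_s:
  "g \<in> carrier G \<Longrightarrow> i \<in> I \<Longrightarrow> y \<in> carrier G \<Longrightarrow> x \<in> A i \<Longrightarrow> translate g (s i y x) = s i (g \<otimes> y) x"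
  using s_facts[of i y x] \<kappa>_closed[of i x] by (simp add: translate_def) (simp add: s_def m_assoc)

lemma translate_continuous: "g \<in> carrier G \<Longrightarrow> continuous_map total_top total_top (translate g)"
  unfolding continuous_map_def topspace_total_top
proof (intro conjI allI impI)
  assume g: "g \<in> carrier G"
  show "translate g \<in> Q \<rightarrow> Q" using translate_facts(1)[OF g] by blast
  fix N assume N: "openin total_top N"
  have "{x \<in> A i. s i y x \<in> {q \<in> Q. translate g q \<in> N}} = {x \<in> A i. s i (g \<otimes> y) x \<in> N}"
    if "i \<in> I" "y \<in> carrier G" for i y
    using translate_s[OF g that] s_facts(1)[OF that] by auto
  then show "openin total_top {q \<in> Q. translate g q \<in> N}" using N g by (auto simp: openin_total_top)
qed

lemma translate_action: "group_action G Q translate"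
  unfolding group_action_def
proof (rule group_hom.intro[OF G group_BijGroup], unfold group_hom_axioms_def hom_def, intro CollectI conjI ballI)
  have comp: "translate g (translate h q) = translate (g \<otimes> h) q" if gh: "g \<in> carrier G" "h \<in> carrier G" "q \<in> Q" for g h q
    using translate_facts[OF gh(2,3)] Q_cases[OF gh(3)] gh by (simp add: translate_def m_assoc)
  have one: "translate \<one> q = q" if "q \<in> Q" for q using Q_cases[OF that] that by (simp add: translate_def)
  have bij: "translate g \<in> Bij Q" if g: "g \<in> carrier G" for g
    unfolding Bij_def
  proof (intro IntI CollectI)
    show "translate g \<in> extensional Q" by (simp add: translate_def)
    show "bij_betw (translate g) Q Q"
      by (rule bij_betwI[where g = "translate (inv g)"]) (use g in \<open>auto simp: comp one translate_facts(1)\<close>)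
  qed
  show "translate \<in> carrier G \<rightarrow> carrier (BijGroup Q)" using bij by (auto simp: BijGroup_def)
  show "translate (g \<otimes> h) = translate g \<otimes>\<^bsub>BijGroup Q\<^esub> translate h" if gh: "g \<in> carrier G" "h \<in> carrier G" for g h
  proof -
    have "translate (g \<otimes> h) q = compose Q (translate g) (translate h) q" for q
      using comp[OF gh, of q] by (cases "q \<in> Q") (simp_all add: compose_def, simp add: translate_def)
    then show ?thesis using bij[OF gh(1)] bij[OF gh(2)] by (auto simp: BijGroup_def)
  qed
qed

text \<open>Both directions lie over the identity of the base, so smoothness follows from
  continuity; the group component is continuous because the sheets are open.\<close>

lemma trivialization:
  assumes i: "i \<in> I"
  shows "diffeo (times_discrete (restrict_surface B (A i)) (carrier G)) (restrict_surface E {q \<in> pts E. \<pi> q \<in> A i}) (\<lambda>(x, y). s i y x)"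
proof -
  let ?T = "times_discrete (restrict_surface B (A i)) (carrier G)" and ?R = "restrict_surface E {q \<in> pts E. \<pi> q \<in> A i}"
  let ?f = "\<lambda>(x, y). s i y x"
  let ?h = "\<lambda>q. (\<pi> q, lev q \<otimes> inv (\<kappa> i (\<pi> q)))"
  have ABP: "A i \<subseteq> pts B" using openin_subset[OF A_open[OF i]] .
  have p1: "pts ?T = A i \<times> carrier G" using ABP by (auto simp: times_discrete_def restrict_surface_def)
  have p2: "pts ?R = {q \<in> Q. \<pi> q \<in> A i}" by (auto simp: restrict_surface_def pts_E)
  have hf: "?h (?f z) = z" if zT: "z \<in> pts ?T" for z
  proof -
    obtain x y where z: "z = (x, y)" "x \<in> A i" "y \<in> carrier G" using zT[unfolded p1] by auto
    show ?thesis using s_facts[OF i z(3,2)] \<kappa>_closed[OF i z(2)] z by (simp add: m_assoc)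
  qed
  have f_in: "?f z \<in> pts ?R" if "z \<in> pts ?T" for z using that s_facts[OF i] unfolding p1 p2 by auto
  have h_in: "?h q \<in> pts ?T" and fh: "?f (?h q) = q" if "q \<in> pts ?R" for q
  proof -
    have q: "q \<in> Q" "\<pi> q \<in> A i" using that p2 by auto
    show "?h q \<in> pts ?T" using Q_cases[OF q(1)] \<kappa>_closed[OF i q(2)] q(2) p1 by simp
    show "?f (?h q) = q" using s_surj[OF q(1) i q(2)] by simp
  qed
  have bij: "bij_betw ?f (pts ?T) (pts ?R)"
    by (rule bij_betwI[where g = ?h]) (use f_in h_in hf fh in auto)
  have inv: "inv_into (pts ?T) ?f q = ?h q" if "q \<in> pts ?R" for q
    by (rule inv_into_f_eq[OF bij_betw_imp_inj_on[OF bij] h_in[OF that] fh[OF that]])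
  have TT: "Top ?T = prod_topology (subtopology (Top B) (A i)) (discrete_topology (carrier G))"
    by (simp add: times_discrete_def restrict_surface_def)
  have TR: "Top ?R = subtopology total_top {q \<in> Q. \<pi> q \<in> A i}" by (simp add: restrict_surface_def E_def topspace_total_top)
  have sub: "{q \<in> pts E. \<pi> q \<in> A i} \<subseteq> pts E" by auto
  note overR = lies_over_restrict[OF E_over sub]
  note overT = lies_over_times[OF lies_over_restrict[OF lies_over_self[OF B] ABP], of "carrier G"]
  have cont_f: "continuous_map (Top ?T) (Top ?R) ?f"
    unfolding continuous_map_def
  proof (intro conjI allI impI)
    show "?f \<in> pts ?T \<rightarrow> pts ?R" using f_in by blast
    fix N assume "openin (Top ?R) N"
    then obtain N' where N': "openin total_top N'" "N = N' \<inter> {q \<in> Q. \<pi> q \<in> A i}" unfolding TR openin_subtopology by blast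
    have "{z \<in> pts ?T. ?f z \<in> N} = (\<Union>y\<in>carrier G. {x \<in> A i. s i y x \<in> N'} \<times> {y})"
      using f_in unfolding p1 p2 N'(2) by fastforce
    moreover have "openin (Top ?T) ({x \<in> A i. s i y x \<in> N'} \<times> {y})" if y: "y \<in> carrier G" for y
    proof -
      have "openin (Top B) {x \<in> A i. s i y x \<in> N'}" using N'(1) i y by (simp add: openin_total_top)
      then have "openin (subtopology (Top B) (A i)) {x \<in> A i. s i y x \<in> N'}"
        using openin_subset_topspace_eq by (auto simp: openin_subtopology)
      then show ?thesis unfolding TT openin_prod_Times_iff using y by simp
    qed
    ultimately show "openin (Top ?T) {z \<in> pts ?T. ?f z \<in> N}" by auto
  qed
  have cont_h: "continuous_map (Top ?R) (Top ?T) ?h"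
    unfolding TT continuous_map_pairwise o_def
  proof
    show "continuous_map (Top ?R) (subtopology (Top B) (A i)) (\<lambda>q. fst (?h q))"
      unfolding TR continuous_map_in_subtopology by (auto intro: continuous_map_from_subtopology[OF \<pi>_continuous])
    show "continuous_map (Top ?R) (discrete_topology (carrier G)) (\<lambda>q. snd (?h q))"
      unfolding continuous_map_def
    proof (intro conjI allI impI)
      show "(\<lambda>q. snd (?h q)) \<in> pts ?R \<rightarrow> topspace (discrete_topology (carrier G))" using h_in p1 by auto
      fix Y assume "openin (discrete_topology (carrier G)) Y"
      then have Y: "Y \<subseteq> carrier G" by simp
      have "{q \<in> pts ?R. snd (?h q) \<in> Y} = (\<Union>y\<in>Y. s i y ` A i)"
      proof (intro subset_antisym subsetI)
        fix q assume q: "q \<in> {q \<in> pts ?R. snd (?h q) \<in> Y}"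
        then have "q = s i (snd (?h q)) (\<pi> q)" using fh[of q] by simp
        then show "q \<in> (\<Union>y\<in>Y. s i y ` A i)" using q p2 by auto
      next
        fix q assume "q \<in> (\<Union>y\<in>Y. s i y ` A i)"
        then obtain x y where xy: "y \<in> Y" "x \<in> A i" "q = ?f (x, y)" by auto
        then have z: "(x, y) \<in> pts ?T" using Y p1 by auto
        have "?h q = (x, y)" "q \<in> pts ?R" using hf[OF z] f_in[OF z] by (simp_all only: xy(3))
        then show "q \<in> {q \<in> pts ?R. snd (?h q) \<in> Y}" using xy(1) by (intro CollectI conjI) (simp_all only: snd_conv)
      qed
      moreover have "openin total_top (\<Union>y\<in>Y. s i y ` A i)" using s_open[OF i _ A_open[OF i] subset_refl] Y by blast
      moreover have "(\<Union>y\<in>Y. s i y ` A i) \<subseteq> {q \<in> Q. \<pi> q \<in> A i}" using s_facts[OF i] Y by auto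
      ultimately show "openin (Top ?R) {q \<in> pts ?R. snd (?h q) \<in> Y}"
        unfolding TR openin_subtopology by (intro exI[of _ "\<Union>y\<in>Y. s i y ` A i"]) auto
    qed
  qed
  have sf: "smooth_map ?T ?R ?f"
    by (rule over_smooth_map[OF B overT overR cont_f]) (use s_facts(2)[OF i] p1 in auto)
  have "smooth_map ?R ?T (inv_into (pts ?T) ?f)"
  proof (rule over_smooth_map[OF B overR overT])
    show "continuous_map (Top ?R) (Top ?T) (inv_into (pts ?T) ?f)"
      by (rule continuous_map_eq[OF cont_h]) (use inv in simp)
    show "fst (inv_into (pts ?T) ?f q) = \<pi> q" if "q \<in> pts ?R" for q using inv[OF that] by simp
  qed
  then show ?thesis using bij sf by (simp add: diffeo_def)
qed

theorem principal_bundle_E: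
  assumes W: "base W = B" "tot W = E" "proj W = \<pi>" "act W = translate"
  shows "principal_bundle G W"
  unfolding principal_bundle_def W
proof (intro conjI ballI)
  have T: "Top E = total_top" by (simp add: E_def)
  show "smooth_surface B" "smooth_surface E" by (rule B E_smooth)+
  show "smooth_map E B \<pi>"
    by (rule over_smooth_map[OF B E_over lies_over_self[OF B]]) (use \<pi>_continuous T in auto)
  show "group_action G (pts E) translate" using translate_action by (simp add: pts_E)
  show "smooth_map E E (translate g)" if "g \<in> carrier G" for g
    by (rule over_smooth_map[OF B E_over E_over]) (use translate_continuous[OF that] T translate_facts[OF that] pts_E in auto)
  show "\<pi> (translate g q) = \<pi> q" if "g \<in> carrier G" "q \<in> pts E" for g q using translate_facts(2) that pts_E by simp
  fix x assume "x \<in> pts B"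
  then obtain i where i: "i \<in> I" "x \<in> A i" using A_cover by blast
  show "\<exists>U \<tau>. openin (Top B) U \<and> x \<in> U \<and> diffeo (times_discrete (restrict_surface B U) (carrier G))
          (restrict_surface E {q \<in> pts E. \<pi> q \<in> U}) \<tau> \<and>
         (\<forall>u\<in>U. \<forall>y\<in>carrier G. \<pi> (\<tau> (u, y)) = u \<and> (\<forall>g\<in>carrier G. translate g (\<tau> (u, y)) = \<tau> (u, g \<otimes> y)))"
    by (intro exI[of _ "A i"] exI[of _ "\<lambda>(x, y). s i y x"] conjI A_open trivialization i)
      (use s_facts(2)[OF i(1)] translate_s[OF _ i(1)] in auto)
qed

lemma E_boundary: "surface_boundary E = {q \<in> Q. \<pi> q \<in> surface_boundary B}"
proof (intro subset_antisym subsetI)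
  fix q assume "q \<in> surface_boundary E"
  then obtain U v where U: "(U, v) \<in> Atlas E" "q \<in> U" "v q $ 2 = 0" by (auto simp: surface_boundary_def)
  obtain D d where D: "(D, d) \<in> Atlas B" "inj_on \<pi> U" "\<pi> ` U \<subseteq> D" "\<And>a. a \<in> U \<Longrightarrow> v a = d (\<pi> a)" "U \<subseteq> pts E"
    by (rule lies_overE[OF E_over U(1)]) (rule that)
  have "\<pi> q \<in> D" "d (\<pi> q) $ 2 = 0" "q \<in> Q" using U D pts_E by auto
  then show "q \<in> {q \<in> Q. \<pi> q \<in> surface_boundary B}" using D(1) by (auto simp: surface_boundary_def)
next
  fix q assume "q \<in> {q \<in> Q. \<pi> q \<in> surface_boundary B}"
  then obtain D d where q: "q \<in> Q" and D: "(D, d) \<in> Atlas B" "\<pi> q \<in> D" "d (\<pi> q) $ 2 = 0" by (auto simp: surface_boundary_def)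
  obtain i where i: "i \<in> I" "\<pi> q \<in> A i" using Q_cases[OF q] A_cover by blast
  let ?y = "lev q \<otimes> inv (\<kappa> i (\<pi> q))"
  have y: "?y \<in> carrier G" using Q_cases[OF q] \<kappa>_closed[OF i] by simp
  have "(s i ?y ` (A i \<inter> D), d \<circ> \<pi>) \<in> Atlas E" using i y D by (auto simp: E_def)
  moreover have "q \<in> s i ?y ` (A i \<inter> D)" by (rule image_eqI[where x = "\<pi> q"], rule s_surj[OF q i]) (use i D in simp)
  ultimately show "q \<in> surface_boundary E"
    unfolding surface_boundary_def using D(3) by (intro CollectI bexI[of _ "(s i ?y ` (A i \<inter> D), d \<circ> \<pi>)"]) auto
qed

end

section \<open>Planar surfaces\<close>

definition vc :: "complex \<Rightarrow> real^2" where "vc z = vector [Re z, Im z]"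
definition cv :: "real^2 \<Rightarrow> complex" where "cv v = Complex (v $ 1) (v $ 2)"

lemma vc_nth [simp]: "vc z $ 1 = Re z" "vc z $ 2 = Im z"
  by (simp_all add: vc_def)

lemma cv_sel [simp]: "Re (cv v) = v $ 1" "Im (cv v) = v $ 2"
  by (simp_all add: cv_def)

lemma cv_vc [simp]: "cv (vc z) = z" and vc_cv [simp]: "vc (cv v) = v"
  by (auto simp: complex_eq_iff vec_eq_iff forall_2)

lemma bounded_linear_vc: "bounded_linear vc"
  by (auto simp: linear_conv_bounded_linear[symmetric] vec_eq_iff forall_2 intro!: linearI)

lemma bounded_linear_cv: "bounded_linear cv"
  by (auto simp: linear_conv_bounded_linear[symmetric] complex_eq_iff intro!: linearI)

lemma continuous_on_vc: "continuous_on S vc" and continuous_on_cv: "continuous_on T cv"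
  by (rule linear_continuous_on bounded_linear_vc bounded_linear_cv)+

lemma open_cv: "open B \<Longrightarrow> open {v. cv v \<in> B}"
  using open_vimage[OF _ continuous_on_cv[of UNIV], of B] by (simp add: vimage_def)

lemma holomorphic_vc_has_derivative:
  assumes "f holomorphic_on A" "open A" "cv v \<in> A"
  shows "((\<lambda>v. vc (f (cv v))) has_derivative (\<lambda>h. vc (deriv f (cv v) * cv h))) (at v)"
proof -
  have f: "(f has_derivative (*) (deriv f (cv v))) (at (cv v))"
    using holomorphic_derivI[OF assms] by (simp add: has_field_derivative_def)
  have c: "(cv has_derivative cv) (at v)" by (rule bounded_linear_imp_has_derivative[OF bounded_linear_cv])
  have "((\<lambda>v. f (cv v)) has_derivative (\<lambda>h. deriv f (cv v) * cv h)) (at v)"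
    using has_derivative_compose[OF c f] by simp
  from has_derivative_compose[OF this bounded_linear_imp_has_derivative[OF bounded_linear_vc]]
  show ?thesis by simp
qed

text \<open>The derivative in a fixed direction is again holomorphic, so one induction over all
  holomorphic functions gives every order.\<close>

lemma holomorphic_Ck_on:
  assumes "f holomorphic_on A" "open A"
  shows "Ck_on k (\<lambda>v. vc (f (cv v))) {v. cv v \<in> A}"
  using assms(1)
proof (induction k arbitrary: f)
  case 0
  have "continuous_on {v. cv v \<in> A} (\<lambda>v. f (cv v))"
    by (rule continuous_on_compose2[OF holomorphic_on_imp_continuous_on[OF 0] continuous_on_cv]) auto
  then show ?case by (auto intro: continuous_on_compose2[OF continuous_on_vc[of UNIV]])
next
  case (Suc k)
  have "Ck_on k (\<lambda>v. vc (deriv f (cv v) * cv h)) {v. cv v \<in> A}" for h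
    by (rule Suc.IH) (intro holomorphic_on_mult holomorphic_deriv[OF Suc.prems assms(2)] holomorphic_on_const)
  then show ?case
    by (intro Ck_on_SucI[where f' = "\<lambda>v h. vc (deriv f (cv v) * cv h)"] open_cv assms(2) holomorphic_vc_has_derivative[OF Suc.prems assms(2)]) auto
qed

lemma second_countable_euclidean: "second_countable (euclidean :: 'a::second_countable_topology topology)"
proof -
  obtain \<B> :: "'a set set" where "countable \<B>" "topological_basis \<B>" using ex_countable_basis by blast
  then show ?thesis
    unfolding second_countable_def using topological_basis_open topological_basisE by (metis open_openin)
qed

lemma det_complex_mult: "det (matrix (\<lambda>h. vc (a * cv h))) = (cmod a)\<^sup>2"
  by (simp add: det_2 matrix_def axis_def cmod_power2) (simp add: power2_eq_square)

lemma deriv_of_left_inverse: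
  assumes "f holomorphic_on A" "open A" "g holomorphic_on B" "open B" "f ` A \<subseteq> B" "\<And>z. z \<in> A \<Longrightarrow> g (f z) = z" "z \<in> A"
  shows "deriv f z \<noteq> (0::complex)"
proof
  assume 0: "deriv f z = 0"
  have f: "(f has_field_derivative 0) (at z)" using holomorphic_derivI[OF assms(1,2,7)] 0 by simp
  have "f z \<in> B" using assms(5,7) by blast
  from DERIV_chain2[OF holomorphic_derivI[OF assms(3,4) this] f] have "((\<lambda>z. g (f z)) has_field_derivative 0) (at z)" by simp
  then have "((\<lambda>z. z) has_field_derivative (0::complex)) (at z)"
    by (rule has_field_derivative_transform_within_open[OF _ assms(2,7)]) (use assms(6) in auto)
  then show False using DERIV_unique DERIV_ident by fastforce
qed

text \<open>A region \<open>P\<close> of the plane with biholomorphic maps \<open>f j\<close>,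
  inverse to \<open>g j\<close>, that straighten its boundary to the real line. Transition maps are
  holomorphic, hence smooth, and their Jacobians are squared norms of nonzero derivatives, hence
  positive. \<open>co\<close> and \<open>ci\<close> allow the points to have another type than
  \<open>complex\<close>.\<close>

locale planar_atlas =
  fixes X :: "'p topology" and co :: "'p \<Rightarrow> complex" and ci :: "complex \<Rightarrow> 'p" and P :: "complex set"
    and J :: "'j set" and A B :: "'j \<Rightarrow> complex set" and f g :: "'j \<Rightarrow> complex \<Rightarrow> complex"
  assumes homeo: "homeomorphic_maps X (top_of_set P) co ci"
    and A_open: "\<And>j. j \<in> J \<Longrightarrow> open (A j)" and B_open: "\<And>j. j \<in> J \<Longrightarrow> open (B j)"
    and f_holo: "\<And>j. j \<in> J \<Longrightarrow> f j holomorphic_on A j" and g_holo: "\<And>j. j \<in> J \<Longrightarrow> g j holomorphic_on B j"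
    and fB: "\<And>j z. j \<in> J \<Longrightarrow> z \<in> A j \<Longrightarrow> f j z \<in> B j" and gA: "\<And>j w. j \<in> J \<Longrightarrow> w \<in> B j \<Longrightarrow> g j w \<in> A j"
    and gf: "\<And>j z. j \<in> J \<Longrightarrow> z \<in> A j \<Longrightarrow> g j (f j z) = z" and fg: "\<And>j w. j \<in> J \<Longrightarrow> w \<in> B j \<Longrightarrow> f j (g j w) = w"
    and half: "\<And>j z. j \<in> J \<Longrightarrow> z \<in> A j \<Longrightarrow> z \<in> P \<longleftrightarrow> 0 \<le> Im (f j z)"
    and cover: "P \<subseteq> (\<Union>j\<in>J. A j)"
begin

definition dom where "dom j = {p \<in> topspace X. co p \<in> A j}"
definition crd where "crd j p = vc (f j (co p))"
definition S :: "'p surface" where "S = \<lparr>Top = X, Atlas = (\<lambda>j. (dom j, crd j)) ` J\<rparr>"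

lemma co_P: "p \<in> topspace X \<Longrightarrow> co p \<in> P" and ci_X: "z \<in> P \<Longrightarrow> ci z \<in> topspace X"
  and ci_co: "p \<in> topspace X \<Longrightarrow> ci (co p) = p" and co_ci: "z \<in> P \<Longrightarrow> co (ci z) = z"
  using homeo unfolding homeomorphic_maps_def continuous_map_def by auto

lemma co_cont: "continuous_map X euclidean co" and ci_cont: "continuous_map (top_of_set P) X ci"
  using homeo unfolding homeomorphic_maps_def by (auto simp: continuous_map_in_subtopology)

lemma dom_open: "j \<in> J \<Longrightarrow> openin X (dom j)"
  unfolding dom_def by (rule openin_continuous_map_preimage[OF co_cont]) (simp add: A_open)

lemma crd_inv: "j \<in> J \<Longrightarrow> p \<in> dom j \<Longrightarrow> ci (g j (cv (crd j p))) = p"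
  unfolding dom_def crd_def by (simp add: gf ci_co)

lemma crd_image:
  assumes j: "j \<in> J" shows "crd j ` dom j = {v. 0 \<le> v $ 2 \<and> cv v \<in> B j}"
proof (intro subset_antisym subsetI)
  fix v assume "v \<in> crd j ` dom j"
  then obtain p where "p \<in> topspace X" "co p \<in> A j" "v = vc (f j (co p))" by (auto simp: dom_def crd_def)
  then show "v \<in> {v. 0 \<le> v $ 2 \<and> cv v \<in> B j}" using half[OF j] co_P fB[OF j] by auto
next
  fix v assume v: "v \<in> {v. 0 \<le> v $ 2 \<and> cv v \<in> B j}"
  then have a: "g j (cv v) \<in> A j" using gA[OF j] by blast
  moreover have "g j (cv v) \<in> P" using half[OF j a] fg[OF j] v by simp
  ultimately have "ci (g j (cv v)) \<in> dom j" "v = crd j (ci (g j (cv v)))"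
    using v fg[OF j] ci_X co_ci by (auto simp: dom_def crd_def)
  then show "v \<in> crd j ` dom j" by blast
qed

lemma crd_cont: "j \<in> J \<Longrightarrow> continuous_map (subtopology X (dom j)) euclidean (crd j)"
proof -
  assume j: "j \<in> J"
  have "continuous_map (subtopology X (dom j)) (top_of_set (A j)) co"
    unfolding continuous_map_in_subtopology using co_cont by (auto simp: dom_def intro: continuous_map_from_subtopology)
  from continuous_map_compose[OF this, of euclidean "\<lambda>z. vc (f j z)"]
  have "continuous_map (top_of_set (A j)) euclidean (\<lambda>z. vc (f j z)) \<Longrightarrow> ?thesis"
    by (simp add: o_def crd_def[abs_def])
  moreover have "continuous_map (top_of_set (A j)) euclidean (\<lambda>z. vc (f j z))"
    unfolding continuous_map_iff_continuous
    by (rule continuous_on_compose2[OF continuous_on_vc[of UNIV] holomorphic_on_imp_continuous_on[OF f_holo[OF j]]]) auto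
  ultimately show ?thesis by blast
qed

lemma chart: assumes j: "j \<in> J" shows "chart_of X (dom j, crd j)"
  unfolding chart_of_def
proof (clarsimp, intro conjI)
  show "openin X (dom j)" by (rule dom_open[OF j])
  have "crd j ` dom j = half_plane \<inter> {v. cv v \<in> B j}" unfolding crd_image[OF j] by (auto simp: half_plane_def)
  then show "openin (top_of_set half_plane) (crd j ` dom j)"
    using openin_open_Int[OF open_cv[OF B_open[OF j]]] by simp
  have "homeomorphic_maps (subtopology X (dom j)) (top_of_set (crd j ` dom j)) (crd j) (\<lambda>v. ci (g j (cv v)))"
    unfolding homeomorphic_maps_def
  proof (intro conjI)
    have dX: "topspace (subtopology X (dom j)) = dom j" using openin_subset[OF dom_open[OF j]] by auto
    show "continuous_map (subtopology X (dom j)) (top_of_set (crd j ` dom j)) (crd j)"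
      unfolding continuous_map_in_subtopology using crd_cont[OF j] dX by auto
    show "\<forall>p\<in>topspace (subtopology X (dom j)). ci (g j (cv (crd j p))) = p" using crd_inv[OF j] dX by simp
    then show "\<forall>v\<in>topspace (top_of_set (crd j ` dom j)). crd j (ci (g j (cv v))) = v" using dX by auto
    have im: "g j (cv v) \<in> P \<and> ci (g j (cv v)) \<in> dom j" if v: "v \<in> crd j ` dom j" for v
    proof -
      obtain p where p: "p \<in> dom j" "v = crd j p" using v by blast
      then have "g j (cv v) = co p" using gf[OF j] by (simp add: dom_def crd_def)
      then show ?thesis using p crd_inv[OF j p(1)] co_P by (auto simp: dom_def)
    qed
    have "continuous_map (top_of_set (crd j ` dom j)) (top_of_set P) (\<lambda>v. g j (cv v))"
      unfolding continuous_map_in_subtopology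
    proof
      show "continuous_map (top_of_set (crd j ` dom j)) euclidean (\<lambda>v. g j (cv v))"
        unfolding continuous_map_iff_continuous
        by (rule continuous_on_compose2[OF holomorphic_on_imp_continuous_on[OF g_holo[OF j]] continuous_on_cv])
          (use crd_image[OF j] in auto)
    qed (use im in auto)
    from continuous_map_compose[OF this ci_cont]
    have "continuous_map (top_of_set (crd j ` dom j)) X (\<lambda>v. ci (g j (cv v)))" by (simp add: o_def)
    then show "continuous_map (top_of_set (crd j ` dom j)) (subtopology X (dom j)) (\<lambda>v. ci (g j (cv v)))"
      unfolding continuous_map_in_subtopology using im by auto
  qed
  then show "homeomorphic_map (subtopology X (dom j)) (top_of_set (crd j ` dom j)) (crd j)"
    unfolding homeomorphic_map_maps by blast
qed

lemma transition:
  assumes j: "j \<in> J" and k: "k \<in> J" and v: "v \<in> coord_dom (\<lambda>p. p) (dom j, crd j) (dom k, crd k)"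
  shows "v \<in> {v. cv v \<in> {w \<in> B j. g j w \<in> A k}}" "coord_rep (\<lambda>p. p) (dom j, crd j) (dom k, crd k) v = vc (f k (g j (cv v)))"
proof -
  obtain p where p: "p \<in> dom j" "p \<in> dom k" "v = crd j p" using v by (auto simp: coord_dom_def)
  have g: "cv v \<in> B j" "g j (cv v) = co p" using p(1,3) gf[OF j] fB[OF j] by (auto simp: dom_def crd_def)
  then show "v \<in> {v. cv v \<in> {w \<in> B j. g j w \<in> A k}}" using p(2) by (auto simp: dom_def)
  have "inj_on (crd j) (dom j)" using crd_inv[OF j] by (rule inj_on_inverseI)
  from inv_into_f_f[OF this p(1)]
  show "coord_rep (\<lambda>p. p) (dom j, crd j) (dom k, crd k) v = vc (f k (g j (cv v)))"
    using p(3) g(2) by (simp add: coord_rep_def crd_def[of k])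
qed

lemma transition_holomorphic:
  assumes j: "j \<in> J" and k: "k \<in> J"
  shows "open {w \<in> B j. g j w \<in> A k}" "(\<lambda>w. f k (g j w)) holomorphic_on {w \<in> B j. g j w \<in> A k}"
    "w \<in> {w \<in> B j. g j w \<in> A k} \<Longrightarrow> deriv (\<lambda>w. f k (g j w)) w \<noteq> 0"
proof -
  have "{w \<in> B j. g j w \<in> A k} = B j \<inter> g j -` A k" by auto
  then show o: "open {w \<in> B j. g j w \<in> A k}"
    using continuous_open_preimage[OF holomorphic_on_imp_continuous_on[OF g_holo[OF j]] B_open[OF j] A_open[OF k]] by simp
  have gh: "g j holomorphic_on {w \<in> B j. g j w \<in> A k}" by (rule holomorphic_on_subset[OF g_holo[OF j]]) auto
  show h: "(\<lambda>w. f k (g j w)) holomorphic_on {w \<in> B j. g j w \<in> A k}"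
    using holomorphic_on_compose_gen[OF gh f_holo[OF k]] by (auto simp: o_def)
  let ?T = "{z \<in> B k. g k z \<in> A j}"
  have "?T = B k \<inter> g k -` A j" by auto
  then have oT: "open ?T"
    using continuous_open_preimage[OF holomorphic_on_imp_continuous_on[OF g_holo[OF k]] B_open[OF k] A_open[OF j]] by simp
  have "g k holomorphic_on ?T" by (rule holomorphic_on_subset[OF g_holo[OF k]]) auto
  then have hT: "(\<lambda>w. f j (g k w)) holomorphic_on ?T"
    using holomorphic_on_compose_gen[OF _ f_holo[OF j]] by (auto simp: o_def)
  show "deriv (\<lambda>w. f k (g j w)) w \<noteq> 0" if "w \<in> {w \<in> B j. g j w \<in> A k}"
    by (rule deriv_of_left_inverse[OF h o hT oT _ _ that]) (use fB[OF k] gf[OF k] gA[OF j] fg[OF j] in auto)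
qed

lemma oriented_S: "oriented_smooth_surface S"
proof -
  have hs: "X homeomorphic_space top_of_set P" using homeo unfolding homeomorphic_space_def by blast
  have "second_countable (top_of_set P)" by (intro second_countable_subtopology second_countable_euclidean)
  then have sc: "second_countable X" using homeomorphic_space_second_countability[OF hs] by simp
  have hd: "Hausdorff_space X" using homeomorphic_Hausdorff_space[OF hs] by (simp add: Hausdorff_space_subtopology)
  have cov: "(\<Union>j\<in>J. dom j) = topspace X" using co_P cover by (auto simp: dom_def)
  have sm: "smooth_on (coord_dom (\<lambda>p. p) (dom j, crd j) (dom k, crd k)) (coord_rep (\<lambda>p. p) (dom j, crd j) (dom k, crd k))"
    if jk: "j \<in> J" "k \<in> J" for j k
    unfolding smooth_on_def
  proof
    fix v assume v: "v \<in> coord_dom (\<lambda>p. p) (dom j, crd j) (dom k, crd k)"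
    show "\<exists>T h. open T \<and> v \<in> T \<and> (\<forall>k. Ck_on k h T) \<and>
        (\<forall>y\<in>coord_dom (\<lambda>p. p) (dom j, crd j) (dom k, crd k) \<inter> T. h y = coord_rep (\<lambda>p. p) (dom j, crd j) (dom k, crd k) y)"
      by (intro exI[of _ "{v. cv v \<in> {w \<in> B j. g j w \<in> A k}}"] exI[of _ "\<lambda>v. vc (f k (g j (cv v)))"] conjI allI ballI
          holomorphic_Ck_on[OF transition_holomorphic(2)[OF jk]] open_cv transition_holomorphic(1)[OF jk])
        (use transition[OF jk] v in auto)
  qed
  have "smooth_map S S (\<lambda>p. p)" unfolding smooth_map_def using sm by (auto simp: S_def)
  then have "smooth_surface S" unfolding smooth_surface_def using sc hd cov chart by (auto simp: S_def)
  moreover have "orientation_preserving S S (\<lambda>p. p)"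
    unfolding orientation_preserving_def
  proof (intro ballI)
    fix c d v assume c: "c \<in> Atlas S" and d: "d \<in> Atlas S" and v: "v \<in> coord_dom (\<lambda>p. p) c d"
    obtain j k where jk: "j \<in> J" "k \<in> J" and cd: "c = (dom j, crd j)" "d = (dom k, crd k)" using c d by (auto simp: S_def)
    let ?a = "deriv (\<lambda>w. f k (g j w)) (cv v)"
    have w: "cv v \<in> {w \<in> B j. g j w \<in> A k}" using transition(1)[OF jk] v cd by simp
    have "((\<lambda>v. vc (f k (g j (cv v)))) has_derivative (\<lambda>h. vc (?a * cv h))) (at v)"
      by (rule holomorphic_vc_has_derivative[OF transition_holomorphic(2,1)[OF jk] w])
    then have "(coord_rep (\<lambda>p. p) c d has_derivative (\<lambda>h. vc (?a * cv h))) (at v within coord_dom (\<lambda>p. p) c d)"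
      by (intro has_derivative_transform[OF v _ has_derivative_at_withinI]) (use transition(2)[OF jk] cd in auto)
    moreover have "0 < det (matrix (\<lambda>h. vc (?a * cv h)))"
      unfolding det_complex_mult using transition_holomorphic(3)[OF jk w] by simp
    ultimately show "\<exists>D. (coord_rep (\<lambda>p. p) c d has_derivative D) (at v within coord_dom (\<lambda>p. p) c d) \<and> 0 < det (matrix D)"
      by blast
  qed
  ultimately show ?thesis by (simp add: oriented_smooth_surface_def)
qed

lemma S_boundary: "surface_boundary S = {p \<in> topspace X. \<exists>j\<in>J. co p \<in> A j \<and> Im (f j (co p)) = 0}"
  unfolding surface_boundary_def by (auto simp: S_def dom_def crd_def)

lemma curve_smooth:
  assumes \<gamma>: "\<And>t. \<gamma> t \<in> P" "\<And>k. Ck_on k (\<lambda>t. vc (\<gamma> t)) (UNIV :: real set)"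
  shows "smooth_curve S (\<lambda>t. ci (\<gamma> t))"
  unfolding smooth_curve_def
proof (intro conjI ballI, goal_cases)
  have "continuous_on UNIV (\<lambda>t. cv (vc (\<gamma> t)))"
    by (rule continuous_on_compose2[OF continuous_on_cv[of UNIV] Ck_on_imp_continuous_on[OF \<gamma>(2)]]) auto
  then have cont: "continuous_on UNIV \<gamma>" by simp
  case 1
  have "continuous_map euclideanreal (top_of_set P) \<gamma>"
    unfolding continuous_map_in_subtopology using \<gamma>(1) cont by auto
  from continuous_map_compose[OF this ci_cont] show ?case by (simp add: S_def o_def)
  case (2 c)
  then obtain j where j: "j \<in> J" and c: "c = (dom j, crd j)" by (auto simp: S_def)
  have o: "open {t. \<gamma> t \<in> A j}" using open_vimage[OF A_open[OF j] cont] by (simp add: vimage_def)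
  have eq: "{t. ci (\<gamma> t) \<in> dom j} = {t. \<gamma> t \<in> A j}" using \<gamma>(1) by (auto simp: dom_def co_ci ci_X)
  have "Ck_on k (\<lambda>t. vc (f j (cv (vc (\<gamma> t))))) {t. \<gamma> t \<in> A j}" for k
    by (rule Ck_on_compose[OF o open_cv[OF A_open[OF j]] Ck_on_subset[OF \<gamma>(2)] holomorphic_Ck_on[OF f_holo[OF j] A_open[OF j]]]) auto
  then have "smooth_on {t. \<gamma> t \<in> A j} (\<lambda>t. vc (f j (\<gamma> t)))"
    unfolding smooth_on_def by (intro ballI exI[of _ "{t. \<gamma> t \<in> A j}"] exI[of _ "\<lambda>t. vc (f j (\<gamma> t))"]) (simp add: o)
  moreover have "crd j \<circ> (\<lambda>t. ci (\<gamma> t)) = (\<lambda>t. vc (f j (\<gamma> t)))" using \<gamma>(1) by (auto simp: crd_def co_ci)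
  ultimately show ?case using c eq by simp
qed

lemma curve_direction:
  assumes \<gamma>: "\<And>t. \<gamma> t \<in> P" "\<And>t. (\<gamma> has_vector_derivative \<gamma>' t) (at t)"
    and pos: "\<And>j t. j \<in> J \<Longrightarrow> \<gamma> t \<in> A j \<Longrightarrow> 0 < \<epsilon> * Re (deriv (f j) (\<gamma> t) * \<gamma>' t)"
  shows "boundary_direction \<epsilon> S (\<lambda>t. ci (\<gamma> t))"
  unfolding boundary_direction_def
proof (intro ballI, clarify)
  fix U u t assume U: "(U, u) \<in> Atlas S" "ci (\<gamma> t) \<in> U"
  then obtain j where j: "j \<in> J" and c: "U = dom j" "u = crd j" by (auto simp: S_def)
  have a: "\<gamma> t \<in> A j" using U(2) c \<gamma>(1) by (simp add: dom_def co_ci)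
  have "(f j \<circ> \<gamma> has_vector_derivative \<gamma>' t * deriv (f j) (\<gamma> t)) (at t)"
    by (rule field_vector_diff_chain_at[OF \<gamma>(2) holomorphic_derivI[OF f_holo[OF j] A_open[OF j] a]])
  from bounded_linear.has_vector_derivative[OF bounded_linear_vc this]
  have "(u \<circ> (\<lambda>t. ci (\<gamma> t)) has_vector_derivative vc (\<gamma>' t * deriv (f j) (\<gamma> t))) (at t)"
    using \<gamma>(1) c by (simp add: o_def crd_def[abs_def] co_ci)
  then show "\<exists>d. (u \<circ> (\<lambda>t. ci (\<gamma> t)) has_vector_derivative d) (at t) \<and> 0 < \<epsilon> * d $ 1"
    by - (rule exI, rule conjI, assumption, use pos[OF j a] in \<open>simp add: mult.commute\<close>)
qed

end

text \<open>For \<open>\<sigma> = 1\<close> this is the Cayley transform of the disc with centre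
  \<open>a\<close> and radius \<open>cmod b\<close> to the upper half plane, with pole at
  \<open>a + b\<close>; \<open>\<sigma> = - 1\<close> brings the exterior there instead.\<close>

definition cay :: "complex \<Rightarrow> complex \<Rightarrow> complex \<Rightarrow> complex \<Rightarrow> complex" where
  "cay \<sigma> a b z = \<sigma> * (\<i> * (b + (z - a)) / (b - (z - a)))"

definition cay_inv :: "complex \<Rightarrow> complex \<Rightarrow> complex \<Rightarrow> complex \<Rightarrow> complex" where
  "cay_inv \<sigma> a b w = a + b * (\<sigma> * w - \<i>) / (\<sigma> * w + \<i>)"

lemma cay_pole: "\<sigma> * \<sigma> = 1 \<Longrightarrow> b \<noteq> 0 \<Longrightarrow> z \<noteq> a + b \<Longrightarrow> \<sigma> * cay \<sigma> a b z + \<i> \<noteq> 0"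
proof -
  assume s: "\<sigma> * \<sigma> = 1" and b: "b \<noteq> 0" "z \<noteq> a + b"
  have nz: "b - (z - a) \<noteq> 0" using b(2) by (simp add: algebra_simps)
  have "\<sigma> * cay \<sigma> a b z = (\<sigma> * \<sigma>) * (\<i> * (b + (z - a)) / (b - (z - a)))" by (simp only: cay_def mult.assoc)
  also have "\<dots> + \<i> = 2 * \<i> * b / (b - (z - a))" using nz s by (simp add: field_simps)
  finally show ?thesis using b nz by simp
qed

lemma cay_inv_cay: "\<sigma> * \<sigma> = 1 \<Longrightarrow> b \<noteq> 0 \<Longrightarrow> z \<noteq> a + b \<Longrightarrow> cay_inv \<sigma> a b (cay \<sigma> a b z) = z"
proof -
  assume s: "\<sigma> * \<sigma> = 1" and b: "b \<noteq> 0" "z \<noteq> a + b"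
  define D where "D = b - (z - a)"
  have nz: "D \<noteq> 0" using b(2) by (simp add: D_def algebra_simps)
  have "\<sigma> * cay \<sigma> a b z = (\<sigma> * \<sigma>) * (\<i> * (b + (z - a)) / D)" by (simp only: cay_def mult.assoc D_def)
  then have e: "\<sigma> * cay \<sigma> a b z = \<i> * (b + (z - a)) / D" using s by simp
  have "\<i> * (b + (z - a)) / D - \<i> = 2 * \<i> * (z - a) / D" "\<i> * (b + (z - a)) / D + \<i> = 2 * \<i> * b / D"
    using nz by (simp_all add: field_simps D_def)
  then show ?thesis unfolding cay_inv_def e using b nz by simp
qed

lemma cay_cay_inv: "\<sigma> * \<sigma> = 1 \<Longrightarrow> b \<noteq> 0 \<Longrightarrow> \<sigma> * w + \<i> \<noteq> 0 \<Longrightarrow> cay \<sigma> a b (cay_inv \<sigma> a b w) = w"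
proof -
  assume s: "\<sigma> * \<sigma> = 1" and b: "b \<noteq> 0" and nz: "\<sigma> * w + \<i> \<noteq> 0"
  define D where "D = \<sigma> * w + \<i>"
  have D: "D \<noteq> 0" using nz by (simp add: D_def)
  have "b + (cay_inv \<sigma> a b w - a) = 2 * b * (\<sigma> * w) / D" "b - (cay_inv \<sigma> a b w - a) = 2 * b * \<i> / D"
    unfolding cay_inv_def D_def[symmetric] using D by (simp_all add: field_simps) (simp_all add: D_def algebra_simps)
  then have "cay \<sigma> a b (cay_inv \<sigma> a b w) = \<sigma> * (\<sigma> * w)" unfolding cay_def using D b by simp
  then show ?thesis using s by (simp flip: mult.assoc)
qed

lemma Im_cay:
  assumes "z \<noteq> a + b"
  shows "Im (cay (of_real \<sigma>) a b z) = \<sigma> * ((cmod b)\<^sup>2 - (cmod (z - a))\<^sup>2) / (cmod (b - (z - a)))\<^sup>2"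
proof -
  define u where "u = z - a"
  have "\<i> * (b + u) / (b - u) = \<i> * ((b + u) * cnj (b - u)) / of_real ((cmod (b - u))\<^sup>2)"
    using complex_div_cnj[of "\<i> * (b + u)" "b - u"] by (simp add: mult.assoc)
  then have "Im (\<i> * (b + u) / (b - u)) = Re ((b + u) * cnj (b - u)) / (cmod (b - u))\<^sup>2"
    by (simp add: Im_divide_of_real)
  also have "Re ((b + u) * cnj (b - u)) = (cmod b)\<^sup>2 - (cmod u)\<^sup>2"
    by (simp only: cmod_power2) (simp add: power2_eq_square algebra_simps)
  finally have X: "Im (\<i> * (b + u) / (b - u)) = ((cmod b)\<^sup>2 - (cmod u)\<^sup>2) / (cmod (b - u))\<^sup>2" .
  have "Im (of_real \<sigma> * w) = \<sigma> * Im w" for w by simp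
  from this[of "\<i> * (b + u) / (b - u)"] show ?thesis by (simp only: cay_def X times_divide_eq_right u_def[symmetric])
qed

lemma cay_has_derivative:
  assumes "z \<noteq> a + b"
  shows "(cay \<sigma> a b has_field_derivative \<sigma> * (2 * \<i> * b / (b - (z - a))\<^sup>2)) (at z)"
proof -
  have nz: "b - (z - a) \<noteq> 0" using assms by (simp add: algebra_simps)
  show ?thesis
    unfolding cay_def
    by (rule derivative_eq_intros refl nz)+ (use nz in \<open>simp add: power2_eq_square algebra_simps divide_simps\<close>)
qed

lemma cay_holomorphic: "a + b \<notin> A \<Longrightarrow> cay \<sigma> a b holomorphic_on A"
  unfolding cay_def by (intro holomorphic_intros) (auto simp: algebra_simps)

lemma cay_inv_holomorphic: "(\<And>w. w \<in> B \<Longrightarrow> \<sigma> * w + \<i> \<noteq> 0) \<Longrightarrow> cay_inv \<sigma> a b holomorphic_on B"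
  unfolding cay_inv_def by (intro holomorphic_intros) auto

text \<open>The expression is the velocity of the clockwise circle in a Cayley chart. With
  \<open>q = b / u\<close> on the unit circle, \<open>q / (q - 1)\<^sup>2\<close> is the negative
  number \<open>- 1 / (cmod (q - 1))\<^sup>2\<close>, and the remaining factors make up
  \<open>4 * pi * \<sigma>\<close>.\<close>

lemma cay_circle_direction:
  assumes u: "cmod u = cmod b" "u \<noteq> b" "b \<noteq> 0" and \<sigma>: "\<sigma> \<noteq> 0"
  shows "0 < (- \<sigma>) * Re (of_real \<sigma> * (2 * \<i> * b / (b - u)\<^sup>2) * (- (2 * pi * \<i>) * u))"
proof -
  have u0: "u \<noteq> 0" using u by auto
  define q where "q = b / u"
  have q: "cmod q = 1" "q \<noteq> 1" using u u0 by (auto simp: q_def norm_divide)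
  have b: "b = q * u" using u0 by (simp add: q_def)
  have q0: "q \<noteq> 0" using q by auto
  have cq: "cnj q = 1 / q" using q by (simp add: complex_div_cnj[of 1 q])
  have "b - u = (q - 1) * u" unfolding b by (simp add: algebra_simps)
  then have "b * u / (b - u)\<^sup>2 = q * u * u / ((q - 1)\<^sup>2 * (u * u))" using b by (simp add: power_mult_distrib power2_eq_square)
  also have "\<dots> = q / (q - 1)\<^sup>2" using u0 by (simp add: mult.assoc)
  also have "\<dots> = - 1 / ((q - 1) * cnj (q - 1))"
  proof -
    have "(q - 1) * cnj (q - 1) = - ((q - 1)\<^sup>2 / q)" using q0 by (simp add: cq power2_eq_square field_simps)
    then show ?thesis by simp
  qed
  also have "(q - 1) * cnj (q - 1) = of_real ((cmod (q - 1))\<^sup>2)" by (simp only: complex_norm_square)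
  finally have e: "b * u / (b - u)\<^sup>2 = of_real (- 1 / (cmod (q - 1))\<^sup>2)" by simp
  have "of_real \<sigma> * (2 * \<i> * b / (b - u)\<^sup>2) * (- (2 * pi * \<i>) * u) = of_real (4 * pi * \<sigma>) * (b * u / (b - u)\<^sup>2)"
    by (simp add: algebra_simps)
  also have "\<dots> = of_real (4 * pi * \<sigma> * (- 1 / (cmod (q - 1))\<^sup>2))" unfolding e by simp
  finally have "Re (of_real \<sigma> * (2 * \<i> * b / (b - u)\<^sup>2) * (- (2 * pi * \<i>) * u)) = 4 * pi * \<sigma> * (- 1 / (cmod (q - 1))\<^sup>2)"
    by (simp only: Re_complex_of_real)
  then have "(- \<sigma>) * Re (of_real \<sigma> * (2 * \<i> * b / (b - u)\<^sup>2) * (- (2 * pi * \<i>) * u)) = 4 * pi * (\<sigma> * \<sigma>) / (cmod (q - 1))\<^sup>2"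
    by simp
  then show ?thesis using q \<sigma> by (simp add: zero_less_mult_iff less_le)
qed

text \<open>The disc of radius \<open>big n\<close> without the open unit discs around \<open>4 k\<close>, \<open>k < n\<close>. Index \<open>k = n\<close> stands
  for the outer circle. Chart \<open>None\<close> is a translation of the interior; chart \<open>Some (k, b)\<close> is a Cayley
  transform near circle \<open>k\<close> with pole at \<open>cen n k + b\<close>, so that all transition maps are holomorphic.\<close>

definition big :: "nat \<Rightarrow> real" where "big n = 4 * real n + 4"
definition cen :: "nat \<Rightarrow> nat \<Rightarrow> real" where "cen n k = (if k < n then 4 * real k else 0)"
definition rad :: "nat \<Rightarrow> nat \<Rightarrow> real" where "rad n k = (if k < n then 1 else big n)"
abbreviation hub :: "nat \<Rightarrow> nat \<Rightarrow> complex" where "hub n k \<equiv> of_real (cen n k)"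
definition sig :: "nat \<Rightarrow> nat \<Rightarrow> real" where "sig n k = (if k < n then - 1 else 1)"
definition pdom :: "nat \<Rightarrow> complex set" where
  "pdom n = {z. cmod z \<le> big n \<and> (\<forall>k<n. 1 \<le> cmod (z - of_real (4 * real k)))}"
text \<open>Centres at distance 4 keep the discs of radius 2 disjoint, and the discs end at modulus
  \<open>4 * real n - 2\<close>, short of the outer collar. So a collar meets no circle but its
  own.\<close>

definition collar :: "nat \<Rightarrow> nat \<Rightarrow> complex set" where
  "collar n k = (if k < n then ball (of_real (4 * real k)) 2 else {z. 4 * real n < cmod z})"

definition chart_dom :: "nat \<Rightarrow> (nat \<times> real) option \<Rightarrow> complex set" where
  "chart_dom n j = (case j of None \<Rightarrow> {z. cmod z < big n \<and> (\<forall>k<n. 1 < cmod (z - of_real (4 * real k)))}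
     | Some (k, b) \<Rightarrow> collar n k - {of_real (cen n k + b)})"
text \<open>The interior chart is shifted up by \<open>big n\<close>, which exceeds the modulus of
  its points, so that its values have positive imaginary part. The sign \<open>sig n k\<close> turns
  the side of circle \<open>k\<close> on which the surface lies into the upper half plane.\<close>

definition chart :: "nat \<Rightarrow> (nat \<times> real) option \<Rightarrow> complex \<Rightarrow> complex" where
  "chart n j = (case j of None \<Rightarrow> (\<lambda>z. z + \<i> * big n) | Some (k, b) \<Rightarrow> cay (of_real (sig n k)) (hub n k) (of_real b))"
definition chart_inv :: "nat \<Rightarrow> (nat \<times> real) option \<Rightarrow> complex \<Rightarrow> complex" where
  "chart_inv n j = (case j of None \<Rightarrow> (\<lambda>w. w - \<i> * big n) | Some (k, b) \<Rightarrow> cay_inv (of_real (sig n k)) (hub n k) (of_real b))"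
definition chart_img :: "nat \<Rightarrow> (nat \<times> real) option \<Rightarrow> complex set" where
  "chart_img n j = {w. (case j of None \<Rightarrow> True | Some (k, b) \<Rightarrow> of_real (sig n k) * w + \<i> \<noteq> 0) \<and> chart_inv n j w \<in> chart_dom n j}"
definition charts :: "nat \<Rightarrow> (nat \<times> real) option set" where
  "charts n = insert None (Some ` {(k, b). k \<le> n \<and> (b = rad n k \<or> b = - rad n k)})"

definition plane_of :: "point \<Rightarrow> complex" where "plane_of p = Complex (fst p) (fst (snd p))"
text \<open>The third coordinate is reserved for the sheets of the bundle.\<close>

definition point_of :: "complex \<Rightarrow> point" where "point_of z = (Re z, Im z, 0)"
definition pdom_top :: "nat \<Rightarrow> point topology" where "pdom_top n = top_of_set (point_of ` pdom n)"

section \<open>The atlas of the disc with holes\<close>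

lemma norm_diff_of_real: "cmod ((z - of_real x) - (z - of_real y)) = \<bar>y - x\<bar>"
proof -
  have "(z - of_real x) - (z - of_real y) = of_real (y - x)" by simp
  then show ?thesis by (simp only: norm_of_real)
qed

lemma rad_pos: "0 < rad n k"
  by (simp add: rad_def big_def)

lemma sig_sq: "complex_of_real (sig n k) * of_real (sig n k) = 1"
  by (simp add: sig_def)

lemma collar_open: "open (collar n k)"
  unfolding collar_def by (auto intro!: open_Collect_less continuous_intros)

text \<open>Within a collar only its own circle can exclude a point, so membership is decided by the
  sign that \<open>Im_cay\<close> shows in the chart.\<close>

lemma collar_pdom:
  assumes k: "k \<le> n" and z: "z \<in> collar n k"
  shows "z \<in> pdom n \<longleftrightarrow> 0 \<le> sig n k * ((rad n k)\<^sup>2 - (cmod (z - hub n k))\<^sup>2)"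
proof (cases "k < n")
  case True
  then have d: "cmod (z - of_real (4 * real k)) < 2" using z by (simp add: collar_def dist_norm norm_minus_commute)
  have "cmod z \<le> cmod (z - of_real (4 * real k)) + cmod (of_real (4 * real k))" using norm_triangle_ineq[of "z - of_real (4 * real k)" "of_real (4 * real k)"] by simp
  then have "cmod z \<le> big n" using d True by (simp add: big_def)
  moreover have "1 \<le> cmod (z - of_real (4 * real i))" if i: "i < n" "i \<noteq> k" for i
  proof -
    have "4 \<le> \<bar>4 * real k - 4 * real i\<bar>" using i(2) by linarith
    also have "\<dots> = cmod ((z - of_real (4 * real i)) - (z - of_real (4 * real k)))"
      by (rule norm_diff_of_real[symmetric])
    also have "\<dots> \<le> cmod (z - of_real (4 * real i)) + cmod (z - of_real (4 * real k))" by (rule norm_triangle_ineq4)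
    finally show ?thesis using d by linarith
  qed
  ultimately have "z \<in> pdom n \<longleftrightarrow> 1 \<le> cmod (z - of_real (4 * real k))" using True unfolding pdom_def by auto
  also have "\<dots> \<longleftrightarrow> 1\<^sup>2 \<le> (cmod (z - of_real (4 * real k)))\<^sup>2"
    using abs_le_square_iff[of 1 "cmod (z - of_real (4 * real k))"] by simp
  finally show ?thesis using True by (simp add: sig_def rad_def cen_def)
next
  case False
  then have kn: "k = n" and d: "4 * real n < cmod z" using k z by (auto simp: collar_def)
  have "1 \<le> cmod (z - of_real (4 * real i))" if i: "i < n" for i
  proof -
    have "cmod z \<le> cmod (z - of_real (4 * real i)) + cmod (of_real (4 * real i))" using norm_triangle_ineq[of "z - of_real (4 * real i)" "of_real (4 * real i)"] by simp
    then show ?thesis using d i by simp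
  qed
  then have "z \<in> pdom n \<longleftrightarrow> cmod z \<le> big n" unfolding pdom_def by auto
  also have "\<dots> \<longleftrightarrow> (cmod z)\<^sup>2 \<le> (big n)\<^sup>2"
    using abs_le_square_iff[of "cmod z" "big n"] by (simp add: big_def)
  finally show ?thesis using kn by (simp add: sig_def rad_def cen_def)
qed

lemma circle_collar: "k \<le> n \<Longrightarrow> cmod (z - hub n k) = rad n k \<Longrightarrow> z \<in> collar n k"
  by (auto simp: collar_def cen_def rad_def big_def dist_norm norm_minus_commute split: if_splits)

lemma circle_pdom: "k \<le> n \<Longrightarrow> cmod (z - hub n k) = rad n k \<Longrightarrow> z \<in> pdom n"
  using collar_pdom[OF _ circle_collar] by simp

lemma charts_cases:
  assumes "j \<in> charts n"
  obtains "j = None" | k b where "j = Some (k, b)" "k \<le> n" "cmod (of_real b) = rad n k" "complex_of_real b \<noteq> 0"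
proof (cases j)
  case (Some kb)
  then obtain k b where kb: "j = Some (k, b)" "k \<le> n" "b = rad n k \<or> b = - rad n k" using assms by (auto simp: charts_def)
  show ?thesis by (rule that(2)[OF kb(1,2)]) (use kb(3) rad_pos[of n k] in auto)
qed (use that in auto)

lemma Im_collar_chart:
  assumes "z \<noteq> hub n k + of_real b" "cmod (of_real b) = rad n k"
  shows "0 < (cmod (of_real b - (z - hub n k)))\<^sup>2"
    "Im (chart n (Some (k, b)) z) = sig n k * ((rad n k)\<^sup>2 - (cmod (z - hub n k))\<^sup>2) / (cmod (of_real b - (z - hub n k)))\<^sup>2" (is ?im)
proof -
  show "0 < (cmod (of_real b - (z - hub n k)))\<^sup>2" using assms(1) by (auto simp: algebra_simps)
  have "b\<^sup>2 = (rad n k)\<^sup>2" using arg_cong[OF assms(2), of "\<lambda>x. x\<^sup>2"] by simp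
  then show ?im
    using Im_cay[OF assms(1), of "sig n k"] by (simp add: chart_def)
qed

lemma chart_dom_half:
  assumes j: "j \<in> charts n" and z: "z \<in> chart_dom n j"
  shows "z \<in> pdom n \<longleftrightarrow> 0 \<le> Im (chart n j z)"
  using j
proof (cases rule: charts_cases)
  case 1
  then have "cmod z < big n" "z \<in> pdom n" using z by (auto simp: chart_dom_def pdom_def intro: less_imp_le)
  then show ?thesis using 1 abs_Im_le_cmod[of z] by (simp add: chart_def)
next
  case (2 k b)
  then have z': "z \<in> collar n k" "z \<noteq> hub n k + of_real b" using z by (auto simp: chart_dom_def)
  note p = Im_collar_chart[OF z'(2) 2(3), folded 2(1)]
  then show ?thesis using collar_pdom[OF 2(2) z'(1)] p by (simp add: zero_le_divide_iff)
qed

lemma homeo_pdom_top: "homeomorphic_maps (pdom_top n) (top_of_set (pdom n)) plane_of point_of"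
  unfolding homeomorphic_maps_def pdom_top_def continuous_map_in_subtopology
proof (intro conjI)
  have "continuous_on (point_of ` pdom n) (\<lambda>p. Complex (fst p) (fst (snd p)))"
    unfolding Complex_eq by (intro continuous_intros)
  then show "continuous_map (top_of_set (point_of ` pdom n)) euclidean plane_of" by (simp add: plane_of_def[abs_def])
  have "continuous_on (pdom n) (\<lambda>z. (Re z, Im z, 0::nat))" by (intro continuous_intros)
  then show "continuous_map (top_of_set (pdom n)) euclidean point_of" by (simp add: point_of_def[abs_def])
qed (auto simp: plane_of_def point_of_def)

lemma pdom_cover: "pdom n \<subseteq> (\<Union>j\<in>charts n. chart_dom n j)"
proof
  fix z assume z: "z \<in> pdom n"
  show "z \<in> (\<Union>j\<in>charts n. chart_dom n j)"
  proof (cases "\<exists>k\<le>n. cmod (z - hub n k) = rad n k")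
    case True
    then obtain k where k: "k \<le> n" "cmod (z - hub n k) = rad n k" by blast
    \<comment> \<open>The poles of the two charts at circle \<open>k\<close> are opposite points, so
      one of them is different from \<open>z\<close>.\<close>
    have "of_real (cen n k + rad n k) \<noteq> (of_real (cen n k + - rad n k) :: complex)" unfolding of_real_eq_iff using rad_pos[of n k] by simp
    then have "\<exists>b. (b = rad n k \<or> b = - rad n k) \<and> z \<noteq> of_real (cen n k + b)" by (cases "z = of_real (cen n k + rad n k)") blast+
    then obtain b where b: "b = rad n k \<or> b = - rad n k" "z \<noteq> of_real (cen n k + b)" by blast
    have "Some (k, b) \<in> charts n" using k(1) b(1) by (auto simp: charts_def)
    then show ?thesis using circle_collar[OF k] b(2) by (intro UN_I[of "Some (k, b)"]) (auto simp: chart_dom_def)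
  next
    case False
    then have F: "cmod (z - hub n k) \<noteq> rad n k" if "k \<le> n" for k using that by blast
    have "cmod z \<noteq> big n" using F[of n] by (simp add: cen_def rad_def)
    moreover have "cmod (z - of_real (4 * real k)) \<noteq> 1" if "k < n" for k
      using F[of k] that by (simp add: cen_def rad_def)
    ultimately have "z \<in> chart_dom n None" using z by (auto simp: chart_dom_def pdom_def order_le_less)
    then show ?thesis by (intro UN_I[of None]) (auto simp: charts_def)
  qed
qed

lemma chart_dom_open: "open (chart_dom n j)"
proof (cases j)
  case None
  have "chart_dom n j = ball 0 (big n) \<inter> (\<Inter>k\<in>{..<n}. {z. 1 < cmod (z - of_real (4 * real k))})"
    using None by (auto simp: chart_dom_def)
  then show ?thesis by (auto intro!: open_INT open_Collect_less continuous_intros)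
next
  case (Some kb)
  then show ?thesis by (cases kb) (auto simp: chart_dom_def intro: collar_open)
qed

lemma chart_inv_holo: assumes "j \<in> charts n" shows "chart_inv n j holomorphic_on {w. case j of None \<Rightarrow> True | Some (k, b) \<Rightarrow> of_real (sig n k) * w + \<i> \<noteq> 0}"
  using assms by (cases rule: charts_cases) (auto simp: chart_inv_def intro!: cay_inv_holomorphic holomorphic_intros)

lemma chart_img_open: assumes "j \<in> charts n" shows "open (chart_img n j)"
proof -
  let ?D = "{w. case j of None \<Rightarrow> True | Some (k, b) \<Rightarrow> of_real (sig n k) * w + \<i> \<noteq> 0}"
  have "open ?D" by (cases j) (auto intro!: open_Collect_neq continuous_intros)
  then have "open (?D \<inter> chart_inv n j -` chart_dom n j)"
    by (rule continuous_open_preimage[OF holomorphic_on_imp_continuous_on[OF chart_inv_holo[OF assms]] _ chart_dom_open])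
  moreover have "chart_img n j = ?D \<inter> chart_inv n j -` chart_dom n j" by (auto simp: chart_img_def)
  ultimately show ?thesis by simp
qed

lemma chart_chart_inv: assumes j: "j \<in> charts n"
  shows "z \<in> chart_dom n j \<Longrightarrow> chart_inv n j (chart n j z) = z" "z \<in> chart_dom n j \<Longrightarrow> chart n j z \<in> chart_img n j" "w \<in> chart_img n j \<Longrightarrow> chart n j (chart_inv n j w) = w"
proof -
  show gf: "chart_inv n j (chart n j z) = z" if z: "z \<in> chart_dom n j" for z
    using j by (cases rule: charts_cases) (use z in \<open>auto simp: chart_inv_def chart_def chart_dom_def intro!: cay_inv_cay sig_sq\<close>)
  show "chart n j z \<in> chart_img n j" if z: "z \<in> chart_dom n j"
    using j
  proof (cases rule: charts_cases)
    case (2 k b)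
    have "z \<noteq> hub n k + of_real b" using z 2(1) by (auto simp: chart_dom_def)
    then have "of_real (sig n k) * chart n j z + \<i> \<noteq> 0" using cay_pole[OF sig_sq 2(4)] 2(1) by (simp add: chart_def)
    then show ?thesis using gf[OF z] z 2(1) by (simp add: chart_img_def)
  qed (use gf[OF z] z in \<open>simp add: chart_img_def\<close>)
  show "chart n j (chart_inv n j w) = w" if w: "w \<in> chart_img n j"
    using j by (cases rule: charts_cases) (use w in \<open>auto simp: chart_inv_def chart_def chart_img_def intro!: cay_cay_inv sig_sq\<close>)
qed

interpretation pd: planar_atlas "pdom_top n" plane_of point_of "pdom n" "charts n" "chart_dom n" "chart_img n" "chart n" "chart_inv n" for n
proof
  fix j assume j: "j \<in> charts n"
  show "chart n j holomorphic_on chart_dom n j"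
    using j by (cases rule: charts_cases) (auto simp: chart_def chart_dom_def intro!: cay_holomorphic holomorphic_intros)
  show "chart_inv n j holomorphic_on chart_img n j" by (rule holomorphic_on_subset[OF chart_inv_holo[OF j]]) (auto simp: chart_img_def)
  show "open (chart_img n j)" by (rule chart_img_open[OF j])
  show "chart n j z \<in> chart_img n j" "chart_inv n j (chart n j z) = z" "z \<in> pdom n \<longleftrightarrow> 0 \<le> Im (chart n j z)" if "z \<in> chart_dom n j" for z
    using chart_chart_inv(1,2)[OF j that] chart_dom_half[OF j that] by simp_all
  show "chart n j (chart_inv n j w) = w" "chart_inv n j w \<in> chart_dom n j" if "w \<in> chart_img n j" for w
    using chart_chart_inv(3)[OF j that] that by (auto simp: chart_img_def)
qed (use homeo_pdom_top chart_dom_open pdom_cover in auto)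

abbreviation planar :: "nat \<Rightarrow> point surface" where "planar n \<equiv> pd.S n"

text \<open>All circles run clockwise. For the holes this is the boundary orientation, as sources
  require; for the outer circle it is the reverse, as targets require.\<close>

definition circ :: "nat \<Rightarrow> nat \<Rightarrow> real \<Rightarrow> complex" where
  "circ n k t = hub n k + of_real (rad n k) * cis (- (2 * pi * t))"

lemma circ_dist: "cmod (circ n k t - hub n k) = rad n k"
  using rad_pos[of n k] by (simp add: circ_def norm_mult)

lemma circ_pdom: "k \<le> n \<Longrightarrow> circ n k t \<in> pdom n"
  by (rule circle_pdom[OF _ circ_dist])

lemma circ_periodic: "circ n k (t + 1) = circ n k t"
  by (simp add: circ_def complex_eq_iff algebra_simps) (simp add: cos_diff sin_diff)

lemma circ_derivative: "(circ n k has_vector_derivative - (2 * pi * \<i>) * (circ n k t - hub n k)) (at t)"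
  unfolding circ_def has_vector_derivative_complex_iff
  by (auto intro!: derivative_eq_intros simp: algebra_simps)

text \<open>The curve is the restriction of an entire function to the real line.\<close>

lemma circ_Ck: "Ck_on m (\<lambda>t. vc (circ n k t)) UNIV"
proof -
  define h where "h z = hub n k + of_real (rad n k) * exp (- (2 * pi * \<i>) * z)" for z
  have h: "h holomorphic_on UNIV" unfolding h_def by (intro holomorphic_intros)
  have "circ n k t = h (cv (vc (of_real t)))" for t
    by (simp add: circ_def h_def cis_conv_exp mult_ac)
  moreover have "Ck_on m (\<lambda>t. vc (h (cv (vc (of_real t))))) (UNIV :: real set)"
  proof (rule Ck_on_compose[OF open_UNIV open_UNIV, where g = "\<lambda>v. vc (h (cv v))"])
    show "Ck_on m (\<lambda>t. vc (of_real t)) (UNIV :: real set)"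
      by (rule Ck_on_linear[OF open_UNIV bounded_linear_compose[OF bounded_linear_vc bounded_linear_of_real]])
    show "Ck_on m (\<lambda>v. vc (h (cv v))) UNIV" using holomorphic_Ck_on[OF h open_UNIV] by simp
  qed auto
  ultimately show ?thesis by simp
qed

lemma planar_curve: "k \<le> n \<Longrightarrow> smooth_curve (planar n) (\<lambda>t. point_of (circ n k t))"
  by (rule pd.curve_smooth) (rule circ_pdom circ_Ck; simp)+

lemma circle_in_collar:
  assumes k: "k \<le> n" "k' \<le> n" and z: "cmod (z - hub n k) = rad n k" "z \<in> collar n k'"
  shows "k = k'"
proof (rule ccontr)
  assume ne: "k \<noteq> k'"
  have t: "cmod z \<le> cmod (z - of_real c) + \<bar>c\<bar>" for c using norm_triangle_ineq[of "z - of_real c" "of_real c"] by simp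
  show False
  proof (cases "k' < n")
    case True
    then have d: "cmod (z - of_real (4 * real k')) < 2" using z(2) by (simp add: collar_def dist_norm norm_minus_commute)
    show False
    proof (cases "k < n")
      case kn: True
      have "4 \<le> \<bar>4 * real k - 4 * real k'\<bar>" using ne by linarith
      also have "\<dots> = cmod ((z - of_real (4 * real k')) - (z - of_real (4 * real k)))"
        by (rule norm_diff_of_real[symmetric])
      also have "\<dots> \<le> cmod (z - of_real (4 * real k')) + cmod (z - of_real (4 * real k))" by (rule norm_triangle_ineq4)
      finally show False using d z(1) kn by (simp add: cen_def rad_def)
    next
      case False
      then show False using d t[of "4 * real k'"] z(1) True k by (simp add: cen_def rad_def big_def)
    qed
  next
    case False
    then show False using t[of "4 * real k"] z k ne by (simp add: cen_def rad_def big_def collar_def)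
  qed
qed

lemma planar_direction: assumes k: "k \<le> n" shows "boundary_direction (- sig n k) (planar n) (\<lambda>t. point_of (circ n k t))"
proof (rule pd.curve_direction[OF circ_pdom[OF k] circ_derivative])
  fix j t assume j: "j \<in> charts n" and a: "circ n k t \<in> chart_dom n j"
  show "0 < - sig n k * Re (deriv (chart n j) (circ n k t) * (- (2 * pi * \<i>) * (circ n k t - hub n k)))"
    using j
  proof (cases rule: charts_cases)
    case 1
    then have "cmod (circ n k t) < big n" "\<And>i. i < n \<Longrightarrow> 1 < cmod (circ n k t - of_real (4 * real i))" using a by (auto simp: chart_dom_def)
    then have "cmod (circ n k t - hub n k) \<noteq> rad n k" using k by (cases "k < n") (simp_all add: cen_def rad_def, metis less_irrefl)
    then show ?thesis using circ_dist by simp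
  next
    case (2 k' b)
    have z: "circ n k t \<in> collar n k'" "circ n k t \<noteq> hub n k' + of_real b" using a 2(1) by (auto simp: chart_dom_def)
    have kk: "k' = k" using circle_in_collar[OF k 2(2) circ_dist z(1)] by simp
    have d: "deriv (chart n j) (circ n k t) = of_real (sig n k) * (2 * \<i> * of_real b / (of_real b - (circ n k t - hub n k))\<^sup>2)"
      using DERIV_imp_deriv[OF cay_has_derivative[OF z(2), of "of_real (sig n k)"]] 2(1) kk by (simp add: chart_def)
    have "0 < - sig n k * Re (of_real (sig n k) * (2 * \<i> * of_real b / (of_real b - (circ n k t - hub n k))\<^sup>2) * (- (2 * pi * \<i>) * (circ n k t - hub n k)))"
      by (rule cay_circle_direction) (use circ_dist[of n k t] 2(3,4) z(2) kk in \<open>auto simp: sig_def algebra_simps\<close>)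
    then show ?thesis unfolding d .
  qed
qed

lemma Im_chart_eq_0:
  assumes j: "j \<in> charts n" and z: "z \<in> chart_dom n j"
  shows "Im (chart n j z) = 0 \<longleftrightarrow> (\<exists>k\<le>n. cmod (z - hub n k) = rad n k)"
  using j
proof (cases rule: charts_cases)
  case 1
  then have a: "cmod z < big n" "\<And>i. i < n \<Longrightarrow> 1 < cmod (z - of_real (4 * real i))" using z by (auto simp: chart_dom_def)
  have "cmod (z - hub n k) \<noteq> rad n k" if "k \<le> n" for k
    using that a(1) a(2)[of k] by (cases "k < n") (simp_all add: cen_def rad_def)
  then show ?thesis using 1 a(1) abs_Im_le_cmod[of z] by (auto simp: chart_def)
next
  case (2 k b)
  have z': "z \<in> collar n k" "z \<noteq> hub n k + of_real b" using z 2(1) by (auto simp: chart_dom_def)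
  note p = Im_collar_chart[OF z'(2) 2(3), folded 2(1)]
  then have "Im (chart n j z) = 0 \<longleftrightarrow> (cmod (z - hub n k))\<^sup>2 = (rad n k)\<^sup>2" using p by (auto simp: sig_def)
  also have "\<dots> \<longleftrightarrow> cmod (z - hub n k) = rad n k" using rad_pos[of n k] by (simp add: power2_eq_iff_nonneg)
  also have "\<dots> \<longleftrightarrow> (\<exists>k\<le>n. cmod (z - hub n k) = rad n k)"
    using circle_in_collar[OF _ 2(2) _ z'(1)] 2(2) by blast
  finally show ?thesis .
qed

lemma point_of_inj: "point_of z = point_of w \<longleftrightarrow> z = w"
  by (auto simp: point_of_def complex_eq_iff)

lemma Top_planar: "Top (planar n) = pdom_top n"
  by (simp add: pd.S_def)

lemma pts_planar: "pts (planar n) = point_of ` pdom n"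
  unfolding Top_planar by (simp add: pdom_top_def)

lemma planar_boundary: "surface_boundary (planar n) = point_of ` {z. \<exists>k\<le>n. cmod (z - hub n k) = rad n k}" (is "_ = ?S")
proof (intro subset_antisym subsetI)
  fix p assume "p \<in> surface_boundary (planar n)"
  then obtain j where p: "p \<in> topspace (pdom_top n)" and j: "j \<in> charts n" "plane_of p \<in> chart_dom n j" "Im (chart n j (plane_of p)) = 0"
    unfolding pd.S_boundary by blast
  then have "\<exists>k\<le>n. cmod (plane_of p - hub n k) = rad n k" using Im_chart_eq_0 by blast
  then show "p \<in> ?S"
    using pd.ci_co[OF p] by (intro image_eqI[where x = "plane_of p"]) auto
next
  fix p assume "p \<in> ?S"
  then obtain z where z: "p = point_of z" "\<exists>k\<le>n. cmod (z - hub n k) = rad n k" by blast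
  then have zp: "z \<in> pdom n" using circle_pdom by blast
  then obtain j where j: "j \<in> charts n" "z \<in> chart_dom n j" using pdom_cover by blast
  then have "Im (chart n j z) = 0" using Im_chart_eq_0 z(2) by blast
  then show "p \<in> surface_boundary (planar n)"
    unfolding pd.S_boundary using j zp z(1) pd.co_ci[OF zp] pd.ci_X[OF zp] by auto
qed

lemma circ_inj:
  assumes t: "t \<in> {0..<1}" "t' \<in> {0..<1}" and e: "circ n k t = circ n k t'"
  shows "t = t'"
proof -
  have "cis (- (2 * pi * t)) = cis (- (2 * pi * t'))" using e rad_pos[of n k] by (simp add: circ_def)
  then have "sin (- (2 * pi * t)) = sin (- (2 * pi * t')) \<and> cos (- (2 * pi * t)) = cos (- (2 * pi * t'))" by (simp add: cis.ctr)
  then obtain m :: int where "- (2 * pi * t) = - (2 * pi * t') + 2 * pi * m" unfolding sin_cos_eq_iff by blast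
  then have "2 * pi * (t' - t) = 2 * pi * m" by (simp add: algebra_simps)
  then have "t' - t = m" by simp
  moreover from this have "m = 0" using t by auto
  ultimately show ?thesis by simp
qed

lemma circ_surj:
  assumes z: "cmod (z - hub n k) = rad n k"
  shows "\<exists>t\<in>{0..<1}. z = circ n k t"
proof -
  define w where "w = (z - hub n k) / of_real (rad n k)"
  have "cmod w = 1" using z rad_pos[of n k] by (simp add: w_def norm_divide)
  then have w: "w = cis (Arg w)" using cis_Arg[of w] by (cases "w = 0") (simp_all add: sgn_eq)
  have "circ n k (- Arg w / (2 * pi)) = z"
    using rad_pos[of n k] by (simp add: circ_def flip: w) (simp add: w_def)
  moreover have "circ n k (- Arg w / (2 * pi)) = circ n k (frac (- Arg w / (2 * pi)))" by (rule periodic_frac) (rule circ_periodic)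
  ultimately show ?thesis by (intro bexI[of _ "frac (- Arg w / (2 * pi))"]) (auto simp: frac_lt_1)
qed

lemma planar_boundary_bij: "bij_betw (\<lambda>(k, t). point_of (circ n k t)) ({..n} \<times> {0..<1}) (surface_boundary (planar n))"
proof (rule bij_betw_imageI)
  have "k = k' \<and> t = t'" if "k \<le> n" "t \<in> {0..<1}" "k' \<le> n" "t' \<in> {0..<1}" "circ n k t = circ n k' t'" for k t k' t'
  proof -
    have "circ n k t \<in> collar n k'" using that(5) circle_collar[OF that(3) circ_dist, of t'] by simp
    then have k: "k = k'" using circle_in_collar[OF that(1,3) circ_dist] by blast
    then show ?thesis using circ_inj that by simp
  qed
  then show "inj_on (\<lambda>(k, t). point_of (circ n k t)) ({..n} \<times> {0..<1})" 
    by (intro inj_onI, clarify) (simp only: point_of_inj mem_Sigma_iff atMost_iff)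
  show "(\<lambda>(k, t). point_of (circ n k t)) ` ({..n} \<times> {0..<1}) = surface_boundary (planar n)"
    unfolding planar_boundary
  proof (intro subset_antisym subsetI)
    fix p assume "p \<in> (\<lambda>(k, t). point_of (circ n k t)) ` ({..n} \<times> {0..<1})"
    then obtain k t where "k \<le> n" "p = point_of (circ n k t)" by auto
    then show "p \<in> point_of ` {z. \<exists>k\<le>n. cmod (z - hub n k) = rad n k}" using circ_dist by blast
  next
    fix p assume "p \<in> point_of ` {z. \<exists>k\<le>n. cmod (z - hub n k) = rad n k}"
    then obtain z k where z: "p = point_of z" "k \<le> n" "cmod (z - hub n k) = rad n k" by blast
    then obtain t where "t \<in> {0..<1}" "z = circ n k t" using circ_surj by blast
    then show "p \<in> (\<lambda>(k, t). point_of (circ n k t)) ` ({..n} \<times> {0..<1})" using z by force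
  qed
qed

lemma planar_compact: "compact_space (Top (planar n))"
proof -
  have "closed {z. 1 \<le> cmod (z - of_real (4 * real k))}" for k by (intro closed_Collect_le continuous_intros)
  moreover have "pdom n = cball 0 (big n) \<inter> (\<Inter>k\<in>{..<n}. {z. 1 \<le> cmod (z - of_real (4 * real k))})" by (auto simp: pdom_def)
  ultimately have "compact (pdom n)" by (auto intro!: compact_Int_closed closed_INT)
  moreover have "continuous_on (pdom n) point_of" unfolding point_of_def by (intro continuous_intros)
  ultimately have "compact (point_of ` pdom n)" by (intro compact_continuous_image)
  then show ?thesis unfolding Top_planar by (simp add: pdom_top_def compact_space_subtopology)
qed

section \<open>Cobordisms that multiply monodromies\<close>

definition list_prod :: "('g, 'r) monoid_scheme \<Rightarrow> 'g list \<Rightarrow> 'g" where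
  "list_prod G xs = foldr (\<lambda>x y. x \<otimes>\<^bsub>G\<^esub> y) xs \<one>\<^bsub>G\<^esub>"

lemma (in group) list_prod_simps [simp]:
  "list_prod G [] = \<one>" "list_prod G (x # xs) = x \<otimes> list_prod G xs"
  by (simp_all add: list_prod_def)

lemma (in group) list_prod_closed [simp]: "set xs \<subseteq> carrier G \<Longrightarrow> list_prod G xs \<in> carrier G"
  by (induction xs) auto

lemma (in group) list_prod_append: "set xs \<subseteq> carrier G \<Longrightarrow> set ys \<subseteq> carrier G \<Longrightarrow> list_prod G (xs @ ys) = list_prod G xs \<otimes> list_prod G ys"
  by (induction xs) (auto simp: m_assoc)

text \<open>\<open>pos\<close> distributes the incoming circles over the holes, and
  \<open>n\<close>, the index of the outer circle, belongs to the single outgoing circle with index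
  0.\<close>

lemma bij_betw_case_sum_reindex:
  fixes n :: nat
  assumes pos: "bij_betw pos C {..<n}" and F: "bij_betw (\<lambda>(k, r). F k r) ({..n} \<times> R) S"
  shows "bij_betw (case_sum (\<lambda>(i, r). F (pos i) r) (\<lambda>(i, r). F n r)) ((C \<times> R) <+> ({0::nat} \<times> R)) S"
proof -
  let ?h = "case_sum (\<lambda>(i, r). (pos i, r)) (\<lambda>(i::nat, r). (n, r))"
  have "bij_betw ?h ((C \<times> R) <+> ({0} \<times> R)) ({..n} \<times> R)"
  proof (rule bij_betwI[where g = "\<lambda>(k, r). if k = n then Inr (0, r) else Inl (inv_into C pos k, r)"])
    have p: "pos i < n \<and> inv_into C pos (pos i) = i" if "i \<in> C" for i
      using inv_into_f_f[OF bij_betw_imp_inj_on[OF pos] that] bij_betwE[OF pos] that by simp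
    have q: "inv_into C pos k \<in> C \<and> pos (inv_into C pos k) = k" if "k < n" for k
      using inv_into_into[of k pos C] f_inv_into_f[of k pos C] bij_betw_imp_surj_on[OF pos] that by simp
    let ?g = "\<lambda>(k, r). if k = n then Inr (0::nat, r) else Inl (inv_into C pos k, r)"
    show "?h \<in> (C \<times> R) <+> ({0} \<times> R) \<rightarrow> {..n} \<times> R"
    proof (rule funcsetI)
      fix x assume "x \<in> (C \<times> R) <+> ({0::nat} \<times> R)"
      then show "?h x \<in> {..n} \<times> R" using p less_imp_le by (cases x) auto
    qed
    show "?g \<in> {..n} \<times> R \<rightarrow> (C \<times> R) <+> ({0} \<times> R)"
    proof (rule funcsetI)
      fix x assume "x \<in> {..n} \<times> R"
      then show "?g x \<in> (C \<times> R) <+> ({0} \<times> R)" using q by (cases x) auto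
    qed
    show "?g (?h x) = x" if "x \<in> (C \<times> R) <+> ({0} \<times> R)" for x
      using that by (cases x) (auto dest: p)
    show "?h (?g x) = x" if "x \<in> {..n} \<times> R" for x using that q by (cases x) auto
  qed
  from bij_betw_trans[OF this F] show ?thesis
    by (rule bij_betw_cong[THEN iffD1, rotated]) auto
qed

locale planar_bundle =
  fixes G :: "('g, 'r) monoid_scheme" (structure) and gs :: "'g list"
  assumes G: "group G" and fin: "finite (carrier G)" and gs: "set gs \<subseteq> carrier G"
begin

interpretation group G by (rule G)

abbreviation n where "n \<equiv> length gs"

text \<open>The bundle is trivial over the plane slit below (\<open>True\<close>) or above (\<open>False\<close>) each hole. The two
  trivializations differ over the real part \<open>x\<close> by \<open>hol x\<close>, the product of the monodromies of the holes
  to the left of \<open>x\<close>.\<close>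

definition hol :: "real \<Rightarrow> 'g" where "hol x = list_prod G (take (card {i. i < n \<and> 4 * real i < x}) gs)"
definition east where "east k = cen n k + rad n k"
definition west where "west k = cen n k - rad n k"
definition monodromy :: "nat \<Rightarrow> 'g" where "monodromy k = (if k < n then gs ! k else list_prod G gs)"

lemma hol_closed [simp]: "hol x \<in> carrier G"
  unfolding hol_def by (intro list_prod_closed order_trans[OF set_take_subset gs])

lemma monodromy_closed: "monodromy k \<in> carrier G"
  using gs nth_mem[of k gs] by (auto simp: monodromy_def)

text \<open>From the west to the east point of a hole only the centre of that hole is passed; from
  the west to the east point of the outer circle all centres are.\<close>

lemma hol_east: assumes k: "k \<le> n" shows "hol (east k) = hol (west k) \<otimes> monodromy k"
proof (cases "k < n")
  case True
  have "{i. i < n \<and> 4 * real i < east k} = {..<Suc k}" "{i. i < n \<and> 4 * real i < west k} = {..<k}"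
    using True by (auto simp: east_def west_def cen_def rad_def)
  then have e: "hol (east k) = list_prod G (take k gs @ [gs ! k])" "hol (west k) = list_prod G (take k gs)"
    using True by (simp_all add: hol_def take_Suc_conv_app_nth)
  have "set (take k gs) \<subseteq> carrier G" "gs ! k \<in> carrier G" using gs True by (auto dest: in_set_takeD)
  then show ?thesis unfolding e using True by (simp add: list_prod_append monodromy_def)
next
  case False
  then have k: "k = n" using k by simp
  have "{i. i < n \<and> 4 * real i < east k} = {..<n}" "{i. i < n \<and> 4 * real i < west k} = {}"
    using k by (auto simp: east_def west_def cen_def rad_def big_def)
  then have "hol (east k) = list_prod G (take (card {..<n}) gs)" "hol (west k) = list_prod G (take (card ({}::nat set)) gs)"
    unfolding hol_def by (simp_all only:)
  then show ?thesis using k gs by (simp add: monodromy_def)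
qed

definition chamber :: "complex set" where "chamber = {z. \<forall>k<n. Re z \<noteq> 4 * real k}"

text \<open>On \<open>chamber\<close> the value of \<open>hol\<close> depends only on the set of
  holes to the left, which is locally constant.\<close>

lemma hol_open: "open {z \<in> chamber. hol (Re z) \<in> Y}"
proof -
  let ?S = "\<lambda>M. {z. \<forall>k\<in>{..<n}. if k \<in> M then 4 * real k < Re z else Re z < 4 * real k}"
  let ?\<M> = "{M. M \<subseteq> {..<n} \<and> list_prod G (take (card M) gs) \<in> Y}"
  have o: "open (?S M)" for M
  proof -
    have "open {z. if k \<in> M then 4 * real k < Re z else Re z < 4 * real k}" for k
      by (cases "k \<in> M") (auto intro!: open_Collect_less continuous_intros)
    moreover have "?S M = (\<Inter>k\<in>{..<n}. {z. if k \<in> M then 4 * real k < Re z else Re z < 4 * real k})" by auto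
    ultimately show ?thesis by (simp only:) (intro open_INT finite_lessThan ballI)
  qed
  have "{z \<in> chamber. hol (Re z) \<in> Y} = (\<Union>M\<in>?\<M>. ?S M)"
  proof (intro subset_antisym subsetI)
    fix z assume z: "z \<in> {z \<in> chamber. hol (Re z) \<in> Y}"
    let ?M = "{i. i < n \<and> 4 * real i < Re z}"
    have "?M \<in> ?\<M>" using z by (auto simp: hol_def)
    moreover have "z \<in> ?S ?M" using z by (auto simp: chamber_def)
    ultimately show "z \<in> (\<Union>M\<in>?\<M>. ?S M)" by blast
  next
    fix z assume "z \<in> (\<Union>M\<in>?\<M>. ?S M)"
    then obtain M where M: "M \<subseteq> {..<n}" "list_prod G (take (card M) gs) \<in> Y" "z \<in> ?S M" by blast
    have "M = {i. i < n \<and> 4 * real i < Re z}"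
    proof (intro subset_antisym subsetI)
      fix i assume i: "i \<in> M"
      then have "i < n" using M(1) by auto
      then show "i \<in> {i. i < n \<and> 4 * real i < Re z}" using M(3) i by auto
    next
      fix i assume i: "i \<in> {i. i < n \<and> 4 * real i < Re z}"
      then show "i \<in> M" using M(3) by (auto split: if_splits dest: spec[where x = i])
    qed
    moreover have "z \<in> chamber" using M(3) by (auto simp: chamber_def split: if_splits)
    ultimately show "z \<in> {z \<in> chamber. hol (Re z) \<in> Y}" using M(2) by (simp add: hol_def)
  qed
  then show ?thesis by (simp only:) (intro open_UN ballI o)
qed

text \<open>The fibre is stored in the third coordinate, through an enumeration of the finite
  group.\<close>

definition emb :: "point \<Rightarrow> 'g \<Rightarrow> point" where "emb p y = (fst p, fst (snd p), to_nat_on (carrier G) y)"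
definition prj :: "point \<Rightarrow> point" where "prj q = (fst q, fst (snd q), 0)"
definition lvl :: "point \<Rightarrow> 'g" where "lvl q = from_nat_into (carrier G) (snd (snd q))"
definition slit :: "bool \<Rightarrow> complex set" where
  "slit i = {z. \<forall>k\<in>{..<n}. Re z \<noteq> 4 * real k \<or> (if i then 0 < Im z else Im z < 0)}"
definition slit_dom :: "bool \<Rightarrow> point set" where "slit_dom i = {p \<in> pts (planar n). plane_of p \<in> slit i}"
text \<open>The coordinates of \<open>emb\<close> are those of the trivialization
  \<open>True\<close>. \<open>hol\<close> jumps at the vertical lines through the holes, which
  \<open>slit False\<close> contains below the real axis: across them the sheets are glued
  differently from the product.\<close>

definition slit_transition :: "bool \<Rightarrow> point \<Rightarrow> 'g" where "slit_transition i p = (if i then \<one> else hol (Re (plane_of p)))"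

lemma preimage_open: "open V \<Longrightarrow> openin (Top (planar n)) {p \<in> pts (planar n). plane_of p \<in> V}"
  unfolding Top_planar by (rule openin_continuous_map_preimage[OF pd.co_cont]) simp

lemma slit_open: "open (slit i)"
proof -
  have "open {z. Re z \<noteq> 4 * real k \<or> (if i then 0 < Im z else Im z < 0)}" for k
  proof -
    have "open {z. Re z \<noteq> 4 * real k \<or> 0 < Im z}" "open {z. Re z \<noteq> 4 * real k \<or> Im z < 0}"
      by (intro open_Collect_disj open_Collect_neq open_Collect_less continuous_intros)+
    then show ?thesis by (cases i) (simp_all only: if_True if_False)
  qed
  moreover have "slit i = (\<Inter>k\<in>{..<n}. {z. Re z \<noteq> 4 * real k \<or> (if i then 0 < Im z else Im z < 0)})" by (auto simp: slit_def)
  ultimately show ?thesis by (simp only:) (intro open_INT finite_lessThan ballI)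
qed

lemma slit_Int: "slit True \<inter> slit False = chamber"
  by (auto simp: slit_def chamber_def)

text \<open>A real point with real part \<open>4 * real k\<close> would be the centre of a hole.
  Hence the two slit regions together cover the surface.\<close>

lemma pdom_real_chamber:
  assumes "z \<in> pdom n" "Im z = 0" shows "z \<in> chamber"
  unfolding chamber_def
proof (intro CollectI allI impI notI)
  fix k assume k: "k < n" "Re z = 4 * real k"
  then have "z = of_real (4 * real k)" using assms(2) by (simp add: complex_eq_iff)
  moreover have "1 \<le> cmod (z - of_real (4 * real k))" using assms(1) k(1) by (simp add: pdom_def)
  ultimately show False by simp
qed

lemma slit_cover: "pdom n \<subseteq> slit True \<union> slit False"
proof
  fix z assume z: "z \<in> pdom n"
  consider "Im z = 0" | "0 < Im z" | "Im z < 0" by linarith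
  then show "z \<in> slit True \<union> slit False"
    by cases (use pdom_real_chamber[OF z] slit_Int in \<open>auto simp: slit_def\<close>)
qed

lemma plane_of_pdom: "p \<in> pts (planar n) \<Longrightarrow> plane_of p \<in> pdom n"
  unfolding Top_planar by (rule pd.co_P)

sublocale etale_bundle G "planar n" emb prj lvl "UNIV :: bool set" slit_dom slit_transition
proof
  show "finite (carrier G)" by (rule fin)
  show "smooth_surface (planar n)" using pd.oriented_S by (simp add: oriented_smooth_surface_def)
  show "prj (emb x y) = x" if "x \<in> pts (planar n)" for x y
    using that unfolding pts_planar by (auto simp: prj_def emb_def point_of_def)
  show "lvl (emb x y) = y" if "y \<in> carrier G" for x y
    using that fin by (simp add: lvl_def emb_def countable_finite)
  show "openin (Top (planar n)) (slit_dom i)" for i unfolding slit_dom_def by (rule preimage_open[OF slit_open])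
  show "(\<Union>i\<in>UNIV. slit_dom i) = pts (planar n)" using slit_cover plane_of_pdom by (auto simp: slit_dom_def UNIV_bool)
  show "slit_transition i x \<in> carrier G" for i x by (simp add: slit_transition_def)
  fix i j :: bool and g
  show "openin (Top (planar n)) {x \<in> slit_dom i \<inter> slit_dom j. slit_transition i x \<otimes> inv (slit_transition j x) = g}"
  proof (cases "i = j")
    case True
    then have "{x \<in> slit_dom i \<inter> slit_dom j. slit_transition i x \<otimes> inv (slit_transition j x) = g} = (if g = \<one> then slit_dom i else {})"
      by (auto simp: slit_transition_def)
    then show ?thesis using preimage_open[OF slit_open] by (simp add: slit_dom_def)
  next
    case False
    let ?Y = "if i then {y. inv y = g} else {y. y = g}"
    have ij: "slit i \<inter> slit j = chamber" using False slit_Int by (cases i; cases j) auto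
    have "{x \<in> slit_dom i \<inter> slit_dom j. slit_transition i x \<otimes> inv (slit_transition j x) = g} = {p \<in> pts (planar n). plane_of p \<in> {z \<in> chamber. hol (Re z) \<in> ?Y}}"
      using False unfolding ij[symmetric] by (cases i; cases j) (auto simp: slit_dom_def slit_transition_def)
    then show ?thesis using preimage_open[OF hol_open[of ?Y]] by simp
  qed
qed simp_all

text \<open>The group coordinate of the lift of circle \<open>k\<close> that starts at the unit over
  the east point. The first half of a turn passes below, where the lift is constant in the
  trivialization \<open>False\<close> and so follows \<open>hol\<close>; the second half passes
  above, where the coordinate keeps its value from the west point. By \<open>hol_east\<close> a full
  turn yields the inverse of the monodromy, hence the power with exponent
  \<open>- \<lfloor>t\<rfloor>\<close>.\<close>

definition lift_factor :: "nat \<Rightarrow> real \<Rightarrow> 'g" where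
  "lift_factor k t = monodromy k [^] (- \<lfloor>t\<rfloor>) \<otimes> inv hol (east k) \<otimes>
     (if frac t \<le> 1 / 2 then hol (Re (circ n k t)) else hol (west k))"

definition bcurve :: "nat \<Rightarrow> real \<Rightarrow> 'g \<Rightarrow> point" where
  "bcurve k t y = emb (point_of (circ n k t)) (y \<otimes> lift_factor k t)"

lemma lift_factor_closed [simp]: "lift_factor k t \<in> carrier G"
  by (simp add: lift_factor_def monodromy_closed)

lemma circ_pts: "k \<le> n \<Longrightarrow> point_of (circ n k t) \<in> pts (planar n)"
  unfolding pts_planar by (rule imageI) (rule circ_pdom)

text \<open>The gluing relation of the bundle over the circle with monodromy
  \<open>monodromy k\<close>, in group coordinates.\<close>

lemma lift_factor_shift: assumes y: "y \<in> carrier G" shows "y \<otimes> monodromy k \<otimes> lift_factor k (t + 1) = y \<otimes> lift_factor k t"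
proof -
  have "monodromy k [^] (1 + (- \<lfloor>t\<rfloor> - 1)) = monodromy k [^] (1::int) \<otimes> monodromy k [^] (- \<lfloor>t\<rfloor> - 1)"
    by (rule int_pow_mult[OF monodromy_closed])
  then have e: "monodromy k \<otimes> monodromy k [^] (- \<lfloor>t\<rfloor> - 1) = monodromy k [^] (- \<lfloor>t\<rfloor>)"
    by (simp add: int_pow_1[OF monodromy_closed])
  have f: "lift_factor k (t + 1) = monodromy k [^] (- \<lfloor>t\<rfloor> - 1) \<otimes> (inv hol (east k) \<otimes>
     (if frac t \<le> 1 / 2 then hol (Re (circ n k t)) else hol (west k)))"
  proof -
    have "\<lfloor>t + 1\<rfloor> = \<lfloor>t\<rfloor> + 1" "frac (t + 1) = frac t" "- (\<lfloor>t\<rfloor> + 1) = - \<lfloor>t\<rfloor> - 1" by (simp_all add: frac_def)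
    then show ?thesis using circ_periodic[of n k t] unfolding lift_factor_def by (simp only:) (simp add: m_assoc monodromy_closed)
  qed
  have "monodromy k \<otimes> lift_factor k (t + 1) = monodromy k [^] (- \<lfloor>t\<rfloor>) \<otimes> (inv hol (east k) \<otimes>
     (if frac t \<le> 1 / 2 then hol (Re (circ n k t)) else hol (west k)))"
    unfolding f e[symmetric] by (simp add: m_assoc monodromy_closed)
  also have "\<dots> = lift_factor k t" by (simp add: lift_factor_def m_assoc monodromy_closed)
  finally have "monodromy k \<otimes> lift_factor k (t + 1) = lift_factor k t" .
  then show ?thesis using y by (simp add: m_assoc monodromy_closed)
qed

lemma bcurve_facts:
  assumes k: "k \<le> n" and y: "y \<in> carrier G"
  shows "bcurve k t y \<in> Q" "prj (bcurve k t y) = point_of (circ n k t)" "lvl (bcurve k t y) = y \<otimes> lift_factor k t"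
    "bcurve k (t + 1) (y \<otimes> monodromy k) = bcurve k t y"
    "g \<in> carrier G \<Longrightarrow> translate g (bcurve k t y) = bcurve k t (g \<otimes> y)"
proof -
  show c: "bcurve k t y \<in> Q" "prj (bcurve k t y) = point_of (circ n k t)" "lvl (bcurve k t y) = y \<otimes> lift_factor k t"
    using circ_pts[OF k] y by (simp_all add: bcurve_def e_Q \<pi>_e lev_e)
  show "bcurve k (t + 1) (y \<otimes> monodromy k) = bcurve k t y" unfolding bcurve_def lift_factor_shift[OF y] circ_periodic by simp
  show "translate g (bcurve k t y) = bcurve k t (g \<otimes> y)" if "g \<in> carrier G"
    using c that y by (simp add: translate_def) (simp add: bcurve_def m_assoc)
qed

lemma circ_Re: "Re (circ n k (of_int q)) = east k" "Re (circ n k (of_int q + 1 / 2)) = west k"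
proof -
  have "circ n k (of_int q) = circ n k (frac (of_int q))" "circ n k (of_int q + 1 / 2) = circ n k (frac (of_int q + 1 / 2))"
    by (rule periodic_frac, rule circ_periodic)+
  moreover have "frac (of_int q :: real) = 0" "frac (of_int q + 1 / 2 :: real) = 1 / 2" by (simp_all add: frac_unique_iff)
  ultimately have e: "circ n k (of_int q) = circ n k 0" "circ n k (of_int q + 1 / 2) = circ n k (1 / 2)" by (simp_all only:)
  show "Re (circ n k (of_int q)) = east k" "Re (circ n k (of_int q + 1 / 2)) = west k"
    unfolding e by (simp_all add: circ_def east_def west_def)
qed

lemma circ_Im:
  shows "t \<in> {of_int q .. of_int q + 1 / 2} \<Longrightarrow> Im (circ n k t) \<le> 0"
    "t \<in> {of_int q + 1 / 2 .. of_int q + 1} \<Longrightarrow> 0 \<le> Im (circ n k t)"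
proof -
  have Im: "Im (circ n k t) = - rad n k * sin (2 * pi * (t - of_int q))" for t
  proof -
    have "circ n k t = circ n k (frac t)" "circ n k (t - of_int q) = circ n k (frac (t - of_int q))"
      by (rule periodic_frac, rule circ_periodic)+
    moreover have "frac (t - of_int q) = frac t" by (simp add: frac_def)
    ultimately have e: "circ n k t = circ n k (t - of_int q)" by simp
    show ?thesis unfolding e by (simp add: circ_def)
  qed
  show "Im (circ n k t) \<le> 0" if t: "t \<in> {of_int q .. of_int q + 1 / 2}"
  proof -
    have "2 * pi * (t - of_int q) \<le> 2 * pi * (1 / 2)" using t by (intro mult_left_mono) auto
    then have "0 \<le> sin (2 * pi * (t - of_int q))" using t by (intro sin_ge_zero) auto
    then show ?thesis unfolding Im using rad_pos[of n k] by simp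
  qed
  show "0 \<le> Im (circ n k t)" if t: "t \<in> {of_int q + 1 / 2 .. of_int q + 1}"
  proof -
    have "2 * pi * (1 / 2) \<le> 2 * pi * (t - of_int q)" "2 * pi * (t - of_int q) \<le> 2 * pi * 1" using t by (intro mult_left_mono; simp)+
    then have "sin (2 * pi * (t - of_int q)) \<le> 0" using sin_ge_zero[of "2 * pi * (t - of_int q) - pi"] by (simp add: sin_diff)
    then show ?thesis unfolding Im using rad_pos[of n k] by (simp add: mult_nonneg_nonpos)
  qed
qed

lemma bcurve_section:
  assumes k: "k \<le> n" and y: "y \<in> carrier G"
  shows "t \<in> {of_int q .. of_int q + 1 / 2} \<Longrightarrow>
      point_of (circ n k t) \<in> slit_dom False \<and> bcurve k t y = s False (y \<otimes> monodromy k [^] (- q) \<otimes> inv hol (east k)) (point_of (circ n k t))" (is "_ \<Longrightarrow> ?A1 \<and> ?A2")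
    "t \<in> {of_int q + 1 / 2 .. of_int q + 1} \<Longrightarrow>
      point_of (circ n k t) \<in> slit_dom True \<and> bcurve k t y = s True (y \<otimes> monodromy k [^] (- q) \<otimes> inv hol (east k) \<otimes> hol (west k)) (point_of (circ n k t))" (is "_ \<Longrightarrow> ?B1 \<and> ?B2")
proof -
  have pp: "plane_of (point_of (circ n k t)) = circ n k t" for t by (simp add: plane_of_def point_of_def)
  show "?A1 \<and> ?A2"
    if t: "t \<in> {of_int q .. of_int q + 1 / 2}"
  proof
    have "circ n k t \<in> slit False"
    proof (cases "Im (circ n k t) = 0")
      case True
      then show ?thesis using pdom_real_chamber[OF circ_pdom[OF k]] slit_Int by blast
    next
      case False
      then show ?thesis using circ_Im(1)[OF t, of k] by (auto simp: slit_def)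
    qed
    then show "?A1" using circ_pts[OF k] by (simp add: slit_dom_def pp)
    have f: "\<lfloor>t\<rfloor> = q" using t by (simp add: floor_eq_iff)
    then have "frac t \<le> 1 / 2" using t by (simp add: frac_def)
    then show "?A2"
      unfolding bcurve_def s_def lift_factor_def f using y by (simp add: slit_transition_def pp m_assoc monodromy_closed)
  qed
  show "?B1 \<and> ?B2"
    if t: "t \<in> {of_int q + 1 / 2 .. of_int q + 1}"
  proof
    have "circ n k t \<in> slit True"
    proof (cases "Im (circ n k t) = 0")
      case True
      then show ?thesis using pdom_real_chamber[OF circ_pdom[OF k]] slit_Int by blast
    next
      case False
      then show ?thesis using circ_Im(2)[OF t, of k] by (auto simp: slit_def)
    qed
    then show "?B1" using circ_pts[OF k] by (simp add: slit_dom_def pp)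
    have "lift_factor k t = monodromy k [^] (- q) \<otimes> inv hol (east k) \<otimes> hol (west k)"
    \<comment> \<open>Both end points of the upper half turn fall under another branch of
      \<open>lift_factor\<close>: at the end the floor has already jumped, and the values agree by
      \<open>hol_east\<close>; at the west point \<open>frac t\<close> is still
      \<open>1 / 2\<close>.\<close>
    proof (cases "t = of_int q + 1")
      case True
      have f: "\<lfloor>t\<rfloor> = q + 1" "frac t \<le> 1 / 2" "Re (circ n k t) = east k" using True circ_Re(1)[of k "q + 1"] by (auto simp: frac_def)
      have "monodromy k [^] (- q + - 1) = monodromy k [^] (- q) \<otimes> monodromy k [^] (- 1 :: int)" by (rule int_pow_mult[OF monodromy_closed])
      moreover have "monodromy k [^] (- 1 :: int) = inv monodromy k" using int_pow_neg[OF monodromy_closed, of k 1] by (simp add: int_pow_1[OF monodromy_closed])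
      moreover have "inv monodromy k = inv hol (east k) \<otimes> hol (west k)"
        using hol_east[OF k] monodromy_closed[of k] by (simp add: inv_mult_group m_assoc)
      ultimately show ?thesis using f monodromy_closed[of k] by (simp add: lift_factor_def m_assoc)
    next
      case False
      then have f: "\<lfloor>t\<rfloor> = q" using t by (simp add: floor_eq_iff)
      show ?thesis
      proof (cases "t = of_int q + 1 / 2")
        case True
        then show ?thesis using circ_Re(2)[of k q] by (simp add: lift_factor_def f)
      next
        case False
        then have "\<not> frac t \<le> 1 / 2" using t f by (simp add: frac_def)
        then show ?thesis by (simp add: lift_factor_def f)
      qed
    qed
    then show "?B2"
      unfolding bcurve_def s_def using y by (simp add: slit_transition_def m_assoc monodromy_closed)
  qed
qed

text \<open>Each closed half turn stays over one trivialization, where the lift is a fixed local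
  section composed with the circle. The half turns form a locally finite closed cover of the
  line.\<close>

lemma bcurve_continuous:
  assumes k: "k \<le> n" and y: "y \<in> carrier G"
  shows "continuous_map euclideanreal total_top (\<lambda>t. bcurve k t y)"
proof (rule pasting_lemma_locally_finite[where I = "UNIV :: (int \<times> bool) set" and f = "\<lambda>_ t. bcurve k t y"
      and T = "\<lambda>(q, i). if i then {of_int q + 1 / 2 .. of_int q + 1} else {of_int q .. of_int q + 1 / 2 :: real}"])
  let ?T = "\<lambda>(q::int, i). if i then {of_int q + 1 / 2 .. of_int q + 1} else {of_int q .. of_int q + 1 / 2 :: real}"
  fix x :: real
  have "{j \<in> UNIV. ?T j \<inter> {x - 1<..<x + 1} \<noteq> {}} \<subseteq> {\<lfloor>x\<rfloor> - 2 .. \<lfloor>x\<rfloor> + 2} \<times> UNIV"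
  proof (rule subsetI)
    fix j assume "j \<in> {j \<in> UNIV. ?T j \<inter> {x - 1<..<x + 1} \<noteq> {}}"
    moreover obtain q i where j: "j = (q, i)" by fastforce
    ultimately have "?T (q, i) \<inter> {x - 1<..<x + 1} \<noteq> {}" by simp
    then obtain t where t: "t \<in> ?T (q, i)" "x - 1 < t" "t < x + 1" by auto
    then have "of_int q \<le> t" "t \<le> of_int q + 1" by (auto split: if_splits)
    with t(2,3) show "j \<in> {\<lfloor>x\<rfloor> - 2 .. \<lfloor>x\<rfloor> + 2} \<times> UNIV" unfolding j by (simp add: le_floor_iff) linarith
  qed
  then show "\<exists>V. openin euclideanreal V \<and> x \<in> V \<and> finite {j \<in> UNIV. ?T j \<inter> V \<noteq> {}}"
    by (intro exI[of _ "{x - 1<..<x + 1}"] conjI, simp, simp) (erule finite_subset, simp)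
  show "\<exists>j. j \<in> UNIV \<and> x \<in> ?T j \<and> bcurve k x y = bcurve k x y"
  proof (cases "frac x \<le> 1 / 2")
    case True
    then have "x \<in> ?T (\<lfloor>x\<rfloor>, False)" by (simp add: frac_def)
    then show ?thesis by blast
  next
    case False
    then have "x \<in> ?T (\<lfloor>x\<rfloor>, True)" by (simp add: frac_def)
    then show ?thesis by blast
  qed
next
  let ?T = "\<lambda>(q::int, i). if i then {of_int q + 1 / 2 .. of_int q + 1} else {of_int q .. of_int q + 1 / 2 :: real}"
  fix j :: "int \<times> bool"
  show "closedin euclideanreal (?T j)" by (auto split: prod.splits)
  obtain q i where j: "j = (q, i)" by fastforce
  define y' where "y' = (if i then y \<otimes> monodromy k [^] (- q) \<otimes> inv hol (east k) \<otimes> hol (west k) else y \<otimes> monodromy k [^] (- q) \<otimes> inv hol (east k))"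
  have y': "y' \<in> carrier G" using y by (simp add: y'_def monodromy_closed)
  have sec: "point_of (circ n k t) \<in> slit_dom i \<and> bcurve k t y = s i y' (point_of (circ n k t))" if "t \<in> ?T j" for t
    using bcurve_section[OF k y, of t q] that by (cases i) (simp_all add: j y'_def)
  have "continuous_map (top_of_set (?T j)) (Top (planar n)) (\<lambda>t. point_of (circ n k t))"
    using planar_curve[OF k] unfolding smooth_curve_def by (auto intro: continuous_map_from_subtopology)
  then have "continuous_map (top_of_set (?T j)) (subtopology (Top (planar n)) (slit_dom i)) (\<lambda>t. point_of (circ n k t))"
    unfolding continuous_map_in_subtopology using sec by auto
  moreover have "continuous_map (subtopology (Top (planar n)) (slit_dom i)) total_top (s i y')"
    using s_homeomorphic[OF UNIV_I y' A_open[OF UNIV_I] subset_refl]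
    unfolding homeomorphic_maps_def continuous_map_in_subtopology by blast
  ultimately have "continuous_map (top_of_set (?T j)) total_top (s i y' \<circ> (\<lambda>t. point_of (circ n k t)))" by (rule continuous_map_compose)
  then show "continuous_map (top_of_set (?T j)) total_top (\<lambda>t. bcurve k t y)"
    by (rule continuous_map_eq) (use sec in auto)
qed simp

lemma bcurve_smooth: "k \<le> n \<Longrightarrow> y \<in> carrier G \<Longrightarrow> smooth_curve E (\<lambda>t. bcurve k t y)"
  by (rule over_smooth_curve[OF E_over]) (use bcurve_continuous planar_curve bcurve_facts(2) in \<open>simp_all add: E_def\<close>)

text \<open>Over a given boundary point, right multiplication by the lift factor permutes the
  fibre.\<close>

lemma bcurve_bij: "bij_betw (\<lambda>(k, t, y). bcurve k t y) ({..n} \<times> {0..<1} \<times> carrier G) (surface_boundary E)" (is "bij_betw ?b ?D _")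
proof (rule bij_betw_imageI)
  note bb = planar_boundary_bij[of n]
  show "inj_on ?b ?D"
  proof (rule inj_onI)
    fix p p' assume p: "p \<in> ?D" "p' \<in> ?D"
      and e0: "?b p = ?b p'"
    obtain k t y k' t' y' where pp: "p = (k, t, y)" "p' = (k', t', y')" using prod_cases3 by metis
    have a: "k \<in> {..n}" "t \<in> {0..<1}" "y \<in> carrier G" "k' \<in> {..n}" "t' \<in> {0..<1}" "y' \<in> carrier G" and e: "bcurve k t y = bcurve k' t' y'"
      using p e0 pp by auto
    have "point_of (circ n k t) = point_of (circ n k' t')" using arg_cong[OF e, of prj] a by (simp add: bcurve_facts(2))
    then have kt: "k = k'" "t = t'" using inj_onD[OF bij_betw_imp_inj_on[OF bb], of "(k, t)" "(k', t')"] a by auto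
    have "y \<otimes> lift_factor k t = y' \<otimes> lift_factor k t" using arg_cong[OF e, of lvl] a kt by (simp add: bcurve_facts(3))
    then have "y = y'" using a by simp
    then show "p = p'" using kt pp by simp
  qed
  show "?b ` ?D = surface_boundary E"
    unfolding E_boundary
  proof (intro subset_antisym subsetI)
    fix q assume "q \<in> ?b ` ?D"
    then obtain k t y where a: "k \<le> n" "t \<in> {0..<1}" "y \<in> carrier G" "q = bcurve k t y" by auto
    have "point_of (circ n k t) \<in> surface_boundary (planar n)" using bij_betwE[OF bb] a by auto
    then show "q \<in> {q \<in> Q. prj q \<in> surface_boundary (planar n)}" using a bcurve_facts(1,2) by simp
  next
    fix q assume "q \<in> {q \<in> Q. prj q \<in> surface_boundary (planar n)}"
    then have q: "q \<in> Q" "prj q \<in> (\<lambda>(k, t). point_of (circ n k t)) ` ({..n} \<times> {0..<1})" using bij_betw_imp_surj_on[OF bb] by auto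
    then obtain k t where kt: "k \<le> n" "t \<in> {0..<1}" "prj q = point_of (circ n k t)" by auto
    have l: "lvl q \<in> carrier G" "emb (prj q) (lvl q) = q" using Q_cases[OF q(1)] by auto
    have "q = bcurve k t (lvl q \<otimes> inv lift_factor k t)" using l kt(3) by (simp add: bcurve_def m_assoc)
    then show "q \<in> ?b ` ?D"
      using kt l(1) by (intro image_eqI[where x = "(k, t, lvl q \<otimes> inv lift_factor k t)"]) auto
  qed
qed

text \<open>Since \<open>pos\<close> is any bijection, the incoming monodromies can be multiplied in
  any order.\<close>

theorem cobordism_to_product:
  assumes pos: "bij_betw pos (circles X) {..<n}" and X: "\<And>i. i \<in> circles X \<Longrightarrow> the (X ! i) = gs ! pos i"
  shows "\<lparr>base = planar n, tot = E, proj = prj, act = translate,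
      in_base = (\<lambda>i t. point_of (circ n (pos i) t)), in_total = (\<lambda>i. bcurve (pos i)),
      out_base = (\<lambda>i t. point_of (circ n n t)), out_total = (\<lambda>i. bcurve n)\<rparr> \<in> cobordisms G X [Some (list_prod G gs)]"
    (is "?W \<in> _")
proof -
  have c: "circles [Some (list_prod G gs)] = {0}" by (auto simp: circles_def)
  have p: "pos i < n" if "i \<in> circles X" for i using bij_betwE[OF pos] that by auto
  have pb: "principal_bundle G ?W" by (rule principal_bundle_E) simp_all
  have inm: "bundle_seq_map G X ?W (in_base ?W) (in_total ?W)"
    unfolding bundle_seq_map_def
  proof (intro ballI conjI allI)
    fix i assume i: "i \<in> circles X"
    then have k: "pos i \<le> n" and m: "the (X ! i) = monodromy (pos i)" using p[OF i] X[OF i] by (auto simp: monodromy_def)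
    show "smooth_curve (base ?W) (in_base ?W i)" using planar_curve[OF k] by simp
    show "in_base ?W i (t + 1) = in_base ?W i t" for t by (simp add: circ_periodic)
    fix y assume y: "y \<in> carrier G"
    show "smooth_curve (tot ?W) (\<lambda>t. in_total ?W i t y)" using bcurve_smooth[OF k y] by simp
    show "in_total ?W i (t + 1) (y \<otimes> the (X ! i)) = in_total ?W i t y" "proj ?W (in_total ?W i t y) = in_base ?W i t" for t
      using bcurve_facts[OF k y] m by simp_all
    show "act ?W g (in_total ?W i t y) = in_total ?W i t (g \<otimes> y)" if "g \<in> carrier G" for g t
      using bcurve_facts(5)[OF k y that] by simp
  qed
  have outm: "bundle_seq_map G [Some (list_prod G gs)] ?W (out_base ?W) (out_total ?W)"
    unfolding bundle_seq_map_def c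
  proof (intro ballI conjI allI)
    fix i :: nat assume i: "i \<in> {0}"
    have m: "the ([Some (list_prod G gs)] ! i) = monodromy n" using i by (simp add: monodromy_def)
    show "smooth_curve (base ?W) (out_base ?W i)" using planar_curve[of n n] by simp
    show "out_base ?W i (t + 1) = out_base ?W i t" for t by (simp add: circ_periodic)
    fix y assume y: "y \<in> carrier G"
    show "smooth_curve (tot ?W) (\<lambda>t. out_total ?W i t y)" using bcurve_smooth[OF order_refl y] by simp
    show "out_total ?W i (t + 1) (y \<otimes> the ([Some (list_prod G gs)] ! i)) = out_total ?W i t y" "proj ?W (out_total ?W i t y) = out_base ?W i t" for t
      unfolding m using bcurve_facts[OF order_refl y] by simp_all
    show "act ?W g (out_total ?W i t y) = out_total ?W i t (g \<otimes> y)" if "g \<in> carrier G" for g t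
      using bcurve_facts(5)[OF order_refl y that] by simp
  qed
  have dirs: "boundary_direction 1 (base ?W) (in_base ?W i)" if "i \<in> circles X" for i
    using planar_direction[of "pos i" n] p[OF that] by (simp add: sig_def)
  have dirs': "boundary_direction (- 1) (base ?W) (out_base ?W i)" for i
    using planar_direction[of n n] by (simp add: sig_def)
  have b1: "bij_betw (case_sum (\<lambda>(i, t). in_base ?W i t) (\<lambda>(i, t). out_base ?W i t))
       ((circles X \<times> {0..<1}) <+> ({0} \<times> {0..<1})) (surface_boundary (base ?W))"
    using bij_betw_case_sum_reindex[OF pos planar_boundary_bij] by simp
  have b2: "bij_betw (case_sum (\<lambda>(i, t, y). in_total ?W i t y) (\<lambda>(i, t, y). out_total ?W i t y))
       ((circles X \<times> {0..<1} \<times> carrier G) <+> ({0} \<times> {0..<1} \<times> carrier G)) (surface_boundary (tot ?W))"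
    using bij_betw_case_sum_reindex[OF pos, of "\<lambda>k (t, y). bcurve k t y" "{0..<1} \<times> carrier G" "surface_boundary E"] bcurve_bij
    by simp
  show ?thesis
    unfolding cobordisms_def c using pb inm outm dirs dirs' b1 b2 pd.oriented_S[of n] planar_compact[of n] by simp
qed

end

section \<open>Zigzags of cobordisms\<close>

definition circle_list :: "'g option list \<Rightarrow> nat list" where
  "circle_list X = filter (\<lambda>i. X ! i \<noteq> None) [0..<length X]"

definition total_monodromy :: "('g, 'r) monoid_scheme \<Rightarrow> 'g option list \<Rightarrow> 'g" where
  "total_monodromy G X = list_prod G (map (\<lambda>i. the (X ! i)) (circle_list X))"

lemma distinct_circle_list: "distinct (circle_list X)" and set_circle_list: "set (circle_list X) = circles X"
  by (auto simp: circle_list_def circles_def)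

lemma monodromies_carrier: "X \<in> bundle_seqs G \<Longrightarrow> set js \<subseteq> circles X \<Longrightarrow> set (map (\<lambda>i. the (X ! i)) js) \<subseteq> carrier G"
  using circles_carrier by fastforce

lemma (in group) total_monodromy_closed: "X \<in> bundle_seqs G \<Longrightarrow> total_monodromy G X \<in> carrier G"
  unfolding total_monodromy_def by (rule list_prod_closed, rule monodromies_carrier) (simp_all add: set_circle_list)

lemma circle_list_append: "circle_list (X @ Y) = circle_list X @ map (\<lambda>i. i + length X) (circle_list Y)"
proof -
  have "[0..<length (X @ Y)] = [0..<length X] @ map (\<lambda>i. i + length X) [0..<length Y]"
    using upt_add_eq_append[of 0 "length X" "length Y"] by (simp add: map_add_upt add.commute[of "length Y"])
  moreover have "filter (\<lambda>i. (X @ Y) ! i \<noteq> None) [0..<length X] = filter (\<lambda>i. X ! i \<noteq> None) [0..<length X]"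
    by (rule filter_cong) (auto simp: nth_append)
  moreover have "(X @ Y) ! (i + length X) = Y ! i" for i by (simp add: nth_append)
  ultimately show ?thesis by (simp add: circle_list_def filter_map o_def)
qed

lemma (in group) total_monodromy_append:
  assumes "X \<in> bundle_seqs G" "Y \<in> bundle_seqs G"
  shows "total_monodromy G (X @ Y) = total_monodromy G X \<otimes> total_monodromy G Y"
proof -
  have "map (\<lambda>i. the ((X @ Y) ! i)) (circle_list (X @ Y)) = map (\<lambda>i. the (X ! i)) (circle_list X) @ map (\<lambda>i. the (Y ! i)) (circle_list Y)"
    unfolding circle_list_append map_append by (auto simp: nth_append circle_list_def)
  then show ?thesis
    unfolding total_monodromy_def
    by (simp only:) (rule list_prod_append; rule monodromies_carrier; simp add: assms set_circle_list)
qed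

lemma append_bundle_seqs: "X \<in> bundle_seqs G \<Longrightarrow> Y \<in> bundle_seqs G \<Longrightarrow> X @ Y \<in> bundle_seqs G"
  by (auto simp: bundle_seqs_def)

lemma cobordism_to_ordered_product:
  assumes G: "group G" and fin: "finite (carrier G)" and X: "X \<in> bundle_seqs G" and js: "distinct js" "set js = circles X"
  shows "(cobordisms G X [Some (list_prod G (map (\<lambda>i. the (X ! i)) js))] :: (point, point, 'g) gcob set) \<noteq> {}"
proof -
  let ?gs = "map (\<lambda>i. the (X ! i)) js"
  interpret planar_bundle G ?gs
    by (rule planar_bundle.intro[OF G fin monodromies_carrier[OF X]]) (simp add: js(2))
  have b: "bij_betw ((!) js) {..<length js} (circles X)" using bij_betw_nth[OF js(1) refl js(2)[symmetric]] .
  have pos: "bij_betw (inv_into {..<length js} ((!) js)) (circles X) {..<length ?gs}"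
    using bij_betw_inv_into[OF b] by simp
  have m: "the (X ! i) = ?gs ! inv_into {..<length js} ((!) js) i" if "i \<in> circles X" for i
    using f_inv_into_f[of i "(!) js" "{..<length js}"] inv_into_into[of i "(!) js" "{..<length js}"] bij_betw_imp_surj_on[OF b] that by simp
  show ?thesis using cobordism_to_product[OF pos m] by blast
qed

lemma (in group) character_list_prod:
  fixes \<xi> :: "'a \<Rightarrow> complex"
  assumes "\<And>x y. x \<in> carrier G \<Longrightarrow> y \<in> carrier G \<Longrightarrow> \<xi> (x \<otimes> y) = \<xi> x * \<xi> y" "\<xi> \<one> = 1"
  shows "set xs \<subseteq> carrier G \<Longrightarrow> \<xi> (list_prod G xs) = prod_list (map \<xi> xs)"
  by (induction xs) (simp_all add: assms)

lemma (in group) derived_coset_eq_iff: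
  assumes "x \<in> carrier G" "y \<in> carrier G"
  shows "derived G (carrier G) #> x = derived G (carrier G) #> y \<longleftrightarrow> x \<otimes> inv y \<in> derived G (carrier G)"
proof -
  have D: "subgroup (derived G (carrier G)) G" by (rule derived_is_subgroup) simp
  have "x \<in> derived G (carrier G) #> y \<longleftrightarrow> x \<otimes> inv y \<in> derived G (carrier G)"
    by (rule subgroup.rcos_module[OF D is_group assms(2,1)])
  moreover have "x \<in> derived G (carrier G) #> y \<longleftrightarrow> derived G (carrier G) #> x = derived G (carrier G) #> y"
    using repr_independence[OF _ assms(2) D, of x] rcos_self[OF assms(1) D] by auto
  ultimately show ?thesis by simp
qed

text \<open>A character that separates the two products in the abelianization would contradict
  \<open>cobordism_character\<close>.\<close>

lemma cobordism_total_monodromy: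
  fixes G (structure)
  assumes G: "group G" and fin: "finite (carrier G)" and X: "X \<in> bundle_seqs G" and Y: "Y \<in> bundle_seqs G"
    and W: "W \<in> cobordisms G X Y"
  shows "derived G (carrier G) #> total_monodromy G X = derived G (carrier G) #> total_monodromy G Y"
proof (rule ccontr)
  interpret group G by (rule G)
  let ?x = "total_monodromy G X" and ?y = "total_monodromy G Y"
  have xy: "?x \<in> carrier G" "?y \<in> carrier G" using total_monodromy_closed X Y by auto
  assume "derived G (carrier G) #> ?x \<noteq> derived G (carrier G) #> ?y"
  then have n: "?x \<otimes> inv ?y \<notin> derived G (carrier G)" using derived_coset_eq_iff[OF xy] by simp
  have c: "?x \<otimes> inv ?y \<in> carrier G" using xy by simp
  obtain \<xi> :: "'a \<Rightarrow> complex" where \<xi>: "\<And>x. x \<in> carrier G \<Longrightarrow> norm (\<xi> x) = 1"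
    "\<And>x y. x \<in> carrier G \<Longrightarrow> y \<in> carrier G \<Longrightarrow> \<xi> (x \<otimes> y) = \<xi> x * \<xi> y" "\<xi> (?x \<otimes> inv ?y) \<noteq> 1"
    using character_separates_derived[OF fin c n] by blast
  have one: "\<xi> \<one> = 1"
    using \<xi>(2)[OF one_closed one_closed] \<xi>(1)[OF one_closed] by (cases "\<xi> \<one> = 0") auto
  have p: "\<xi> (total_monodromy G Z) = (\<Prod>i\<in>circles Z. \<xi> (the (Z ! i)))" if Z: "Z \<in> bundle_seqs G" for Z
    using character_list_prod[of \<xi>, OF \<xi>(2) one monodromies_carrier[OF Z, of "circle_list Z"]]
      prod.distinct_set_conv_list[OF distinct_circle_list, of "\<lambda>i. \<xi> (the (Z ! i))" Z]
    by (simp add: total_monodromy_def set_circle_list o_def)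
  have "\<xi> ?x = \<xi> ?y" using cobordism_character[OF G \<xi>(1,2) X Y W] p[OF X] p[OF Y] by simp
  then have "\<xi> (?x \<otimes> inv ?y) = \<xi> (?y \<otimes> inv ?y)"
    using \<xi>(2)[OF xy(1) inv_closed[OF xy(2)]] \<xi>(2)[OF xy(2) inv_closed[OF xy(2)]] by (simp only:)
  then show False using \<xi>(3) one xy by simp
qed

text \<open>Every cobordism has an equivalence class, and classes are nonempty.\<close>

lemma cobordism_arrow_iff:
  "(\<exists>f\<in>Arr (cobordism_category G). Dom (cobordism_category G) f = X \<and> Cod (cobordism_category G) f = Y) \<longleftrightarrow>
     X \<in> bundle_seqs G \<and> Y \<in> bundle_seqs G \<and> (cobordisms G X Y :: (point, point, 'g) gcob set) \<noteq> {}"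
  by (auto simp: cobordism_category_def quotient_def) 

definition zigzag :: "('g, 'r) monoid_scheme \<Rightarrow> 'g option list rel" where
  "zigzag G = ({(Dom (cobordism_category G) f, Cod (cobordism_category G) f) | f. f \<in> Arr (cobordism_category G)} \<union>
     {(Cod (cobordism_category G) f, Dom (cobordism_category G) f) | f. f \<in> Arr (cobordism_category G)})\<^sup>*"

lemma zigzag_trans: "(X, Y) \<in> zigzag G \<Longrightarrow> (Y, Z) \<in> zigzag G \<Longrightarrow> (X, Z) \<in> zigzag G"
  unfolding zigzag_def by (rule rtrancl_trans)

lemma zigzag_refl: "(X, X) \<in> zigzag G"
  by (simp add: zigzag_def)

lemma zigzag_arrow:
  assumes "X \<in> bundle_seqs G" "Y \<in> bundle_seqs G" "(cobordisms G X Y :: (point, point, 'g) gcob set) \<noteq> {}"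
  shows "(X, Y) \<in> zigzag G" "(Y, X) \<in> zigzag G"
proof -
  obtain f where f: "f \<in> Arr (cobordism_category G)" "Dom (cobordism_category G) f = X" "Cod (cobordism_category G) f = Y"
    using cobordism_arrow_iff[of G X Y] assms by blast
  show "(X, Y) \<in> zigzag G" unfolding zigzag_def using f by (intro r_into_rtrancl UnI1 CollectI exI[of _ f]) simp
  show "(Y, X) \<in> zigzag G" unfolding zigzag_def using f by (intro r_into_rtrancl UnI2 CollectI exI[of _ f]) simp
qed

lemma zigzag_ordered_product:
  assumes G: "group G" and fin: "finite (carrier G)" and X: "X \<in> bundle_seqs G" and js: "distinct js" "set js = circles X"
  shows "(X, [Some (list_prod G (map (\<lambda>i. the (X ! i)) js))]) \<in> zigzag G" "([Some (list_prod G (map (\<lambda>i. the (X ! i)) js))], X) \<in> zigzag G"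
proof -
  interpret group G by (rule G)
  have "list_prod G (map (\<lambda>i. the (X ! i)) js) \<in> carrier G" by (rule list_prod_closed, rule monodromies_carrier[OF X]) (simp add: js)
  then have "[Some (list_prod G (map (\<lambda>i. the (X ! i)) js))] \<in> bundle_seqs G" by (simp add: bundle_seqs_def)
  from zigzag_arrow[OF X this cobordism_to_ordered_product[OF G fin X js]]
  show "(X, [Some (list_prod G (map (\<lambda>i. the (X ! i)) js))]) \<in> zigzag G" "([Some (list_prod G (map (\<lambda>i. the (X ! i)) js))], X) \<in> zigzag G" .
qed

lemma zigzag_derived:
  fixes G (structure)
  assumes G: "group G" and fin: "finite (carrier G)" and d: "d \<in> derived G (carrier G)" and p: "p \<in> carrier G"
  shows "([Some (d \<otimes> p)], [Some p]) \<in> zigzag G \<and> ([Some p], [Some (d \<otimes> p)]) \<in> zigzag G"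
proof -
  interpret group G by (rule G)
  have comm: "([Some (a \<otimes> b \<otimes> inv a \<otimes> inv b \<otimes> p)], [Some p]) \<in> zigzag G \<and>
      ([Some p], [Some (a \<otimes> b \<otimes> inv a \<otimes> inv b \<otimes> p)]) \<in> zigzag G"
    if ab: "a \<in> carrier G" "b \<in> carrier G" "p \<in> carrier G" for a b p
  proof -
    let ?X = "map Some [a, b, inv a, inv b, p]"
    have X: "?X \<in> bundle_seqs G" using ab by (simp add: bundle_seqs_def)
    have c: "circles ?X = {0, 1, 2, 3, 4}"
      unfolding circles_def by (auto simp: less_Suc_eq numeral_eq_Suc)
    have 1: "distinct [0, 1, 2, 3, 4::nat]" "set [0, 1, 2, 3, 4] = circles ?X" unfolding c by auto
    \<comment> \<open>In this order each factor is followed by its inverse, and only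
      \<open>p\<close> remains.\<close>
    have 2: "distinct [0, 2, 1, 3, 4::nat]" "set [0, 2, 1, 3, 4] = circles ?X" unfolding c by auto
    have e1: "list_prod G (map (\<lambda>i. the (?X ! i)) [0, 1, 2, 3, 4]) = a \<otimes> b \<otimes> inv a \<otimes> inv b \<otimes> p"
      using ab by (simp add: m_assoc numeral_eq_Suc)
    have e2: "list_prod G (map (\<lambda>i. the (?X ! i)) [0, 2, 1, 3, 4]) = p"
      using ab by (simp add: numeral_eq_Suc) (simp flip: m_assoc)
    show ?thesis
      using zigzag_ordered_product[OF G fin X 1, unfolded e1] zigzag_ordered_product[OF G fin X 2, unfolded e2] zigzag_trans by blast
  qed
  have DG: "derived G (carrier G) \<subseteq> carrier G" by (rule derived_in_carrier) simp
  have "d \<in> generate G (derived_set G (carrier G))" using d by (simp add: derived_def)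
  then show ?thesis using p
  proof (induction arbitrary: p)
    case one
    then show ?case using zigzag_refl by simp
  next
    case (incl h)
    then show ?case using comm by blast
  next
    case (inv h)
    then obtain a b where ab: "a \<in> carrier G" "b \<in> carrier G" "h = a \<otimes> b \<otimes> inv a \<otimes> inv b" by blast
    then have "h \<in> carrier G" by simp
    \<comment> \<open>Applied at \<open>inv h \<otimes> p\<close>, the zigzag of \<open>h\<close>
      leads to \<open>h \<otimes> (inv h \<otimes> p) = p\<close>, and zigzags can be
      reversed.\<close>
    then show ?case using comm[OF ab(1,2), of "inv h \<otimes> p", folded ab(3)] inv.prems by (simp flip: m_assoc)
  next
    case (eng h k)
    have hk: "h \<in> carrier G" "k \<in> carrier G" using eng.hyps DG by (auto simp: derived_def)
    have "([Some (h \<otimes> (k \<otimes> p))], [Some (k \<otimes> p)]) \<in> zigzag G \<and> ([Some (k \<otimes> p)], [Some (h \<otimes> (k \<otimes> p))]) \<in> zigzag G"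
      using eng.IH(1) hk eng.prems by simp
    then show ?case using eng.IH(2)[OF eng.prems] zigzag_trans hk eng.prems by (metis m_assoc)
  qed
qed

text \<open>Each sequence is joined to the single circle with its total monodromy, and the two
  monodromies differ by an element of the derived subgroup.\<close>

lemma zigzag_complete:
  fixes G (structure)
  assumes G: "group G" and fin: "finite (carrier G)" and X: "X \<in> bundle_seqs G" and Y: "Y \<in> bundle_seqs G"
    and eq: "derived G (carrier G) #> total_monodromy G X = derived G (carrier G) #> total_monodromy G Y"
  shows "(X, Y) \<in> zigzag G"
proof -
  interpret group G by (rule G)
  let ?x = "total_monodromy G X" and ?y = "total_monodromy G Y"
  have xy: "?x \<in> carrier G" "?y \<in> carrier G" using total_monodromy_closed X Y by auto
  have "?x \<otimes> inv ?y \<in> derived G (carrier G)" using eq derived_coset_eq_iff[OF xy] by simp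
  from zigzag_derived[OF G fin this xy(2)] have "([Some ?x], [Some ?y]) \<in> zigzag G" using xy by (simp add: m_assoc)
  moreover have "(X, [Some ?x]) \<in> zigzag G" "([Some ?y], Y) \<in> zigzag G"
    using zigzag_ordered_product[OF G fin X distinct_circle_list set_circle_list] zigzag_ordered_product[OF G fin Y distinct_circle_list set_circle_list]
    by (simp_all add: total_monodromy_def)
  ultimately show ?thesis using zigzag_trans by blast
qed

theorem theorem1:
  fixes G :: "('g, 'r) monoid_scheme"
  assumes "group G" and "finite (carrier G)"
  shows "\<exists>\<phi>.
    bij_betw \<phi> (pi0 (cobordism_category G)) (carrier (G Mod derived G (carrier G))) \<and>
    (\<forall>c\<in>pi0 (cobordism_category G). \<forall>d\<in>pi0 (cobordism_category G).
       pi0_tensor (cobordism_category G) (@) c d \<in> pi0 (cobordism_category G) \<and>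
       \<phi> (pi0_tensor (cobordism_category G) (@) c d) =
         \<phi> c \<otimes>\<^bsub>G Mod derived G (carrier G)\<^esub> \<phi> d)"
proof -
  interpret group G by (rule assms(1))
  let ?C = "cobordism_category G" and ?D = "derived G (carrier G)"
  let ?comp = "component_of_object ?C"
  interpret N: normal ?D G by (rule derived_self_is_normal)
  define Q where "Q X = ?D #>\<^bsub>G\<^esub> total_monodromy G X" for X
  have Ob: "Ob ?C = bundle_seqs G" by (simp add: cobordism_category_def)
  have arr: "Dom ?C f \<in> Ob ?C \<and> Cod ?C f \<in> Ob ?C \<and> Q (Dom ?C f) = Q (Cod ?C f)" if f: "f \<in> Arr ?C" for f
  proof -
    let ?X = "Dom ?C f" and ?Y = "Cod ?C f"
    have XY: "?X \<in> bundle_seqs G" "?Y \<in> bundle_seqs G" "(cobordisms G ?X ?Y :: (point, point, 'g) gcob set) \<noteq> {}"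
      using cobordism_arrow_iff[of G ?X ?Y] f by blast+
    from XY(3) obtain W :: "(point, point, 'g) gcob" where "W \<in> cobordisms G ?X ?Y" by blast
    from cobordism_total_monodromy[OF assms XY(1,2) this] show ?thesis using XY Ob by (simp add: Q_def)
  qed
  have complete: "(X, Y) \<in> ({(Dom ?C f, Cod ?C f) | f. f \<in> Arr ?C} \<union> {(Cod ?C f, Dom ?C f) | f. f \<in> Arr ?C})\<^sup>*"
    if "X \<in> Ob ?C" "Y \<in> Ob ?C" "Q X = Q Y" for X Y
    using zigzag_complete[OF assms, of X Y] that unfolding zigzag_def Q_def Ob by blast
  have comp_iff: "?comp X = ?comp Y \<longleftrightarrow> Q X = Q Y" if "X \<in> bundle_seqs G" "Y \<in> bundle_seqs G" for X Y
    by (rule component_of_object_eq_iff[where C = ?C and Q = Q], use arr in blast, use arr in blast, use arr in blast, erule (2) complete, use that Ob in simp_all)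
  have pi0: "pi0 ?C = ?comp ` bundle_seqs G"
    unfolding Ob[symmetric] by (rule pi0_eq[where Q = Q], use arr in blast, use arr in blast, use arr in blast, erule (2) complete)
  \<comment> \<open>By \<open>comp_iff\<close> the value does not depend on the chosen
    object.\<close>
  define \<phi> where "\<phi> c = Q (SOME X. X \<in> bundle_seqs G \<and> ?comp X = c)" for c
  have \<phi>: "\<phi> (?comp X) = Q X" if X: "X \<in> bundle_seqs G" for X
  proof -
    have "(SOME Z. Z \<in> bundle_seqs G \<and> ?comp Z = ?comp X) \<in> bundle_seqs G \<and> ?comp (SOME Z. Z \<in> bundle_seqs G \<and> ?comp Z = ?comp X) = ?comp X"
      by (rule someI[of _ X]) (use X in simp)
    then show ?thesis unfolding \<phi>_def using comp_iff X by blast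
  qed
  have Q_append: "Q (X @ Y) = Q X \<otimes>\<^bsub>G Mod ?D\<^esub> Q Y" if "X \<in> bundle_seqs G" "Y \<in> bundle_seqs G" for X Y
    using N.rcos_sum[of "total_monodromy G X" "total_monodromy G Y"] total_monodromy_append[OF that] total_monodromy_closed that
    by (simp add: Q_def)
  have Q_surj: "Q ` bundle_seqs G = carrier (G Mod ?D)"
  proof (intro subset_antisym subsetI)
    fix A assume "A \<in> Q ` bundle_seqs G"
    then show "A \<in> carrier (G Mod ?D)" using total_monodromy_closed by (auto simp: Q_def carrier_FactGroup)
  next
    fix A assume "A \<in> carrier (G Mod ?D)"
    then obtain x where x: "x \<in> carrier G" "A = ?D #>\<^bsub>G\<^esub> x" by (auto simp: carrier_FactGroup)
    have "total_monodromy G [Some x] = x" using x(1) by (simp add: total_monodromy_def circle_list_def)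
    then show "A \<in> Q ` bundle_seqs G" using x by (intro image_eqI[where x = "[Some x]"]) (simp_all add: Q_def bundle_seqs_def)
  qed
  have tensor: "pi0_tensor ?C (@) (?comp X) (?comp Y) = ?comp (X @ Y)" if XY: "X \<in> bundle_seqs G" "Y \<in> bundle_seqs G" for X Y
  proof -
    \<comment> \<open>All choices of objects give the same component, so the union in
      \<open>pi0_tensor\<close> is the union of one set.\<close>
    have "{?comp (X' @ Y') | X' Y'. X' \<in> Ob ?C \<and> Y' \<in> Ob ?C \<and> ?comp X' = ?comp X \<and> ?comp Y' = ?comp Y} = {?comp (X @ Y)}"
    proof (intro subset_antisym subsetI)
      fix c assume "c \<in> {?comp (X' @ Y') | X' Y'. X' \<in> Ob ?C \<and> Y' \<in> Ob ?C \<and> ?comp X' = ?comp X \<and> ?comp Y' = ?comp Y}"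
      then obtain X' Y' where c: "c = ?comp (X' @ Y')" "X' \<in> bundle_seqs G" "Y' \<in> bundle_seqs G" "?comp X' = ?comp X" "?comp Y' = ?comp Y"
        unfolding Ob by blast
      have "Q (X' @ Y') = Q (X @ Y)" using Q_append XY c comp_iff by simp
      then show "c \<in> {?comp (X @ Y)}"
        using comp_iff[OF append_bundle_seqs[OF c(2,3)] append_bundle_seqs[OF XY]] c(1) by simp
    next
      fix c assume "c \<in> {?comp (X @ Y)}"
      then show "c \<in> {?comp (X' @ Y') | X' Y'. X' \<in> Ob ?C \<and> Y' \<in> Ob ?C \<and> ?comp X' = ?comp X \<and> ?comp Y' = ?comp Y}"
        using XY Ob by (intro CollectI exI[of _ X] exI[of _ Y]) simp
    qed
    then show ?thesis unfolding pi0_tensor_def by simp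
  qed
  show ?thesis
  proof (intro exI[of _ \<phi>] conjI ballI)
    show "bij_betw \<phi> (pi0 ?C) (carrier (G Mod ?D))"
    proof (rule bij_betw_imageI)
      show "inj_on \<phi> (pi0 ?C)" unfolding pi0 by (auto simp: inj_on_def \<phi> comp_iff)
      show "\<phi> ` pi0 ?C = carrier (G Mod ?D)" unfolding pi0 Q_surj[symmetric] image_image by (rule image_cong) (simp_all add: \<phi>)
    qed
    fix c d assume "c \<in> pi0 ?C" "d \<in> pi0 ?C"
    then obtain X Y where c: "c = ?comp X" "X \<in> bundle_seqs G" and d: "d = ?comp Y" "Y \<in> bundle_seqs G" unfolding pi0 by blast
    show "pi0_tensor ?C (@) c d \<in> pi0 ?C" unfolding c(1) d(1) tensor[OF c(2) d(2)] pi0 using append_bundle_seqs c(2) d(2) by blast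
    show "\<phi> (pi0_tensor ?C (@) c d) = \<phi> c \<otimes>\<^bsub>G Mod ?D\<^esub> \<phi> d"
      unfolding c(1) d(1) tensor[OF c(2) d(2)] 
        \<phi>[OF append_bundle_seqs[OF c(2) d(2)]] \<phi>[OF c(2)] \<phi>[OF d(2)] by (rule Q_append[OF c(2) d(2)])
  qed
qed

end
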